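(* For $1\le p\le t-1$, the map $\tau_p$ is an isomorphism of graded posets $(\mathrm{LRT}(R),\le_R)\to(\mathrm{LRT}(\tau_pR),\le_{\tau_pR})$; i.e. it is a bijection such that for $S,T\in\mathrm{LRT}(R)$, $T<_RS$ implies $\tau_pT<_{\tau_pR}\tau_pS$ (and it is order-preserving in both directions).
   Context: $\sim_K$ is Knuth equivalence; $w|_B$ is the subword of $w$ of letters in $B$; tableaux are in English notation, column-strict meaning rows weakly increase and columns strictly increase; $\mathrm{word}(T)=\dotsb u^2u^1$ with $u^i$ the $i$-th row read left to right; $P(w)$, $Q(w)$ are the Schensted row-insertion and recording tableaux. $R=(R_1,\dots,R_t)$ is a sequence of rectangular partitions, $R_i$ with $\eta_i$ rows and $\mu_i$ columns; $n=\sum\eta_i$; $a=\max_i\mu_i$; $A_i=\{\eta_1+\dots+\eta_{i-1}+1,\dots,\eta_1+\dots+\eta_i\}$; $Y_i$ is the column-strict tableau of shape $R_i$ whose $j$-th row consists of $\mu_i$ copies of $\eta_1+\dots+\eta_{i-1}+j$. $W(R)$ is the set of words $w$ in $[n]$ with $w|_{A_i}\sim_K\mathrm{word}(Y_i)$ for all $i$; $\mathrm{LRT}(\lambda;R)$ ($\mathrm{LRT}(R)$) is the set of column-strict tableaux of shape $\lambda$ (of any partition shape) whose word lies in $W(R)$. Rectangle switching: $\tau_pR=(R_1,\dots,R_{p-1},R_{p+1},R_p,R_{p+2},\dots,R_t)$. For $t=2$, $\tau_1:\mathrm{LRT}(\lambda;(R_1,R_2))\to\mathrm{LRT}(\lambda;(R_2,R_1))$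 is the unique map (both sets are empty or singletons of equal size) and $\tau_1:W((R_1,R_2))\to W((R_2,R_1))$ is defined by $P(\tau_1w)=\tau_1P(w)$, $Q(\tau_1w)=Q(w)$. For general $t$, $\tau_pw$ replaces the subword $w|_{A_p\cup A_{p+1}}$ (same positions) by its image under the two-rectangle map for $(R_p,R_{p+1})$ (letters shifted by $\eta_1+\dots+\eta_{p-1}$); for a tableau $T$, $\tau_pT$ is the tableau of the same shape with $\mathrm{word}(\tau_pT)=\tau_p\mathrm{word}(T)$. Cocyclage: for $1\le r\le n-1$ and a word $u$, regard letters $r$ as right and $r+1$ as left parentheses, match them, leaving an unmatched subword $r^c(r+1)^d$; $s_ru$ replaces it by $r^d(r+1)^c$; this gives an action of $S_n$ on words. $w_0^R$ is the longest element of the Young subgroup of $S_n$ stabilizing each $A_i$; for $w=ux$ with $x$ a letter, $\chi_R(w)=(w_0^Rx)(w_0^Ru)$. For $S,T\in\mathrm{LRT}(R)$, $T<_RS$ if there is $w=ux\in W(R)$ ($x$ a letter) with $S=P(w)$, $T=P(\chi_R(w))$, and the cell by which the shape of $P(w)$ exceeds that of $P(u)$ lies in a column strictly right of column $a$; $\le_R$ is the reflexive transitive closure of $<_R$, a graded partial order. *)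

theory Defs
  imports Main
begin

type_synonym word = "nat list"
type_synonym tableau = "nat list list"  (* list of rows, top row first (English notation) *)

definition shape :: "tableau \<Rightarrow> nat list" where
  "shape T = map length T"

definition column_strict :: "tableau \<Rightarrow> bool" where
  "column_strict T \<longleftrightarrow>
     (\<forall>i < length T. T ! i \<noteq> []) \<and>
     (\<forall>i. Suc i < length T \<longrightarrow> length (T ! Suc i) \<le> length (T ! i)) \<and>
     (\<forall>i < length T. sorted (T ! i)) \<and>
     (\<forall>i j. Suc i < length T \<longrightarrow> j < length (T ! Suc i) \<longrightarrow> T ! i ! j < T ! Suc i ! j)"

definition tab_word :: "tableau \<Rightarrow> word" where
  "tab_word T = concat (rev T)"

inductive knuth_step :: "word \<Rightarrow> word \<Rightarrow> bool" where
  K1: "x \<le> y \<Longrightarrow> y < z \<Longrightarrow> knuth_step (a @ [x, z, y] @ b) (a @ [z, x, y] @ b)"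
| K2: "x < y \<Longrightarrow> y \<le> z \<Longrightarrow> knuth_step (a @ [y, x, z] @ b) (a @ [y, z, x] @ b)"

definition knuth_equiv :: "word \<Rightarrow> word \<Rightarrow> bool" (infix "\<sim>\<^sub>K" 50) where
  "u \<sim>\<^sub>K v \<longleftrightarrow> (sup knuth_step knuth_step\<inverse>\<inverse>)\<^sup>*\<^sup>* u v"

fun row_ins :: "nat \<Rightarrow> nat list \<Rightarrow> nat list \<times> nat option" where
  "row_ins x [] = ([x], None)"
| "row_ins x (y # ys) = (if x < y then (x # ys, Some y)
                         else (let (r, b) = row_ins x ys in (y # r, b)))"

fun tab_ins :: "nat \<Rightarrow> tableau \<Rightarrow> tableau" where
  "tab_ins x [] = [[x]]"
| "tab_ins x (r # rs) = (case row_ins x r of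
      (r', None) \<Rightarrow> r' # rs
    | (r', Some y) \<Rightarrow> r' # tab_ins y rs)"

definition add_entry :: "tableau \<Rightarrow> nat list \<Rightarrow> nat \<Rightarrow> tableau" where
  "add_entry Q sh k =
     (let i = (LEAST i. length Q \<le> i \<or> length (Q ! i) < sh ! i) in
      if i < length Q then Q[i := Q ! i @ [k]] else Q @ [[k]])"

definition RS :: "word \<Rightarrow> tableau \<times> tableau" where
  "RS w = fold (\<lambda>x (P, Q). let P' = tab_ins x P in
                 (P', add_entry Q (shape P') (Suc (length (concat Q))))) w ([], [])"

definition Ptab :: "word \<Rightarrow> tableau" where "Ptab w = fst (RS w)"
definition Qtab :: "word \<Rightarrow> tableau" where "Qtab w = snd (RS w)"

text \<open>A sequence R of rectangles is a list of pairs (eta_i, mu_i): eta_i rows, mu_i columns.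
  Indices of the list are 0-based: R ! (i-1) is the paper's R_i.\<close>
type_synonym rects = "(nat \<times> nat) list"

definition rect_n :: "rects \<Rightarrow> nat" where
  "rect_n R = sum_list (map fst R)"

definition rect_a :: "rects \<Rightarrow> nat" where
  "rect_a R = Max (insert 0 (snd ` set R))"

definition offs :: "rects \<Rightarrow> nat \<Rightarrow> nat" where
  "offs R i = sum_list (map fst (take i R))"

definition Ablock :: "rects \<Rightarrow> nat \<Rightarrow> nat set" where
  "Ablock R i = {offs R i + 1 .. offs R i + fst (R ! i)}"

definition Ytab :: "rects \<Rightarrow> nat \<Rightarrow> tableau" where
  "Ytab R i = map (\<lambda>j. replicate (snd (R ! i)) (offs R i + j)) [1 ..< Suc (fst (R ! i))]"

definition Wset :: "rects \<Rightarrow> word set" where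
  "Wset R = {w. set w \<subseteq> {1 .. rect_n R} \<and>
     (\<forall>i < length R. filter (\<lambda>x. x \<in> Ablock R i) w \<sim>\<^sub>K tab_word (Ytab R i))}"

definition LRT :: "rects \<Rightarrow> tableau set" where
  "LRT R = {T. column_strict T \<and> tab_word T \<in> Wset R}"

text \<open>tau_p R for 1 \<le> p \<le> t-1: swap R_p and R_{p+1} (0-based positions p-1 and p)\<close>
definition swapR :: "nat \<Rightarrow> rects \<Rightarrow> rects" where
  "swapR p R = R[p - 1 := R ! p, p := R ! (p - 1)]"

definition tau2_tab :: "nat \<times> nat \<Rightarrow> nat \<times> nat \<Rightarrow> tableau \<Rightarrow> tableau" where
  "tau2_tab R1 R2 T = (THE T'. T' \<in> LRT [R2, R1] \<and> shape T' = shape T)"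

definition tau2_word :: "nat \<times> nat \<Rightarrow> nat \<times> nat \<Rightarrow> word \<Rightarrow> word" where
  "tau2_word R1 R2 w = (THE v. Ptab v = tau2_tab R1 R2 (Ptab w) \<and> Qtab v = Qtab w)"

text \<open>general tau_p on words: replace the subword on A_p \<union> A_{p+1} (same positions)\<close>
definition tau_word :: "rects \<Rightarrow> nat \<Rightarrow> word \<Rightarrow> word" where
  "tau_word R p w =
     (let s = offs R (p - 1); R1 = R ! (p - 1); R2 = R ! p;
          B = {s + 1 .. s + fst R1 + fst R2};
          pos = filter (\<lambda>i. w ! i \<in> B) [0 ..< length w];
          u = map (\<lambda>i. w ! i - s) pos;
          v = tau2_word R1 R2 u
      in map (\<lambda>i. if w ! i \<in> B then v ! length (filter (\<lambda>j. j < i) pos) + s else w ! i)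
             [0 ..< length w])"

definition tau_tab :: "rects \<Rightarrow> nat \<Rightarrow> tableau \<Rightarrow> tableau" where
  "tau_tab R p T = (THE T'. column_strict T' \<and> shape T' = shape T \<and>
                            tab_word T' = tau_word R p (tab_word T))"

text \<open>bracket matching: r+1 is a left, r a right parenthesis; returns the set of
  positions (0-based) of unmatched letters r and r+1\<close>
fun match_aux :: "nat \<Rightarrow> word \<Rightarrow> nat \<Rightarrow> nat list \<Rightarrow> nat set \<Rightarrow> nat set" where
  "match_aux r [] i st U = U \<union> set st"
| "match_aux r (x # xs) i st U =
     (if x = Suc r then match_aux r xs (Suc i) (i # st) U
      else if x = r then (case st of [] \<Rightarrow> match_aux r xs (Suc i) [] (insert i U)
                                   | _ # st' \<Rightarrow> match_aux r xs (Suc i) st' U)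
      else match_aux r xs (Suc i) st U)"

definition unmatched :: "nat \<Rightarrow> word \<Rightarrow> nat set" where
  "unmatched r w = match_aux r w 0 [] {}"

text \<open>s_r: unmatched subword r^c (r+1)^d replaced by r^d (r+1)^c\<close>
definition s_op :: "nat \<Rightarrow> word \<Rightarrow> word" where
  "s_op r w = (let U = unmatched r w; d = card {i \<in> U. w ! i = Suc r} in
     map (\<lambda>i. if i \<in> U then (if card {j \<in> U. j < i} < d then r else Suc r) else w ! i)
         [0 ..< length w])"

definition transp :: "nat \<Rightarrow> nat \<Rightarrow> nat" where
  "transp r x = (if x = r then Suc r else if x = Suc r then r else x)"

definition perm_of :: "nat list \<Rightarrow> nat \<Rightarrow> nat" where
  "perm_of rs = foldr (\<lambda>r f. transp r \<circ> f) rs id"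

definition act :: "nat \<Rightarrow> (nat \<Rightarrow> nat) \<Rightarrow> word \<Rightarrow> word" where
  "act n \<sigma> w = (THE v. \<forall>rs. set rs \<subseteq> {1 ..< n} \<and> perm_of rs = \<sigma> \<longrightarrow> foldr s_op rs w = v)"

text \<open>longest element of the Young subgroup stabilising each A_i\<close>
definition w0R :: "rects \<Rightarrow> nat \<Rightarrow> nat" where
  "w0R R x = (if \<exists>i < length R. x \<in> Ablock R i
     then (let i = (THE i. i < length R \<and> x \<in> Ablock R i) in
           offs R i + fst (R ! i) + 1 - (x - offs R i))
     else x)"

definition chiR :: "rects \<Rightarrow> word \<Rightarrow> word" where
  "chiR R w = act (rect_n R) (w0R R) [last w] @ act (rect_n R) (w0R R) (butlast w)"

definition lessR :: "rects \<Rightarrow> tableau \<Rightarrow> tableau \<Rightarrow> bool" where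
  "lessR R T S \<longleftrightarrow> S \<in> LRT R \<and> T \<in> LRT R \<and>
     (\<exists>u x. u @ [x] \<in> Wset R \<and> S = Ptab (u @ [x]) \<and> T = Ptab (chiR R (u @ [x])) \<and>
        (\<exists>k < length (Ptab (u @ [x])).
           (length (Ptab u) \<le> k \<or> length (Ptab u ! k) \<noteq> length (Ptab (u @ [x]) ! k)) \<and>
           rect_a R < length (Ptab (u @ [x]) ! k)))"

definition leR :: "rects \<Rightarrow> tableau \<Rightarrow> tableau \<Rightarrow> bool" where
  "leR R = (lessR R)\<^sup>*\<^sup>*"

end

theory Submission
  imports Defs
begin

text \<open>
  Call two words dual equivalent if every sequence of elementary Knuth moves, applied to both at the
  same positions, leaves them with the same descents; this forces equal recording tableaux and
  insertion tableaux of equal shape for corresponding factors.  Changing how the unmatched letters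
  \<open>r\<close>, \<open>r + 1\<close> are distributed commutes with Knuth moves and hence stays inside a dual equivalence
  class.  The operators \<open>s\<^sub>r\<close> are of this kind, and so is \<open>\<tau>\<^sub>p\<close> on each Knuth class, because
  a tableau in \<open>LRT (R\<^sub>1, R\<^sub>2)\<close> is determined by its shape.  So \<open>\<tau>\<^sub>p\<close> is compatible
  with \<open>P\<close> and preserves the shapes of prefixes, and everything reduces to
  \<open>\<tau>\<^sub>p \<chi>\<^sub>R w = \<chi>\<^bsub>\<tau>\<^sub>p R\<^esub> \<tau>\<^sub>p w\<close>.  If the last letter of \<open>w\<close> lies outside
  \<open>A\<^sub>p \<union> A\<^bsub>p+1\<^esub>\<close>, the operators involved act on disjoint sets of letters and commute.
  Otherwise the claim concerns two rectangles and a word \<open>w = u x\<close>, and it suffices that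
  \<open>\<chi> w\<close> and \<open>\<chi> (\<tau> w)\<close> have tableaux of the same shape.  Both shapes add a cell to the
  shape of \<open>u\<close>, and the cell is determined by the side of column \<open>max (\<mu>\<^sub>1, \<mu>\<^sub>2)\<close> on
  which it lies.  If the cell added by \<open>x\<close> lies to the right of that column, the new cell lies to the left
  for both words; otherwise injectivity of \<open>\<chi>\<close> and reverse complements transfer the side from one order
  of the rectangles to the other.
\<close>

section \<open>Knuth equivalence\<close>

text \<open>A Knuth move is made a total involution attached to a position. So one list of positions
  can be run on two words at once, and dual equivalence passes to prefixes and suffixes by
  re-indexing. Reverse complement does three jobs: it keeps the shape while exchanging the order of
  two rectangles, so both orders admit the same shapes; it turns facts on last letters into facts on
  first letters; it carries what holds for column \<open>m1\<close> over to column
  \<open>m2\<close>. This explains the maximum: if adding either of two different cells to one shape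
  gives shapes of two-rectangle tableaux, the cells lie on opposite sides of column
  \<open>m1\<close> and of column \<open>m2\<close>, hence of the larger one. The larger one is the
  useful bound because an appended 1 stays within \<open>m1\<close> columns and a prepended largest
  letter within \<open>m2\<close>. What is defined by a definite description needs existence and
  uniqueness: for the action of the symmetric group this is the braid relation plus completeness of
  the Coxeter relations, for the switch it is injectivity of the Schensted correspondence.\<close>

lemma knuth_refl [simp]: "u \<sim>\<^sub>K u"
  by (simp add: knuth_equiv_def)

lemma knuth_trans [trans]: "u \<sim>\<^sub>K v \<Longrightarrow> v \<sim>\<^sub>K w \<Longrightarrow> u \<sim>\<^sub>K w"
  by (auto simp: knuth_equiv_def)

lemma knuth_step_equiv: "knuth_step u v \<Longrightarrow> u \<sim>\<^sub>K v"
  by (auto simp: knuth_equiv_def)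

lemma knuth_step_equiv': "knuth_step u v \<Longrightarrow> v \<sim>\<^sub>K u"
  by (auto simp: knuth_equiv_def)

lemma knuth_map_rel:
  assumes "u \<sim>\<^sub>K v" and "\<And>a b. knuth_step a b \<Longrightarrow> f a \<sim>\<^sub>K f b \<and> f b \<sim>\<^sub>K f a"
  shows "f u \<sim>\<^sub>K f v"
  using assms(1) unfolding knuth_equiv_def[of u v]
proof (induction rule: rtranclp_induct)
  case base then show ?case by simp
next
  case (step y z)
  from step(2) have "f y \<sim>\<^sub>K f z" using assms(2) by auto
  with step(3) show ?case by (rule knuth_trans)
qed

lemma knuth_invariant:
  assumes "u \<sim>\<^sub>K v" and "\<And>a b. knuth_step a b \<Longrightarrow> f a = f b"
  shows "f u = f v"
  using assms(1) unfolding knuth_equiv_def[of u v]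
  by (induction rule: rtranclp_induct) (use assms(2) in auto)

lemma knuth_sym: "u \<sim>\<^sub>K v \<Longrightarrow> v \<sim>\<^sub>K u"
proof -
  assume "u \<sim>\<^sub>K v"
  have "symp ((sup knuth_step knuth_step\<inverse>\<inverse>)\<^sup>*\<^sup>*)"
    by (rule symp_rtranclp) (auto simp: symp_def)
  with \<open>u \<sim>\<^sub>K v\<close> show ?thesis by (auto simp: knuth_equiv_def symp_def)
qed

lemma knuth_step_ctxt: "knuth_step u v \<Longrightarrow> knuth_step (a @ u @ b) (a @ v @ b)"
proof (induction rule: knuth_step.induct)
  case (K1 x y z c d)
  then show ?case using knuth_step.K1[of x y z "a @ c" "d @ b"] by simp
next
  case (K2 x y z c d)
  then show ?case using knuth_step.K2[of x y z "a @ c" "d @ b"] by simp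
qed

lemma knuth_ctxt: "u \<sim>\<^sub>K v \<Longrightarrow> a @ u @ b \<sim>\<^sub>K a @ v @ b"
  by (rule knuth_map_rel[where f = "\<lambda>u. a @ u @ b"])
     (auto intro: knuth_step_equiv knuth_step_equiv' knuth_step_ctxt)

lemma knuth_app: "u \<sim>\<^sub>K u' \<Longrightarrow> v \<sim>\<^sub>K v' \<Longrightarrow> u @ v \<sim>\<^sub>K u' @ v'"
  using knuth_ctxt[of u u' "[]" v] knuth_ctxt[of v v' u' "[]"] knuth_trans by fastforce

lemma knuth_count: "u \<sim>\<^sub>K v \<Longrightarrow> count_list u x = count_list v x"
  by (erule knuth_invariant) (auto elim!: knuth_step.cases)

lemma knuth_length: "u \<sim>\<^sub>K v \<Longrightarrow> length u = length v"
  by (erule knuth_invariant) (auto elim!: knuth_step.cases)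

lemma knuth_set: "u \<sim>\<^sub>K v \<Longrightarrow> set u = set v"
  by (erule knuth_invariant) (auto elim!: knuth_step.cases)

lemma knuth_K1: "x \<le> y \<Longrightarrow> y < z \<Longrightarrow> [x, z, y] \<sim>\<^sub>K [z, x, y]"
  using knuth_step.K1[of x y z "[]" "[]"] by (simp add: knuth_step_equiv)

lemma knuth_K2: "x < y \<Longrightarrow> y \<le> z \<Longrightarrow> [y, x, z] \<sim>\<^sub>K [y, z, x]"
  using knuth_step.K2[of x y z "[]" "[]"] by (simp add: knuth_step_equiv)

text \<open>If both exchanged letters \<open>x\<close> and \<open>z\<close> survive, so does the
  letter \<open>y\<close> between them, because \<open>P\<close> is convex, and the relation
  persists. If one of them is deleted, both sides become the same word.\<close>

lemma knuth_filter:
  assumes "u \<sim>\<^sub>K v" and P: "\<And>x y z. x \<le> y \<Longrightarrow> y \<le> z \<Longrightarrow> P x \<Longrightarrow> P z \<Longrightarrow> P y"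
  shows "filter P u \<sim>\<^sub>K filter P v"
proof (rule knuth_map_rel[OF assms(1)])
  fix a b :: word assume "knuth_step a b"
  then have "filter P a \<sim>\<^sub>K filter P b"
  proof (cases rule: knuth_step.cases)
    case (K1 x y z a' b')
    have "filter P [x, z, y] \<sim>\<^sub>K filter P [z, x, y]"
      using K1(3,4) P[of x y z] by (auto intro: knuth_K1)
    then have "filter P a' @ filter P [x, z, y] @ filter P b' \<sim>\<^sub>K filter P a' @ filter P [z, x, y] @ filter P b'"
      by (rule knuth_ctxt)
    then show ?thesis unfolding K1 filter_append .
  next
    case (K2 x y z a' b')
    have "filter P [y, x, z] \<sim>\<^sub>K filter P [y, z, x]"
      using K2(3,4) P[of x y z] by (auto intro: knuth_K2)
    then have "filter P a' @ filter P [y, x, z] @ filter P b' \<sim>\<^sub>K filter P a' @ filter P [y, z, x] @ filter P b'"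
      by (rule knuth_ctxt)
    then show ?thesis unfolding K2 filter_append .
  qed
  then show "filter P a \<sim>\<^sub>K filter P b \<and> filter P b \<sim>\<^sub>K filter P a"
    using knuth_sym by blast
qed

lemma knuth_map:
  assumes "u \<sim>\<^sub>K v" and "strict_mono_on (set u) f"
  shows "map f u \<sim>\<^sub>K map f v"
proof -
  have mono: "x < y \<Longrightarrow> x \<in> set u \<Longrightarrow> y \<in> set u \<Longrightarrow> f x < f y" for x y
    using assms(2) by (auto simp: strict_mono_on_def)
  have monole: "x \<le> y \<Longrightarrow> x \<in> set u \<Longrightarrow> y \<in> set u \<Longrightarrow> f x \<le> f y" for x y
    using mono by (cases "x = y") (auto simp: less_imp_le)
  have stp: "map f a \<sim>\<^sub>K map f b" if "knuth_step a b" "set a = set u" for a b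
    using that(1)
  proof (cases rule: knuth_step.cases)
    case (K1 x y z a' b')
    then have "x \<in> set u" "y \<in> set u" "z \<in> set u" using that(2) by auto
    then have "[f x, f z, f y] \<sim>\<^sub>K [f z, f x, f y]" using K1 mono monole by (auto intro: knuth_K1)
    from knuth_ctxt[OF this, of "map f a'" "map f b'"] show ?thesis using K1 by simp
  next
    case (K2 x y z a' b')
    then have "x \<in> set u" "y \<in> set u" "z \<in> set u" using that(2) by auto
    then have "[f y, f x, f z] \<sim>\<^sub>K [f y, f z, f x]" using K2 mono monole by (auto intro: knuth_K2)
    from knuth_ctxt[OF this, of "map f a'" "map f b'"] show ?thesis using K2 by simp
  qed
  from assms(1) show ?thesis unfolding knuth_equiv_def[of u v]
  proof (induction rule: rtranclp_induct)
    case base then show ?case by simp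
  next
    case (step y z)
    have "u \<sim>\<^sub>K y" using step(1) by (simp add: knuth_equiv_def)
    then have sy: "set y = set u" using knuth_set by blast
    from step(2) have "set y = set z"
      using knuth_set knuth_step_equiv by auto
    then have "map f y \<sim>\<^sub>K map f z" using step(2) sy knuth_sym stp
      by (metis (no_types, lifting) conversep_iff sup2E)
    with step(3) show ?case by (rule knuth_trans)
  qed
qed

text \<open>Weakly increasing and strictly decreasing triples stay. Each remaining pattern admits
  exactly one Knuth relation, in one of its two directions, and that one is applied; hence the move
  is its own inverse.\<close>

definition ktrip :: "nat \<Rightarrow> nat \<Rightarrow> nat \<Rightarrow> nat list" where
  "ktrip x y z = (if (x \<le> y) = (y \<le> z) then [x, y, z]
                  else if (x \<le> y) = (x \<le> z) then [y, x, z] else [x, z, y])"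

text \<open>The position belongs to the move and a position out of range changes nothing, so the
  same list of positions makes sense for any two words of equal length.\<close>

primrec kmove :: "nat \<Rightarrow> word \<Rightarrow> word" where
  "kmove 0 w = (case w of x # y # z # v \<Rightarrow> ktrip x y z @ v | _ \<Rightarrow> w)"
| "kmove (Suc i) w = (case w of [] \<Rightarrow> [] | x # v \<Rightarrow> x # kmove i v)"

lemma kmove_app: "kmove (length a) (a @ x # y # z # b) = a @ ktrip x y z @ b"
  by (induction a) auto

lemma kmove_short: "length w < i + 3 \<Longrightarrow> kmove i w = w"
  by (induction i arbitrary: w) (auto split: list.splits)

lemma kmove_decomp:
  assumes "\<not> length w < i + 3"
  obtains a x y z b where "w = a @ x # y # z # b" "length a = i"
proof -
  have "i < length w" "Suc i < length w" "Suc (Suc i) < length w" using assms by auto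
  then have "w = take i w @ w ! i # w ! Suc i # w ! Suc (Suc i) # drop (Suc (Suc (Suc i))) w"
    by (metis Cons_nth_drop_Suc append_take_drop_id)
  then show ?thesis using that \<open>i < length w\<close> by (metis length_take min.absorb4)
qed

lemma length_kmove [simp]: "length (kmove i w) = length w"
  by (induction i arbitrary: w) (auto simp: ktrip_def split: list.splits)

lemma kmove_involution [simp]: "kmove i (kmove i w) = w"
proof (induction i arbitrary: w)
  case 0
  then show ?case by (auto split: list.splits simp: ktrip_def)
next
  case (Suc i)
  then show ?case by (auto split: list.splits)
qed

lemma ktrip_equiv: "[x, y, z] \<sim>\<^sub>K ktrip x y z"
proof -
  have "x \<le> z \<Longrightarrow> z < y \<Longrightarrow> [x, y, z] \<sim>\<^sub>K [y, x, z]" by (rule knuth_K1)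
  moreover have "z < x \<Longrightarrow> x \<le> y \<Longrightarrow> [x, y, z] \<sim>\<^sub>K [x, z, y]" by (rule knuth_sym[OF knuth_K2])
  moreover have "y < x \<Longrightarrow> x \<le> z \<Longrightarrow> [x, y, z] \<sim>\<^sub>K [x, z, y]" by (rule knuth_K2)
  moreover have "y \<le> z \<Longrightarrow> z < x \<Longrightarrow> [x, y, z] \<sim>\<^sub>K [y, x, z]" by (rule knuth_sym[OF knuth_K1])
  ultimately show ?thesis by (auto simp: ktrip_def)
qed

lemma kmove_equiv: "kmove i w \<sim>\<^sub>K w"
proof (cases "length w < i + 3")
  case False
  then obtain a x y z b where w: "w = a @ x # y # z # b" "length a = i" by (rule kmove_decomp)
  have "a @ [x, y, z] @ b \<sim>\<^sub>K a @ ktrip x y z @ b" by (rule knuth_ctxt[OF ktrip_equiv])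
  then show ?thesis using kmove_app[of a x y z b] w knuth_sym by simp
qed (simp add: kmove_short)

lemma knuth_step_kmove: assumes "knuth_step u v" shows "\<exists>i. v = kmove i u"
  using assms
proof (cases rule: knuth_step.cases)
  case (K1 x y z a b)
  then show ?thesis using kmove_app[of a x z y b] by (auto simp: ktrip_def intro!: exI[of _ "length a"])
next
  case (K2 x y z a b)
  then show ?thesis using kmove_app[of a y x z b] by (auto simp: ktrip_def intro!: exI[of _ "length a"])
qed

lemma fold_kmove_equiv: "fold kmove ks u \<sim>\<^sub>K u"
  by (induction ks arbitrary: u) (auto intro: knuth_trans kmove_equiv)

lemma length_fold_kmove [simp]: "length (fold kmove ks u) = length u"
  by (induction ks arbitrary: u) auto

lemma fold_kmove_inverse: "fold kmove (rev ks) (fold kmove ks u) = u"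
  by (induction ks arbitrary: u) auto

lemma knuth_kmoves: assumes "u \<sim>\<^sub>K v" obtains ks where "v = fold kmove ks u"
proof -
  have "\<exists>ks. v = fold kmove ks u"
    using assms unfolding knuth_equiv_def[of u v]
  proof (induction rule: rtranclp_induct)
    case base then show ?case by (auto intro: exI[of _ "[]"])
  next
    case (step y z)
    then obtain ks where ks: "y = fold kmove ks u" by blast
    \<comment> \<open>A relation read backwards is the same move, because moves are
      involutions.\<close>
    from step(2) have "\<exists>i. z = kmove i y"
      by (auto dest!: knuth_step_kmove) (metis kmove_involution)
    then obtain i where "z = kmove i y" by blast
    then have "z = fold kmove (ks @ [i]) u" using ks by simp
    then show ?case by blast
  qed
  then show ?thesis using that by blast
qed

section \<open>Row insertion\<close>

lemma row_ins_cases: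
  obtains (app) "\<forall>a\<in>set r. a \<le> x" "row_ins x r = (r @ [x], None)"
  | (bump) A y B where "r = A @ y # B" "\<forall>a\<in>set A. a \<le> x" "x < y" "row_ins x r = (A @ x # B, Some y)"
proof -
  have "(\<forall>a\<in>set r. a \<le> x) \<and> row_ins x r = (r @ [x], None) \<or>
    (\<exists>A y B. r = A @ y # B \<and> (\<forall>a\<in>set A. a \<le> x) \<and> x < y \<and> row_ins x r = (A @ x # B, Some y))"
  proof (induction r)
    case (Cons a r)
    show ?case
    proof (cases "x < a")
      case True
      then show ?thesis by (intro disjI2 exI[of _ "[]"]) auto
    next
      case False
      from Cons show ?thesis
      proof
        assume "\<exists>A y B. r = A @ y # B \<and> (\<forall>a\<in>set A. a \<le> x) \<and> x < y \<and> row_ins x r = (A @ x # B, Some y)"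
        then obtain A y B where "r = A @ y # B" "\<forall>a\<in>set A. a \<le> x" "x < y" "row_ins x r = (A @ x # B, Some y)"
          by blast
        then show ?thesis using False by (intro disjI2 exI[of _ "a # A"]) auto
      qed (use False in auto)
    qed
  qed simp
  then show ?thesis using that by blast
qed

lemma row_ins_app: "\<forall>a\<in>set r. a \<le> x \<Longrightarrow> row_ins x r = (r @ [x], None)"
  by (induction r) auto

lemma row_ins_bump: "\<forall>a\<in>set A. a \<le> x \<Longrightarrow> x < y \<Longrightarrow> row_ins x (A @ y # B) = (A @ x # B, Some y)"
  by (induction A) auto

lemma row_ins_sorted: "sorted r \<Longrightarrow> sorted (fst (row_ins x r))"
  by (rule row_ins_cases[of r x]) (auto simp: sorted_append)

text \<open>The second component is the word of bumped letters. Passing it to the next row makes the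
  insertion of a word a cascade through the rows, which permits induction on the tableau instead of
  the word.\<close>

fun ins_row :: "nat list \<Rightarrow> word \<Rightarrow> nat list \<times> word" where
  "ins_row r [] = (r, [])"
| "ins_row r (x # xs) = (case row_ins x r of (r', b) \<Rightarrow>
     (case ins_row r' xs of (r'', bs) \<Rightarrow> (r'', (case b of None \<Rightarrow> bs | Some y \<Rightarrow> y # bs))))"

lemma fold_tab_ins_Cons:
  "fold tab_ins w (r # rs) = fst (ins_row r w) # fold tab_ins (snd (ins_row r w)) rs"
  by (induction w arbitrary: r rs) (auto split: prod.splits option.splits)

lemma fold_tab_ins_Nil: "w \<noteq> [] \<Longrightarrow> fold tab_ins w [] = fold tab_ins w [[]]"
  by (cases w) auto

lemma ins_row_append:
  "ins_row r (u @ v) = (fst (ins_row (fst (ins_row r u)) v), snd (ins_row r u) @ snd (ins_row (fst (ins_row r u)) v))"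
  by (induction u arbitrary: r) (auto split: prod.splits option.splits)

lemma RS_snoc: "RS (u @ [x]) = (tab_ins x (Ptab u),
    add_entry (Qtab u) (shape (tab_ins x (Ptab u))) (Suc (length (concat (Qtab u)))))"
  by (auto simp: RS_def Ptab_def Qtab_def Let_def split: prod.splits)

lemma Ptab_fold: "Ptab w = fold tab_ins w []"
  by (induction w rule: rev_induct) (auto simp: RS_snoc Ptab_def, simp add: RS_def)

lemma Ptab_append: "Ptab (u @ v) = fold tab_ins v (Ptab u)"
  by (simp add: Ptab_fold)

lemma Ptab_Nil [simp]: "Ptab [] = []"
  by (simp add: Ptab_fold)

subsection \<open>Invariance of the insertion tableau\<close>

definition knuth_triple :: "word \<Rightarrow> word \<Rightarrow> bool" where
  "knuth_triple t t' \<longleftrightarrow> (\<exists>x y z. x \<le> y \<and> y < z \<and> t = [x, z, y] \<and> t' = [z, x, y]) \<or>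
     (\<exists>x y z. x < y \<and> y \<le> z \<and> t = [y, x, z] \<and> t' = [y, z, x])"

lemma knuth_step_triple: "knuth_step u v \<Longrightarrow> \<exists>a b t t'. u = a @ t @ b \<and> v = a @ t' @ b \<and> knuth_triple t t'"
proof (erule knuth_step.cases)
  fix x y z a b assume "u = a @ [x, z, y] @ b" "v = a @ [z, x, y] @ b" "x \<le> y" "y < z"
  then show ?thesis unfolding knuth_triple_def by (intro exI[of _ a] exI[of _ b] exI[of _ "[x, z, y]"] exI[of _ "[z, x, y]"]) auto
next
  fix x y z a b assume "u = a @ [y, x, z] @ b" "v = a @ [y, z, x] @ b" "x < y" "y \<le> z"
  then show ?thesis unfolding knuth_triple_def by (intro exI[of _ a] exI[of _ b] exI[of _ "[y, x, z]"] exI[of _ "[y, z, x]"]) auto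
qed

lemma ins_row_pass:
  "\<forall>x\<in>set w. h \<le> x \<Longrightarrow> ins_row (h # t) w = (h # fst (ins_row t w), snd (ins_row t w))"
  by (induction w arbitrary: t) (auto split: prod.splits option.splits)

lemma row_ins_set: "x \<in> set (fst (row_ins x r))"
  by (rule row_ins_cases[of r x]) auto

lemma row_ins_snd_in: "row_ins x r = (r', Some y) \<Longrightarrow> y \<in> set r \<and> x < y"
  by (rule row_ins_cases[of r x]) auto

lemma row_ins_fst_sub: "set (fst (row_ins x r)) \<subseteq> insert x (set r)"
  by (rule row_ins_cases[of r x]) auto

lemma row_ins_exists_bump:
  assumes "sorted r" "z \<in> set r" "y < z"
  obtains p r' where "row_ins y r = (r', Some p)" "y < p" "p \<le> z" "p \<in> set r"
proof (rule row_ins_cases[of r y])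
  assume "\<forall>a\<in>set r. a \<le> y" then show ?thesis using assms(2,3) by auto
next
  fix A p B assume *: "r = A @ p # B" "\<forall>a\<in>set A. a \<le> y" "y < p" "row_ins y r = (A @ y # B, Some p)"
  then have "z \<in> set (p # B)" using assms(2,3) by auto
  then have "p \<le> z" using assms(1) * by (auto simp: sorted_append)
  with * that show ?thesis by auto
qed

lemma row_ins_second_bump:
  assumes "sorted t" "y \<le> z" "row_ins y t = (t', b1)" "row_ins z t' = (t'', Some q)"
  obtains p where "b1 = Some p" "p \<le> q" "y < p" "z < q"
proof (rule row_ins_cases[of t y])
  assume *: "\<forall>a\<in>set t. a \<le> y" "row_ins y t = (t @ [y], None)"
  then have "\<forall>a\<in>set (t @ [y]). a \<le> z" using assms(2) by (auto intro: order_trans)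
  then have "row_ins z (t @ [y]) = (t @ [y] @ [z], None)" using row_ins_app[of "t @ [y]" z] by simp
  then show ?thesis using assms * by auto
next
  fix A p B assume *: "t = A @ p # B" "\<forall>a\<in>set A. a \<le> y" "y < p" "row_ins y t = (A @ y # B, Some p)"
  then have t': "t' = A @ y # B" "b1 = Some p" using assms(3) by auto
  have q: "q \<in> set t'" "z < q" using row_ins_snd_in assms(4) by blast+
  then have "q \<in> set B" using t' * assms(2) by auto
  then have "p \<le> q" using assms(1) * by (auto simp: sorted_append)
  then show ?thesis using that t' * q by auto
qed

text \<open>Induction on the row: a head that bounds the triple from below is passed untouched,
  otherwise the smallest letter displaces an entry at the front. The reversed alternative is needed,
  since a relation of the first kind can leave the row as one of the second kind read
  backwards.\<close>

lemma ins_row_triple: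
  assumes "sorted r" "knuth_triple u v"
  shows "fst (ins_row r u) = fst (ins_row r v) \<and>
     (snd (ins_row r u) = snd (ins_row r v) \<or> knuth_triple (snd (ins_row r u)) (snd (ins_row r v)) \<or>
      knuth_triple (snd (ins_row r v)) (snd (ins_row r u)))"
  using assms(1)
proof (induction r)
  case Nil
  from assms(2) show ?case by (auto simp: knuth_triple_def)
next
  case (Cons h t)
  have st: "sorted t" and ht: "\<forall>a\<in>set t. h \<le> a" using Cons.prems by auto
  show ?case
  proof (cases "\<forall>x\<in>set u. h \<le> x")
    case True
    then have "\<forall>x\<in>set v. h \<le> x" using assms(2) by (auto simp: knuth_triple_def)
    then show ?thesis using True Cons.IH[OF st] by (simp add: ins_row_pass)
  next
    case False
    from assms(2)[unfolded knuth_triple_def] show ?thesis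
    proof (elim disjE exE conjE)
      fix x y z assume K: "x \<le> y" "y < z" "u = [x, z, y]" "v = [z, x, y]"
      then have xh: "x < h" using False by auto
      show ?thesis
      proof (cases "z < h")
        case True
        show ?thesis
        proof (cases t)
          case Nil
          then show ?thesis using K xh True by auto
        next
          case (Cons t1 t')
          then have "h \<le> t1" using ht by auto
          then show ?thesis using K xh True Cons
            by (auto simp: knuth_triple_def)
        qed
      next
        case False
        obtain t1 b1 where e1: "row_ins z t = (t1, b1)" by (cases "row_ins z t")
        have st1: "sorted t1" using row_ins_sorted[OF st, of z] e1 by simp
        have zt1: "z \<in> set t1" using row_ins_set[of z t] e1 by simp
        obtain p t2 where p: "row_ins y t1 = (t2, Some p)" "y < p" "p \<le> z" "p \<in> set t1"
          using row_ins_exists_bump[OF st1 zt1 K(2)] by metis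
        have hp: "h \<le> p" using p(4) row_ins_fst_sub[of z t] e1 ht False by auto
        have bq: "b1 = Some q \<Longrightarrow> z < q" for q using row_ins_snd_in e1 by blast
        show ?thesis using K xh False e1 p hp bq
          by (cases b1) (auto simp: knuth_triple_def not_less intro: le_less_trans)
      qed
    next
      fix x y z assume K: "x < y" "y \<le> z" "u = [y, x, z]" "v = [y, z, x]"
      then have xh: "x < h" using False by auto
      show ?thesis
      proof (cases "y < h")
        case True
        obtain t1 b1 where e1: "row_ins z t = (t1, b1)" by (cases "row_ins z t")
        have bq: "b1 = Some q \<Longrightarrow> h \<le> q" for q using row_ins_snd_in e1 ht by blast
        show ?thesis using K xh True e1 bq
          by (cases b1) (auto simp: knuth_triple_def not_less)
      next
        case False
        obtain t1 b1 where e1: "row_ins y t = (t1, b1)" by (cases "row_ins y t")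
        obtain t2 b2 where e2: "row_ins z t1 = (t2, b2)" by (cases "row_ins z t1")
        show ?thesis
        proof (cases b2)
          case None
          then show ?thesis using K xh False e1 e2 by (cases b1) auto
        next
          case (Some q)
          obtain p where p: "b1 = Some p" "p \<le> q" "y < p" "z < q"
            using row_ins_second_bump[OF st K(2) e1] e2 Some by metis
          then have "h < p" using False by auto
          then show ?thesis using K xh False e1 e2 Some p
            by (auto simp: knuth_triple_def)
        qed
      qed
    qed
  qed
qed

lemma fold_tab_ins_triple:
  assumes "\<forall>r\<in>set T. sorted r" "knuth_triple u v"
  shows "fold tab_ins u T = fold tab_ins v T"
  using assms
proof (induction T arbitrary: u v)
  case Nil
  have "u \<noteq> []" "v \<noteq> []" using Nil by (auto simp: knuth_triple_def)
  moreover have "fold tab_ins u [[]] = fold tab_ins v [[]]"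
    using Nil(2) by (auto simp: knuth_triple_def)
  ultimately show ?case by (simp add: fold_tab_ins_Nil)
next
  case (Cons r T)
  then show ?case using ins_row_triple[of r u v] by (auto simp: fold_tab_ins_Cons)
qed

lemma tab_ins_sorted: "\<forall>r\<in>set T. sorted r \<Longrightarrow> \<forall>r\<in>set (tab_ins x T). sorted r"
proof (induction T arbitrary: x)
  case (Cons r T)
  then show ?case using row_ins_sorted[of r x] by (cases "row_ins x r") (auto split: option.splits)
qed simp

lemma fold_tab_ins_sorted: "\<forall>r\<in>set T. sorted r \<Longrightarrow> \<forall>r\<in>set (fold tab_ins w T). sorted r"
proof (induction w arbitrary: T)
  case (Cons x w)
  from Cons.IH[OF tab_ins_sorted[OF Cons.prems]] show ?case by simp
qed simp

lemma Ptab_rows_sorted: "r \<in> set (Ptab w) \<Longrightarrow> sorted r"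
  unfolding Ptab_fold using fold_tab_ins_sorted[of "[]" w, simplified] by blast

lemma Ptab_knuth: assumes "u \<sim>\<^sub>K v" shows "Ptab u = Ptab v"
proof (rule knuth_invariant[OF assms])
  fix a b assume "knuth_step a b"
  then obtain c d t t' where *: "a = c @ t @ d" "b = c @ t' @ d" "knuth_triple t t'"
    using knuth_step_triple by blast
  have "fold tab_ins t (Ptab c) = fold tab_ins t' (Ptab c)"
    by (rule fold_tab_ins_triple) (use * Ptab_rows_sorted in auto)
  then show "Ptab a = Ptab b" using * by (simp add: Ptab_append)
qed

lemma knuth_move_left:
  assumes "sorted B" "\<forall>b\<in>set B. y \<le> b" "x < y"
  shows "y # B @ [x] \<sim>\<^sub>K y # x # B"
  using assms
proof (induction B rule: rev_induct)
  case (snoc b B)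
  define c where "c = last (y # B)"
  have c: "y # B = butlast (y # B) @ [c]" by (simp add: c_def)
  have "c \<in> set (y # B)" unfolding c_def by (rule last_in_set) simp
  then have cb: "y \<le> c" "c \<le> b" using snoc.prems by (auto simp: sorted_append)
  then have "[c, b, x] \<sim>\<^sub>K [c, x, b]" using snoc.prems by (intro knuth_sym[OF knuth_K2]) auto
  from knuth_ctxt[OF this, of "butlast (y # B)" "[]"] have "(butlast (y # B) @ [c]) @ [b, x] \<sim>\<^sub>K (butlast (y # B) @ [c]) @ [x, b]"
    by simp
  then have "y # (B @ [b]) @ [x] \<sim>\<^sub>K (y # B @ [x]) @ [b]" unfolding c[symmetric] by simp
  moreover have "(y # B @ [x]) @ [b] \<sim>\<^sub>K (y # x # B) @ [b]"
    using snoc by (intro knuth_app) (auto simp: sorted_append)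
  ultimately show ?case using knuth_trans by fastforce
qed simp

lemma knuth_move_left':
  assumes "sorted A" "\<forall>a\<in>set A. a \<le> x" "x < y"
  shows "A @ [y, x] \<sim>\<^sub>K y # A @ [x]"
  using assms
proof (induction A)
  case (Cons a A)
  define c where "c = hd (A @ [x])"
  have c: "A @ [x] = c # tl (A @ [x])" by (simp add: c_def)
  have "c \<in> set (A @ [x])" unfolding c_def by (rule hd_in_set) simp
  then have cb: "a \<le> c" "c < y" using Cons.prems by auto
  then have "[a, y, c] \<sim>\<^sub>K [y, a, c]" by (rule knuth_K1)
  from knuth_ctxt[OF this, of "[]" "tl (A @ [x])"]
  have "[a, y] @ (c # tl (A @ [x])) \<sim>\<^sub>K [y, a] @ (c # tl (A @ [x]))" by simp
  then have "[a, y] @ A @ [x] \<sim>\<^sub>K [y, a] @ A @ [x]" unfolding c[symmetric] .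
  moreover have "[a] @ (A @ [y, x]) \<sim>\<^sub>K [a] @ (y # A @ [x])"
    using Cons by (intro knuth_app) auto
  ultimately show ?case using knuth_trans by fastforce
qed simp

text \<open>First \<open>x\<close> travels left to the place just behind the bumped
  \<open>y\<close>, using the second Knuth relation; then \<open>y\<close> travels left to the front
  past the entries that are at most \<open>x\<close>, using the first.\<close>

lemma row_ins_knuth:
  assumes "sorted r" "row_ins x r = (r', Some y)"
  shows "r @ [x] \<sim>\<^sub>K y # r'"
proof (rule row_ins_cases[of r x])
  fix A z B assume *: "r = A @ z # B" "\<forall>a\<in>set A. a \<le> x" "x < z" "row_ins x r = (A @ x # B, Some z)"
  then have [simp]: "z = y" "r' = A @ x # B" using assms by auto
  have "A @ (y # B @ [x]) \<sim>\<^sub>K A @ (y # x # B)"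
    using assms * by (intro knuth_app knuth_move_left) (auto simp: sorted_append)
  also have "(A @ [y, x]) @ B \<sim>\<^sub>K (y # A @ [x]) @ B"
    using assms * by (intro knuth_app knuth_move_left') (auto simp: sorted_append)
  then have "A @ (y # x # B) \<sim>\<^sub>K y # r'" by simp
  finally show ?thesis using * by simp
qed (use assms(2) in simp)

lemma tab_word_Cons: "tab_word (r # T) = tab_word T @ r"
  by (simp add: tab_word_def)

lemma tab_word_Nil [simp]: "tab_word [] = []"
  by (simp add: tab_word_def)

lemma tab_ins_knuth: "\<forall>r\<in>set T. sorted r \<Longrightarrow> tab_word (tab_ins x T) \<sim>\<^sub>K tab_word T @ [x]"
proof (induction T arbitrary: x)
  case (Cons r T)
  show ?case
  proof (cases "snd (row_ins x r)")
    case None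
    then have "row_ins x r = (r @ [x], None)" by (rule_tac row_ins_cases[of r x]) auto
    then show ?thesis by (simp add: tab_word_Cons)
  next
    case (Some y)
    then obtain r' where r': "row_ins x r = (r', Some y)" by (metis prod.collapse)
    have "tab_word (tab_ins y T) @ r' \<sim>\<^sub>K (tab_word T @ [y]) @ r'"
      using Cons by (intro knuth_app) auto
    moreover have "tab_word T @ (y # r') \<sim>\<^sub>K tab_word T @ (r @ [x])"
      using Cons.prems r' by (intro knuth_app knuth_sym[OF row_ins_knuth]) auto
    ultimately show ?thesis using r' knuth_trans by (fastforce simp: tab_word_Cons)
  qed
qed (simp add: tab_word_def)

lemma tab_word_Ptab: "tab_word (Ptab w) \<sim>\<^sub>K w"
proof (induction w rule: rev_induct)
  case (snoc x w)
  have "tab_word (Ptab (w @ [x])) \<sim>\<^sub>K tab_word (Ptab w) @ [x]"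
    using tab_ins_knuth[of "Ptab w" x] Ptab_rows_sorted by (simp add: Ptab_append)
  also have "\<dots> \<sim>\<^sub>K w @ [x]" using snoc by (intro knuth_app) auto
  finally show ?case .
qed simp

lemma knuth_iff_Ptab: "u \<sim>\<^sub>K v \<longleftrightarrow> Ptab u = Ptab v"
proof
  assume "Ptab u = Ptab v"
  then have "u \<sim>\<^sub>K tab_word (Ptab v)" using knuth_sym[OF tab_word_Ptab[of u]] by simp
  then show "u \<sim>\<^sub>K v" using tab_word_Ptab by (rule knuth_trans)
qed (rule Ptab_knuth)

subsection \<open>Column-strict tableaux\<close>

definition dom_row :: "nat list \<Rightarrow> nat list \<Rightarrow> bool" where
  "dom_row r s \<longleftrightarrow> length s \<le> length r \<and> (\<forall>j<length s. r ! j < s ! j)"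

lemma column_strict_Nil [simp]: "column_strict []"
  by (simp add: column_strict_def)

lemma column_strict_Cons:
  "column_strict (r # T) \<longleftrightarrow> r \<noteq> [] \<and> sorted r \<and> column_strict T \<and> (T = [] \<or> dom_row r (hd T))"
proof (cases T)
  case Nil then show ?thesis by (auto simp: column_strict_def dom_row_def)
next
  case (Cons s U)
  have all: "(\<forall>i<Suc n. P i) \<longleftrightarrow> P 0 \<and> (\<forall>i<n. P (Suc i))" for P n
    using less_Suc_eq_0_disj by auto
  have al: "(\<forall>i. P i) \<longleftrightarrow> P 0 \<and> (\<forall>i. P (Suc i))" for P :: "nat \<Rightarrow> bool"
    by (metis not0_implies_Suc)
  have 1: "(\<forall>i. Suc i < Suc n \<longrightarrow> P i) \<longleftrightarrow> (\<forall>i<n. P i)" for P n by simp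
  show ?thesis unfolding Cons column_strict_def dom_row_def
    by (simp add: all al[of "\<lambda>i. i < length U \<longrightarrow> _ i"] al[of "\<lambda>i. \<forall>j. i < length U \<longrightarrow> _ i j"]) blast
qed

lemma column_strict_sorted: "column_strict T \<Longrightarrow> r \<in> set T \<Longrightarrow> sorted r"
  by (induction T) (auto simp: column_strict_Cons)

lemma column_strict_nonempty: "column_strict T \<Longrightarrow> r \<in> set T \<Longrightarrow> r \<noteq> []"
  by (induction T) (auto simp: column_strict_Cons)

lemma dom_row_Nil [simp]: "dom_row r []"
  by (simp add: dom_row_def)

text \<open>The entry below the old place of \<open>y\<close> exceeds \<open>y\<close>, so
  \<open>y\<close> enters the next row weakly to the left of column \<open>length A\<close>; there
  the row above now carries an entry at most \<open>x\<close>, hence smaller than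
  \<open>y\<close>.\<close>

lemma dom_row_bump:
  assumes "dom_row (A @ y # B) s" "\<forall>a\<in>set A. a \<le> x" "x < y" "sorted s"
  shows "dom_row (A @ x # B) (fst (row_ins y s))"
proof (rule row_ins_cases[of s y])
  assume *: "\<forall>a\<in>set s. a \<le> y" "row_ins y s = (s @ [y], None)"
  have "length s \<le> length A"
  proof (rule ccontr)
    assume "\<not> ?thesis"
    then have "y < s ! length A" "s ! length A \<in> set s" using assms(1) unfolding dom_row_def
      by (auto dest!: spec[of _ "length A"])
    then show False using * by auto
  qed
  moreover have "(A @ x # B) ! length s < y"
  proof (cases "length s < length A")
    case True
    then have "A ! length s \<le> x" using assms(2) by auto
    then show ?thesis using True assms(3) by (simp add: nth_append)
  qed (use \<open>length s \<le> length A\<close> assms(3) in \<open>auto simp: nth_append\<close>)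
  moreover have "(A @ x # B) ! j < s ! j" if "j < length s" for j
  proof -
    have "(A @ x # B) ! j \<le> (A @ y # B) ! j" using assms(3) by (auto simp: nth_append nth_Cons')
    also have "\<dots> < s ! j" using assms(1) that unfolding dom_row_def by auto
    finally show ?thesis .
  qed
  ultimately show ?thesis using * unfolding dom_row_def
    by (auto simp: nth_append less_Suc_eq)
next
  fix C z D assume *: "s = C @ z # D" "\<forall>a\<in>set C. a \<le> y" "y < z" "row_ins y s = (C @ y # D, Some z)"
  have le: "length C \<le> length A"
  proof (rule ccontr)
    assume "\<not> ?thesis"
    then have "y < C ! length A" "C ! length A \<in> set C" using assms(1) * unfolding dom_row_def
      by (auto dest!: spec[of _ "length A"] simp: nth_append)
    then show False using * by auto
  qed
  have d: "j < length s \<Longrightarrow> (A @ y # B) ! j < s ! j" for j using assms(1) unfolding dom_row_def by auto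
  have "(A @ x # B) ! j < (C @ y # D) ! j" if "j < length s" for j
  proof (cases "j = length C")
    case True
    show ?thesis
    proof (cases "j < length A")
      case True
      then have "A ! j \<le> x" using assms(2) by auto
      then show ?thesis using True \<open>j = length C\<close> assms(3) by (simp add: nth_append)
    qed (use True le assms(3) in \<open>auto simp: nth_append\<close>)
  next
    case False
    then have "(C @ y # D) ! j = s ! j" by (auto simp: * nth_append nth_Cons')
    moreover have "(A @ x # B) ! j \<le> (A @ y # B) ! j" using assms(3) by (auto simp: nth_append nth_Cons')
    ultimately show ?thesis using d[OF that] by simp
  qed
  then show ?thesis using assms(1) * unfolding dom_row_def by auto
qed

lemma tab_ins_neq_Nil [simp]: "tab_ins x T \<noteq> []"
  by (cases T) (auto split: prod.splits option.splits)

lemma hd_tab_ins: "hd (tab_ins x T) = fst (row_ins x (if T = [] then [] else hd T))"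
  by (cases T) (auto split: prod.splits option.splits)

lemma tab_ins_column_strict: "column_strict T \<Longrightarrow> column_strict (tab_ins x T)"
proof (induction T arbitrary: x)
  case Nil then show ?case by (simp add: column_strict_Cons)
next
  case (Cons r T)
  note cs = Cons.prems[unfolded column_strict_Cons]
  show ?case
  proof (rule row_ins_cases[of r x])
    assume *: "\<forall>a\<in>set r. a \<le> x" "row_ins x r = (r @ [x], None)"
    then show ?thesis using cs
      by (auto simp: column_strict_Cons dom_row_def sorted_append nth_append)
  next
    fix A y B assume *: "r = A @ y # B" "\<forall>a\<in>set A. a \<le> x" "x < y" "row_ins x r = (A @ x # B, Some y)"
    have s: "sorted (A @ x # B)" using row_ins_sorted[of r x] * cs by simp
    have "dom_row (A @ x # B) (fst (row_ins y (if T = [] then [] else hd T)))"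
    proof (rule dom_row_bump)
      show "dom_row (A @ y # B) (if T = [] then [] else hd T)" using cs * by auto
      show "sorted (if T = [] then [] else hd T)" using cs column_strict_sorted by auto
    qed (use * in auto)
    then show ?thesis using * cs s Cons.IH[of y] by (simp add: column_strict_Cons hd_tab_ins)
  qed
qed

lemma Ptab_column_strict: "column_strict (Ptab w)"
proof (induction w rule: rev_induct)
  case (snoc x xs)
  then show ?case by (simp add: Ptab_append tab_ins_column_strict)
qed simp

subsection \<open>Inserting a whole row\<close>

text \<open>The letters before position \<open>j\<close> already occupy the columns before
  \<open>j\<close>, so letter \<open>j\<close> bumps exactly the entry of column \<open>j\<close>,
  if there is one.\<close>

lemma ins_row_run:
  assumes "sorted r" "\<forall>j<min (length r) (length s). r ! j < s ! j"
  shows "ins_row s r = (r @ drop (length r) s, take (length r) s)"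
  using assms
proof (induction r rule: rev_induct)
  case (snoc x r)
  have "\<forall>j<min (length r) (length s). r ! j < s ! j"
  proof (intro allI impI)
    fix j assume "j < min (length r) (length s)"
    then show "r ! j < s ! j" using snoc.prems(2)[rule_format, of j] by (simp add: nth_append)
  qed
  then have IH: "ins_row s r = (r @ drop (length r) s, take (length r) s)"
    using snoc by (simp add: sorted_append)
  have rx: "\<forall>a\<in>set r. a \<le> x" using snoc.prems by (simp add: sorted_append)
  show ?case
  proof (cases "length r < length s")
    case True
    then have d: "drop (length r) s = s ! length r # drop (Suc (length r)) s"
      by (simp add: Cons_nth_drop_Suc)
    have "x < s ! length r" using snoc.prems(2)[rule_format, of "length r"] True by simp
    then show ?thesis using True IH row_ins_bump[OF rx, of "s ! length r" "drop (Suc (length r)) s"]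
      by (simp add: ins_row_append d take_Suc_conv_app_nth)
  next
    case False
    then show ?thesis using IH row_ins_app[OF rx] by (simp add: ins_row_append)
  qed
qed simp

text \<open>At the first column where domination fails, an old entry stays in front of the inserted
  letter. From then on the initial segment of entries at most \<open>last r\<close> is longer than
  \<open>r\<close>, and each further letter prolongs it. Thus domination can be recognised from the
  length of the resulting row.\<close>

lemma ins_row_sorted_cases:
  assumes "sorted r"
  shows "(\<forall>j<min (length r) (length s). r ! j < s ! j) \<or>
    (r \<noteq> [] \<and> (\<exists>M N. fst (ins_row s r) = M @ N \<and> length r < length M \<and> (\<forall>m\<in>set M. m \<le> last r)))"
  using assms
proof (induction r rule: rev_induct)
  case (snoc x r)
  have rx: "\<forall>a\<in>set r. a \<le> x" and sr: "sorted r" using snoc.prems by (simp_all add: sorted_append)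
  from snoc.IH[OF sr] show ?case
  proof
    assume IH: "\<forall>j<min (length r) (length s). r ! j < s ! j"
    have e: "ins_row s r = (r @ drop (length r) s, take (length r) s)"
      by (rule ins_row_run[OF sr IH])
    show ?thesis
    proof (cases "length r < length s \<and> s ! length r \<le> x")
      case False
      have "\<forall>j<min (length (r @ [x])) (length s). (r @ [x]) ! j < s ! j"
        using False IH by (auto simp: nth_append less_Suc_eq)
      then show ?thesis by blast
    next
      case True
      then have d: "drop (length r) s = s ! length r # drop (Suc (length r)) s"
        by (simp add: Cons_nth_drop_Suc)
      have a: "fst (ins_row s (r @ [x])) = fst (row_ins x (r @ s ! length r # drop (Suc (length r)) s))"
        by (simp add: ins_row_append e d split: prod.splits)
      have "\<exists>M N. fst (row_ins x (r @ s ! length r # D)) = M @ N \<and> Suc (length r) < length M \<and> (\<forall>m\<in>set M. m \<le> x)" for D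
      proof -
        have p: "\<forall>a\<in>set (r @ [s ! length r]). a \<le> x" using rx True by auto
        have "\<exists>M N. fst (row_ins x (q @ D)) = M @ N \<and> length q < length M \<and> (\<forall>m\<in>set M. m \<le> x)"
          if "\<forall>a\<in>set q. a \<le> x" for q
          using that
        proof (induction q)
          case Nil
          show ?case
          proof (rule row_ins_cases[of D x])
            assume "\<forall>a\<in>set D. a \<le> x" "row_ins x D = (D @ [x], None)"
            then show ?thesis by (intro exI[of _ "D @ [x]"] exI[of _ "[]"]) auto
          next
            fix A y B assume "D = A @ y # B" "\<forall>a\<in>set A. a \<le> x" "row_ins x D = (A @ x # B, Some y)"
            then show ?thesis by (intro exI[of _ "A @ [x]"] exI[of _ B]) auto
          qed
        next
          case (Cons a q)
          then obtain M N where "fst (row_ins x (q @ D)) = M @ N" "length q < length M" "\<forall>m\<in>set M. m \<le> x" by auto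
          then show ?case using Cons.prems
            by (intro exI[of _ "a # M"] exI[of _ N]) (auto split: prod.splits)
        qed
        from this[OF p] show ?thesis by simp
      qed
      then show ?thesis using a by simp
    qed
  next
    assume "r \<noteq> [] \<and> (\<exists>M N. fst (ins_row s r) = M @ N \<and> length r < length M \<and> (\<forall>m\<in>set M. m \<le> last r))"
    then obtain M N where M: "fst (ins_row s r) = M @ N" "length r < length M" "\<forall>m\<in>set M. m \<le> last r"
      and rn: "r \<noteq> []" by blast
    have Mx: "\<forall>m\<in>set M. m \<le> x"
      using M(3) rx last_in_set[OF rn] by (meson order_trans)
    have "\<exists>M' N'. fst (row_ins x (M @ N)) = M' @ N' \<and> length M < length M' \<and> (\<forall>m\<in>set M'. m \<le> x)"
      using Mx
    proof (induction M)
      case Nil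
      show ?case
      proof (rule row_ins_cases[of N x])
        assume "\<forall>a\<in>set N. a \<le> x" "row_ins x N = (N @ [x], None)"
        then show ?thesis by (intro exI[of _ "N @ [x]"] exI[of _ "[]"]) auto
      next
        fix A y B assume "N = A @ y # B" "\<forall>a\<in>set A. a \<le> x" "row_ins x N = (A @ x # B, Some y)"
        then show ?thesis by (intro exI[of _ "A @ [x]"] exI[of _ B]) auto
      qed
    next
      case (Cons a q)
      then obtain M' N' where "fst (row_ins x (q @ N)) = M' @ N'" "length q < length M'" "\<forall>m\<in>set M'. m \<le> x" by auto
      then show ?case using Cons.prems
        by (intro exI[of _ "a # M'"] exI[of _ N']) (auto split: prod.splits)
    qed
    then obtain M' N' where "fst (row_ins x (M @ N)) = M' @ N'" "length M < length M'" "\<forall>m\<in>set M'. m \<le> x" by blast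
    then show ?thesis using M
      by (intro disjI2 conjI exI[of _ M'] exI[of _ N']) (auto simp: ins_row_append split: prod.splits)
  qed
qed simp

lemma fold_tab_ins_run:
  assumes "column_strict T" "sorted r" "r \<noteq> []" "T = [] \<or> dom_row r (hd T)"
  shows "fold tab_ins r T = r # T"
  using assms
proof (induction T arbitrary: r)
  case Nil
  then show ?case using ins_row_run[of r "[]"] by (simp add: fold_tab_ins_Nil fold_tab_ins_Cons)
next
  case (Cons s T)
  then have d: "length s \<le> length r" "\<forall>j<min (length r) (length s). r ! j < s ! j"
    by (auto simp: dom_row_def)
  have "fold tab_ins s T = s # T" using Cons by (auto simp: column_strict_Cons)
  then show ?case using d ins_row_run[OF Cons.prems(2) d(2)] by (simp add: fold_tab_ins_Cons)
qed

lemma Ptab_tab_word: "column_strict T \<Longrightarrow> Ptab (tab_word T) = T"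
proof (induction T)
  case (Cons r T)
  then show ?case
    by (auto simp: tab_word_Cons Ptab_append column_strict_Cons intro: fold_tab_ins_run)
qed simp

lemma tab_word_inj:
  "column_strict T \<Longrightarrow> column_strict T' \<Longrightarrow> tab_word T = tab_word T' \<Longrightarrow> T = T'"
  using Ptab_tab_word by metis

lemma shape_Cons [simp]: "shape (r # T) = length r # shape T"
  and shape_Nil [simp]: "shape [] = []"
  by (simp_all add: shape_def)

lemma length_shape [simp]: "length (shape T) = length T"
  by (simp add: shape_def)

text \<open>The first \<open>length r\<close> columns are pushed down by one cell and the others do
  not move, because every row is at least as long as \<open>r\<close>.\<close>

lemma shape_push_row:
  assumes "column_strict T" "\<forall>s\<in>set T. length r \<le> length s" "sorted r" "r \<noteq> []"
    "T \<noteq> [] \<Longrightarrow> \<forall>j<length r. r ! j < hd T ! j"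
  shows "shape (fold tab_ins r T) = shape T @ [length r]"
  using assms
proof (induction T arbitrary: r)
  case Nil
  then show ?case by (simp add: fold_tab_ins_run)
next
  case (Cons s T)
  have d: "\<forall>j<min (length r) (length s). r ! j < s ! j" using Cons.prems by auto
  have ls: "length r \<le> length s" using Cons.prems by simp
  have cs: "sorted s" "column_strict T" "T = [] \<or> dom_row s (hd T)"
    using Cons.prems(1) by (auto simp: column_strict_Cons)
  have "shape (fold tab_ins (take (length r) s) T) = shape T @ [length (take (length r) s)]"
  proof (rule Cons.IH)
    show "\<forall>s'\<in>set T. length (take (length r) s) \<le> length s'" using Cons.prems ls by simp
    show "sorted (take (length r) s)" using cs by (simp add: sorted_wrt_take)
    show "take (length r) s \<noteq> []" using Cons.prems ls by auto
    show "T \<noteq> [] \<Longrightarrow> \<forall>j<length (take (length r) s). take (length r) s ! j < hd T ! j"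
    proof -
      assume "T \<noteq> []"
      then have "length r \<le> length (hd T)" using Cons.prems(2) by simp
      then show ?thesis using cs \<open>T \<noteq> []\<close> ls by (auto simp: dom_row_def)
    qed
  qed (use cs in simp)
  then show ?case using ls ins_row_run[OF Cons.prems(3) d] by (simp add: fold_tab_ins_Cons)
qed

lemma first_row_run:
  assumes "sorted r" shows "length r \<le> length (fst (ins_row s r))"
  using ins_row_sorted_cases[OF assms, of s] ins_row_run[OF assms, of s] by auto

lemma length_ins_row: "length s \<le> length (fst (ins_row s r))"
proof (induction r arbitrary: s)
  case (Cons x r)
  have "length s \<le> length (fst (row_ins x s))" by (rule row_ins_cases[of s x]) auto
  also have "\<dots> \<le> length (fst (ins_row (fst (row_ins x s)) r))" by (rule Cons)
  finally show ?case by (auto simp: case_prod_beta)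
qed simp

lemma dom_row_of_run:
  assumes "sorted r" "length (fst (ins_row s r)) = length r"
  shows "dom_row r s"
proof -
  have "length s \<le> length r" using length_ins_row[of s r] assms(2) by simp
  moreover have "\<forall>j<min (length r) (length s). r ! j < s ! j"
    using ins_row_sorted_cases[OF assms(1), of s] assms(2) by auto
  ultimately show ?thesis by (simp add: dom_row_def)
qed

subsection \<open>Shapes\<close>

text \<open>Rows are counted from 0; an index past the last row opens a new row of length
  one.\<close>

fun add_cell :: "nat \<Rightarrow> nat list \<Rightarrow> nat list" where
  "add_cell i [] = [1]"
| "add_cell 0 (a # l) = Suc a # l"
| "add_cell (Suc i) (a # l) = a # add_cell i l"

text \<open>Bumping paths drift weakly to the left: when \<open>y\<close> leaves column
  \<open>length A\<close>, the next row has at most \<open>length A\<close> entries not exceeding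
  \<open>y\<close>. So the bound \<open>k\<close> found in the top row survives all the way
  down.\<close>

lemma tab_ins_shape_col:
  assumes "column_strict T" "length (filter (\<lambda>a. a \<le> x) (if T = [] then [] else hd T)) \<le> k"
  shows "\<exists>i\<le>length T. shape (tab_ins x T) = add_cell i (shape T) \<and> length (tab_ins x T ! i) \<le> Suc k"
  using assms
proof (induction T arbitrary: x)
  case Nil
  then show ?case by simp
next
  case (Cons r T)
  show ?case
  proof (rule row_ins_cases[of r x])
    assume *: "\<forall>a\<in>set r. a \<le> x" "row_ins x r = (r @ [x], None)"
    then have "filter (\<lambda>a. a \<le> x) r = r" by simp
    then show ?thesis using * Cons.prems(2) by (intro exI[of _ 0]) auto
  next
    fix A y B assume *: "r = A @ y # B" "\<forall>a\<in>set A. a \<le> x" "x < y" "row_ins x r = (A @ x # B, Some y)"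
    note cs = Cons.prems(1)[unfolded column_strict_Cons]
    have "filter (\<lambda>a. a \<le> x) A = A" using * by simp
    then have A: "length A \<le> k" using * Cons.prems(2) by simp
    have "length (filter (\<lambda>a. a \<le> y) (if T = [] then [] else hd T)) \<le> length A"
    proof (cases "T = []")
      case False
      define s where "s = hd T"
      have d: "dom_row r s" "sorted s" using cs False column_strict_sorted[of T s] by (auto simp: s_def)
      have "filter (\<lambda>a. a \<le> y) (drop (length A) s) = []"
      proof (cases "length A < length s")
        case True
        then have y: "y < s ! length A" using d(1) * by (auto simp: dom_row_def nth_append dest!: spec[of _ "length A"])
        have "s ! length A \<le> a" if "a \<in> set (drop (length A) s)" for a
          using that d(2) by (auto simp: in_set_conv_nth intro!: sorted_nth_mono[OF d(2)])
        then show ?thesis using y by (fastforce simp: filter_empty_conv)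
      qed simp
      then have "length (filter (\<lambda>a. a \<le> y) s) = length (filter (\<lambda>a. a \<le> y) (take (length A) s))"
        by (metis append_Nil2 append_take_drop_id filter_append)
      also have "\<dots> \<le> length A" by (rule order_trans[OF length_filter_le]) simp
      finally show ?thesis using False by (simp add: s_def)
    qed simp
    then have "length (filter (\<lambda>a. a \<le> y) (if T = [] then [] else hd T)) \<le> k" using A by simp
    with Cons.IH[of y] cs obtain i where
      "i \<le> length T" "shape (tab_ins y T) = add_cell i (shape T)" "length (tab_ins y T ! i) \<le> Suc k" by auto
    then show ?thesis using * by (intro exI[of _ "Suc i"]) auto
  qed
qed

lemma tab_ins_shape:
  assumes "column_strict T" obtains i where "i \<le> length T" "shape (tab_ins x T) = add_cell i (shape T)"
  using tab_ins_shape_col[OF assms order_refl] by blast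

text \<open>Reverse insertion. As the old shapes agree, the new row lengths show whether the letter
  was appended or bumped an entry; in the latter case the rows below return the bumped entry, which
  in turn locates the inserted letter.\<close>

lemma tab_ins_inj:
  assumes "shape T1 = shape T2" "\<forall>r\<in>set T1. sorted r" "\<forall>r\<in>set T2. sorted r" "tab_ins x T1 = tab_ins y T2"
  shows "x = y \<and> T1 = T2"
  using assms
proof (induction T1 arbitrary: T2 x y)
  case Nil
  then show ?case by (cases T2) auto
next
  case (Cons r1 T1)
  obtain r2 T2' where T2: "T2 = r2 # T2'" using Cons.prems(1) by (cases T2) auto
  have l: "length r1 = length r2" using Cons.prems T2 by simp
  have n: "length (fst (row_ins x r1)) = length (fst (row_ins y r2))"
    using Cons.prems(4) T2 by (auto split: prod.splits option.splits)
  show ?case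
  proof (rule row_ins_cases[of r1 x])
    assume 1: "row_ins x r1 = (r1 @ [x], None)"
    then have "row_ins y r2 = (r2 @ [y], None)"
      using n l by (rule_tac row_ins_cases[of r2 y]) auto
    then show ?thesis using 1 Cons.prems T2 by auto
  next
    fix A b B assume 1: "r1 = A @ b # B" "\<forall>a\<in>set A. a \<le> x" "x < b" "row_ins x r1 = (A @ x # B, Some b)"
    have "\<exists>C d D. r2 = C @ d # D \<and> (\<forall>a\<in>set C. a \<le> y) \<and> y < d \<and> row_ins y r2 = (C @ y # D, Some d)"
      using n l 1 by (rule_tac row_ins_cases[of r2 y]) auto
    then obtain C d D where 2: "r2 = C @ d # D" "\<forall>a\<in>set C. a \<le> y" "y < d" "row_ins y r2 = (C @ y # D, Some d)"
      by blast
    have e: "A @ x # B = C @ y # D" "tab_ins b T1 = tab_ins d T2'" using Cons.prems(4) 1 2 T2 by auto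
    have IH: "b = d" "T1 = T2'" using Cons.IH[of T2' b d] Cons.prems e T2 by auto
    \<comment> \<open>The inserted letter is the last entry of the new row that is smaller than the
      bumped \<open>b\<close>.\<close>
    have "takeWhile (\<lambda>z. z < b) (A @ x # B) = A @ [x]"
    proof -
      have "takeWhile (\<lambda>z. z < b) B = []" using Cons.prems(2) 1 by (cases B) (auto simp: sorted_append)
      then show ?thesis using 1 by (subst takeWhile_append2) auto
    qed
    moreover have "takeWhile (\<lambda>z. z < b) (C @ y # D) = C @ [y]"
    proof -
      have "takeWhile (\<lambda>z. z < b) D = []" using Cons.prems(3) 2 IH T2 by (cases D) (auto simp: sorted_append)
      then show ?thesis using 2 IH by (subst takeWhile_append2) auto
    qed
    ultimately have "A @ [x] = C @ [y]" using e by simp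
    then show ?thesis using e 1 2 IH T2 by auto
  qed
qed

section \<open>Recording tableaux and injectivity of the Schensted correspondence\<close>

lemma length_concat_add_cell: "sum_list (add_cell i l) = Suc (sum_list l)"
  by (induction i l rule: add_cell.induct) auto

text \<open>\<open>add_entry\<close> with the row as an argument instead of the result of a search,
  so that shape and inverse follow by structural recursion.\<close>

fun put_entry :: "nat \<Rightarrow> nat \<Rightarrow> tableau \<Rightarrow> tableau" where
  "put_entry i k [] = [[k]]"
| "put_entry 0 k (r # Q) = (r @ [k]) # Q"
| "put_entry (Suc i) k (r # Q) = r # put_entry i k Q"

lemma put_entry_upd:
  "i \<le> length Q \<Longrightarrow> put_entry i k Q = (if i < length Q then Q[i := Q ! i @ [k]] else Q @ [[k]])"
  by (induction i k Q rule: put_entry.induct) auto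

lemma shape_put_entry: "shape (put_entry i k Q) = add_cell i (shape Q)"
  by (induction i k Q rule: put_entry.induct) auto

lemma put_entry_nonempty: "[] \<notin> set Q \<Longrightarrow> [] \<notin> set (put_entry i k Q)"
  by (induction i k Q rule: put_entry.induct) auto

lemma put_entry_set: "set (concat (put_entry i k Q)) = insert k (set (concat Q))"
  by (induction i k Q rule: put_entry.induct) auto

text \<open>Erasing the newest label undoes the step. A row emptied in this way must have been
  opened by it, because no older row is empty.\<close>

lemma put_entry_remove:
  assumes "[] \<notin> set Q" "k \<notin> set (concat Q)"
  shows "filter (\<lambda>r. r \<noteq> []) (map (filter (\<lambda>z. z \<noteq> k)) (put_entry i k Q)) = Q"
proof -
  have r: "filter (\<lambda>z. z \<noteq> k) r = r" if "r \<in> set Q" for r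
    using assms(2) that by (auto simp: filter_id_conv)
  have m: "filter (\<lambda>r. r \<noteq> []) (map (filter (\<lambda>z. z \<noteq> k)) Q') = Q'" if "set Q' \<subseteq> set Q" for Q'
    using that assms(1) r by (induction Q') auto
  show ?thesis using assms(1) r m
  proof (induction i k Q rule: put_entry.induct)
    case (2 k r Q)
    have "filter (\<lambda>r. r \<noteq> []) (map (filter (\<lambda>z. z \<noteq> k)) Q) = Q" using 2(3)[of Q] by auto
    then show ?case using 2 by auto
  next
    case (3 i k r Q)
    have "set Q' \<subseteq> set (r # Q)" if "set Q' \<subseteq> set Q" for Q' using that by auto
    then show ?case using 3 by auto
  qed auto
qed

lemma add_cell_nth: "i \<le> length l \<Longrightarrow> j < length (add_cell i l) \<Longrightarrow>
   add_cell i l ! j = (if j = i then Suc (if i < length l then l ! i else 0) else l ! j)"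
  by (induction i l arbitrary: j rule: add_cell.induct) (auto simp: nth_Cons split: nat.splits)

lemma length_add_cell: "i \<le> length l \<Longrightarrow> length (add_cell i l) = (if i < length l then length l else Suc (length l))"
  by (induction i l rule: add_cell.induct) auto

lemma add_entry_put:
  assumes "i \<le> length Q"
  shows "add_entry Q (add_cell i (shape Q)) k = put_entry i k Q"
proof -
  have "(LEAST j. length Q \<le> j \<or> length (Q ! j) < add_cell i (shape Q) ! j) = i"
  proof (rule Least_equality)
    show "length Q \<le> i \<or> length (Q ! i) < add_cell i (shape Q) ! i"
      using assms by (auto simp: add_cell_nth length_add_cell shape_def)
  next
    fix j assume "length Q \<le> j \<or> length (Q ! j) < add_cell i (shape Q) ! j"
    then show "i \<le> j" using assms
      by (rule_tac ccontr) (auto simp: add_cell_nth length_add_cell shape_def)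
  qed
  then show ?thesis using assms by (simp add: add_entry_def put_entry_upd)
qed

lemma Qtab_props:
  "shape (Qtab w) = shape (Ptab w) \<and> [] \<notin> set (Qtab w) \<and> (\<forall>k\<in>set (concat (Qtab w)). k \<le> length (concat (Qtab w)))"
proof (induction w rule: rev_induct)
  case Nil
  then show ?case by (simp add: Qtab_def RS_def)
next
  case (snoc x w)
  obtain i where i: "i \<le> length (Ptab w)" "shape (tab_ins x (Ptab w)) = add_cell i (shape (Ptab w))"
    using tab_ins_shape[OF Ptab_column_strict] by metis
  have l: "length (Qtab w) = length (Ptab w)" using snoc by (metis length_shape)
  define k where "k = Suc (length (concat (Qtab w)))"
  have Q: "Qtab (w @ [x]) = put_entry i k (Qtab w)"
    using i l snoc add_entry_put[of i "Qtab w" k] by (simp add: Qtab_def[of "w @ [x]"] RS_snoc k_def)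
  have "length (concat (put_entry i k (Qtab w))) = k"
    using length_concat_add_cell[of i "shape (Qtab w)"]
    by (simp add: k_def length_concat shape_put_entry shape_def[symmetric])
  moreover have "\<forall>k'\<in>set (concat (put_entry i k (Qtab w))). k' \<le> k"
  proof
    fix k' assume "k' \<in> set (concat (put_entry i k (Qtab w)))"
    then have "k' = k \<or> k' \<le> length (concat (Qtab w))" using snoc unfolding put_entry_set by blast
    then show "k' \<le> k" by (auto simp: k_def)
  qed
  ultimately show ?case using Q i snoc by (simp add: shape_put_entry put_entry_nonempty Ptab_append)
qed

lemma shape_Qtab: "shape (Qtab w) = shape (Ptab w)"
  using Qtab_props by blast

lemma Qtab_snoc:
  assumes "i \<le> length (Ptab w)" "shape (Ptab (w @ [x])) = add_cell i (shape (Ptab w))"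
  shows "Qtab (w @ [x]) = put_entry i (Suc (length (concat (Qtab w)))) (Qtab w)"
proof -
  have l: "length (Qtab w) = length (Ptab w)" using shape_Qtab by (metis length_shape)
  show ?thesis using assms l shape_Qtab[of w] add_entry_put[of i "Qtab w"]
    by (simp add: Qtab_def[of "w @ [x]"] RS_snoc Ptab_append)
qed

lemma length_concat_Ptab: "length (concat (Ptab w)) = length w"
proof -
  have "length (tab_word (Ptab w)) = length w" using knuth_length[OF tab_word_Ptab] .
  then show ?thesis by (simp add: tab_word_def length_concat sum_list_rev rev_map[symmetric])
qed

lemma sum_shape_Ptab: "sum_list (shape (Ptab w)) = length w"
  using length_concat_Ptab[of w] by (simp add: shape_def length_concat)

text \<open>The largest label of the recording tableau marks the last cell. Erasing it gives the
  shape before the last step, and with that shape the last insertion can be reversed.\<close>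

lemma RS_inj:
  assumes "Ptab u = Ptab v" "Qtab u = Qtab v"
  shows "u = v"
  using assms
proof (induction u arbitrary: v rule: rev_induct)
  case Nil
  then show ?case using length_concat_Ptab[of v] by simp
next
  case (snoc x u)
  have "length v = Suc (length u)" using snoc.prems length_concat_Ptab[of v] length_concat_Ptab[of "u @ [x]"] by simp
  then obtain v' y where v: "v = v' @ [y]" by (metis length_Suc_conv_rev)
  have len: "length (concat (Qtab w)) = length w" for w
    using sum_shape_Ptab[of w] shape_Qtab[of w] by (simp add: shape_def length_concat)
  have lv: "length v' = length u" using \<open>length v = _\<close> v by simp
  define k where "k = Suc (length u)"
  obtain i where i: "i \<le> length (Ptab u)" "shape (Ptab (u @ [x])) = add_cell i (shape (Ptab u))"
    using tab_ins_shape[OF Ptab_column_strict, of u x] by (auto simp: Ptab_append)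
  obtain j where j: "j \<le> length (Ptab v')" "shape (Ptab (v' @ [y])) = add_cell j (shape (Ptab v'))"
    using tab_ins_shape[OF Ptab_column_strict, of v' y] by (auto simp: Ptab_append)
  have q: "put_entry i k (Qtab u) = put_entry j k (Qtab v')"
    using snoc.prems(2) v Qtab_snoc[OF i] Qtab_snoc[OF j] len lv by (simp add: k_def)
  have "k \<notin> set (concat (Qtab u))" "k \<notin> set (concat (Qtab v'))"
    using Qtab_props[of u] Qtab_props[of v'] len[of u] len[of v'] lv unfolding k_def by fastforce+
  then have Q: "Qtab u = Qtab v'"
    using put_entry_remove[of "Qtab u" k i] put_entry_remove[of "Qtab v'" k j] q Qtab_props by metis
  then have "shape (Ptab u) = shape (Ptab v')" using shape_Qtab by metis
  then have "x = y \<and> Ptab u = Ptab v'"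
    using snoc.prems(1) v by (intro tab_ins_inj) (auto simp: Ptab_append Ptab_rows_sorted)
  then show ?case using snoc.IH[of v'] Q v by simp
qed

section \<open>Coplactic operators\<close>

text \<open>The number of unmatched letters \<open>r\<close>. A letter \<open>r + 1\<close> put in
  front is matched with the first unmatched \<open>r\<close> behind it, if any; hence the truncated
  subtraction.\<close>

fun phi :: "nat \<Rightarrow> word \<Rightarrow> nat" where
  "phi r [] = 0"
| "phi r (x # w) = (if x = r then Suc (phi r w) else if x = Suc r then phi r w - 1 else phi r w)"

text \<open>The number of unmatched letters of both kinds. A front letter \<open>r + 1\<close> that
  finds a partner takes this partner out of the count.\<close>

fun unm :: "nat \<Rightarrow> word \<Rightarrow> nat" where
  "unm r [] = 0"
| "unm r (x # w) = (if x = r \<or> x = Suc r \<and> phi r w = 0 then Suc (unm r w)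
     else if x = Suc r then unm r w - 1 else unm r w)"

text \<open>All words of an \<open>r\<close>-string at once: the unmatched letters become
  \<open>r\<close> for the first \<open>p\<close> places and \<open>r + 1\<close> afterwards.
  Raising, lowering and \<open>s_op\<close> are special values of \<open>p\<close>. When the front
  letter \<open>r + 1\<close> is matched, its partner is the first unmatched place of
  \<open>w\<close> and must stay \<open>r\<close>, which is why \<open>p\<close> grows by
  one.\<close>

fun refill :: "nat \<Rightarrow> nat \<Rightarrow> word \<Rightarrow> word" where
  "refill r p [] = []"
| "refill r p (x # w) =
    (if x = r \<or> x = Suc r \<and> phi r w = 0 then
       (if p = 0 then Suc r # refill r 0 w else r # refill r (p - 1) w)
     else if x = Suc r then x # refill r (Suc p) w else x # refill r p w)"

lemma phi_le_unm: "phi r w \<le> unm r w"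
  by (induction w) auto

lemma phi_pos_unm: "0 < phi r w \<Longrightarrow> 0 < unm r w"
  using phi_le_unm[of r w] by simp

lemma unm_zero [simp]: "unm r w = 0 \<Longrightarrow> phi r w = 0"
  using phi_le_unm[of r w] by simp

lemma phi_unm_refill: "phi r (refill r p w) = min p (unm r w) \<and> unm r (refill r p w) = unm r w"
proof (induction w arbitrary: p)
  case (Cons x w)
  have IH: "phi r (refill r q w) = min q (unm r w)" "unm r (refill r q w) = unm r w" for q
    using Cons by auto
  show ?case using phi_le_unm[of r w]
    by (cases p) (auto simp: IH simp del: unm_zero)
qed simp

lemma phi_refill [simp]: "phi r (refill r p w) = min p (unm r w)"
  and unm_refill [simp]: "unm r (refill r p w) = unm r w"
  using phi_unm_refill by auto

lemma refill_refill [simp]: "refill r q (refill r p w) = refill r q w"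
proof (induction w arbitrary: p q)
  case (Cons x w)
  then show ?case using phi_le_unm[of r w] by (auto simp del: unm_zero)
qed simp

lemma refill_phi [simp]: "refill r (phi r w) w = w"
  by (induction w) auto

lemma length_refill [simp]: "length (refill r p w) = length w"
  by (induction w arbitrary: p) auto

lemma phi_append: "phi r (a @ b) = phi r a + (phi r b - (unm r a - phi r a))"
  by (induction a) (auto simp: phi_le_unm Suc_diff_le dest: phi_pos_unm)

text \<open>The minimum counts the pairs across the boundary: unmatched \<open>r + 1\<close> of
  \<open>a\<close> against unmatched \<open>r\<close> of \<open>b\<close>.\<close>

lemma unm_append: "unm r (a @ b) = unm r a + unm r b - 2 * min (unm r a - phi r a) (phi r b)"
proof (induction a)
  case (Cons x a)
  have l: "phi r a \<le> unm r a" "phi r b \<le> unm r b" by (rule phi_le_unm)+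
  consider "x = r" | "x = Suc r" "phi r (a @ b) = 0" | "x = Suc r" "phi r (a @ b) > 0" "phi r a = 0"
    | "x = Suc r" "phi r (a @ b) > 0" "phi r a > 0" | "x \<noteq> r" "x \<noteq> Suc r" by auto
  then show ?case
  proof cases
    case 1
    then show ?thesis using Cons l by simp
  next
    case 2
    then have z: "phi r a = 0" "phi r b \<le> unm r a" by (auto simp: phi_append)
    then show ?thesis using Cons 2 l by (simp add: min_absorb2)
  next
    case 3
    then have z: "phi r b > unm r a" by (auto simp: phi_append)
    then show ?thesis using 3 Cons l by (simp add: min_absorb1)
  next
    case 4
    have "unm r a - 1 - (phi r a - 1) = unm r a - phi r a" using 4 l by simp
    moreover define m where "m = min (unm r a - phi r a) (phi r b)"
    moreover have "m \<le> unm r a - phi r a" "m \<le> phi r b" by (simp_all add: m_def)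
    ultimately show ?thesis using 4 Cons l by simp
  next
    case 5
    then show ?thesis using Cons by simp
  qed
qed simp

text \<open>With \<open>m\<close> pairs across the boundary, the last \<open>m\<close> unmatched
  places of \<open>a\<close> must stay \<open>r + 1\<close> and the first \<open>m\<close> of
  \<open>b\<close> must stay \<open>r\<close>. So \<open>a\<close> can take only
  \<open>unm r a - m\<close> letters \<open>r\<close>, and the excess goes to \<open>b\<close> on
  top of its reserved \<open>m\<close>.\<close>

lemma refill_append:
  "refill r p (a @ b) = (let m = min (unm r a - phi r a) (phi r b) in
     refill r (min p (unm r a - m)) a @ refill r (m + (p - (unm r a - m))) b)"
proof (induction a arbitrary: p)
  case (Cons x a)
  have l: "phi r a \<le> unm r a" by (rule phi_le_unm)
  define A where "A = unm r a"
  define m where "m = min (A - phi r a) (phi r b)"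
  have m: "m \<le> A - phi r a" "m \<le> phi r b" "m \<le> A" by (simp_all add: m_def)
  have IH: "refill r q (a @ b) = refill r (min q (A - m)) a @ refill r (m + (q - (A - m))) b" for q
    by (simp only: Cons m_def A_def Let_def)
  have goal: ?case if "min (unm r (x # a) - phi r (x # a)) (phi r b) = m'"
    "refill r p ((x # a) @ b) = refill r (min p (unm r (x # a) - m')) (x # a) @ refill r (m' + (p - (unm r (x # a) - m'))) b" for m'
    unfolding Let_def that(1) by (rule that(2))
  consider "x = r" | "x = Suc r" "phi r (a @ b) = 0" | "x = Suc r" "phi r (a @ b) > 0" "phi r a = 0"
    | "x = Suc r" "phi r (a @ b) > 0" "phi r a > 0" | "x \<noteq> r" "x \<noteq> Suc r" by auto
  then show ?case
  proof cases
    case 1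
    show ?thesis
    proof (rule goal)
      show "min (unm r (x # a) - phi r (x # a)) (phi r b) = m" using 1 by (simp add: m_def A_def)
      have u: "unm r (x # a) = Suc A" using 1 by (simp add: A_def)
      show "refill r p ((x # a) @ b) = refill r (min p (unm r (x # a) - m)) (x # a) @ refill r (m + (p - (unm r (x # a) - m))) b"
      proof (cases p)
        case 0
        then show ?thesis using 1 IH[of 0] by simp
      next
        case (Suc q)
        have e: "min (Suc q) (Suc A - m) = Suc (min q (A - m))" "Suc q - (Suc A - m) = q - (A - m)"
          using m by auto
        show ?thesis unfolding u Suc e using 1 IH[of q] by simp
      qed
    qed
  next
    case 2
    then have z: "phi r a = 0" "phi r b \<le> A" by (auto simp: phi_append A_def)
    show ?thesis
    proof (rule goal)
      show "min (unm r (x # a) - phi r (x # a)) (phi r b) = m" using 2 z by (simp add: m_def A_def)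
      have u: "unm r (x # a) = Suc A" using 2 z by (simp add: A_def)
      show "refill r p ((x # a) @ b) = refill r (min p (unm r (x # a) - m)) (x # a) @ refill r (m + (p - (unm r (x # a) - m))) b"
      proof (cases p)
        case 0
        then show ?thesis using 2 z IH[of 0] by simp
      next
        case (Suc q)
        have e: "min (Suc q) (Suc A - m) = Suc (min q (A - m))" "Suc q - (Suc A - m) = q - (A - m)"
          using m by auto
        show ?thesis unfolding u Suc e using 2 z IH[of q] by simp
      qed
    qed
  next
    case 3
    then have z: "A < phi r b" by (auto simp: phi_append A_def)
    then have mA: "m = A" using 3 by (simp add: m_def)
    show ?thesis
    proof (rule goal)
      show "min (unm r (x # a) - phi r (x # a)) (phi r b) = Suc A" using 3 z by (simp add: A_def)
      have u: "unm r (x # a) = Suc A" using 3 by (simp add: A_def)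
      have "refill r p ((x # a) @ b) = Suc r # refill r 0 a @ refill r (Suc A + p) b"
        using 3 IH[of "Suc p"] mA by simp
      then show "refill r p ((x # a) @ b) = refill r (min p (unm r (x # a) - Suc A)) (x # a) @ refill r (Suc A + (p - (unm r (x # a) - Suc A))) b"
        unfolding u using 3 by simp
    qed
  next
    case 4
    show ?thesis
    proof (rule goal)
      have u: "unm r (x # a) = A - 1" "phi r (x # a) = phi r a - 1" using 4 by (simp_all add: A_def)
      show "min (unm r (x # a) - phi r (x # a)) (phi r b) = m" unfolding u m_def using 4 by simp
      have e: "min (Suc p) (A - m) = Suc (min p (A - 1 - m))" "Suc p - (A - m) = p - (A - 1 - m)"
        using m 4 l unfolding A_def[symmetric] by auto
      show "refill r p ((x # a) @ b) = refill r (min p (unm r (x # a) - m)) (x # a) @ refill r (m + (p - (unm r (x # a) - m))) b"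
        unfolding u using 4 IH[of "Suc p"] unfolding e by simp
    qed
  next
    case 5
    show ?thesis
    proof (rule goal)
      show "min (unm r (x # a) - phi r (x # a)) (phi r b) = m" using 5 by (simp add: m_def A_def)
      have u: "unm r (x # a) = A" using 5 by (simp add: A_def)
      show "refill r p ((x # a) @ b) = refill r (min p (unm r (x # a) - m)) (x # a) @ refill r (m + (p - (unm r (x # a) - m))) b"
        unfolding u using 5 IH[of p] by simp
    qed
  qed
qed simp

section \<open>Redistribution of unmatched letters commutes with Knuth moves\<close>

lemma letter_cases:
  obtains (lt) "x < r" "x \<noteq> r" "x \<noteq> Suc r" | (eq) "x = r" | (suc) "x = Suc r"
    | (gt) "Suc r < x" "x \<noteq> r" "x \<noteq> Suc r"
  by linarith

lemma ktrip_phi3: "phi r (ktrip x y z) = phi r [x, y, z]"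
  by (rule letter_cases[of x r]; rule letter_cases[of y r]; rule letter_cases[of z r]; simp add: ktrip_def)

lemma ktrip_unm: "unm r (ktrip x y z) = unm r [x, y, z]"
  by (rule letter_cases[of x r]; rule letter_cases[of y r]; rule letter_cases[of z r]; simp add: ktrip_def)

lemma ktrip_refill_0: "refill r 0 (ktrip x y z) = kmove 0 (refill r 0 [x, y, z])"
  by (rule letter_cases[of x r]; rule letter_cases[of y r]; rule letter_cases[of z r]; simp add: ktrip_def)

lemma ktrip_refill_1: "refill r (Suc 0) (ktrip x y z) = kmove 0 (refill r (Suc 0) [x, y, z])"
  by (rule letter_cases[of x r]; rule letter_cases[of y r]; rule letter_cases[of z r]; simp add: ktrip_def)

lemma ktrip_refill_2: "refill r (Suc (Suc 0)) (ktrip x y z) = kmove 0 (refill r (Suc (Suc 0)) [x, y, z])"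
  by (rule letter_cases[of x r]; rule letter_cases[of y r]; rule letter_cases[of z r]; simp add: ktrip_def)

lemma ktrip_refill_3: "refill r (Suc (Suc (Suc p))) (ktrip x y z) = kmove 0 (refill r (Suc (Suc (Suc p))) [x, y, z])"
  by (rule letter_cases[of x r]; rule letter_cases[of y r]; rule letter_cases[of z r]; simp add: ktrip_def)

text \<open>A triple has at most three unmatched places, so all values of \<open>p\<close> from 3 on
  behave alike.\<close>

lemma ktrip_refill: "refill r p (ktrip x y z) = kmove 0 (refill r p [x, y, z])"
proof -
  obtain q where "p = 0 \<or> p = Suc 0 \<or> p = Suc (Suc 0) \<or> p = Suc (Suc (Suc q))"
    by (metis not0_implies_Suc)
  then show ?thesis
    by (elim disjE) (simp_all only: ktrip_refill_0 ktrip_refill_1 ktrip_refill_2 ktrip_refill_3)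
qed

lemma ktrip_phi: "phi r (ktrip x y z @ b) = phi r ([x, y, z] @ b)"
  unfolding phi_append ktrip_phi3 ktrip_unm ..

lemma kmove_phi [simp]: "phi r (kmove i w) = phi r w"
proof (cases "length w < i + 3")
  case False
  then obtain a x y z b where w: "w = a @ x # y # z # b" "length a = i" by (rule kmove_decomp)
  have "phi r (a @ ktrip x y z @ b) = phi r (a @ [x, y, z] @ b)"
    unfolding phi_append[of r a] ktrip_phi ..
  then show ?thesis unfolding w(2)[symmetric] unfolding w(1) kmove_app by (simp only: append_Cons append_Nil)
qed (simp add: kmove_short)

lemma length_3E: "length l = 3 \<Longrightarrow> \<exists>x y z. l = [x, y, z]"
  by (auto simp: numeral_3_eq_3 length_Suc_conv)

lemma length_2E: "length l = 2 \<Longrightarrow> \<exists>x y. l = [x, y]"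
  by (auto simp: numeral_2_eq_2 length_Suc_conv)

lemma refill_append_ex: "\<exists>p1 p2. refill r p (a @ b) = refill r p1 a @ refill r p2 b"
  unfolding refill_append Let_def by blast

text \<open>Equality of words at the same position, which is sharper than preserving Knuth classes
  and is what dual equivalence requires. The letters around the triple are affected by it only
  through its \<open>phi\<close> and \<open>unm\<close>, which the move keeps.\<close>

lemma refill_kmove: "refill r p (kmove i w) = kmove i (refill r p w)"
proof (cases "length w < i + 3")
  case False
  then obtain a x y z b where w: "w = a @ x # y # z # b" "length a = i" by (rule kmove_decomp)
  define t where "t = [x, y, z]"
  have e: "unm r (ktrip x y z) = unm r t" "phi r (ktrip x y z) = phi r t"
    using ktrip_phi[of r x y z "[]"] by (simp_all add: ktrip_unm t_def)
  have e': "phi r (ktrip x y z @ b) = phi r (t @ b)"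
    using ktrip_phi[of r x y z b] by (simp add: t_def)
  define m where "m = min (unm r a - phi r a) (phi r (t @ b))"
  define p1 where "p1 = min p (unm r a - m)"
  define p2 where "p2 = m + (p - (unm r a - m))"
  define m' where "m' = min (unm r t - phi r t) (phi r b)"
  define p3 where "p3 = min p2 (unm r t - m')"
  define p4 where "p4 = m' + (p2 - (unm r t - m'))"
  have 1: "refill r p (a @ t @ b) = refill r p1 a @ refill r p3 t @ refill r p4 b"
    unfolding refill_append[of r p a] Let_def m_def[symmetric] p1_def[symmetric] p2_def[symmetric]
    unfolding refill_append[of r p2 t] Let_def m'_def[symmetric] p3_def[symmetric] p4_def[symmetric] ..
  have 2: "refill r p (a @ ktrip x y z @ b) = refill r p1 a @ refill r p3 (ktrip x y z) @ refill r p4 b"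
    unfolding refill_append[of r p a] Let_def e' m_def[symmetric] p1_def[symmetric] p2_def[symmetric]
    unfolding refill_append[of r p2 "ktrip x y z"] e Let_def m'_def[symmetric] p3_def[symmetric] p4_def[symmetric] ..
  have "length (refill r p3 t) = 3" by (simp add: t_def)
  then obtain x' y' z' where t': "refill r p3 t = [x', y', z']"
    using length_3E by blast
  have 3: "refill r p3 (ktrip x y z) = ktrip x' y' z'"
    unfolding ktrip_refill t_def[symmetric] t' by simp
  have k1: "kmove i w = a @ ktrip x y z @ b"
    unfolding w(1) w(2)[symmetric] by (rule kmove_app)
  have "refill r p w = refill r p1 a @ x' # y' # z' # refill r p4 b"
    using 1 unfolding w(1) t' unfolding t_def by (simp only: append_Cons append_Nil)
  moreover have "length (refill r p1 a) = i" using w(2) by simp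
  ultimately have "kmove i (refill r p w) = refill r p1 a @ ktrip x' y' z' @ refill r p4 b"
    using kmove_app by metis
  then show ?thesis unfolding k1 2 3 by simp
qed (simp add: kmove_short)

text \<open>\<open>unm\<close> is the largest value that \<open>phi\<close> takes on redistributions
  of the word; moves commute with these and preserve \<open>phi\<close>.\<close>

lemma kmove_unm [simp]: "unm r (kmove i w) = unm r w"
proof -
  have "min (unm r w) (unm r (kmove i w)) = phi r (refill r (unm r w) (kmove i w))" by simp
  also have "\<dots> = phi r (refill r (unm r w) w)" unfolding refill_kmove by (rule kmove_phi)
  finally have "unm r w \<le> unm r (kmove i w)" by simp
  moreover have "min (unm r (kmove i w)) (unm r w) = phi r (refill r (unm r (kmove i w)) w)" by simp
  moreover have "\<dots> = phi r (refill r (unm r (kmove i w)) (kmove i w))" unfolding refill_kmove by simp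
  ultimately show ?thesis by simp
qed

lemma refill_pair: "refill r p [x, y] = [x', y'] \<Longrightarrow> y' < x' \<longleftrightarrow> y < x"
  by (auto split: if_splits)

text \<open>Locality of \<open>refill\<close> reduces this to words of two letters: a descent
  \<open>r + 1, r\<close> is matched and stays, unmatched letters are refilled in weakly increasing
  order, and a letter outside the pair compares in the same way with \<open>r\<close> and
  \<open>r + 1\<close>.\<close>

lemma refill_descent:
  assumes "Suc i < length w"
  shows "refill r p w ! Suc i < refill r p w ! i \<longleftrightarrow> w ! Suc i < w ! i"
proof -
  define a where "a = take i w"
  define b where "b = drop (Suc (Suc i)) w"
  have la: "length a = i" using assms by (simp add: a_def)
  have w: "w = a @ [w ! i, w ! Suc i] @ b" using assms unfolding a_def b_def
    by (simp add: Cons_nth_drop_Suc)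
  obtain p1 p2 where 1: "refill r p w = refill r p1 a @ refill r p2 ([w ! i, w ! Suc i] @ b)"
    using refill_append_ex[of r p a "[w ! i, w ! Suc i] @ b"] w by metis
  obtain p3 p4 where 2: "refill r p2 ([w ! i, w ! Suc i] @ b) = refill r p3 [w ! i, w ! Suc i] @ refill r p4 b"
    using refill_append_ex by blast
  have "length (refill r p3 [w ! i, w ! Suc i]) = 2" by (simp only: length_refill) simp
  then obtain x' y' where t': "refill r p3 [w ! i, w ! Suc i] = [x', y']"
    using length_2E by blast
  have "refill r p w ! i = x'" "refill r p w ! Suc i = y'"
    unfolding 1 2 t' using la by (simp_all add: nth_append)
  then show ?thesis using refill_pair[OF t'] by simp
qed

lemma filter_refill:
  assumes "P r" "P (Suc r)"
  shows "phi r (filter P w) = phi r w" "unm r (filter P w) = unm r w"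
    "filter P (refill r p w) = refill r p (filter P w)"
proof -
  show 1: "phi r (filter P w) = phi r w" for w using assms by (induction w) auto
  show "unm r (filter P w) = unm r w" using assms 1 by (induction w) auto
  show "filter P (refill r p w) = refill r p (filter P w)"
    using assms 1 by (induction w arbitrary: p) auto
qed

lemma refill_nth:
  assumes "i < length w"
  shows "w ! i \<noteq> r \<Longrightarrow> w ! i \<noteq> Suc r \<Longrightarrow> refill r p w ! i = w ! i"
    and "w ! i = r \<or> w ! i = Suc r \<Longrightarrow> refill r p w ! i = r \<or> refill r p w ! i = Suc r"
  using assms by (induction w arbitrary: p i) (auto simp: nth_Cons split: nat.splits)

lemma refill_set: "set (refill r p w) \<subseteq> {x. x \<in> set w \<or> x = r \<or> x = Suc r}"
  by (induction w arbitrary: p) auto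

text \<open>What happens at a letter of the pair depends on the rest only through its
  \<open>phi\<close>. Hence the same \<open>y\<close> and \<open>p'\<close> remain valid after the
  rest is changed by an operator for a distant pair, and the two operators commute.\<close>

lemma refill_Cons_in:
  assumes "x = r \<or> x = Suc r"
  obtains y p' where "y = r \<or> y = Suc r"
    "\<And>w'. phi r w' = phi r w \<Longrightarrow> refill r p (x # w') = y # refill r p' w'"
proof (cases "x = r \<or> phi r w = 0")
  case True
  show ?thesis
  proof (rule that)
    show "(if p = 0 then Suc r else r) = r \<or> (if p = 0 then Suc r else r) = Suc r" by simp
    fix w' assume "phi r w' = phi r w"
    then have c: "x = r \<or> x = Suc r \<and> phi r w' = 0" using True assms by auto
    show "refill r p (x # w') = (if p = 0 then Suc r else r) # refill r (p - 1) w'"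
      unfolding refill.simps if_P[OF c] by (cases p) simp_all
  qed
next
  case False
  then have x: "x = Suc r" using assms by auto
  show ?thesis
  proof (rule that)
    show "x = r \<or> x = Suc r" by fact
    fix w' assume "phi r w' = phi r w"
    then have c: "\<not> (x = r \<or> x = Suc r \<and> phi r w' = 0)" using False by auto
    show "refill r p (x # w') = x # refill r (Suc p) w'"
      unfolding refill.simps if_not_P[OF c] using x by simp
  qed
qed

lemma refill_Cons_out:
  assumes "x \<noteq> r" "x \<noteq> Suc r"
  shows "refill r p (x # w) = x # refill r p w" "phi r (x # w) = phi r w" "unm r (x # w) = unm r w"
  using assms by (simp_all only: refill.simps phi.simps unm.simps if_False simp_thms)

lemma phi_refill_other:
  assumes "r \<noteq> q" "r \<noteq> Suc q" "q \<noteq> Suc r"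
  shows "phi r (refill q p w) = phi r w \<and> unm r (refill q p w) = unm r w"
proof (induction w arbitrary: p)
  case (Cons x w)
  show ?case
  proof (cases "x = q \<or> x = Suc q")
    case True
    obtain y p' where y: "y = q \<or> y = Suc q" "\<And>w'. phi q w' = phi q w \<Longrightarrow> refill q p (x # w') = y # refill q p' w'"
      using refill_Cons_in[OF True] by metis
    have n: "y \<noteq> r" "y \<noteq> Suc r" "x \<noteq> r" "x \<noteq> Suc r" using y(1) True assms by auto
    show ?thesis unfolding y(2)[OF refl] refill_Cons_out[OF n(1,2)] refill_Cons_out[OF n(3,4)] by (rule Cons)
  next
    case False
    then have n: "x \<noteq> q" "x \<noteq> Suc q" by auto
    show ?thesis unfolding refill_Cons_out[OF n] using Cons[of p] by (simp only: phi.simps unm.simps)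
  qed
qed simp

lemma refill_commute_aux:
  assumes "r \<noteq> q" "r \<noteq> Suc q" "q \<noteq> Suc r" "x = q \<or> x = Suc q"
    and IH: "\<And>p p'. refill r p (refill q p' w) = refill q p' (refill r p w)"
  shows "refill r p (refill q p' (x # w)) = refill q p' (refill r p (x # w))"
proof -
  obtain y p'' where y: "y = q \<or> y = Suc q" "\<And>w'. phi q w' = phi q w \<Longrightarrow> refill q p' (x # w') = y # refill q p'' w'"
    using refill_Cons_in[OF assms(4)] by metis
  have n: "y \<noteq> r" "y \<noteq> Suc r" "x \<noteq> r" "x \<noteq> Suc r" using y(1) assms by auto
  have "phi q (refill r p w) = phi q w" using phi_refill_other[of q r] assms by blast
  then show ?thesis unfolding y(2)[OF refl] refill_Cons_out[OF n(1,2)] refill_Cons_out[OF n(3,4)]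
    by (simp only: y(2) IH)
qed

lemma refill_commute:
  assumes "r \<noteq> q" "r \<noteq> Suc q" "q \<noteq> Suc r"
  shows "refill r p (refill q p' w) = refill q p' (refill r p w)"
proof (induction w arbitrary: p p')
  case (Cons x w)
  consider "x = q \<or> x = Suc q" | "x = r \<or> x = Suc r" | "x \<noteq> r" "x \<noteq> Suc r" "x \<noteq> q" "x \<noteq> Suc q" by blast
  then show ?case
  proof cases
    case 1
    from refill_commute_aux[OF assms 1 Cons] show ?thesis .
  next
    case 2
    from refill_commute_aux[OF assms(1)[symmetric] assms(3,2) 2 Cons[symmetric]] show ?thesis by (rule sym)
  next
    case 3
    show ?thesis unfolding refill_Cons_out[OF 3(1,2)] refill_Cons_out[OF 3(3,4)] by (simp only: Cons)
  qed
qed simp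

lemma refill_shift:
  "phi (r + s) (map (\<lambda>x. x + s) w) = phi r w" "unm (r + s) (map (\<lambda>x. x + s) w) = unm r w"
  "refill (r + s) p (map (\<lambda>x. x + s) w) = map (\<lambda>x. x + s) (refill r p w)"
proof -
  show 1: "phi (r + s) (map (\<lambda>x. x + s) w) = phi r w" for w by (induction w) auto
  show "unm (r + s) (map (\<lambda>x. x + s) w) = unm r w" by (induction w) (auto simp: 1)
  show "refill (r + s) p (map (\<lambda>x. x + s) w) = map (\<lambda>x. x + s) (refill r p w)"
    by (induction w arbitrary: p) (auto simp: 1)
qed

text \<open>Matched pairs contribute equally to both counts; among the unmatched letters,
  \<open>phi\<close> are \<open>r\<close> and \<open>unm - phi\<close> are
  \<open>r + 1\<close>.\<close>

lemma count_phi: "count_list w (Suc r) + 2 * phi r w = count_list w r + unm r w"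
proof (induction w)
  case (Cons x w)
  then show ?case using phi_le_unm[of r w] by auto
qed simp

lemma count_refill:
  "count_list (refill r p w) r + phi r w = count_list w r + min p (unm r w)"
  "count_list (refill r p w) (Suc r) + min p (unm r w) = count_list w (Suc r) + phi r w"
  "x \<noteq> r \<Longrightarrow> x \<noteq> Suc r \<Longrightarrow> count_list (refill r p w) x = count_list w x"
proof -
  show 1: "count_list (refill r p w) r + phi r w = count_list w r + min p (unm r w)"
  proof (induction w arbitrary: p)
    case (Cons x w)
    consider "x = r" | "x = Suc r" "phi r w = 0" | "x = Suc r" "phi r w > 0" | "x \<noteq> r" "x \<noteq> Suc r" by auto
    then show ?case
    proof cases
      case 1
      then show ?thesis using Cons[of 0] Cons[of "p - 1"] by (cases p) simp_all
    next
      case 2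
      then show ?thesis using Cons[of 0] Cons[of "p - 1"] by (cases p) simp_all
    next
      case 3
      then obtain m where m: "unm r w = Suc m" using phi_pos_unm[of r w] by (cases "unm r w") auto
      from 3 obtain k where k: "phi r w = Suc k" by (cases "phi r w") auto
      show ?thesis using 3(1) k m Cons[of "Suc p"] by simp
    next
      case 4
      then show ?thesis using Cons[of p] by (simp add: refill_Cons_out)
    qed
  qed simp
  then show "count_list (refill r p w) (Suc r) + min p (unm r w) = count_list w (Suc r) + phi r w"
    using count_phi[of w r] count_phi[of "refill r p w" r] by simp
  show "x \<noteq> r \<Longrightarrow> x \<noteq> Suc r \<Longrightarrow> count_list (refill r p w) x = count_list w x"
    by (induction w arbitrary: p) auto
qed

section \<open>Agreement with the bracketing by a stack\<close>

fun unm_pos :: "nat \<Rightarrow> word \<Rightarrow> nat list" where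
  "unm_pos r [] = []"
| "unm_pos r (x # w) = (if x = r \<or> x = Suc r \<and> phi r w = 0 then 0 # map Suc (unm_pos r w)
     else if x = Suc r then map Suc (tl (unm_pos r w)) else map Suc (unm_pos r w))"

lemma length_unm_pos [simp]: "length (unm_pos r w) = unm r w"
  by (induction w) auto

lemma sorted_unm_pos: "sorted_wrt (<) (unm_pos r w)"
proof (induction w)
  case (Cons x w)
  have "sorted_wrt (<) (tl (unm_pos r w))" using Cons by (cases "unm_pos r w") auto
  with Cons show ?case by (auto simp: sorted_wrt_map)
qed simp

text \<open>Stated for an arbitrary stack to make the induction work: the first unmatched letters
  \<open>r\<close> of \<open>w\<close> close the topmost stack entries,
  \<open>min (length st) (phi r w)\<close> of them, and whatever is left on either side stays
  unmatched.\<close>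

lemma match_aux_unm:
  "match_aux r w i st U = U \<union> set (drop (phi r w) st) \<union>
     (\<lambda>j. i + j) ` set (drop (min (length st) (phi r w)) (unm_pos r w))"
proof (induction w arbitrary: i st U)
  case Nil
  then show ?case by simp
next
  case (Cons x w)
  have im: "(\<lambda>j. i + j) ` set (map Suc l) = (\<lambda>j. Suc i + j) ` set l" for l by force
  consider "x = Suc r" "phi r w = 0" | "x = Suc r" "phi r w > 0" | "x = r" "st = []"
    | s st' where "x = r" "st = s # st'" | "x \<noteq> r" "x \<noteq> Suc r" by (cases st) auto
  then show ?case
  proof cases
    case 1
    then show ?thesis using Cons[of "Suc i" "i # st" U] im[of "unm_pos r w"] by (auto simp del: set_map)
  next
    case 2
    then obtain k where k: "phi r w = Suc k" by (cases "phi r w") auto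
    show ?thesis using 2 k Cons[of "Suc i" "i # st" U] im[of "drop (min (length st) k) (tl (unm_pos r w))"]
      by (simp add: drop_map drop_Suc del: set_map)
  next
    case 3
    then show ?thesis using Cons[of "Suc i" "[]" "insert i U"] im[of "unm_pos r w"] by (auto simp del: set_map)
  next
    case 4
    then show ?thesis using Cons[of "Suc i" st' U] im[of "drop (min (length st') (phi r w)) (unm_pos r w)"]
      by (simp add: drop_map del: set_map)
  next
    case 5
    then show ?thesis using Cons[of "Suc i" st U] im[of "drop (min (length st) (phi r w)) (unm_pos r w)"]
      by (simp add: drop_map del: set_map)
  qed
qed

lemma unmatched_eq: "unmatched r w = set (unm_pos r w)"
  by (simp add: unmatched_def match_aux_unm)

lemma refill_unm_pos:
  "k < unm r w \<Longrightarrow> refill r p w ! (unm_pos r w ! k) = (if k < p then r else Suc r)"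
proof (induction w arbitrary: p k)
  case (Cons x w)
  consider "x = r \<or> x = Suc r \<and> phi r w = 0" | "x = Suc r" "phi r w > 0" | "x \<noteq> r" "x \<noteq> Suc r" by auto
  then show ?case
  proof cases
    case 1
    then have e: "unm_pos r (x # w) = 0 # map Suc (unm_pos r w)" "unm r (x # w) = Suc (unm r w)" by auto
    have f: "refill r p (x # w) = (if p = 0 then Suc r else r) # refill r (p - 1) w"
      using 1 by (cases p) auto
    show ?thesis
    proof (cases k)
      case 0
      then show ?thesis unfolding e f by simp
    next
      case (Suc j)
      then have j: "j < unm r w" using Cons.prems e by simp
      then show ?thesis unfolding e f Suc using Cons.IH[OF j, of "p - 1"] by auto
    qed
  next
    case 2
    then have e: "unm_pos r (x # w) = map Suc (tl (unm_pos r w))" "refill r p (x # w) = x # refill r (Suc p) w"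
      "unm r (x # w) = unm r w - 1" by auto
    have k: "Suc k < unm r w" using Cons.prems e by simp
    then show ?thesis unfolding e using Cons.IH[OF k, of "Suc p"] by (simp add: nth_tl)
  next
    case 3
    then show ?thesis using Cons by (simp add: refill_Cons_out)
  qed
qed simp

lemma refill_not_unm_pos:
  "i < length w \<Longrightarrow> i \<notin> set (unm_pos r w) \<Longrightarrow> refill r p w ! i = w ! i"
proof (induction w arbitrary: p i)
  case (Cons x w)
  consider "x = r \<or> x = Suc r \<and> phi r w = 0" | "x = Suc r" "phi r w > 0" | "x \<noteq> r" "x \<noteq> Suc r" by auto
  then show ?case
  proof cases
    case 1
    then have e: "unm_pos r (x # w) = 0 # map Suc (unm_pos r w)" by auto
    have f: "refill r p (x # w) = (if p = 0 then Suc r else r) # refill r (p - 1) w"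
      using 1 by (cases p) auto
    obtain j where j: "i = Suc j" using Cons.prems e by (cases i) auto
    show ?thesis unfolding f j using Cons.IH[of j "p - 1"] Cons.prems e j by auto
  next
    case 2
    then have e: "unm_pos r (x # w) = map Suc (tl (unm_pos r w))" "refill r p (x # w) = x # refill r (Suc p) w"
      by auto
    show ?thesis
    proof (cases i)
      case 0
      then show ?thesis unfolding e by simp
    next
      case (Suc j)
      have u: "0 < unm r w" using phi_pos_unm 2 by blast
      show ?thesis
      proof (cases "j \<in> set (unm_pos r w)")
        case True
        have l: "unm_pos r w = unm_pos r w ! 0 # tl (unm_pos r w)" using u
          by (metis hd_conv_nth length_greater_0_conv length_unm_pos list.collapse)
        have "j \<notin> set (tl (unm_pos r w))" using Cons.prems(2) Suc unfolding e(1) by auto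
        then have j: "j = unm_pos r w ! 0" using True l by (metis set_ConsD)
        have "refill r (Suc p) w ! j = r" using refill_unm_pos[OF u, of "Suc p"] unfolding j by simp
        moreover have "refill r (phi r w) w ! j = r"
          using refill_unm_pos[OF u, of "phi r w"] 2 unfolding j by (simp del: refill_phi)
        ultimately show ?thesis unfolding e Suc by simp
      next
        case False
        then show ?thesis unfolding e Suc using Cons.IH[of j "Suc p"] Cons.prems Suc by simp
      qed
    qed
  next
    case 3
    then have "unm_pos r (x # w) = map Suc (unm_pos r w)" by simp
    then show ?thesis using Cons.IH[of "i - 1" p] Cons.prems unfolding refill_Cons_out[OF 3] by (cases i) auto
  qed
qed simp

lemma strict_sorted_distinct: "sorted_wrt (<) l \<Longrightarrow> distinct (l :: nat list)"
  by (induction l) auto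

lemma card_less_sorted:
  assumes "sorted_wrt (<) (l :: nat list)" "k < length l"
  shows "card {j \<in> set l. j < l ! k} = k"
proof -
  have d: "distinct l" using assms(1) by (rule strict_sorted_distinct)
  have "{j \<in> set l. j < l ! k} = (\<lambda>i. l ! i) ` {..<k}"
  proof (intro set_eqI iffI)
    fix j assume "j \<in> {j \<in> set l. j < l ! k}"
    then obtain i where i: "i < length l" "j = l ! i" "l ! i < l ! k" by (auto simp: in_set_conv_nth)
    have "\<not> k < i" using sorted_wrt_nth_less[OF assms(1), of k i] i by auto
    moreover have "k \<noteq> i" using i by auto
    ultimately have "i < k" by simp
    then show "j \<in> (\<lambda>i. l ! i) ` {..<k}" using i by auto
  next
    fix j assume "j \<in> (\<lambda>i. l ! i) ` {..<k}"
    then obtain i where i: "i < k" "j = l ! i" by auto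
    then show "j \<in> {j \<in> set l. j < l ! k}" using assms(2) sorted_wrt_nth_less[OF assms(1) i(1) assms(2)] by simp
  qed
  moreover have "inj_on (\<lambda>i. l ! i) {..<k}" using d assms(2) by (intro inj_onI) (simp add: nth_eq_iff_index_eq)
  ultimately show ?thesis by (simp add: card_image)
qed

text \<open>Exchanging the two multiplicities means that the number of unmatched \<open>r\<close>
  becomes the former number \<open>unm - phi\<close> of unmatched \<open>r + 1\<close>.\<close>

lemma s_op_refill: "s_op r w = refill r (unm r w - phi r w) w"
proof -
  define l where "l = unm_pos r w"
  have sl: "sorted_wrt (<) l" "length l = unm r w" by (simp_all add: l_def sorted_unm_pos)
  have dl: "distinct l" using sl(1) by (rule strict_sorted_distinct)
  have wl: "w ! (l ! k) = Suc r \<longleftrightarrow> phi r w \<le> k" if "k < unm r w" for k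
    using refill_unm_pos[OF that, of "phi r w"] by (simp add: l_def not_less split: if_splits)
  have "{i \<in> set l. w ! i = Suc r} = (\<lambda>i. l ! i) ` {phi r w..<unm r w}"
    using wl sl(2) by (auto simp: in_set_conv_nth image_def)
  moreover have "inj_on (\<lambda>i. l ! i) {phi r w..<unm r w}"
    using dl sl(2) by (intro inj_onI) (simp add: nth_eq_iff_index_eq)
  ultimately have c: "card {i \<in> set l. w ! i = Suc r} = unm r w - phi r w" by (simp add: card_image)
  show ?thesis
  proof (rule nth_equalityI)
    show "length (s_op r w) = length (refill r (unm r w - phi r w) w)" by (simp add: s_op_def Let_def)
    fix i assume "i < length (s_op r w)"
    then have i: "i < length w" by (simp add: s_op_def Let_def)
    have s: "s_op r w ! i = (if i \<in> set l then if card {j \<in> set l. j < i} < unm r w - phi r w then r else Suc r else w ! i)"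
      using i c unfolding s_op_def unmatched_eq l_def[symmetric] by (simp add: Let_def)
    show "s_op r w ! i = refill r (unm r w - phi r w) w ! i"
    proof (cases "i \<in> set l")
      case True
      then obtain k where k: "k < length l" "i = l ! k" by (auto simp: in_set_conv_nth)
      have "card {j \<in> set l. j < i} = k" using card_less_sorted[OF sl(1) k(1)] k(2) by simp
      then show ?thesis using s True k refill_unm_pos[of k r w] sl(2) by (simp add: l_def)
    next
      case False
      then show ?thesis using s refill_not_unm_pos[OF i, of r] by (simp add: l_def)
    qed
  qed
qed

lemma s_op_involution [simp]: "s_op r (s_op r w) = w"
  using phi_le_unm[of r w] by (simp add: s_op_refill)

lemma s_op_kmove: "s_op r (kmove i w) = kmove i (s_op r w)"
  by (simp add: s_op_refill refill_kmove)

lemma length_s_op [simp]: "length (s_op r w) = length w"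
  by (simp add: s_op_refill)

lemma s_op_commute:
  assumes "r \<noteq> q" "r \<noteq> Suc q" "q \<noteq> Suc r"
  shows "s_op r (s_op q w) = s_op q (s_op r w)"
  using assms phi_refill_other[of r q] phi_refill_other[of q r] by (simp add: s_op_refill refill_commute)

lemma count_s_op: "count_list (s_op r w) (transp r x) = count_list w x"
proof -
  have "count_list w (Suc r) + 2 * phi r w = count_list w r + unm r w" by (rule count_phi)
  moreover have "phi r w \<le> unm r w" by (rule phi_le_unm)
  ultimately show ?thesis
    using count_refill(1,2)[where r = r and w = w and p = "unm r w - phi r w"]
      count_refill(3)[where r = r and w = w and p = "unm r w - phi r w" and x = x]
    by (auto simp: s_op_refill transp_def)
qed

lemma filter_s_op:
  assumes "P r" "P (Suc r)"
  shows "filter P (s_op r w) = s_op r (filter P w)"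
  using assms by (simp add: s_op_refill filter_refill)

text \<open>Provides the decreasing measure for raising: each unmatched \<open>r + 1\<close> turned
  into \<open>r\<close> lowers the sum of the letters by one.\<close>

lemma sum_refill: "sum_list (refill r p w) + min p (unm r w) = sum_list w + phi r w"
proof (induction w arbitrary: p)
  case (Cons x w)
  consider "x = r" | "x = Suc r" "phi r w = 0" | "x = Suc r" "phi r w > 0" | "x \<noteq> r" "x \<noteq> Suc r" by auto
  then show ?case
  proof cases
    case 1
    then show ?thesis using Cons[of 0] Cons[of "p - 1"] by (cases p) simp_all
  next
    case 2
    then show ?thesis using Cons[of 0] Cons[of "p - 1"] by (cases p) simp_all
  next
    case 3
    then obtain m where m: "unm r w = Suc m" using phi_pos_unm[of r w] by (cases "unm r w") auto
    from 3 obtain k where k: "phi r w = Suc k" by (cases "phi r w") auto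
    show ?thesis using 3(1) k m Cons[of "Suc p"] by simp
  next
    case 4
    then show ?thesis using Cons[of p] by (simp add: refill_Cons_out)
  qed
qed simp

section \<open>Compositions of redistributions\<close>

definition refills :: "(nat \<times> nat) list \<Rightarrow> word \<Rightarrow> word" where
  "refills gs = fold (\<lambda>(r, p). refill r p) gs"

lemma refills_Nil [simp]: "refills [] w = w"
  and refills_Cons: "refills ((r, p) # gs) w = refills gs (refill r p w)"
  and refills_append: "refills (gs @ hs) w = refills hs (refills gs w)"
  by (simp_all add: refills_def)

lemma length_refills [simp]: "length (refills gs w) = length w"
  by (induction gs arbitrary: w) (auto simp: refills_Cons)

lemma refills_kmove: "refills gs (kmove i w) = kmove i (refills gs w)"
  by (induction gs arbitrary: w) (auto simp: refills_Cons refill_kmove)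

lemma refills_kmoves: "refills gs (fold kmove ks w) = fold kmove ks (refills gs w)"
  by (induction ks arbitrary: w) (auto simp: refills_kmove)

lemma refills_knuth: "u \<sim>\<^sub>K v \<Longrightarrow> refills gs u \<sim>\<^sub>K refills gs v"
  by (metis fold_kmove_equiv knuth_kmoves knuth_sym refills_kmoves)

lemma refills_inverse: "\<exists>hs. fst ` set hs = fst ` set gs \<and> refills hs (refills gs w) = w"
proof (induction gs arbitrary: w)
  case (Cons g gs)
  obtain r p where g: "g = (r, p)" by (cases g)
  obtain hs where hs: "fst ` set hs = fst ` set gs" "refills hs (refills gs (refill r p w)) = refill r p w"
    using Cons by blast
  show ?case using hs by (intro exI[of _ "hs @ [(r, phi r w)]"]) (auto simp: g refills_Cons refills_append)
qed simp

lemma filter_refills: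
  assumes "\<forall>r\<in>fst ` set gs. P r \<and> P (Suc r)"
  shows "filter P (refills gs w) = refills gs (filter P w)"
  using assms by (induction gs arbitrary: w) (auto simp: refills_Cons filter_refill)

lemma refills_nth_outside:
  assumes "\<forall>r\<in>fst ` set gs. P r \<and> P (Suc r)" "i < length w"
  shows "(P (refills gs w ! i) \<longleftrightarrow> P (w ! i)) \<and> (\<not> P (w ! i) \<longrightarrow> refills gs w ! i = w ! i)"
  using assms
proof (induction gs arbitrary: w)
  case (Cons g gs)
  obtain r p where g: "g = (r, p)" by (cases g)
  have P: "P r" "P (Suc r)" using Cons.prems by (auto simp: g)
  have "(P (refill r p w ! i) \<longleftrightarrow> P (w ! i)) \<and> (\<not> P (w ! i) \<longrightarrow> refill r p w ! i = w ! i)"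
    using refill_nth[OF Cons.prems(2), of r p] P by (metis)
  moreover have "(P (refills gs (refill r p w) ! i) \<longleftrightarrow> P (refill r p w ! i)) \<and>
     (\<not> P (refill r p w ! i) \<longrightarrow> refills gs (refill r p w) ! i = refill r p w ! i)"
    using Cons by auto
  ultimately show ?case by (auto simp: g refills_Cons)
qed simp

lemma refills_shift:
  "refills (map (\<lambda>(r, p). (r + s, p)) gs) (map (\<lambda>x. x + s) w) = map (\<lambda>x. x + s) (refills gs w)"
  by (induction gs arbitrary: w) (auto simp: refills_Cons refill_shift)

section \<open>Dual equivalence\<close>

definition dual :: "word \<Rightarrow> word \<Rightarrow> bool" where
  "dual u v \<longleftrightarrow> length u = length v \<and> (\<forall>ks i. Suc i < length u \<longrightarrow>
     (fold kmove ks u ! Suc i < fold kmove ks u ! i \<longleftrightarrow> fold kmove ks v ! Suc i < fold kmove ks v ! i))"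

lemma dual_refl [simp]: "dual u u"
  by (simp add: dual_def)

lemma dual_sym: "dual u v \<Longrightarrow> dual v u"
  by (simp add: dual_def)

lemma dual_trans [trans]: "dual u v \<Longrightarrow> dual v w \<Longrightarrow> dual u w"
  by (simp add: dual_def)

lemma dual_length: "dual u v \<Longrightarrow> length u = length v"
  by (simp add: dual_def)

lemma dual_kmoves: "dual u v \<Longrightarrow> dual (fold kmove ks u) (fold kmove ks v)"
proof -
  assume d: "dual u v"
  have f: "fold kmove ks' (fold kmove ks w) = fold kmove (ks @ ks') w" for ks' w by simp
  from d show ?thesis unfolding dual_def f length_fold_kmove by blast
qed

lemma dual_refill: "dual w (refill r p w)"
proof -
  have "fold kmove ks (refill r p w) = refill r p (fold kmove ks w)" for ks
    using refills_kmoves[of "[(r, p)]" ks w] by (simp add: refills_Cons)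
  then show ?thesis by (simp add: dual_def refill_descent)
qed

lemma dual_refills: "dual w (refills gs w)"
proof (induction gs arbitrary: w)
  case (Cons g gs)
  obtain r p where g: "g = (r, p)" by (cases g)
  show ?case unfolding g refills_Cons by (rule dual_trans[OF dual_refill Cons])
qed simp

lemma dual_s_op: "dual w (s_op r w)"
  by (simp add: s_op_refill dual_refill)

lemma take_kmove: "kmove i (take k w) = (if i + 3 \<le> k then take k (kmove i w) else take k w)"
proof (cases "length w < i + 3")
  case True
  then show ?thesis by (simp add: kmove_short min_def)
next
  case False
  show ?thesis
  proof (cases "i + 3 \<le> k")
    case True
    obtain a x y z b where w: "w = a @ x # y # z # b" "length a = i" using False by (rule kmove_decomp)
    have t: "take k w = a @ x # y # z # take (k - i - 3) b"
      using True w by (simp add: take_Cons' numeral_3_eq_3)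
    have "length (ktrip x y z) = 3" by (simp add: ktrip_def)
    then have "take k (a @ ktrip x y z @ b) = a @ ktrip x y z @ take (k - i - 3) b"
      using True w by (simp)
    then show ?thesis unfolding t using True w kmove_app[of a x y z] by simp
  qed (simp add: kmove_short)
qed

lemma drop_kmove: "kmove i (drop k w) = drop k (kmove (k + i) w)"
  by (induction k arbitrary: w) (auto split: list.splits simp: drop_Cons' kmove_short)

text \<open>Moves of the prefix are those moves of the whole word whose triple fits into the prefix;
  the others do nothing to the prefix and are filtered out.\<close>

lemma dual_take: assumes "dual u v" shows "dual (take k u) (take k v)"
proof -
  have t: "fold kmove ks (take k w) = take k (fold kmove (filter (\<lambda>i. i + 3 \<le> k) ks) w)" for ks w
    by (induction ks arbitrary: w) (auto simp: take_kmove)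
  show ?thesis using assms unfolding dual_def t by simp
qed

lemma dual_drop: assumes "dual u v" shows "dual (drop k u) (drop k v)"
proof -
  have t: "fold kmove ks (drop k w) = drop k (fold kmove (map ((+) k) ks) w)" for ks w
    by (induction ks arbitrary: w) (auto simp: drop_kmove)
  show ?thesis using assms unfolding dual_def t by (auto simp: less_diff_conv add.commute)
qed

lemma dual_append:
  assumes "dual (u @ u') (v @ v')" "length u = length v"
  shows "dual u v" "dual u' v'"
  using dual_take[OF assms(1), of "length u"] dual_drop[OF assms(1), of "length u"] assms(2) by simp_all

lemma dual_sorted: "dual u v \<Longrightarrow> sorted u \<Longrightarrow> sorted v"
proof -
  assume "dual u v" "sorted u"
  then have "length u = length v" "\<And>i. Suc i < length u \<Longrightarrow> u ! Suc i < u ! i \<longleftrightarrow> v ! Suc i < v ! i"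
    by (auto simp: dual_def dest: spec[of _ "[]"])
  then show ?thesis using \<open>sorted u\<close> by (auto simp: sorted_iff_nth_Suc not_less[symmetric])
qed

lemma hd_fold_tab_ins: "w \<noteq> [] \<Longrightarrow> hd (fold tab_ins w T) = fst (ins_row (if T = [] then [] else hd T) w)"
  by (cases T) (auto simp: fold_tab_ins_Cons fold_tab_ins_Nil)

lemma first_row_suffix: "sorted z \<Longrightarrow> z \<noteq> [] \<Longrightarrow> length z \<le> length (hd (Ptab (y @ z)))"
  by (simp add: Ptab_append hd_fold_tab_ins first_row_run)

lemma Ptab_neq_Nil: "w \<noteq> [] \<Longrightarrow> Ptab w \<noteq> []"
  using length_concat_Ptab[of w] by auto

text \<open>The first row of an insertion tableau is the longest increasing run that ends a word of the
  Knuth class, and dual equivalence preserves descents; so it also preserves the length of this row.\<close>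

lemma dual_tab_word:
  assumes "column_strict T" "dual (tab_word T) v"
  shows "\<exists>T'. column_strict T' \<and> shape T' = shape T \<and> v = tab_word T'"
  using assms
proof (induction T arbitrary: v)
  case Nil
  then show ?case by (auto simp: dual_def intro: exI[of _ "[]"])
next
  case (Cons r T)
  note cs = Cons.prems(1)[unfolded column_strict_Cons]
  define v1 where "v1 = take (length (tab_word T)) v"
  define v2 where "v2 = drop (length (tab_word T)) v"
  have v: "v = v1 @ v2" by (simp add: v1_def v2_def)
  have lv: "length v = length (tab_word T) + length r"
    using dual_length[OF Cons.prems(2)] by (simp add: tab_word_Cons)
  have l1: "length v1 = length (tab_word T)" "length v2 = length r" using lv by (simp_all add: v1_def v2_def)
  have d: "dual (tab_word T) v1" "dual r v2"
    using dual_append[of "tab_word T" r v1 v2] Cons.prems(2) v l1 by (simp_all add: tab_word_Cons)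
  have s2: "sorted v2" using dual_sorted[OF d(2)] cs by simp
  have n2: "v2 \<noteq> []" using l1 cs by auto
  from Cons.IH[OF _ d(1)] cs obtain T' where
    T': "column_strict T'" "shape T' = shape T" "v1 = tab_word T'" by blast
  define m where "m = length (hd (Ptab v))"
  have Pv: "Ptab v = fold tab_ins v2 T'" by (simp add: v Ptab_append T' Ptab_tab_word)
  have h: "hd (Ptab v) = fst (ins_row (if T' = [] then [] else hd T') v2)"
    unfolding Pv by (rule hd_fold_tab_ins[OF n2])
  have ge: "length v2 \<le> m" unfolding m_def h by (rule first_row_run[OF s2])
  obtain ks where ks: "tab_word (Ptab v) = fold kmove ks v"
    using knuth_kmoves[OF knuth_sym[OF tab_word_Ptab[of v]]] by blast
  have vn: "v \<noteq> []" using v n2 by simp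
  obtain h0 t0 where P: "Ptab v = h0 # t0" using Ptab_neq_Nil[OF vn] by (cases "Ptab v") auto
  have sh: "sorted h0" "h0 \<noteq> []" using Ptab_column_strict[of v] unfolding P column_strict_Cons by auto
  \<comment> \<open>The moves that straighten \<open>v\<close> are replayed on the given tableau
    word. The result stays in the class of \<open>r # T\<close> and has the descents of the
    straightened \<open>v\<close>.\<close>
  define u where "u = fold kmove ks (tab_word (r # T))"
  have du: "dual (tab_word (Ptab v)) u" unfolding u_def ks by (rule dual_sym[OF dual_kmoves[OF Cons.prems(2)]])
  have lu: "length u = length (tab_word t0) + length h0" using dual_length[OF du] by (simp add: P tab_word_Cons)
  define u1 where "u1 = take (length (tab_word t0)) u"
  define u2 where "u2 = drop (length (tab_word t0)) u"
  have uu: "u = u1 @ u2" "length u1 = length (tab_word t0)" "length u2 = length h0"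
    using lu by (simp_all add: u1_def u2_def)
  have "dual h0 u2" using dual_append(2)[of "tab_word t0" h0 u1 u2] du uu by (simp add: P tab_word_Cons)
  then have "sorted u2" "u2 \<noteq> []" using dual_sorted sh uu by auto
  then have "length h0 \<le> length (hd (Ptab u))" unfolding uu(1) uu(3)[symmetric] by (rule first_row_suffix)
  also have "Ptab u = r # T" unfolding u_def
    using Ptab_knuth[OF fold_kmove_equiv] Ptab_tab_word[OF Cons.prems(1)] by simp
  finally have "m \<le> length v2" by (simp add: m_def P l1)
  then have e: "length (fst (ins_row (if T' = [] then [] else hd T') v2)) = length v2"
    using ge h by (simp add: m_def)
  have "T' = [] \<or> dom_row v2 (hd T')" using dom_row_of_run[OF s2 e] by (auto split: if_splits)
  then have "column_strict (v2 # T')" using s2 n2 T' by (simp add: column_strict_Cons)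
  then show ?case using T' v l1 by (intro exI[of _ "v2 # T'"]) (simp add: tab_word_Cons)
qed

text \<open>One list of moves straightens both words: it turns \<open>v\<close> into a word dual to
  a tableau word, which is itself a tableau word of the same shape, necessarily that of
  \<open>Ptab v\<close>.\<close>

lemma dual_shape_kmoves:
  assumes "dual u v"
  obtains ks where "shape (Ptab u) = shape (Ptab v)" "fold kmove ks u = tab_word (Ptab u)"
    "fold kmove ks v = tab_word (Ptab v)"
proof -
  obtain ks where ks: "tab_word (Ptab u) = fold kmove ks u"
    using knuth_kmoves[OF knuth_sym[OF tab_word_Ptab[of u]]] by blast
  have "dual (tab_word (Ptab u)) (fold kmove ks v)" unfolding ks by (rule dual_kmoves[OF assms])
  then obtain T' where T': "column_strict T'" "shape T' = shape (Ptab u)" "fold kmove ks v = tab_word T'"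
    using dual_tab_word[OF Ptab_column_strict] by blast
  have "Ptab v = Ptab (fold kmove ks v)" by (rule Ptab_knuth[OF fold_kmove_equiv, symmetric])
  then have "Ptab v = T'" using T' Ptab_tab_word by simp
  then show ?thesis using that ks T' by simp
qed

lemma dual_shape: "dual u v \<Longrightarrow> shape (Ptab u) = shape (Ptab v)"
  by (erule dual_shape_kmoves) simp

text \<open>The recording tableau lists the shapes of the prefixes, and prefixes of dual words are
  dual.\<close>

lemma dual_Qtab: "dual u v \<Longrightarrow> Qtab u = Qtab v"
proof (induction u arbitrary: v rule: rev_induct)
  case Nil
  then show ?case by (simp add: dual_def)
next
  case (snoc x u)
  have "length v = Suc (length u)" using dual_length[OF snoc.prems] by simp
  then obtain v' y where v: "v = v' @ [y]" "length v' = length u" by (auto simp: length_Suc_conv_rev)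
  have d: "dual u v'" using dual_append(1)[of u "[x]" v' "[y]"] snoc.prems v by simp
  obtain i where i: "i \<le> length (Ptab u)" "shape (Ptab (u @ [x])) = add_cell i (shape (Ptab u))"
    using tab_ins_shape[OF Ptab_column_strict, of u x] by (auto simp: Ptab_append)
  have j: "i \<le> length (Ptab v')" "shape (Ptab (v' @ [y])) = add_cell i (shape (Ptab v'))"
    using i dual_shape[OF d] dual_shape[OF snoc.prems] v by (metis length_shape, metis)
  show ?case using Qtab_snoc[OF i] Qtab_snoc[OF j] snoc.IH[OF d] v by simp
qed

lemma dual_Ptab_eq: "dual u v \<Longrightarrow> Ptab u = Ptab v \<Longrightarrow> u = v"
  by (rule RS_inj) (auto dest: dual_Qtab)

section \<open>Superstandard tableaux\<close>

definition superstd :: "nat list \<Rightarrow> tableau" where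
  "superstd l = map (\<lambda>i. replicate (l ! i) (Suc i)) [0..<length l]"

text \<open>No letter \<open>r + 1\<close> is unmatched. Equivalently, every suffix has at least as
  many \<open>r\<close> as \<open>r + 1\<close>; these are the highest weight words.\<close>

definition yamanouchi :: "nat \<Rightarrow> word \<Rightarrow> bool" where
  "yamanouchi N w \<longleftrightarrow> (\<forall>r\<in>{1..<N}. unm r w = phi r w)"

lemma unm_phi_suffix: "unm r (u @ v) = phi r (u @ v) \<Longrightarrow> unm r v = phi r v"
  using phi_le_unm[of r u] phi_le_unm[of r v] unfolding unm_append phi_append
  by (cases "unm r u - phi r u \<le> phi r v") (simp_all add: min_def)

lemma yamanouchi_suffix: "yamanouchi N (u @ v) \<Longrightarrow> yamanouchi N v"
  unfolding yamanouchi_def using unm_phi_suffix by blast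

lemma yamanouchi_kmoves: "yamanouchi N (fold kmove ks w) = yamanouchi N w"
  by (induction ks arbitrary: w) (auto simp: yamanouchi_def)

lemma yamanouchi_knuth: "u \<sim>\<^sub>K v \<Longrightarrow> yamanouchi N u \<longleftrightarrow> yamanouchi N v"
  by (metis knuth_kmoves yamanouchi_kmoves)

lemma tab_word_append: "tab_word (T @ U) = tab_word U @ tab_word T"
  by (simp add: tab_word_def)

lemma set_tab_word: "set (tab_word T) = \<Union> (set ` set T)"
  by (auto simp: tab_word_def)

lemma sorted_nth_last: "sorted l \<Longrightarrow> x \<in> set l \<Longrightarrow> x \<le> last l"
  by (induction l) auto

lemma phi_zero: "r \<notin> set w \<Longrightarrow> phi r w = 0"
  by (induction w) auto

lemma column_strict_nth:
  assumes "column_strict T" "Suc i < length T" "j < length (T ! Suc i)"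
  shows "j < length (T ! i)" "T ! i ! j < T ! Suc i ! j"
  using assms unfolding column_strict_def by (auto intro: less_le_trans)

text \<open>By column strictness the entries of row \<open>k\<close> are at least
  \<open>k + 1\<close>. If its last entry were \<open>r + 1\<close> with \<open>r\<close> at least
  \<open>k + 1\<close>, no \<open>r\<close> would follow it in the word, because each row above
  holds only its own smaller letter; it would be unmatched.\<close>

lemma yamanouchi_superstd:
  assumes cs: "column_strict T" and y: "yamanouchi N (tab_word T)" and N: "set (tab_word T) \<subseteq> {1..N}"
  shows "T = superstd (shape T)"
proof -
  have "T ! k = replicate (length (T ! k)) (Suc k)" if "k < length T" for k
    using that
  proof (induction k rule: less_induct)
    case (less k)
    have ge: "Suc k \<le> x" if xk: "x \<in> set (T ! k)" for x
    proof (cases k)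
      case 0
      have "x \<in> set (tab_word T)" using xk less.prems by (auto simp: set_tab_word)
      then show ?thesis using N 0 by auto
    next
      case (Suc i)
      obtain j where j: "j < length (T ! k)" "x = T ! k ! j" using xk by (auto simp: in_set_conv_nth)
      have *: "j < length (T ! i)" "T ! i ! j < x" using column_strict_nth[OF cs, of i j] less.prems Suc j by auto
      have "T ! i = replicate (length (T ! i)) (Suc i)" using less Suc by auto
      then have "T ! i ! j = Suc i" using *(1) by (metis nth_replicate)
      then show ?thesis using * Suc by simp
    qed
    have T: "T = take k T @ T ! k # drop (Suc k) T" using less.prems by (simp add: id_take_nth_drop)
    have Tk: "T ! k \<in> set T" using less.prems by simp
    have ne: "T ! k \<noteq> []" "sorted (T ! k)" using column_strict_nonempty[OF cs Tk] column_strict_sorted[OF cs Tk] by auto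
    define x where "x = last (T ! k)"
    have xT: "x \<in> set (T ! k)" using ne by (simp add: x_def)
    have "x \<le> Suc k"
    proof (rule ccontr)
      assume "\<not> x \<le> Suc k"
      then obtain r where r: "x = Suc r" "Suc k \<le> r" by (cases x) auto
      have xN: "x \<le> N" using xT N Tk by (auto simp: set_tab_word)
      have "tab_word T = (tab_word (drop (Suc k) T) @ butlast (T ! k)) @ (x # tab_word (take k T))"
        using arg_cong[OF T, of tab_word] ne by (simp add: tab_word_append tab_word_Cons x_def)
      then have "yamanouchi N (x # tab_word (take k T))" using y yamanouchi_suffix by metis
      then have e: "unm r (x # tab_word (take k T)) = phi r (x # tab_word (take k T))"
        unfolding yamanouchi_def by (rule bspec) (use r xN in auto)
      have "r \<notin> set (tab_word (take k T))"
      proof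
        assume "r \<in> set (tab_word (take k T))"
        then obtain s where s: "s \<in> set (take k T)" "r \<in> set s" by (auto simp: set_tab_word)
        then obtain i where i: "i < k" "i < length T" "r \<in> set (T ! i)"
          by (auto simp: in_set_conv_nth[of s])
        then have "r \<in> set (replicate (length (T ! i)) (Suc i))" using less.IH[of i] by simp
        then show False using r i by auto
      qed
      then have "phi r (tab_word (take k T)) = 0" by (rule phi_zero)
      then show False using e r by simp
    qed
    then have "\<forall>y\<in>set (T ! k). y = Suc k" using ge sorted_nth_last[OF ne(2)] unfolding x_def
      by (meson le_antisym order_trans)
    then show ?case by (metis replicate_eqI)
  qed
  then show ?thesis by (intro nth_equalityI) (auto simp: superstd_def shape_def)
qed

text \<open>Turning all unmatched letters of a pair into \<open>r\<close> keeps a tableau word of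
  the same shape, by duality, and lowers the sum of the letters; so raising ends at a highest weight
  word.\<close>

lemma raise_superstd:
  assumes "column_strict T" "set (tab_word T) \<subseteq> {1..N}"
  shows "\<exists>gs. fst ` set gs \<subseteq> {1..<N} \<and> refills gs (tab_word T) = tab_word (superstd (shape T))"
  using assms
proof (induction "sum_list (tab_word T)" arbitrary: T rule: less_induct)
  case less
  show ?case
  proof (cases "yamanouchi N (tab_word T)")
    case True
    then show ?thesis using yamanouchi_superstd[OF less.prems(1) True less.prems(2)]
      by (intro exI[of _ "[]"]) simp
  next
    case False
    then obtain r where r: "r \<in> {1..<N}" "unm r (tab_word T) \<noteq> phi r (tab_word T)" by (auto simp: yamanouchi_def)
    define w where "w = refill r (unm r (tab_word T)) (tab_word T)"
    have lt: "sum_list w < sum_list (tab_word T)"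
      using sum_refill[of r "unm r (tab_word T)" "tab_word T"] r(2) phi_le_unm[of r "tab_word T"] by (simp add: w_def)
    have "dual (tab_word T) w" by (simp add: w_def dual_refill)
    then obtain T' where T': "column_strict T'" "shape T' = shape T" "w = tab_word T'"
      using dual_tab_word[OF less.prems(1)] by blast
    have "set w \<subseteq> {1..N}" using refill_set[of r _ "tab_word T"] less.prems(2) r(1) unfolding w_def by fastforce
    then obtain gs where gs: "fst ` set gs \<subseteq> {1..<N}" "refills gs w = tab_word (superstd (shape T))"
      using less.hyps[of T'] lt T' by auto
    then show ?thesis using r(1)
      by (intro exI[of _ "(r, unm r (tab_word T)) # gs"]) (auto simp: refills_Cons w_def)
  qed
qed

text \<open>Connectedness of the crystal of a shape: raise both tableaux to the same highest one and
  run the second path backwards.\<close>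

lemma refills_same_shape:
  assumes "column_strict T" "column_strict T'" "shape T = shape T'"
    "set (tab_word T) \<subseteq> {1..N}" "set (tab_word T') \<subseteq> {1..N}"
  shows "\<exists>gs. fst ` set gs \<subseteq> {1..<N} \<and> refills gs (tab_word T) = tab_word T'"
proof -
  obtain gs where gs: "fst ` set gs \<subseteq> {1..<N}" "refills gs (tab_word T) = tab_word (superstd (shape T))"
    using raise_superstd assms by blast
  obtain hs where hs: "fst ` set hs \<subseteq> {1..<N}" "refills hs (tab_word T') = tab_word (superstd (shape T))"
    using raise_superstd[of T' N] assms by auto
  obtain hs' where "fst ` set hs' = fst ` set hs" "refills hs' (refills hs (tab_word T')) = tab_word T'"
    using refills_inverse by blast
  moreover have "fst ` set (gs @ hs') = fst ` set gs \<union> fst ` set hs'" by (simp add: image_Un)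
  ultimately show ?thesis using gs hs by (intro exI[of _ "gs @ hs'"]) (simp add: refills_append)
qed

section \<open>Reverse complement\<close>

definition revcomp :: "nat \<Rightarrow> word \<Rightarrow> word" where
  "revcomp N w = rev (map (\<lambda>x. Suc N - x) w)"

lemma revcomp_append: "revcomp N (u @ v) = revcomp N v @ revcomp N u"
  by (simp add: revcomp_def)

lemma length_revcomp [simp]: "length (revcomp N w) = length w"
  by (simp add: revcomp_def)

lemma revcomp_set: "set w \<subseteq> {1..N} \<Longrightarrow> set (revcomp N w) \<subseteq> {1..N}"
  by (fastforce simp: revcomp_def)

lemma revcomp_revcomp: "set w \<subseteq> {1..N} \<Longrightarrow> revcomp N (revcomp N w) = w"
  by (induction w) (auto simp: revcomp_def)

lemma revcomp_ktrip:
  assumes "x \<le> N" "y \<le> N" "z \<le> N"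
  shows "revcomp N (ktrip x y z) = ktrip (Suc N - z) (Suc N - y) (Suc N - x)"
proof -
  have "Suc N - z \<le> Suc N - y \<longleftrightarrow> y \<le> z" "Suc N - y \<le> Suc N - x \<longleftrightarrow> x \<le> y" "Suc N - z \<le> Suc N - x \<longleftrightarrow> x \<le> z"
    using assms by auto
  then show ?thesis unfolding ktrip_def revcomp_def by auto
qed

lemma revcomp_kmove:
  assumes "i + 3 \<le> length w" "set w \<subseteq> {1..N}"
  shows "revcomp N (kmove i w) = kmove (length w - i - 3) (revcomp N w)"
proof -
  obtain a x y z b where w: "w = a @ x # y # z # b" "length a = i"
    using assms(1) by (metis kmove_decomp not_le)
  have 1: "revcomp N w = revcomp N b @ (Suc N - z) # (Suc N - y) # (Suc N - x) # revcomp N a"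
    by (simp add: w revcomp_def)
  have 2: "length w - i - 3 = length (revcomp N b)" using w by simp
  have 3: "revcomp N (kmove i w) = revcomp N b @ revcomp N (ktrip x y z) @ revcomp N a"
    unfolding w(2)[symmetric] unfolding w(1) kmove_app by (simp add: revcomp_append)
  show ?thesis unfolding 1 2 3 kmove_app using assms w by (subst revcomp_ktrip) auto
qed

lemma kmove_set [simp]: "set (kmove i w) = set w"
  using knuth_set[OF kmove_equiv] .

text \<open>A triple starting at \<open>i\<close> starts at \<open>n - i - 3\<close> in the reversed
  word. Positions out of range are removed first, since truncated subtraction would turn them into
  position 0.\<close>

lemma revcomp_kmoves:
  "set w \<subseteq> {1..N} \<Longrightarrow> length w = n \<Longrightarrow>
   fold kmove ks (revcomp N w) =
   revcomp N (fold kmove (map (\<lambda>i. n - i - 3) (filter (\<lambda>i. i + 3 \<le> n) ks)) w)"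
proof (induction ks arbitrary: w)
  case (Cons i ks)
  show ?case
  proof (cases "i + 3 \<le> n")
    case True
    then have "kmove i (revcomp N w) = revcomp N (kmove (n - i - 3) w)"
      using revcomp_kmove[of "n - i - 3" w N] Cons.prems by simp
    then show ?thesis using Cons True by simp
  next
    case False
    then have "kmove i (revcomp N w) = revcomp N w" using Cons.prems by (intro kmove_short) simp
    then show ?thesis using Cons False by simp
  qed
qed simp

lemma revcomp_knuth:
  assumes "u \<sim>\<^sub>K v" "set u \<subseteq> {1..N}"
  shows "revcomp N u \<sim>\<^sub>K revcomp N v"
proof -
  have v: "set v \<subseteq> {1..N}" using knuth_set assms by blast
  have lv: "length v = length u" using knuth_length assms by metis
  have 1: "revcomp N v \<sim>\<^sub>K revcomp N (kmove i v)" if "set v \<subseteq> {1..N}" for i v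
  proof (cases "i + 3 \<le> length v")
    case True
    then show ?thesis using revcomp_kmove[OF True that] knuth_sym[OF kmove_equiv] by simp
  qed (simp add: kmove_short)
  have "revcomp N u \<sim>\<^sub>K revcomp N (fold kmove ks u)" if "set u \<subseteq> {1..N}" for ks u
    using that
  proof (induction ks arbitrary: u)
    case (Cons i ks)
    have "revcomp N u \<sim>\<^sub>K revcomp N (kmove i u)" by (rule 1[OF Cons.prems])
    also have "\<dots> \<sim>\<^sub>K revcomp N (fold kmove ks (kmove i u))" using Cons by simp
    finally show ?case by simp
  qed simp
  then show ?thesis using knuth_kmoves[OF assms(1)] assms(2) by metis
qed

lemma dual_revcomp:
  assumes "dual u v" "set u \<subseteq> {1..N}" "set v \<subseteq> {1..N}"
  shows "dual (revcomp N u) (revcomp N v)"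
proof -
  have l: "length v = length u" using dual_length[OF assms(1)] by simp
  have f: "fold kmove ks w ! i \<in> {1..N}" if "set w \<subseteq> {1..N}" "i < length w" for ks w i
  proof -
    have "fold kmove ks w ! i \<in> set (fold kmove ks w)" using that(2) by simp
    then show ?thesis using knuth_set[OF fold_kmove_equiv[of ks w]] that(1) by auto
  qed
  have n: "revcomp N w ! i = Suc N - w ! (length w - Suc i)" if "i < length w" for w i
    using that by (simp add: revcomp_def rev_nth)
  have "fold kmove ks (revcomp N u) ! Suc i < fold kmove ks (revcomp N u) ! i \<longleftrightarrow>
      fold kmove ks (revcomp N v) ! Suc i < fold kmove ks (revcomp N v) ! i" if i: "Suc i < length u" for ks i
  proof -
    define ls where "ls = map (\<lambda>i. length u - i - 3) (filter (\<lambda>i. i + 3 \<le> length u) ks)"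
    define j where "j = length u - Suc (Suc i)"
    have j: "length u - Suc i = Suc j" "Suc j < length u" using i by (auto simp: j_def)
    have e: "fold kmove ks (revcomp N w) ! Suc i < fold kmove ks (revcomp N w) ! i \<longleftrightarrow>
        fold kmove ls w ! Suc j < fold kmove ls w ! j" if w: "set w \<subseteq> {1..N}" "length w = length u" for w
    proof -
      have "fold kmove ks (revcomp N w) = revcomp N (fold kmove ls w)"
        unfolding ls_def using revcomp_kmoves[OF w] .
      moreover have "revcomp N (fold kmove ls w) ! Suc i = Suc N - fold kmove ls w ! j"
        "revcomp N (fold kmove ls w) ! i = Suc N - fold kmove ls w ! Suc j"
        using i j w by (simp_all add: n j_def)
      moreover have "fold kmove ls w ! j \<le> N" "fold kmove ls w ! Suc j \<le> N"
        using f[OF w(1)] j w(2) by auto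
      ultimately show ?thesis by auto
    qed
    show ?thesis using e[OF assms(2) refl] e[OF assms(3) l] assms(1) j(2) by (simp add: dual_def)
  qed
  then show ?thesis using l by (simp add: dual_def)
qed

lemma refills_set:
  "fst ` set gs \<subseteq> {1..<N} \<Longrightarrow> set w \<subseteq> {1..N} \<Longrightarrow> set (refills gs w) \<subseteq> {1..N}"
proof (induction gs arbitrary: w)
  case (Cons g gs)
  obtain r p where g: "g = (r, p)" by (cases g)
  have "set (refill r p w) \<subseteq> {1..N}" using refill_set[of r p w] Cons.prems by (fastforce simp: g)
  then show ?case using Cons by (simp add: g refills_Cons)
qed simp

lemma column_strict_hd_longest: "column_strict (r # T) \<Longrightarrow> s \<in> set T \<Longrightarrow> length s \<le> length r"
proof (induction T arbitrary: r)
  case (Cons t T)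
  then have "length t \<le> length r" "column_strict (t # T)" by (auto simp: column_strict_Cons dom_row_def)
  then show ?case using Cons by fastforce
qed simp

lemma shape_sorted: "column_strict T \<Longrightarrow> sorted_wrt (\<ge>) (shape T)"
proof (induction T)
  case (Cons r T)
  then have "\<forall>s\<in>set T. length s \<le> length r" using column_strict_hd_longest by blast
  then show ?case using Cons by (auto simp: column_strict_Cons shape_def)
qed simp

lemma shape_pos: "column_strict T \<Longrightarrow> x \<in> set (shape T) \<Longrightarrow> 0 < x"
  by (auto simp: shape_def dest: column_strict_nonempty)

lemma set_Ptab: "r \<in> set (Ptab w) \<Longrightarrow> set r \<subseteq> set w"
  using knuth_set[OF tab_word_Ptab[of w]] by (auto simp: set_tab_word)

text \<open>The word is the reverse complement of a superstandard word. Each new block consists of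
  equal letters smaller than all previous ones and is not longer than any existing row, so it pushes
  columns down.\<close>

lemma shape_lowest_word:
  assumes "sorted_wrt (\<ge>) l" "\<forall>x\<in>set l. 0 < x" "length l \<le> N" "k \<le> length l"
  shows "shape (Ptab (concat (map (\<lambda>i. replicate (l ! i) (N - i)) [0..<k]))) = take k l"
  using assms(4)
proof (induction k)
  case (Suc k)
  define w where "w = concat (map (\<lambda>i. replicate (l ! i) (N - i)) [0..<k])"
  have k: "k < length l" using Suc.prems by simp
  have IH: "shape (Ptab w) = take k l" using Suc by (simp add: w_def)
  have "shape (fold tab_ins (replicate (l ! k) (N - k)) (Ptab w)) =
      shape (Ptab w) @ [length (replicate (l ! k) (N - k))]"
  proof (rule shape_push_row[OF Ptab_column_strict])
    show "\<forall>s\<in>set (Ptab w). length (replicate (l ! k) (N - k)) \<le> length s"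
    proof
      fix s assume "s \<in> set (Ptab w)"
      then have "length s \<in> set (shape (Ptab w))" by (auto simp: shape_def)
      then obtain i where "i < k" "length s = l ! i" unfolding IH using k by (auto simp: in_set_conv_nth)
      then show "length (replicate (l ! k) (N - k)) \<le> length s"
        using sorted_wrt_nth_less[OF assms(1), of i k] k by simp
    qed
    show "replicate (l ! k) (N - k) \<noteq> []" using assms(2) k by auto
    show "\<forall>j<length (replicate (l ! k) (N - k)). replicate (l ! k) (N - k) ! j < hd (Ptab w) ! j" if ne: "Ptab w \<noteq> []"
    proof (intro allI impI)
      fix j assume j: "j < length (replicate (l ! k) (N - k))"
      have h: "hd (Ptab w) \<in> set (Ptab w)" using ne by simp
      have "l ! k \<le> length (hd (Ptab w))"
      proof -
        have "length (hd (Ptab w)) \<in> set (shape (Ptab w))" using h by (auto simp: shape_def)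
        then obtain i where "i < k" "length (hd (Ptab w)) = l ! i" unfolding IH using k by (auto simp: in_set_conv_nth)
        then show ?thesis using sorted_wrt_nth_less[OF assms(1), of i k] k by simp
      qed
      then have "hd (Ptab w) ! j \<in> set (hd (Ptab w))" using j by simp
      then have "hd (Ptab w) ! j \<in> set w" using set_Ptab[OF h] by blast
      then obtain i where "i < k" "hd (Ptab w) ! j = N - i" by (auto simp: w_def)
      then show "replicate (l ! k) (N - k) ! j < hd (Ptab w) ! j" using j k assms(3) by simp
    qed
  qed simp
  then have "shape (Ptab (w @ replicate (l ! k) (N - k))) = take k l @ [l ! k]"
    by (simp add: Ptab_append IH)
  then show ?case using k by (simp add: w_def take_Suc_conv_app_nth)
qed simp

lemma revcomp_superstd:
  "revcomp N (tab_word (superstd l)) = concat (map (\<lambda>i. replicate (l ! i) (N - i)) [0..<length l])"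
  by (simp add: revcomp_def tab_word_def superstd_def rev_concat rev_map map_concat o_def)

text \<open>Both sides depend only on the dual class of \<open>w\<close>. Inside this class there is
  a word whose tableau is superstandard, and for it the reverse complement can be inserted
  explicitly.\<close>

theorem shape_revcomp:
  assumes "set w \<subseteq> {1..N}"
  shows "shape (Ptab (revcomp N w)) = shape (Ptab w)"
proof -
  define l where "l = shape (Ptab w)"
  have sw: "set (tab_word (Ptab w)) \<subseteq> {1..N}" using knuth_set[OF tab_word_Ptab] assms by blast
  obtain gs where gs: "fst ` set gs \<subseteq> {1..<N}" "refills gs (tab_word (Ptab w)) = tab_word (superstd l)"
    using raise_superstd[OF Ptab_column_strict sw] by (auto simp: l_def)
  have ss: "set (tab_word (superstd l)) \<subseteq> {1..N}" using refills_set[OF gs(1) sw] gs(2) by simp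
  have l: "sorted_wrt (\<ge>) l" "\<forall>x\<in>set l. 0 < x"
    using shape_sorted[OF Ptab_column_strict] shape_pos[OF Ptab_column_strict] by (auto simp: l_def)
  \<comment> \<open>Ensures that the letters \<open>N - i\<close> of the complemented rows are
    strictly decreasing. The letter of the last row is \<open>length l\<close>.\<close>
  have lN: "length l \<le> N"
  proof (cases "l = []")
    case False
    then have "0 < l ! (length l - 1)" using l(2) by simp
    then have "length l \<in> set (tab_word (superstd l))" using False
      by (auto simp: set_tab_word superstd_def intro!: bexI[of _ "length l - 1"])
    then show ?thesis using ss by auto
  qed simp
  have v: "set (refills gs w) \<subseteq> {1..N}" by (rule refills_set[OF gs(1) assms])
  have "shape (Ptab (revcomp N w)) = shape (Ptab (revcomp N (refills gs w)))"
    by (rule dual_shape[OF dual_revcomp[OF dual_refills assms v]])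
  also have "refills gs w \<sim>\<^sub>K tab_word (superstd l)"
    using refills_knuth[OF knuth_sym[OF tab_word_Ptab[of w]], of gs] gs(2) by simp
  then have "Ptab (revcomp N (refills gs w)) = Ptab (revcomp N (tab_word (superstd l)))"
    by (intro Ptab_knuth revcomp_knuth v)
  also have "shape (Ptab (revcomp N (tab_word (superstd l)))) = l"
    unfolding revcomp_superstd using shape_lowest_word[OF l lN order_refl] by simp
  finally show ?thesis by (simp add: l_def)
qed

section \<open>Splitting off the first or the last letter\<close>

lemma shape_eq_letter:
  assumes "Ptab (u @ [x]) = Ptab (v @ [y])" "shape (Ptab u) = shape (Ptab v)"
  shows "x = y \<and> Ptab u = Ptab v"
  by (rule tab_ins_inj) (use assms Ptab_rows_sorted in \<open>auto simp: Ptab_append\<close>)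

lemma revcomp_Ptab_eq:
  assumes "set u \<subseteq> {1..N}" "set v \<subseteq> {1..N}" "Ptab (revcomp N u) = Ptab (revcomp N v)"
  shows "Ptab u = Ptab v"
proof -
  have "revcomp N u \<sim>\<^sub>K revcomp N v" using assms(3) knuth_iff_Ptab by blast
  from revcomp_knuth[OF this revcomp_set[OF assms(1)]] show ?thesis
    using assms(1,2) revcomp_revcomp knuth_iff_Ptab by simp
qed

lemma revcomp_Cons: "revcomp N (x # u) = revcomp N u @ [Suc N - x]"
  by (simp add: revcomp_def)

text \<open>Reverse complement of the statement on last letters; it preserves the shape of
  \<open>u\<close> and of \<open>v\<close>.\<close>

lemma shape_eq_first_letter:
  assumes "Ptab (x # u) = Ptab (y # v)" "shape (Ptab u) = shape (Ptab v)"
    "set (x # u) \<subseteq> {1..N}" "set (y # v) \<subseteq> {1..N}"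
  shows "x = y \<and> Ptab u = Ptab v"
proof -
  have "x # u \<sim>\<^sub>K y # v" using assms(1) knuth_iff_Ptab by blast
  then have "Ptab (revcomp N (x # u)) = Ptab (revcomp N (y # v))" using revcomp_knuth assms(3) Ptab_knuth by blast
  moreover have "shape (Ptab (revcomp N u)) = shape (Ptab (revcomp N v))"
    using shape_revcomp[of u N] shape_revcomp[of v N] assms by simp
  ultimately have "Suc N - x = Suc N - y \<and> Ptab (revcomp N u) = Ptab (revcomp N v)"
    unfolding revcomp_Cons by (rule shape_eq_letter)
  then show ?thesis using revcomp_Ptab_eq[of u N v] assms(3,4) by auto
qed

text \<open>A smallest letter enters the first row directly behind its own copies, and bumping only
  drifts to the left.\<close>

lemma last_letter_col:
  assumes "\<forall>y\<in>set u. x \<le> y" "count_list u x \<le> k"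
  shows "\<exists>i\<le>length (Ptab u). shape (Ptab (u @ [x])) = add_cell i (shape (Ptab u)) \<and> shape (Ptab (u @ [x])) ! i \<le> Suc k"
proof -
  have "length (filter (\<lambda>a. a \<le> x) (if Ptab u = [] then [] else hd (Ptab u))) \<le> k"
  proof (cases "Ptab u")
    case (Cons h T)
    have "set h \<subseteq> set u" using set_Ptab[of h u] Cons by simp
    then have "\<forall>y\<in>set h. y \<le> x \<longleftrightarrow> x = y" using assms(1) by force
    then have "filter (\<lambda>a. a \<le> x) h = filter ((=) x) h" by (intro filter_cong) auto
    then have "length (filter (\<lambda>a. a \<le> x) h) = count_list h x" by (simp add: count_list_eq_length_filter)
    also have "\<dots> \<le> count_list (tab_word (Ptab u)) x" by (simp add: Cons tab_word_Cons)
    also have "\<dots> = count_list u x" by (rule knuth_count[OF tab_word_Ptab])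
    finally show ?thesis using Cons assms(2) by simp
  qed simp
  from tab_ins_shape_col[OF Ptab_column_strict this] obtain i where
    i: "i \<le> length (Ptab u)" "shape (tab_ins x (Ptab u)) = add_cell i (shape (Ptab u))"
    "length (tab_ins x (Ptab u) ! i) \<le> Suc k" by blast
  have "i < length (shape (tab_ins x (Ptab u)))" unfolding i(2) using i(1) by (simp add: length_add_cell)
  then have "shape (tab_ins x (Ptab u)) ! i \<le> Suc k" using i(3) by (simp add: shape_def)
  then show ?thesis using i by (auto simp: Ptab_append)
qed

lemma count_revcomp:
  assumes "set w \<subseteq> {1..N}" "x \<in> {1..N}"
  shows "count_list (revcomp N w) (Suc N - x) = count_list w x"
proof -
  have "count_list (map (\<lambda>x. Suc N - x) w) (Suc N - x) = count_list w x"
    using assms by (induction w) auto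
  then show ?thesis by (simp add: revcomp_def)
qed

text \<open>A prepended \<open>N\<close> becomes an appended 1 under reverse complement.\<close>

lemma first_letter_col:
  assumes "set u \<subseteq> {1..N}" "1 \<le> N" "count_list u N \<le> k"
  shows "\<exists>i\<le>length (Ptab u). shape (Ptab (N # u)) = add_cell i (shape (Ptab u)) \<and> shape (Ptab (N # u)) ! i \<le> Suc k"
proof -
  have r: "revcomp N (N # u) = revcomp N u @ [1]" by (simp add: revcomp_def)
  have "\<forall>y\<in>set (revcomp N u). 1 \<le> y" using revcomp_set[OF assms(1)] by auto
  moreover have "count_list (revcomp N u) 1 \<le> k" using count_revcomp[OF assms(1), of N] assms(2,3) by simp
  ultimately obtain i where "i \<le> length (Ptab (revcomp N u))"
    "shape (Ptab (revcomp N u @ [1])) = add_cell i (shape (Ptab (revcomp N u)))" "shape (Ptab (revcomp N u @ [1])) ! i \<le> Suc k"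
    using last_letter_col by blast
  moreover have "shape (Ptab (revcomp N u)) = shape (Ptab u)" "shape (Ptab (revcomp N u @ [1])) = shape (Ptab (N # u))"
    using shape_revcomp[of u N] shape_revcomp[of "N # u" N] assms r by auto
  ultimately show ?thesis by (metis length_shape)
qed

section \<open>The action of the symmetric group\<close>

subsection \<open>The braid relation\<close>

lemma phi_rep [simp]:
  "phi r (replicate k r @ w) = k + phi r w"
  "phi r (replicate k (Suc r) @ w) = phi r w - k"
  "x \<noteq> r \<Longrightarrow> x \<noteq> Suc r \<Longrightarrow> phi r (replicate k x @ w) = phi r w"
  by (induction k) auto

lemma unm_rep [simp]:
  "unm r (replicate k r @ w) = k + unm r w"
  "x \<noteq> r \<Longrightarrow> x \<noteq> Suc r \<Longrightarrow> unm r (replicate k x @ w) = unm r w"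
  by (induction k) auto

lemma unm_rep_Suc [simp]:
  "unm r (replicate k (Suc r) @ w) = k + unm r w - 2 * min k (phi r w)"
proof (induction k)
  case (Suc k)
  then show ?case using phi_le_unm[of r w] by (cases "phi r w \<le> k") auto
qed simp

lemma phi_unm_replicate [simp]:
  "phi r (replicate k r) = k" "phi r (replicate k (Suc r)) = 0"
  "x \<noteq> r \<Longrightarrow> x \<noteq> Suc r \<Longrightarrow> phi r (replicate k x) = 0"
  "unm r (replicate k r) = k" "unm r (replicate k (Suc r)) = k"
  "x \<noteq> r \<Longrightarrow> x \<noteq> Suc r \<Longrightarrow> unm r (replicate k x) = 0"
  by (induction k) auto

lemma refill_rep:
  "refill r p (replicate k r @ w) = replicate (min p k) r @ replicate (k - p) (Suc r) @ refill r (p - k) w"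
proof (induction k arbitrary: p)
  case (Suc k)
  show ?case
  proof (cases p)
    case 0
    then show ?thesis using Suc[of 0] by simp
  next
    case (Suc q)
    then show ?thesis using Suc.IH[of q] by simp
  qed
qed simp

lemma refill_rep_other:
  "x \<noteq> r \<Longrightarrow> x \<noteq> Suc r \<Longrightarrow> refill r p (replicate k x @ w) = replicate k x @ refill r p w"
  by (induction k) auto

lemma refill_rep_matched:
  "k \<le> phi r w \<Longrightarrow> refill r p (replicate k (Suc r) @ w) = replicate k (Suc r) @ refill r (k + p) w"
proof (induction k arbitrary: p)
  case (Suc k)
  then show ?case by simp
qed simp

lemma refill_rep_unmatched:
  "phi r w = 0 \<Longrightarrow> refill r p (replicate k (Suc r) @ w) =
     replicate (min p k) r @ replicate (k - p) (Suc r) @ refill r (p - k) w"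
proof (induction k arbitrary: p)
  case (Suc k)
  show ?case
  proof (cases p)
    case 0
    then show ?thesis using Suc.IH[of 0] Suc.prems by simp
  next
    case (Suc q)
    then show ?thesis using Suc.IH[of q] Suc.prems by simp
  qed
qed simp

lemma refill_rep_Suc:
  assumes "phi r w = f" "m = min k f"
  shows "refill r p (replicate k (Suc r) @ w) =
     replicate (min p (k - m)) r @ replicate (k - min p (k - m)) (Suc r) @ refill r (m + (p - (k - m))) w"
proof -
  have k: "k = (k - m) + m" using assms by simp
  have e: "replicate k (Suc r) @ w = replicate (k - m) (Suc r) @ (replicate m (Suc r) @ w)"
    by (subst k) (simp add: replicate_add)
  have m: "refill r q (replicate m (Suc r) @ w) = replicate m (Suc r) @ refill r (m + q) w" for q
    by (rule refill_rep_matched) (use assms in simp)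
  have "k - min p (k - m) = (k - m - p) + m" using assms by auto
  then have e2: "replicate (k - min p (k - m)) (Suc r) = replicate (k - m - p) (Suc r) @ replicate m (Suc r)"
    by (simp add: replicate_add)
  show ?thesis
  proof (cases "k \<le> f")
    case True
    then show ?thesis using assms m by simp
  next
    case False
    then have "phi r (replicate m (Suc r) @ w) = 0" using assms by simp
    then show ?thesis unfolding e refill_rep_unmatched[OF \<open>phi r (replicate m (Suc r) @ w) = 0\<close>] m e2 by simp
  qed
qed

text \<open>The word of the general tableau in the letters \<open>r\<close>, \<open>r + 1\<close>,
  \<open>r + 2\<close>: third row \<open>c3\<close>, second row \<open>b2, b3\<close>, first row
  \<open>a1, a2, a3\<close>. The final empty list brings every block into the form
  \<open>replicate k x @ w\<close> of the computation rules.\<close>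

definition tri_word :: "nat \<Rightarrow> nat \<Rightarrow> nat \<Rightarrow> nat \<Rightarrow> nat \<Rightarrow> nat \<Rightarrow> nat \<Rightarrow> word" where
  "tri_word r c3 b2 b3 a1 a2 a3 =
     replicate c3 (Suc (Suc r)) @ replicate b2 (Suc r) @ replicate b3 (Suc (Suc r)) @
     replicate a1 r @ replicate a2 (Suc r) @ replicate a3 (Suc (Suc r)) @ []"

text \<open>All \<open>b2\<close> letters \<open>r + 1\<close> of the second row find partners in
  the first row. So only the first row changes, and its unmatched parts of sizes
  \<open>a1 - b2\<close> and \<open>a2\<close> trade places.\<close>

lemma s_op_tri_word1:
  assumes "b2 \<le> a1"
  shows "s_op r (tri_word r c3 b2 b3 a1 a2 a3) = tri_word r c3 b2 b3 (b2 + a2) (a1 - b2) a3"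
proof -
  let ?w = "tri_word r c3 b2 b3 a1 a2 a3"
  have ph: "phi r ?w = a1 - b2" by (simp add: tri_word_def)
  have un: "unm r ?w = a1 + a2 - b2" using assms by (simp add: tri_word_def)
  have p: "unm r ?w - phi r ?w = a2" using ph un assms by simp
  have f: "phi r (replicate b3 (Suc (Suc r)) @ replicate a1 r @ replicate a2 (Suc r) @ replicate a3 (Suc (Suc r)) @ []) = a1"
    by simp
  have f2: "phi r (replicate a3 (Suc (Suc r)) @ []) = 0" using phi_rep(3)[of "Suc (Suc r)" r a3 "[]"] by simp
  have o: "Suc (Suc r) \<noteq> r" "Suc (Suc r) \<noteq> Suc r" by auto
  have "s_op r ?w = replicate c3 (Suc (Suc r)) @ replicate b2 (Suc r) @ replicate b3 (Suc (Suc r)) @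
     (replicate (min (b2 + a2) a1) r @ replicate (a1 - (b2 + a2)) (Suc r) @
     replicate (min (b2 + a2 - a1) a2) r @ replicate (a2 - (b2 + a2 - a1)) (Suc r)) @ replicate a3 (Suc (Suc r)) @ []"
    unfolding s_op_refill p unfolding tri_word_def refill_rep_other[OF o]
    using assms f by (subst refill_rep_matched) (simp_all only: refill_rep_other[OF o] refill_rep refill_rep_unmatched[OF f2] append_assoc refill.simps)
  also have "\<dots> = tri_word r c3 b2 b3 (b2 + a2) (a1 - b2) a3"
  proof (cases "b2 + a2 \<le> a1")
    case True
    then have e: "a1 - b2 = a1 - (b2 + a2) + a2" "b2 + a2 - a1 = 0" by simp_all
    have "replicate (a1 - b2) (Suc r) = replicate (a1 - (b2 + a2)) (Suc r) @ replicate a2 (Suc r)"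
      unfolding replicate_add[symmetric] using e(1) by simp
    then show ?thesis using True e(2) by (simp add: tri_word_def)
  next
    case False
    then have e: "b2 + a2 = a1 + (b2 + a2 - a1)" "b2 + a2 - a1 \<le> a2" "a2 - (b2 + a2 - a1) = a1 - b2" "a1 - (b2 + a2) = 0"
      using assms by simp_all
    then have "replicate (b2 + a2) r = replicate a1 r @ replicate (b2 + a2 - a1) r" by (metis replicate_add)
    then show ?thesis using False e by (simp add: tri_word_def)
  qed
  finally show ?thesis .
qed

text \<open>\<open>D\<close> is the number of unmatched \<open>r + 2\<close>, hence of unmatched
  \<open>r + 1\<close> afterwards, and \<open>U\<close> the number of unmatched places in the second
  row. The third row is matched with \<open>c3\<close> letters of the second, and \<open>m\<close>
  pairs join the second row to the first. The second row is filled before the first, whence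
  \<open>min D U\<close> and the truncated \<open>D - U\<close>.\<close>

lemma s_op_tri_word2:
  assumes "c3 \<le> b2" "m = min b3 a2" "D = b3 - m + a3" "U = b2 - c3 + (b3 - m)"
    "B2 = c3 + min D U" "A2 = m + (D - U)"
  shows "s_op (Suc r) (tri_word r c3 b2 b3 a1 a2 a3) = tri_word r c3 B2 (b2 + b3 - B2) a1 A2 (a2 + a3 - A2)"
proof -
  let ?y = "Suc r" and ?z = "Suc (Suc r)"
  let ?w = "tri_word r c3 b2 b3 a1 a2 a3"
  have ne: "r \<noteq> ?y" "r \<noteq> Suc ?y" by auto
  define t1 where "t1 = replicate a1 r @ replicate a2 ?y @ replicate a3 ?z @ []"
  have f3: "phi ?y (replicate a3 ?z @ []) = 0" using phi_rep(2)[of ?y a3 "[]"] by simp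
  have u3: "unm ?y (replicate a3 ?z @ []) = a3" using unm_rep_Suc[of ?y a3 "[]"] by simp
  have f1: "phi ?y t1 = a2" using ne f3 by (simp add: t1_def del: append_Nil2)
  have u1: "unm ?y t1 = a2 + a3" using ne u3 by (simp add: t1_def del: append_Nil2)
  define t2 where "t2 = replicate b3 ?z @ t1"
  have f2: "phi ?y t2 = a2 - b3" using f1 by (simp add: t2_def)
  have u2: "unm ?y t2 = b3 + (a2 + a3) - 2 * m" using f1 u1 assms by (simp add: t2_def)
  define t4 where "t4 = replicate b2 ?y @ t2"
  have w: "?w = replicate c3 ?z @ t4" by (simp add: tri_word_def t4_def t2_def t1_def)
  have f4: "phi ?y t4 = b2 + (a2 - b3)" using f2 by (simp add: t4_def)
  have p: "unm ?y ?w - phi ?y ?w = D"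
    using f4 f2 u2 assms by (simp add: w t4_def min_def)
  have r1: "refill ?y q t1 = replicate a1 r @ replicate (min q a2) ?y @ replicate (a2 - q) ?z @
      replicate (min (q - a2) a3) ?y @ replicate (a3 - (q - a2)) ?z @ []" for q
    unfolding t1_def by (simp only: refill_rep_other[OF ne] refill_rep refill_rep_unmatched[of ?y "[]", OF phi.simps(1)] refill.simps)
  have r2: "refill ?y q t2 = replicate (min q (b3 - m)) ?y @ replicate (b3 - min q (b3 - m)) ?z @ refill ?y (m + (q - (b3 - m))) t1" for q
    unfolding t2_def by (rule refill_rep_Suc[OF f1 assms(2)])
  have "s_op ?y ?w = replicate c3 ?z @ refill ?y (c3 + D) t4"
    unfolding s_op_refill p unfolding w by (rule refill_rep_matched) (use f4 assms in simp)
  also have "refill ?y (c3 + D) t4 = replicate (min (c3 + D) b2) ?y @ replicate (b2 - (c3 + D)) ?z @ refill ?y (c3 + D - b2) t2"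
    unfolding t4_def by (rule refill_rep)
  finally have s: "s_op ?y ?w = replicate c3 ?z @ replicate (min (c3 + D) b2) ?y @ replicate (b2 - (c3 + D)) ?z @
     replicate (min (c3 + D - b2) (b3 - m)) ?y @ replicate (b3 - min (c3 + D - b2) (b3 - m)) ?z @ replicate a1 r @
     replicate (min (m + (c3 + D - b2 - (b3 - m))) a2) ?y @ replicate (a2 - (m + (c3 + D - b2 - (b3 - m)))) ?z @
      replicate (min (m + (c3 + D - b2 - (b3 - m)) - a2) a3) ?y @ replicate (a3 - (m + (c3 + D - b2 - (b3 - m)) - a2)) ?z @ []"
    unfolding r2 r1 by simp
  define q where "q = m + (D - U)"
  have qe: "m + (c3 + D - b2 - (b3 - m)) = q" using assms(1,4) by (simp add: q_def)
  have b: "replicate (min (c3 + D) b2) ?y @ replicate (b2 - (c3 + D)) ?z @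
     replicate (min (c3 + D - b2) (b3 - m)) ?y @ replicate (b3 - min (c3 + D - b2) (b3 - m)) ?z @ v =
     replicate B2 ?y @ replicate (b2 + b3 - B2) ?z @ v" for v
  proof (cases "c3 + D \<le> b2")
    case True
    have "D \<le> U" using True assms(4) by linarith
    then have B2: "B2 = c3 + D" by (simp add: assms(5))
    have "replicate (b2 + b3 - (c3 + D)) ?z = replicate (b2 - (c3 + D)) ?z @ replicate b3 ?z"
      unfolding replicate_add[symmetric] using True by simp
    then show ?thesis unfolding B2 using True by simp
  next
    case False
    define k where "k = min (c3 + D - b2) (b3 - m)"
    have "min D U = b2 - c3 + k"
      using False assms(1) unfolding assms(4) k_def by (cases "c3 + D - b2 \<le> b3 - m") (simp_all only: min_def if_True if_False split: if_split, linarith+)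
    then have B2: "B2 = b2 + k" using assms(1) unfolding assms(5) by simp
    have "b2 + b3 - (b2 + k) = b3 - k" by simp
    then show ?thesis using False unfolding B2 k_def[symmetric] by (simp add: replicate_add)
  qed
  have a: "replicate (min q a2) ?y @ replicate (a2 - q) ?z @ replicate (min (q - a2) a3) ?y @ replicate (a3 - (q - a2)) ?z @ [] =
     replicate A2 ?y @ replicate (a2 + a3 - A2) ?z @ []"
  proof (cases "q \<le> a2")
    case True
    then have "replicate (a2 + a3 - q) ?z = replicate (a2 - q) ?z @ replicate a3 ?z"
      unfolding replicate_add[symmetric] by simp
    then show ?thesis using True assms(6) by (simp add: q_def[symmetric])
  next
    case False
    have "m \<le> a2" unfolding assms(2) by simp
    moreover have "D - U \<le> a3" unfolding assms(3,4) by linarith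
    ultimately have "q - a2 \<le> a3" unfolding q_def by linarith
    moreover have "replicate q ?y = replicate a2 ?y @ replicate (q - a2) ?y" unfolding replicate_add[symmetric] using False by simp
    ultimately show ?thesis using False assms(6) by (simp add: q_def[symmetric])
  qed
  show ?thesis unfolding s qe b a by (simp only: tri_word_def)
qed

text \<open>Integers avoid truncated subtraction; \<open>q\<close> stands for \<open>b2 - c3\<close>
  and \<open>p\<close> for \<open>a1 - b2\<close>. Index 1 belongs to the middle operator of one
  side of the braid relation, indices 2 and 3 to the two outer operators of the other side. Once
  \<open>M\<close>, \<open>N\<close> and \<open>L\<close> isolate the minima, the rest is
  linear.\<close>

lemma braid_numeric:
  fixes c b2 b3 a1 a2 a3 p q :: int
  assumes "0 \<le> c" "0 \<le> q" "0 \<le> b3" "0 \<le> p" "b3 \<le> p + a2" "0 \<le> a2" "0 \<le> a3"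
    and "b2 = c + q" "a1 = b2 + p"
  and "m1 = min b3 p" "D1 = b3 - m1 + a3" "U1 = q + (b3 - m1)" "B1 = c + min D1 U1" "A1 = m1 + max 0 (D1 - U1)"
  and "m2 = min b3 a2" "D2 = b3 - m2 + a3" "U2 = q + (b3 - m2)" "B2 = c + min D2 U2" "A2 = m2 + max 0 (D2 - U2)"
  and "m3 = min (b2 + b3 - B2) (a1 - B2)" "D3 = b2 + b3 - B2 - m3 + (a2 + a3 - A2)" "U3 = B2 - c + (b2 + b3 - B2 - m3)"
    "B3 = c + min D3 U3" "A3 = m3 + max 0 (D3 - U3)"
  shows "B1 = B3 \<and> B1 + A1 = B2 + A2 \<and> b2 + a2 - B1 = A3 \<and> B1 \<le> b2 + a2 \<and> B2 \<le> a1"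
proof -
  define M where "M = min (0::int) (a3 - q)"
  have B1: "B1 = c + q + (b3 - m1) + M" "A1 = m1 + (a3 - q - M)" unfolding assms M_def by linarith+
  have B2: "B2 = c + q + (b3 - m2) + M" "A2 = m2 + (a3 - q - M)" unfolding assms M_def by linarith+
  define N where "N = min (0::int) (p - b3)"
  have m1: "m1 = b3 + N" unfolding assms N_def by linarith
  have m3: "m3 = b2 + b3 - B2 + N" unfolding assms(20,9) N_def by linarith
  define L where "L = min (0::int) (a2 - b3)"
  have m2: "m2 = b3 + L" unfolding assms L_def by linarith
  have DU: "D3 - U3 = a2 - b3" unfolding assms(21,22) B2 assms(8) by linarith
  then have B3: "B3 = c + U3 + L" "A3 = m3 + (a2 - b3 - L)" unfolding assms(23,24) L_def by linarith+
  have N0: "N \<le> 0" "L \<le> 0" "M \<le> 0" by (simp_all add: N_def L_def M_def)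
  have NL: "N = 0 \<or> N = p - b3" "L = 0 \<or> L = a2 - b3" "M = 0 \<or> M = a3 - q" by (auto simp: N_def L_def M_def min_def)
  have 1: "B1 = B3" unfolding B1 B3 assms(22) m3 B2 m1 m2 assms(8) by linarith
  have 2: "B1 + A1 = B2 + A2" unfolding B1 B2 by linarith
  have 3: "b2 + a2 - B1 = A3" unfolding B1 B3 m3 B2 m1 m2 assms(8) by linarith
  have 4: "B1 \<le> b2 + a2" unfolding B1 m1 assms(8) using NL N0 assms(5,6) by (elim disjE; linarith)
  have 5: "B2 \<le> a1" unfolding B2 m2 assms(9,8) using NL N0 assms(4,5) by (elim disjE; linarith)
  from 1 2 3 4 5 show ?thesis by blast
qed

lemma tri_word_exists:
  assumes cs: "column_strict T" and set: "set (tab_word T) \<subseteq> {r, Suc r, Suc (Suc r)}"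
  obtains c3 b2 b3 a1 a2 a3 where "tab_word T = tri_word r c3 b2 b3 a1 a2 a3" "c3 \<le> b2" "b2 \<le> a1" "b2 + b3 \<le> a1 + a2"
proof -
  have srow: "\<exists>a b c. s = replicate a r @ replicate b (Suc r) @ replicate c (Suc (Suc r))"
    if "sorted s" "set s \<subseteq> {r, Suc r, Suc (Suc r)}" for s
    using that
  proof (induction s)
    case Nil
    show ?case by (intro exI[of _ 0]) simp
  next
    case (Cons x s)
    then obtain a b c where s: "s = replicate a r @ replicate b (Suc r) @ replicate c (Suc (Suc r))" by auto
    have le: "\<forall>y\<in>set s. x \<le> y" using Cons.prems by simp
    consider "x = r" | "x = Suc r" | "x = Suc (Suc r)" using Cons.prems by auto
    then show ?case
    proof cases
      case 1
      then show ?thesis using s by (intro exI[of _ "Suc a"] exI[of _ b] exI[of _ c]) simp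
    next
      case 2
      then have "a = 0" using le s by (cases a) auto
      then show ?thesis using s 2 by (intro exI[of _ 0] exI[of _ "Suc b"] exI[of _ c]) simp
    next
      case 3
      then have a: "a = 0" using le s by (cases a) auto
      then have "b = 0" using 3 le s by (cases b) auto
      with a show ?thesis using s 3 by (intro exI[of _ 0] exI[of _ "Suc c"]) simp
    qed
  qed
  have row: "\<exists>a b c. s = replicate a r @ replicate b (Suc r) @ replicate c (Suc (Suc r))" if "s \<in> set T" for s
  proof -
    have "set s \<subseteq> set (tab_word T)" using that by (auto simp: tab_word_def)
    then show ?thesis using srow[OF column_strict_sorted[OF cs that]] set by blast
  qed
  have lT: "length T \<le> 3"
  proof (rule ccontr)
    assume "\<not> ?thesis"
    then have l: "3 < length T" by simp
    have ne: "T ! i \<noteq> []" if "i < length T" for i using cs that unfolding column_strict_def by blast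
    have st: "T ! i ! 0 < T ! Suc i ! 0" if "Suc i < length T" for i
      using column_strict_nth(2)[OF cs that, of 0] ne[OF that] by simp
    have "T ! 0 ! 0 < T ! 1 ! 0" "T ! 1 ! 0 < T ! 2 ! 0" "T ! 2 ! 0 < T ! 3 ! 0"
      using st[of 0] st[of 1] st[of 2] l by (simp_all add: numeral_2_eq_2 numeral_3_eq_3)
    moreover have m: "T ! i ! 0 \<in> {r, Suc r, Suc (Suc r)}" if "i < length T" for i
    proof -
      have "T ! i ! 0 \<in> set (T ! i)" "T ! i \<in> set T" using ne[OF that] that by simp_all
      then have "T ! i ! 0 \<in> set (tab_word T)" unfolding set_tab_word by blast
      then show ?thesis using set by blast
    qed
    have "T ! 0 ! 0 \<in> {r, Suc r, Suc (Suc r)}" "T ! 3 ! 0 \<in> {r, Suc r, Suc (Suc r)}"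
      by (rule m; use l in linarith)+
    then have "r \<le> T ! 0 ! 0" "T ! 3 ! 0 \<le> Suc (Suc r)" by auto
    ultimately show False by linarith
  qed
  define R1 where "R1 = (if 0 < length T then T ! 0 else [])"
  define R2 where "R2 = (if 1 < length T then T ! 1 else [])"
  define R3 where "R3 = (if 2 < length T then T ! 2 else [])"
  consider "T = []" | x where "T = [x]" | x y where "T = [x, y]" | x y z where "T = [x, y, z]"
  proof -
    have "length T = 0 \<or> length T = Suc 0 \<or> length T = Suc (Suc 0) \<or> length T = Suc (Suc (Suc 0))"
      using lT by linarith
    then show thesis using that by (elim disjE) (auto simp: length_Suc_conv)
  qed
  then have w: "tab_word T = R3 @ R2 @ R1"
    by cases (simp_all add: tab_word_def R1_def R2_def R3_def)
  have e: "\<exists>a b c. [] = replicate a r @ replicate b (Suc r) @ replicate c (Suc (Suc r))"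
    by (intro exI[of _ 0]) simp
  obtain a1 a2 a3 where R1: "R1 = replicate a1 r @ replicate a2 (Suc r) @ replicate a3 (Suc (Suc r))"
    using row[of "T ! 0"] e unfolding R1_def by (cases "0 < length T") auto
  obtain b1 b2 b3 where R2: "R2 = replicate b1 r @ replicate b2 (Suc r) @ replicate b3 (Suc (Suc r))"
    using row[of "T ! 1"] e unfolding R2_def by (cases "1 < length T") auto
  obtain c1 c2 c3 where R3: "R3 = replicate c1 r @ replicate c2 (Suc r) @ replicate c3 (Suc (Suc r))"
    using row[of "T ! 2"] e unfolding R3_def by (cases "2 < length T") auto
  have 12: "j < length R1 \<and> R1 ! j < R2 ! j" if "j < length R2" for j
  proof -
    have l: "Suc 0 < length T" using that by (auto simp: R2_def split: if_splits)
    then have "R1 = T ! 0" "R2 = T ! Suc 0" by (auto simp: R1_def R2_def)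
    then show ?thesis using column_strict_nth[OF cs l, of j] that by simp
  qed
  have 23: "j < length R2 \<and> R2 ! j < R3 ! j" if "j < length R3" for j
  proof -
    have l: "Suc (Suc 0) < length T" using that by (auto simp: R3_def numeral_2_eq_2 split: if_splits)
    then have "R2 = T ! Suc 0" "R3 = T ! Suc (Suc 0)" by (simp_all add: R2_def R3_def numeral_2_eq_2)
    then show ?thesis using column_strict_nth[OF cs l, of j] that by simp
  qed
  have R1ge: "r \<le> R1 ! j" if "j < length R1" for j
  proof -
    have "R1 ! j \<in> set R1" using that by simp
    then show ?thesis using R1 by auto
  qed
  have b1: "b1 = 0"
  proof (rule ccontr)
    assume "b1 \<noteq> 0"
    then have "R2 ! 0 = r" "0 < length R2" using R2 by (auto simp: nth_append)
    then show False using 12[of 0] R1ge[of 0] by simp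
  qed
  have R2ge: "Suc r \<le> R2 ! j" if "j < length R2" for j
  proof -
    have "R2 ! j \<in> set R2" using that by simp
    then show ?thesis using R2 b1 by auto
  qed
  have c12: "c1 + c2 = 0"
  proof (rule ccontr)
    assume "c1 + c2 \<noteq> 0"
    then have "R3 ! 0 \<le> Suc r" "0 < length R3" using R3 by (auto simp: nth_append)
    then show False using 23[of 0] R2ge[of 0] by simp
  qed
  have "c3 \<le> b2"
  proof (rule ccontr)
    assume n: "\<not> c3 \<le> b2"
    then have "R3 ! b2 = Suc (Suc r)" "b2 < length R3" using R3 c12 by auto
    then have "b2 < length R2" "R2 ! b2 < Suc (Suc r)" using 23[of b2] by auto
    then show False using R2 b1 by (auto simp: nth_append)
  qed
  moreover have "b2 \<le> a1"
  proof (rule ccontr)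
    assume n: "\<not> b2 \<le> a1"
    then have "R2 ! a1 = Suc r" "a1 < length R2" using R2 b1 by (auto simp: nth_append)
    then have "a1 < length R1" "R1 ! a1 < Suc r" using 12[of a1] by auto
    then show False using R1 by (auto simp: nth_append split: if_splits)
  qed
  moreover have "b2 + b3 \<le> a1 + a2"
  proof (rule ccontr)
    assume n: "\<not> b2 + b3 \<le> a1 + a2"
    then have l: "a1 + a2 < length R2" using R2 b1 by auto
    then have "R2 ! (a1 + a2) \<in> set R2" by simp
    then have "R2 ! (a1 + a2) \<le> Suc (Suc r)" using R2 by auto
    then have "a1 + a2 < length R1" "R1 ! (a1 + a2) < Suc (Suc r)" using 12[OF l] by auto
    then show False using R1 by (auto simp: nth_append split: if_splits)
  qed
  moreover have "tab_word T = tri_word r c3 b2 b3 a1 a2 a3"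
    unfolding w R1 R2 R3 tri_word_def using b1 c12 by simp
  ultimately show ?thesis using that by blast
qed

lemma s_op_braid_tri:
  assumes "c3 \<le> b2" "b2 \<le> a1" "b2 + b3 \<le> a1 + a2" "w = tri_word r c3 b2 b3 a1 a2 a3"
  shows "s_op r (s_op (Suc r) (s_op r w)) = s_op (Suc r) (s_op r (s_op (Suc r) w))"
proof -
  define m1 where "m1 = min b3 (a1 - b2)"
  define D1 where "D1 = b3 - m1 + a3"
  define U1 where "U1 = b2 - c3 + (b3 - m1)"
  define B1 where "B1 = c3 + min D1 U1"
  define A1 where "A1 = m1 + (D1 - U1)"
  define m2 where "m2 = min b3 a2"
  define D2 where "D2 = b3 - m2 + a3"
  define U2 where "U2 = b2 - c3 + (b3 - m2)"
  define B2 where "B2 = c3 + min D2 U2"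
  define A2 where "A2 = m2 + (D2 - U2)"
  define m3 where "m3 = min (b2 + b3 - B2) (a1 - B2)"
  define D3 where "D3 = b2 + b3 - B2 - m3 + (a2 + a3 - A2)"
  define U3 where "U3 = B2 - c3 + (b2 + b3 - B2 - m3)"
  define B3 where "B3 = c3 + min D3 U3"
  define A3 where "A3 = m3 + (D3 - U3)"
  have m: "m1 \<le> b3" "m1 \<le> a1 - b2" "m2 \<le> b3" "m2 \<le> a2" by (simp_all add: m1_def m2_def)
  have B2le: "B2 \<le> b2 + b3" unfolding B2_def U2_def using assms(1) by linarith
  have A2le: "A2 \<le> a2 + a3" unfolding A2_def D2_def U2_def using m by linarith
  have c2: "c3 \<le> B2" by (simp add: B2_def)
  have B2a: "B2 \<le> a1"
  proof -
    have "min D2 U2 \<le> b2 - c3 + (b3 - m2)" by (simp add: U2_def)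
    show ?thesis
    proof (cases "b3 \<le> a2")
      case True
      then have "U2 = b2 - c3" by (simp add: U2_def m2_def)
      then show ?thesis unfolding B2_def using assms by linarith
    next
      case False
      then have "U2 = b2 - c3 + (b3 - a2)" by (simp add: U2_def m2_def)
      then show ?thesis unfolding B2_def using assms by linarith
    qed
  qed
  have m3: "m3 \<le> b2 + b3 - B2" by (simp add: m3_def)
  have N: "int B1 = int B3 \<and> int B1 + int A1 = int B2 + int A2 \<and> int b2 + int a2 - int B1 = int A3 \<and>
    int B1 \<le> int b2 + int a2 \<and> int B2 \<le> int a1"
  proof (rule braid_numeric[where c = "int c3" and q = "int b2 - int c3" and p = "int a1 - int b2" and ?b3.0 = "int b3" and ?a3.0 = "int a3"
      and ?m1.0 = "int m1" and ?m2.0 = "int m2" and ?m3.0 = "int m3" and ?D1.0 = "int D1" and ?D2.0 = "int D2" and ?D3.0 = "int D3"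
      and ?U1.0 = "int U1" and ?U2.0 = "int U2" and ?U3.0 = "int U3"])
    show "int m1 = min (int b3) (int a1 - int b2)" unfolding m1_def using assms(2) by linarith
    show "int D1 = int b3 - int m1 + int a3" unfolding D1_def using m by linarith
    show "int U1 = int b2 - int c3 + (int b3 - int m1)" unfolding U1_def using m assms(1) by linarith
    show "int B1 = int c3 + min (int D1) (int U1)" unfolding B1_def by simp
    show "int A1 = int m1 + max 0 (int D1 - int U1)" unfolding A1_def by linarith
    show "int m2 = min (int b3) (int a2)" unfolding m2_def by linarith
    show "int D2 = int b3 - int m2 + int a3" unfolding D2_def using m by linarith
    show "int U2 = int b2 - int c3 + (int b3 - int m2)" unfolding U2_def using m assms(1) by linarith
    show "int B2 = int c3 + min (int D2) (int U2)" unfolding B2_def by simp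
    show "int A2 = int m2 + max 0 (int D2 - int U2)" unfolding A2_def by linarith
    show "int m3 = min (int b2 + int b3 - int B2) (int a1 - int B2)" unfolding m3_def using B2le B2a by linarith
    show "int D3 = int b2 + int b3 - int B2 - int m3 + (int a2 + int a3 - int A2)" unfolding D3_def using B2le m3 A2le by linarith
    show "int U3 = int B2 - int c3 + (int b2 + int b3 - int B2 - int m3)" unfolding U3_def using B2le m3 c2 by linarith
    show "int B3 = int c3 + min (int D3) (int U3)" unfolding B3_def by simp
    show "int A3 = int m3 + max 0 (int D3 - int U3)" unfolding A3_def by linarith
  qed (use assms in simp_all)
  then have N: "B1 = B3" "B1 + A1 = B2 + A2" "b2 + a2 - B1 = A3" "B1 \<le> b2 + a2" by linarith+
  have A1le: "A1 \<le> a1 - b2 + a3" unfolding A1_def D1_def U1_def using m by linarith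
  have l1: "s_op r w = tri_word r c3 b2 b3 (b2 + a2) (a1 - b2) a3"
    unfolding assms(4) by (rule s_op_tri_word1[OF assms(2)])
  have l2: "s_op (Suc r) (s_op r w) = tri_word r c3 B1 (b2 + b3 - B1) (b2 + a2) A1 (a1 - b2 + a3 - A1)"
    unfolding l1 by (rule s_op_tri_word2[OF assms(1) m1_def D1_def U1_def B1_def A1_def])
  have l3: "s_op r (s_op (Suc r) (s_op r w)) = tri_word r c3 B1 (b2 + b3 - B1) (B1 + A1) (b2 + a2 - B1) (a1 - b2 + a3 - A1)"
    unfolding l2 by (rule s_op_tri_word1[OF N(4)])
  have r1: "s_op (Suc r) w = tri_word r c3 B2 (b2 + b3 - B2) a1 A2 (a2 + a3 - A2)"
    unfolding assms(4) by (rule s_op_tri_word2[OF assms(1) m2_def D2_def U2_def B2_def A2_def])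
  have r2: "s_op r (s_op (Suc r) w) = tri_word r c3 B2 (b2 + b3 - B2) (B2 + A2) (a1 - B2) (a2 + a3 - A2)"
    unfolding r1 by (rule s_op_tri_word1[OF B2a])
  have r3: "s_op (Suc r) (s_op r (s_op (Suc r) w)) =
     tri_word r c3 B3 (B2 + (b2 + b3 - B2) - B3) (B2 + A2) A3 (a1 - B2 + (a2 + a3 - A2) - A3)"
    unfolding r2 by (rule s_op_tri_word2[OF c2 m3_def D3_def U3_def B3_def A3_def])
  have "B2 + (b2 + b3 - B2) - B3 = b2 + b3 - B1" using N B2le by simp
  moreover have "a1 - B2 + (a2 + a3 - A2) - A3 = a1 - b2 + a3 - A1" using N A2le B2a A1le assms(2) by linarith
  ultimately show ?thesis unfolding l3 r3 using N by simp
qed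

lemma s_op_kmoves: "s_op r (fold kmove ks w) = fold kmove ks (s_op r w)"
  by (induction ks arbitrary: w) (auto simp: s_op_kmove)

lemma s_op_nth_outside:
  assumes "i < length w" "P r" "P (Suc r)"
  shows "(P (s_op r w ! i) \<longleftrightarrow> P (w ! i)) \<and> (\<not> P (w ! i) \<longrightarrow> s_op r w ! i = w ! i)"
  using refills_nth_outside[of "[(r, unm r w - phi r w)]" P i w] assms by (simp add: s_op_refill refills_Cons)

lemma filter_outside_eq:
  assumes "length u = length v" "\<And>i. i < length u \<Longrightarrow> P (u ! i) \<longleftrightarrow> P (v ! i)"
    "\<And>i. i < length u \<Longrightarrow> \<not> P (u ! i) \<Longrightarrow> u ! i = v ! i" "filter P u = filter P v"
  shows "u = v"
  using assms
proof (induction u v rule: list_induct2)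
  case (Cons x u y v)
  have h: "P x \<longleftrightarrow> P y" "\<not> P x \<Longrightarrow> x = y" using Cons.prems(1)[of 0] Cons.prems(2)[of 0] by simp_all
  have "u = v"
  proof (rule Cons.IH)
    show "P (u ! i) \<longleftrightarrow> P (v ! i)" if "i < length u" for i using Cons.prems(1)[of "Suc i"] that by simp
    show "u ! i = v ! i" if "i < length u" "\<not> P (u ! i)" for i using Cons.prems(2)[of "Suc i"] that by simp
    show "filter P u = filter P v" using Cons.prems(3) h by (auto split: if_splits)
  qed
  then show ?case using h Cons.prems(3) by (auto split: if_splits)
qed simp

text \<open>Only the letters \<open>r\<close>, \<open>r + 1\<close>, \<open>r + 2\<close> are
  affected, and the operators commute with moves. So their subword may be moved to a tableau word,
  where the relation is arithmetic, and moved back.\<close>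

theorem s_op_braid: "s_op r (s_op (Suc r) (s_op r w)) = s_op (Suc r) (s_op r (s_op (Suc r) w))"
proof -
  define P where "P = (\<lambda>x. x \<in> {r, Suc r, Suc (Suc r)})"
  have P: "P r" "P (Suc r)" "P (Suc (Suc r))" by (simp_all add: P_def)
  define v where "v = filter P w"
  obtain ks where ks: "tab_word (Ptab v) = fold kmove ks v"
    using knuth_kmoves[OF knuth_sym[OF tab_word_Ptab[of v]]] by blast
  have "set (tab_word (Ptab v)) = set v" using knuth_set[OF tab_word_Ptab] .
  then have "set (tab_word (Ptab v)) \<subseteq> {r, Suc r, Suc (Suc r)}" by (auto simp: v_def P_def)
  from tri_word_exists[OF Ptab_column_strict this] obtain c3 b2 b3 a1 a2 a3
    where "tab_word (Ptab v) = tri_word r c3 b2 b3 a1 a2 a3" "c3 \<le> b2" "b2 \<le> a1" "b2 + b3 \<le> a1 + a2" .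
  then have "s_op r (s_op (Suc r) (s_op r (fold kmove ks v))) = s_op (Suc r) (s_op r (s_op (Suc r) (fold kmove ks v)))"
    using s_op_braid_tri ks by metis
  then have "fold kmove ks (s_op r (s_op (Suc r) (s_op r v))) = fold kmove ks (s_op (Suc r) (s_op r (s_op (Suc r) v)))"
    by (simp only: s_op_kmoves)
  then have "s_op r (s_op (Suc r) (s_op r v)) = s_op (Suc r) (s_op r (s_op (Suc r) v))"
    by (metis fold_kmove_inverse)
  then have f: "filter P (s_op r (s_op (Suc r) (s_op r w))) = filter P (s_op (Suc r) (s_op r (s_op (Suc r) w)))"
    using P by (simp only: filter_s_op v_def)
  have o: "(P (s_op q u ! i) \<longleftrightarrow> P (u ! i)) \<and> (\<not> P (u ! i) \<longrightarrow> s_op q u ! i = u ! i)"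
    if "i < length u" "q = r \<or> q = Suc r" for q u i
    using s_op_nth_outside[OF that(1), of P q] that(2) P by auto
  show ?thesis
  proof (rule filter_outside_eq[where P = P, OF _ _ _ f])
    fix i assume i: "i < length (s_op r (s_op (Suc r) (s_op r w)))"
    then have i: "i < length w" by simp
    show "P (s_op r (s_op (Suc r) (s_op r w)) ! i) \<longleftrightarrow> P (s_op (Suc r) (s_op r (s_op (Suc r) w)) ! i)"
      using o i by (simp add: length_s_op)
    assume "\<not> P (s_op r (s_op (Suc r) (s_op r w)) ! i)"
    then show "s_op r (s_op (Suc r) (s_op r w)) ! i = s_op (Suc r) (s_op r (s_op (Suc r) w)) ! i"
      using o i by (simp add: length_s_op)
  qed simp
qed

subsection \<open>Words in the simple transpositions\<close>

text \<open>Equality in the Coxeter group of type A, as a congruence on words in the simple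
  transpositions.\<close>

inductive cox :: "nat list \<Rightarrow> nat list \<Rightarrow> bool" where
  cox_refl: "cox a a"
| cox_sym: "cox a b \<Longrightarrow> cox b a"
| cox_trans: "cox a b \<Longrightarrow> cox b c \<Longrightarrow> cox a c"
| cox_ctxt: "cox a b \<Longrightarrow> cox (u @ a @ v) (u @ b @ v)"
| cox_square: "cox [r, r] []"
| cox_far: "Suc r < q \<Longrightarrow> cox [r, q] [q, r]"
| cox_braid: "cox [r, Suc r, r] [Suc r, r, Suc r]"

lemma cox_sound:
  assumes "cox a b" "\<And>r x. f r (f r x) = x" "\<And>r q x. Suc r < q \<Longrightarrow> f r (f q x) = f q (f r x)"
    "\<And>r x. f r (f (Suc r) (f r x)) = f (Suc r) (f r (f (Suc r) x))"
  shows "foldr f a x = foldr f b x"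
  using assms(1)
proof (induction arbitrary: x rule: cox.induct)
  case (cox_far r q)
  then show ?case using assms(3)[of r q x] by simp
next
  case (cox_braid r)
  then show ?case using assms(4)[of r x] by simp
qed (simp_all add: assms(2))

lemma foldr_s_op_cox: "cox a b \<Longrightarrow> foldr s_op a w = foldr s_op b w"
  by (erule cox_sound) (auto intro: s_op_commute s_op_braid)

lemma perm_of_foldr: "perm_of rs x = foldr transp rs x"
  by (induction rs arbitrary: x) (auto simp: perm_of_def)

lemma perm_of_cox: "cox a b \<Longrightarrow> perm_of a = perm_of b"
  by (rule ext, unfold perm_of_foldr, erule cox_sound) (auto simp: transp_def)

lemma perm_of_append: "perm_of (a @ b) x = perm_of a (perm_of b x)"
  by (simp add: perm_of_foldr)

lemma transp_transp [simp]: "transp r (transp r x) = x"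
  by (simp add: transp_def)

lemma perm_of_inverse: "perm_of (rev a) (perm_of a x) = x"
  by (induction a arbitrary: x) (auto simp: perm_of_foldr)

lemma cox_app: "cox a b \<Longrightarrow> cox c d \<Longrightarrow> cox (a @ c) (b @ d)"
  using cox_ctxt[of a b "[]" c] cox_ctxt[of c d b "[]"] cox_trans by fastforce

lemma cox_commute_list:
  assumes "\<forall>q\<in>set l. Suc r < q \<or> Suc q < r"
  shows "cox (r # l) (l @ [r])"
  using assms
proof (induction l)
  case (Cons q l)
  have "cox [r, q] [q, r]" using Cons.prems by (auto intro: cox_far cox_sym[OF cox_far])
  from cox_ctxt[OF this, of "[]" l] have 1: "cox (r # q # l) ([q] @ (r # l))" by simp
  have "cox ([q] @ (r # l)) ([q] @ (l @ [r]))" by (rule cox_app[OF cox_refl]) (use Cons in auto)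
  from cox_trans[OF 1 this] show ?case by simp
qed (simp add: cox_refl)

text \<open>The tail \<open>rev [k..<n]\<close> is the coset representative that carries
  \<open>k\<close> to \<open>n\<close>. A further generator on the right is cancelled by the tail,
  prolongs it, or passes through it into the smaller group.\<close>

lemma cox_normal_form:
  assumes "set rs \<subseteq> {1..<n}" "1 \<le> n"
  shows "\<exists>rs' k. set rs' \<subseteq> {1..<n - 1} \<and> 1 \<le> k \<and> k \<le> n \<and> cox rs (rs' @ rev [k..<n])"
  using assms(1)
proof (induction rs rule: rev_induct)
  case Nil
  then show ?case using assms(2) by (intro exI[of _ "[]"] exI[of _ n]) (auto intro: cox_refl)
next
  case (snoc r rs)
  then obtain rs' k where IH: "set rs' \<subseteq> {1..<n - 1}" "1 \<le> k" "k \<le> n" "cox rs (rs' @ rev [k..<n])" by auto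
  have r: "1 \<le> r" "r < n" using snoc.prems by auto
  have c: "cox (rs @ [r]) (rs' @ (rev [k..<n] @ [r]))" using cox_app[OF IH(4) cox_refl[of "[r]"]] by simp
  consider "r = k" | "Suc r = k" | "Suc r < k" | "k < r" by linarith
  then show ?case
  proof cases
    case 1
    then have "[k..<n] = k # [Suc k..<n]" using r by (simp add: upt_conv_Cons)
    then have e: "rev [k..<n] @ [r] = rev [Suc k..<n] @ [k, k]" using 1 by simp
    have "cox (rev [Suc k..<n] @ [k, k]) (rev [Suc k..<n] @ [])" by (rule cox_app[OF cox_refl cox_square])
    from cox_app[OF cox_refl[of rs'] this] have "cox (rs' @ (rev [k..<n] @ [r])) (rs' @ rev [Suc k..<n])"
      unfolding e by simp
    then have "cox (rs @ [r]) (rs' @ rev [Suc k..<n])" by (rule cox_trans[OF c])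
    then show ?thesis using IH 1 r by (intro exI[of _ rs'] exI[of _ "Suc k"]) auto
  next
    case 2
    then have "rev [k..<n] @ [r] = rev [r..<n]" using r by (simp add: upt_conv_Cons)
    then show ?thesis using c IH r by (intro exI[of _ rs'] exI[of _ r]) auto
  next
    case 3
    have "cox (r # rev [k..<n]) (rev [k..<n] @ [r])" by (rule cox_commute_list) (use 3 in auto)
    from cox_trans[OF c cox_app[OF cox_refl[of rs'] cox_sym[OF this]]]
    have "cox (rs @ [r]) ((rs' @ [r]) @ rev [k..<n])" by simp
    moreover have "set (rs' @ [r]) \<subseteq> {1..<n - 1}" using IH r 3 by auto
    ultimately show ?thesis using IH by blast
  next
    \<comment> \<open>The generator meets its own copy inside the tail: a braid relation lets it
      through, and it emerges on the left as \<open>r - 1\<close>.\<close>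
    case 4
    then obtain q where q: "r = Suc q" "k \<le> q" by (cases r) auto
    define A where "A = rev [Suc r..<n]"
    define B where "B = rev [k..<q]"
    have "[k..<n] = [k..<q] @ [q..<n]" using upt_add_eq_append[OF q(2), of "n - q"] q r by simp
    also have "[q..<n] = [q, r] @ [Suc r..<n]" using q r by (simp add: upt_conv_Cons)
    finally have "[k..<n] = [k..<q] @ [q, r] @ [Suc r..<n]" .
    then have e: "rev [k..<n] = A @ [Suc q, q] @ B" unfolding A_def B_def using q by simp
    have B: "cox (B @ [Suc q]) (Suc q # B)" by (rule cox_sym[OF cox_commute_list]) (auto simp: B_def)
    have A: "cox (A @ [q]) (q # A)" by (rule cox_sym[OF cox_commute_list]) (use q in \<open>auto simp: A_def\<close>)
    have 1: "cox (A @ [Suc q, q] @ (B @ [Suc q])) (A @ [Suc q, q] @ (Suc q # B))"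
      by (intro cox_app cox_refl B)
    have 2: "cox (A @ [Suc q, q, Suc q] @ B) (A @ [q, Suc q, q] @ B)"
      by (rule cox_ctxt[OF cox_sym[OF cox_braid]])
    have 3: "cox ((A @ [q]) @ ([Suc q, q] @ B)) ((q # A) @ ([Suc q, q] @ B))"
      by (rule cox_app[OF A cox_refl])
    have "cox (A @ [Suc q, q] @ (B @ [Suc q])) (q # A @ [Suc q, q] @ B)"
      using cox_trans[OF 1[simplified] cox_trans[OF 2[simplified] 3[simplified]]] by simp
    then have "cox (rev [k..<n] @ [r]) ([q] @ rev [k..<n])" unfolding e using q by simp
    from cox_trans[OF c cox_app[OF cox_refl[of rs'] this]]
    have "cox (rs @ [r]) ((rs' @ [q]) @ rev [k..<n])" by simp
    moreover have "set (rs' @ [q]) \<subseteq> {1..<n - 1}" using IH r q by auto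
    ultimately show ?thesis using IH by blast
  qed
qed

lemma perm_of_fix: "\<forall>r\<in>set rs. x \<noteq> r \<and> x \<noteq> Suc r \<Longrightarrow> perm_of rs x = x"
  by (induction rs) (auto simp: perm_of_foldr transp_def)

lemma perm_of_rev_upt: "k \<le> n \<Longrightarrow> perm_of (rev [k..<n]) k = n"
proof (induction n)
  case (Suc n)
  show ?case
  proof (cases "k = Suc n")
    case False
    then have "k \<le> n" using Suc.prems by simp
    then show ?thesis using Suc.IH by (simp add: perm_of_foldr transp_def)
  qed (simp add: perm_of_foldr)
qed (simp add: perm_of_foldr)

lemma perm_of_rev_upt_greater: "k < x \<Longrightarrow> x \<le> n \<Longrightarrow> perm_of (rev [k..<n]) x = x - 1"
proof (induction n)
  case (Suc n)
  show ?case
  proof (cases "x = Suc n")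
    case True
    then have "perm_of (rev [k..<n]) x = x" by (intro perm_of_fix) auto
    then show ?thesis using True Suc.prems by (simp add: perm_of_foldr transp_def)
  next
    case False
    then have "x \<le> n" using Suc.prems by simp
    then show ?thesis using Suc by (auto simp: perm_of_foldr transp_def)
  qed
qed simp

text \<open>In the normal form, \<open>k\<close> is the preimage of the largest point and therefore
  determined by the permutation. After cancelling the common tail the induction hypothesis
  applies.\<close>

lemma cox_complete:
  assumes "set rs \<subseteq> {1..<n}" "set ss \<subseteq> {1..<n}" "perm_of rs = perm_of ss"
  shows "cox rs ss"
  using assms
proof (induction n arbitrary: rs ss)
  case 0
  then show ?case by (auto intro: cox_refl)
next
  case (Suc m)
  obtain rs' k where r: "set rs' \<subseteq> {1..<Suc m - 1}" "1 \<le> k" "k \<le> Suc m" "cox rs (rs' @ rev [k..<Suc m])"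
    using cox_normal_form[OF Suc.prems(1)] by auto
  obtain ss' j where s: "set ss' \<subseteq> {1..<Suc m - 1}" "1 \<le> j" "j \<le> Suc m" "cox ss (ss' @ rev [j..<Suc m])"
    using cox_normal_form[OF Suc.prems(2)] by auto
  have p: "perm_of (rs' @ rev [k..<Suc m]) = perm_of (ss' @ rev [j..<Suc m])"
    using perm_of_cox[OF r(4)] perm_of_cox[OF s(4)] Suc.prems(3) by simp
  have 1: "perm_of (rs' @ rev [k..<Suc m]) k = Suc m"
    unfolding perm_of_append perm_of_rev_upt[OF r(3)] by (rule perm_of_fix) (use r(1) in auto)
  have 2: "perm_of (ss' @ rev [j..<Suc m]) j = Suc m"
    unfolding perm_of_append perm_of_rev_upt[OF s(3)] by (rule perm_of_fix) (use s(1) in auto)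
  have kj: "k = j" using 1 2 p perm_of_inverse by metis
  have "perm_of rs' x = perm_of ss' x" for x
  proof -
    have "perm_of (rev [k..<Suc m]) (perm_of (rev (rev [k..<Suc m])) x) = x"
      using perm_of_inverse[of "rev (rev [k..<Suc m])" x] by simp
    then show ?thesis using fun_cong[OF p, of "perm_of (rev (rev [k..<Suc m])) x"] kj unfolding perm_of_append by simp
  qed
  then have "cox rs' ss'" using Suc.IH r(1) s(1) by auto
  then have "cox (rs' @ rev [k..<Suc m]) (ss' @ rev [j..<Suc m])" unfolding kj by (rule cox_app[OF _ cox_refl])
  then show ?case using r(4) s(4) cox_trans cox_sym by blast
qed

text \<open>The definite description demands one value for all generator words of the permutation.
  Completeness of the relations makes these values agree, and the given word shows that the demand
  is not vacuous.\<close>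

theorem act_foldr:
  assumes "set rs \<subseteq> {1..<n}" "perm_of rs = \<sigma>"
  shows "act n \<sigma> w = foldr s_op rs w"
  unfolding act_def
proof (rule the_equality)
  show "\<forall>ss. set ss \<subseteq> {1..<n} \<and> perm_of ss = \<sigma> \<longrightarrow> foldr s_op ss w = foldr s_op rs w"
  proof (intro allI impI)
    fix ss assume "set ss \<subseteq> {1..<n} \<and> perm_of ss = \<sigma>"
    then have "cox ss rs" using assms by (intro cox_complete[of ss n rs]) simp_all
    then show "foldr s_op ss w = foldr s_op rs w" by (rule foldr_s_op_cox)
  qed
  fix v assume "\<forall>ss. set ss \<subseteq> {1..<n} \<and> perm_of ss = \<sigma> \<longrightarrow> foldr s_op ss w = v"
  then have "set rs \<subseteq> {1..<n} \<and> perm_of rs = \<sigma> \<longrightarrow> foldr s_op rs w = v" ..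
  then show "v = foldr s_op rs w" using assms by simp
qed

lemma dual_foldr_s_op: "dual w (foldr s_op rs w)"
proof (induction rs)
  case (Cons r rs)
  from dual_trans[OF Cons dual_s_op] show ?case by simp
qed simp

lemma length_foldr_s_op [simp]: "length (foldr s_op rs w) = length w"
  by (induction rs) auto

lemma foldr_s_op_inj: "foldr s_op rs u = foldr s_op rs v \<Longrightarrow> u = v"
proof (induction rs)
  case (Cons r rs)
  then have "s_op r (s_op r (foldr s_op rs u)) = s_op r (s_op r (foldr s_op rs v))" by simp
  then show ?case using Cons.IH by simp
qed simp

lemma count_foldr_s_op: "count_list (foldr s_op rs w) (perm_of rs x) = count_list w x"
  by (induction rs) (auto simp: perm_of_foldr count_s_op)

lemma s_op_single: "s_op r [x] = [transp r x]"
  by (auto simp: s_op_refill transp_def)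

lemma foldr_s_op_single: "foldr s_op rs [x] = [perm_of rs x]"
  by (induction rs) (auto simp: perm_of_foldr s_op_single)

lemma filter_foldr_s_op:
  "\<forall>r\<in>set rs. P r \<and> P (Suc r) \<Longrightarrow> filter P (foldr s_op rs w) = foldr s_op rs (filter P w)"
  by (induction rs) (auto simp: filter_s_op)

lemma foldr_s_op_nth_outside:
  assumes "\<forall>r\<in>set rs. P r \<and> P (Suc r)" "i < length w"
  shows "(P (foldr s_op rs w ! i) \<longleftrightarrow> P (w ! i)) \<and> (\<not> P (w ! i) \<longrightarrow> foldr s_op rs w ! i = w ! i)"
  using assms(1)
proof (induction rs)
  case (Cons r rs)
  then show ?case using s_op_nth_outside[of i "foldr s_op rs w" P r] assms(2) by auto
qed simp

lemma s_op_shift: "s_op (r + s) (map (\<lambda>x. x + s) w) = map (\<lambda>x. x + s) (s_op r w)"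
  by (simp add: s_op_refill refill_shift)

lemma foldr_s_op_shift:
  "foldr s_op (map (\<lambda>r. r + s) rs) (map (\<lambda>x. x + s) w) = map (\<lambda>x. x + s) (foldr s_op rs w)"
  by (induction rs) (simp_all add: s_op_shift del: map_map)

section \<open>Rectangles\<close>

definition rect_tab :: "nat \<Rightarrow> nat \<Rightarrow> nat \<Rightarrow> tableau" where
  "rect_tab s h m = map (\<lambda>j. replicate m (s + j)) [1..<Suc h]"

lemma length_rect_tab [simp]: "length (rect_tab s h m) = h"
  by (simp add: rect_tab_def)

lemma nth_rect_tab: "i < h \<Longrightarrow> rect_tab s h m ! i = replicate m (s + Suc i)"
  by (simp add: rect_tab_def del: upt_Suc)

lemma shape_rect_tab: "shape (rect_tab s h m) = replicate h m"
  by (simp add: rect_tab_def shape_def o_def map_replicate_const)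

lemma rect_tab_column_strict: "0 < m \<Longrightarrow> column_strict (rect_tab s h m)"
  unfolding column_strict_def by (auto simp: nth_rect_tab)

lemma rect_tab_Suc: "rect_tab s (Suc h) m = rect_tab s h m @ [replicate m (s + Suc h)]"
  by (simp add: rect_tab_def)

lemma rect_word_Suc: "tab_word (rect_tab s (Suc h) m) = replicate m (s + Suc h) @ tab_word (rect_tab s h m)"
  by (simp add: rect_tab_Suc tab_word_append tab_word_Cons)

lemma rect_word_0: "tab_word (rect_tab s 0 m) = []"
  by (simp add: rect_tab_def)

lemma set_rect_word: "set (tab_word (rect_tab s h m)) \<subseteq> {s + 1..s + h}"
  by (induction h) (auto simp: rect_word_Suc rect_word_0)

lemma count_rect_word: "count_list (tab_word (rect_tab s h m)) x = (if x \<in> {s + 1..s + h} then m else 0)"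
proof (induction h)
  case (Suc h)
  have "count_list (replicate m y) x = (if x = y then m else 0)" for y by (induction m) auto
  then show ?case using Suc by (auto simp: rect_word_Suc)
qed (simp add: rect_word_0)

lemma phi_unm_no_Suc: "Suc r \<notin> set w \<Longrightarrow> phi r w = count_list w r \<and> unm r w = count_list w r"
  by (induction w) auto

text \<open>Consecutive rows have equal length, so each \<open>r + 1\<close> has its partner
  \<open>r\<close> in the row above. This is why the operators inside a block fix every word in the
  class of its rectangle.\<close>

lemma rect_word_unm:
  assumes "s + 1 \<le> r" "r < s + h"
  shows "unm r (tab_word (rect_tab s h m)) = 0"
  using assms
proof (induction h)
  case (Suc h)
  let ?w = "tab_word (rect_tab s h m)"
  show ?case
  proof (cases "r = s + h")
    case True
    have "Suc r \<notin> set ?w" using set_rect_word[of s h m] True by auto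
    then have "phi r ?w = m" "unm r ?w = m" using phi_unm_no_Suc count_rect_word[of s h m r] Suc.prems True by auto
    then show ?thesis using True by (simp add: rect_word_Suc)
  next
    case False
    then have "unm r ?w = 0" using Suc by simp
    then show ?thesis using False Suc.prems by (simp add: rect_word_Suc)
  qed
qed simp

lemma unm_knuth: "u \<sim>\<^sub>K v \<Longrightarrow> unm r u = unm r v \<and> phi r u = phi r v"
proof -
  have "unm r (fold kmove ks w) = unm r w \<and> phi r (fold kmove ks w) = phi r w" for ks w
    by (induction ks arbitrary: w) auto
  then show "u \<sim>\<^sub>K v \<Longrightarrow> unm r u = unm r v \<and> phi r u = phi r v" using knuth_kmoves by metis
qed

lemma rect_tab_superstd: "rect_tab 0 h m = superstd (replicate h m)"
  by (rule nth_equalityI) (auto simp: nth_rect_tab superstd_def)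

lemma rect_word_alt: "tab_word (rect_tab 0 h m) = concat (map (\<lambda>i. replicate m (h - i)) [0..<h])"
proof -
  have "rev [1..<Suc h] = map (\<lambda>i. h - i) [0..<h]"
    by (rule nth_equalityI) (auto simp: rev_nth simp del: upt_Suc)
  then show ?thesis by (simp add: tab_word_def rect_tab_def rev_map o_def del: upt_Suc)
qed

lemma revcomp_rect_word: "revcomp h (tab_word (rect_tab 0 h m)) = tab_word (rect_tab 0 h m)"
  unfolding rect_tab_superstd revcomp_superstd
  unfolding rect_tab_superstd[symmetric] rect_word_alt
  by (simp only: length_replicate, intro arg_cong[where f = concat] map_cong) simp_all

lemma shift_rect_word: "map (\<lambda>x. x + t) (tab_word (rect_tab s h m)) = tab_word (rect_tab (s + t) h m)"
  by (induction h) (auto simp: rect_word_Suc rect_word_0)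

lemma nth_in_tab_word: "i < length T \<Longrightarrow> j < length (T ! i) \<Longrightarrow> T ! i ! j \<in> set (tab_word T)"
  unfolding set_tab_word by (rule UnionI[of "set (T ! i)"]) simp_all

lemma column_strict_entry_ge:
  assumes "column_strict T" "\<forall>x\<in>set (tab_word T). 1 \<le> x" "i < length T" "j < length (T ! i)"
  shows "Suc i \<le> T ! i ! j"
  using assms(3,4)
proof (induction i)
  case 0
  then have "T ! 0 ! j \<in> set (tab_word T)" by (rule nth_in_tab_word)
  then show ?case using assms(2) by auto
next
  case (Suc i)
  then show ?case using column_strict_nth[OF assms(1) Suc.prems] by fastforce
qed

lemma column_strict_length_le:
  assumes "column_strict T" "set (tab_word T) \<subseteq> {1..N}"
  shows "length T \<le> N"
proof (cases "T = []")
  case False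
  define i where "i = length T - 1"
  have i: "i < length T" using False by (simp add: i_def)
  have all: "\<forall>x\<in>set (tab_word T). 1 \<le> x" using assms(2) by auto
  have ne: "T ! i \<noteq> []" using i column_strict_nonempty[OF assms(1)] by simp
  then have ge: "Suc i \<le> T ! i ! 0" using column_strict_entry_ge[OF assms(1) all i, of 0] by simp
  have "T ! i ! 0 \<in> set (tab_word T)" using i ne by (intro nth_in_tab_word) simp_all
  then show ?thesis using assms(2) ge i by (auto simp: i_def)
qed simp

text \<open>In a column of full height \<open>h\<close> the entries are squeezed: counting from the
  top gives a lower bound and counting from the bottom the same upper bound.\<close>

lemma rect_tab_unique:
  assumes "column_strict T" "set (tab_word T) \<subseteq> {1..h}" "shape T = replicate h m"
  shows "T = rect_tab 0 h m"
proof -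
  have lT: "length T = h" using arg_cong[OF assms(3), of length] by simp
  have lr: "length (T ! i) = m" if "i < h" for i
    using arg_cong[OF assms(3), of "\<lambda>l. l ! i"] that lT by (simp add: shape_def)
  have up: "T ! i ! j + (h - Suc i) \<le> h" if "i < h" "j < m" for i j
    using that
  proof (induction "h - Suc i" arbitrary: i)
    case 0
    have "T ! i ! j \<in> set (T ! i)" "T ! i \<in> set T" using 0 lT lr by auto
    then have "T ! i ! j \<in> set (tab_word T)" unfolding set_tab_word by blast
    then show ?case using 0 assms(2) by auto
  next
    case (Suc k)
    then have "Suc i < h" by simp
    then have "T ! i ! j < T ! Suc i ! j" using column_strict_nth(2)[OF assms(1), of i j] lT lr Suc by simp
    moreover have "T ! Suc i ! j + (h - Suc (Suc i)) \<le> h" using Suc \<open>Suc i < h\<close> by (intro Suc.hyps) auto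
    ultimately show ?case using \<open>Suc i < h\<close> by simp
  qed
  show ?thesis
  proof (rule nth_equalityI)
    fix i assume "i < length T"
    then have i: "i < h" using lT by simp
    show "T ! i = rect_tab 0 h m ! i"
    proof (rule nth_equalityI)
      fix j assume "j < length (T ! i)"
      then have j: "j < m" using lr i by simp
      have all: "\<forall>x\<in>set (tab_word T). 1 \<le> x" using assms(2) by auto
      have "Suc i \<le> T ! i ! j" using column_strict_entry_ge[OF assms(1) all, of i j] i j lT lr by simp
      then show "T ! i ! j = rect_tab 0 h m ! i ! j" using up[OF i j] i j by (simp add: nth_rect_tab)
    qed (use i lr in \<open>simp add: nth_rect_tab\<close>)
  qed (simp add: lT)
qed

subsection \<open>Cutting a tableau along a column\<close>

lemma column_strict_snoc:
  "column_strict (T @ [r]) \<longleftrightarrow> column_strict T \<and> r \<noteq> [] \<and> sorted r \<and> (T = [] \<or> dom_row (last T) r)"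
proof (induction T)
  case (Cons t T)
  then show ?case by (cases T) (auto simp: column_strict_Cons)
qed (simp add: column_strict_Cons)

lemma Ptab_row: "sorted r \<Longrightarrow> r \<noteq> [] \<Longrightarrow> Ptab r = [r]"
  by (simp add: Ptab_fold fold_tab_ins_run)

text \<open>Both words insert to the tableau with rows \<open>t @ d\<close> and
  \<open>l\<close>.\<close>

lemma cut_swap:
  assumes "sorted (l @ d)" "sorted t" "length t = length l" "t \<noteq> []" "\<forall>j<length l. t ! j < l ! j"
  shows "l @ d @ t \<sim>\<^sub>K l @ t @ d"
proof -
  have td: "sorted (t @ d)"
  proof -
    have "x \<le> y" if xy: "x \<in> set t" "y \<in> set d" for x y
    proof -
      obtain j where j: "j < length t" "x = t ! j" using xy(1) by (auto simp: in_set_conv_nth)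
      then have "x < l ! j" "l ! j \<in> set l" using assms by auto
      moreover have "l ! j \<le> y" using assms(1) xy(2) calculation(2) by (simp add: sorted_append)
      ultimately show ?thesis by simp
    qed
    then show ?thesis using assms(1,2) by (simp add: sorted_append)
  qed
  have l: "sorted l" "l \<noteq> []" using assms by (auto simp: sorted_append)
  have "Ptab (l @ t @ d) = fold tab_ins (t @ d) [l]" using Ptab_append[of l "t @ d"] Ptab_row[OF l] by simp
  also have "\<dots> = (t @ d) # [l]"
    by (rule fold_tab_ins_run) (use l td assms in \<open>auto simp: column_strict_Cons dom_row_def nth_append\<close>)
  finally have 1: "Ptab (l @ t @ d) = [t @ d, l]" .
  have ld: "Ptab (l @ d) = [l @ d]" using assms(1) l by (intro Ptab_row) auto
  have "ins_row (l @ d) t = (t @ drop (length t) (l @ d), take (length t) (l @ d))"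
    by (rule ins_row_run) (use assms in \<open>auto simp: nth_append\<close>)
  then have "ins_row (l @ d) t = (t @ d, l)" using assms(3) by simp
  then have "Ptab ((l @ d) @ t) = (t @ d) # fold tab_ins l []"
    unfolding Ptab_append[of "l @ d"] ld by (simp add: fold_tab_ins_Cons)
  also have "fold tab_ins l [] = [l]" using l by (simp add: fold_tab_ins_run)
  finally have "Ptab (l @ d @ t) = [t @ d, l]" by simp
  then show ?thesis using 1 knuth_iff_Ptab by simp
qed

lemma cut_move:
  assumes "column_strict (T @ [l @ d])" "l \<noteq> []" "d \<noteq> []" "length l = c"
  shows "l @ d @ tab_word (map (take c) T) \<sim>\<^sub>K l @ tab_word (map (take c) T) @ d"
  using assms
proof (induction T arbitrary: l rule: rev_induct)
  case (snoc t T)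
  have cs: "column_strict (T @ [t])" "sorted (l @ d)" "dom_row t (l @ d)"
    using snoc.prems(1) column_strict_snoc[of "T @ [t]" "l @ d"] by auto
  have st: "sorted t" using cs(1) column_strict_snoc by auto
  have lt: "length (l @ d) \<le> length t" using cs(3) by (simp add: dom_row_def)
  define t' where "t' = take c t"
  have t': "sorted t'" "length t' = c" "t' \<noteq> []" using st lt snoc.prems(2,4) by (auto simp: t'_def sorted_wrt_take)
  have tl: "\<forall>j<length l. t' ! j < l ! j"
  proof (intro allI impI)
    fix j assume j: "j < length l"
    then have "t ! j < (l @ d) ! j" using cs(3) by (simp add: dom_row_def)
    then show "t' ! j < l ! j" using j snoc.prems(4) by (simp add: t'_def nth_append)
  qed
  have 1: "l @ d @ t' \<sim>\<^sub>K l @ t' @ d" by (rule cut_swap[OF cs(2) t'(1) _ t'(3) tl]) (use t' snoc.prems in simp)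
  have "sorted (t' @ d)"
  proof -
    have "x \<le> y" if xy: "x \<in> set t'" "y \<in> set d" for x y
    proof -
      obtain j where j: "j < length t'" "x = t' ! j" using xy(1) by (auto simp: in_set_conv_nth)
      then have "x < l ! j" "l ! j \<in> set l" using tl t' snoc.prems(4) by auto
      moreover have "l ! j \<le> y" using cs(2) xy(2) calculation(2) by (simp add: sorted_append)
      ultimately show ?thesis by simp
    qed
    then show ?thesis using t'(1) cs(2) by (simp add: sorted_append)
  qed
  moreover have "T = [] \<or> dom_row (last T) (t' @ d)"
  proof (cases "T = []")
    case False
    then have d: "dom_row (last T) t" using cs(1) column_strict_snoc by auto
    have "last T ! j < (t' @ d) ! j" if "j < length (t' @ d)" for j
    proof -
      have jt: "j < length t" using that lt t'(2) snoc.prems(4) by simp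
      then have a: "last T ! j < t ! j" using d by (simp add: dom_row_def)
      show ?thesis
      proof (cases "j < c")
        case True
        then show ?thesis using a t'(2) by (simp add: nth_append t'_def)
      next
        case False
        have "t ! j < (l @ d) ! j" using cs(3) that t'(2) snoc.prems(4) by (simp add: dom_row_def)
        then show ?thesis using a False t'(2) snoc.prems(4) by (simp add: nth_append)
      qed
    qed
    then show ?thesis using d lt t'(2) snoc.prems(4) by (auto simp: dom_row_def)
  qed simp
  ultimately have "column_strict (T @ [t' @ d])"
    using cs(1) column_strict_snoc[of T t] column_strict_snoc[of T "t' @ d"] t'(3) by auto
  then have IH: "t' @ d @ tab_word (map (take c) T) \<sim>\<^sub>K t' @ tab_word (map (take c) T) @ d"
    by (rule snoc.IH[OF _ t'(3) snoc.prems(3) t'(2)])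
  have w: "tab_word (map (take c) (T @ [t])) = t' @ tab_word (map (take c) T)"
    by (simp add: tab_word_append tab_word_Cons t'_def)
  have "(l @ d @ t') @ tab_word (map (take c) T) \<sim>\<^sub>K (l @ t' @ d) @ tab_word (map (take c) T)"
    by (rule knuth_app[OF 1 knuth_refl])
  moreover have "l @ (t' @ d @ tab_word (map (take c) T)) \<sim>\<^sub>K l @ (t' @ tab_word (map (take c) T) @ d)"
    by (rule knuth_app[OF knuth_refl IH])
  ultimately show ?case unfolding w using knuth_trans by fastforce
qed simp

text \<open>The right part of the lowest row is moved past the left parts of the rows above, one row
  at a time; the left part standing in front is what makes each exchange a Knuth
  equivalence.\<close>

lemma tab_word_cut:
  assumes "column_strict T" "0 < c"
  shows "tab_word T \<sim>\<^sub>K tab_word (map (take c) T) @ tab_word (map (drop c) T)"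
  using assms(1)
proof (induction T rule: rev_induct)
  case (snoc r T)
  define l where "l = take c r"
  define d where "d = drop c r"
  have r: "r = l @ d" by (simp add: l_def d_def)
  have IH: "tab_word T \<sim>\<^sub>K tab_word (map (take c) T) @ tab_word (map (drop c) T)"
    using snoc column_strict_snoc by auto
  have "l @ d @ tab_word (map (take c) T) \<sim>\<^sub>K l @ tab_word (map (take c) T) @ d"
  proof (cases "d = []")
    case False
    then have "length l = c" by (auto simp: l_def d_def)
    then show ?thesis using cut_move[of T l d c] snoc.prems r False assms(2) by auto
  qed simp
  then have 1: "(l @ d @ tab_word (map (take c) T)) @ tab_word (map (drop c) T) \<sim>\<^sub>K
     (l @ tab_word (map (take c) T) @ d) @ tab_word (map (drop c) T)" by (rule knuth_app[OF _ knuth_refl])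
  have 2: "(l @ d) @ tab_word T \<sim>\<^sub>K (l @ d) @ (tab_word (map (take c) T) @ tab_word (map (drop c) T))"
    by (rule knuth_app[OF knuth_refl IH])
  have "tab_word (T @ [r]) = (l @ d) @ tab_word T" by (simp add: tab_word_append tab_word_Cons r)
  moreover have "tab_word (map (take c) (T @ [r])) @ tab_word (map (drop c) (T @ [r])) =
    (l @ tab_word (map (take c) T) @ d) @ tab_word (map (drop c) T)"
    by (simp add: tab_word_append tab_word_Cons l_def d_def)
  ultimately show ?case using 1 2 knuth_trans by fastforce
qed simp

text \<open>Stopping at the first row without small entries loses nothing for a column-strict
  tableau, since the rows below have none either; it also avoids empty rows.\<close>

fun restrict_tab :: "nat \<Rightarrow> tableau \<Rightarrow> tableau" where
  "restrict_tab k [] = []"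
| "restrict_tab k (r # T) = (let r' = filter (\<lambda>x. x \<le> k) r in if r' = [] then [] else r' # restrict_tab k T)"

lemma column_strict_greater:
  assumes "column_strict (r # T)" "filter (\<lambda>x. x \<le> k) r = []" "s \<in> set T"
  shows "filter (\<lambda>x. x \<le> k) s = []"
  using assms
proof (induction T arbitrary: r)
  case (Cons t T)
  have t: "filter (\<lambda>x. x \<le> k) t = []"
  proof -
    have "k < t ! j" if "j < length t" for j
    proof -
      have "r ! j < t ! j" "j < length r" using Cons.prems(1) that by (auto simp: column_strict_Cons dom_row_def)
      moreover have "\<not> r ! j \<le> k" using Cons.prems(2) calculation(2) by (auto simp: filter_empty_conv)
      ultimately show ?thesis by simp
    qed
    then have "\<forall>x\<in>set t. k < x" by (metis in_set_conv_nth)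
    then show ?thesis by (simp add: filter_empty_conv not_le)
  qed
  then show ?case using Cons by (auto simp: column_strict_Cons)
qed simp

lemma restrict_tab_word: "column_strict T \<Longrightarrow> tab_word (restrict_tab k T) = filter (\<lambda>x. x \<le> k) (tab_word T)"
proof (induction T)
  case (Cons r T)
  show ?case
  proof (cases "filter (\<lambda>x. x \<le> k) r = []")
    case True
    have "filter (\<lambda>x. x \<le> k) s = []" if "s \<in> set T" for s using column_strict_greater[OF Cons.prems True that] .
    then have "filter (\<lambda>x. x \<le> k) (tab_word T) = []" by (auto simp: filter_empty_conv set_tab_word)
    then show ?thesis using True by (simp add: tab_word_Cons Let_def)
  next
    case False
    then show ?thesis using Cons by (simp add: tab_word_Cons Let_def column_strict_Cons)
  qed
qed simp

lemma sorted_filter_take: "sorted r \<Longrightarrow> filter (\<lambda>x. x \<le> k) r = take (length (filter (\<lambda>x. x \<le> k) r)) r"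
proof (induction r)
  case (Cons a r)
  show ?case
  proof (cases "a \<le> k")
    case False
    then have "filter (\<lambda>x. x \<le> k) r = []" using Cons.prems by (auto simp: filter_empty_conv)
    then show ?thesis using False by simp
  qed (use Cons in auto)
qed simp

lemma dom_row_filter:
  assumes "dom_row r s" "sorted r" "sorted s"
  shows "dom_row (filter (\<lambda>x. x \<le> k) r) (filter (\<lambda>x. x \<le> k) s)"
proof -
  define a where "a = length (filter (\<lambda>x. x \<le> k) r)"
  define b where "b = length (filter (\<lambda>x. x \<le> k) s)"
  have r: "filter (\<lambda>x. x \<le> k) r = take a r" and s: "filter (\<lambda>x. x \<le> k) s = take b s"
    using sorted_filter_take assms by (simp_all add: a_def b_def)
  have bs: "b \<le> length s" by (simp add: b_def)
  have "b \<le> a"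
  proof (rule ccontr)
    assume n: "\<not> b \<le> a"
    then have "s ! a \<in> set (take b s)" using bs by (auto simp: in_set_conv_nth intro!: exI[of _ a])
    then have "s ! a \<le> k" unfolding s[symmetric] by simp
    then have "r ! a \<le> k" "a < length r" using assms(1) n bs by (auto simp: dom_row_def dest!: spec[of _ a])
    moreover have "r ! a \<in> set (drop a r)" using calculation(2) by (auto simp: in_set_conv_nth intro!: exI[of _ 0])
    moreover have "filter (\<lambda>x. x \<le> k) (drop a r) = []"
    proof -
      have "filter (\<lambda>x. x \<le> k) r = filter (\<lambda>x. x \<le> k) (take a r) @ filter (\<lambda>x. x \<le> k) (drop a r)"
        by (metis append_take_drop_id filter_append)
      moreover have "filter (\<lambda>x. x \<le> k) (take a r) = take a r" unfolding r[symmetric] by simp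
      ultimately show ?thesis using r by simp
    qed
    ultimately show False by (auto simp: filter_empty_conv)
  qed
  then show ?thesis unfolding r s using assms(1) bs by (auto simp: dom_row_def)
qed

lemma restrict_tab_column_strict: "column_strict T \<Longrightarrow> column_strict (restrict_tab k T)"
proof (induction T)
  case (Cons r T)
  have IH: "column_strict (restrict_tab k T)" using Cons by (simp add: column_strict_Cons)
  have sr: "sorted (filter (\<lambda>x. x \<le> k) r)" using Cons.prems by (simp add: column_strict_Cons sorted_wrt_filter)
  have "restrict_tab k T = [] \<or> dom_row (filter (\<lambda>x. x \<le> k) r) (hd (restrict_tab k T))"
  proof (cases T)
    case (Cons s U)
    have "dom_row r s" "sorted r" "sorted s" using Cons.prems Cons \<open>column_strict (r # T)\<close> by (auto simp: column_strict_Cons)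
    from dom_row_filter[OF this] show ?thesis by (simp add: Cons Let_def)
  qed simp
  then show ?case using IH sr by (simp add: column_strict_Cons Let_def)
qed simp

lemma restrict_tab_nth:
  assumes "column_strict T"
  shows "length (restrict_tab k T) \<le> length T"
    "i < length (restrict_tab k T) \<Longrightarrow> restrict_tab k T ! i = filter (\<lambda>x. x \<le> k) (T ! i)"
    "length (restrict_tab k T) \<le> i \<Longrightarrow> i < length T \<Longrightarrow> filter (\<lambda>x. x \<le> k) (T ! i) = []"
proof -
  show "length (restrict_tab k T) \<le> length T" by (induction T) (auto simp: Let_def)
  show "i < length (restrict_tab k T) \<Longrightarrow> restrict_tab k T ! i = filter (\<lambda>x. x \<le> k) (T ! i)"
    by (induction T arbitrary: i) (auto simp: Let_def nth_Cons split: nat.splits if_splits)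
  show "length (restrict_tab k T) \<le> i \<Longrightarrow> i < length T \<Longrightarrow> filter (\<lambda>x. x \<le> k) (T ! i) = []"
    using assms
  proof (induction T arbitrary: i)
    case (Cons r T)
    show ?case
    proof (cases "filter (\<lambda>x. x \<le> k) r = []")
      case True
      then show ?thesis using Cons.prems column_strict_greater[OF Cons.prems(3) True] by (cases i) auto
    next
      case False
      then show ?thesis using Cons by (cases i) (auto simp: column_strict_Cons Let_def)
    qed
  qed simp
qed

lemma column_strict_drop: "column_strict T \<Longrightarrow> column_strict (drop k T)"
proof (induction k arbitrary: T)
  case (Suc k)
  then show ?case by (cases T) (auto simp: column_strict_Cons)
qed simp

lemma dom_row_take: "dom_row r s \<Longrightarrow> dom_row (take c r) (take c s)"
  by (auto simp: dom_row_def)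

lemma dom_row_drop: "dom_row r s \<Longrightarrow> dom_row (drop c r) (drop c s)"
  by (auto simp: dom_row_def)

lemma column_strict_take: "0 < c \<Longrightarrow> column_strict T \<Longrightarrow> column_strict (map (take c) T)"
proof (induction T)
  case (Cons r T)
  then show ?case by (cases T) (auto simp: column_strict_Cons sorted_wrt_take dom_row_take)
qed simp

lemma column_strict_drop_cols:
  "column_strict T \<Longrightarrow> column_strict (filter (\<lambda>r. r \<noteq> []) (map (drop c) T))"
proof (induction T)
  case (Cons r T)
  have IH: "column_strict (filter (\<lambda>r. r \<noteq> []) (map (drop c) T))" using Cons by (simp add: column_strict_Cons)
  show ?case
  proof (cases "drop c r = []")
    case False
    have "filter (\<lambda>r. r \<noteq> []) (map (drop c) T) = [] \<or> dom_row (drop c r) (hd (filter (\<lambda>r. r \<noteq> []) (map (drop c) T)))"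
    proof (cases T)
      case T: (Cons s U)
      show ?thesis
      proof (cases "drop c s = []")
        case True
        have "length t \<le> c" if "t \<in> set T" for t
        proof -
          have "column_strict (s # U)" using Cons.prems T by (simp add: column_strict_Cons)
          then have "length t \<le> length s" using column_strict_hd_longest[of s U t] that T by auto
          then show ?thesis using True by simp
        qed
        then have "filter (\<lambda>r. r \<noteq> []) (map (drop c) T) = []" by (auto simp: filter_empty_conv)
        then show ?thesis ..
      next
        case False
        then show ?thesis using Cons.prems T by (auto simp: column_strict_Cons intro: dom_row_drop)
      qed
    qed simp
    then show ?thesis using IH False Cons.prems by (simp add: column_strict_Cons sorted_wrt_drop)
  qed (use IH in simp)
qed simp

lemma column_strict_map:
  assumes "column_strict T" "strict_mono_on (set (tab_word T)) f"
  shows "column_strict (map (map f) T)"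
  using assms
proof (induction T)
  case (Cons r T)
  have st: "set (tab_word T) \<subseteq> set (tab_word (r # T))" "set r \<subseteq> set (tab_word (r # T))" by (auto simp: tab_word_Cons)
  have mono: "x < y \<Longrightarrow> x \<in> set (tab_word (r # T)) \<Longrightarrow> y \<in> set (tab_word (r # T)) \<Longrightarrow> f x < f y" for x y
    using Cons.prems(2) by (auto simp: strict_mono_on_def)
  have "strict_mono_on (set (tab_word T)) f" using st(1) mono by (auto simp: strict_mono_on_def)
  then have IH: "column_strict (map (map f) T)" using Cons by (simp add: column_strict_Cons)
  have "sorted (map f r)"
  proof -
    have "sorted r" using Cons.prems by (simp add: column_strict_Cons)
    then show ?thesis unfolding sorted_map
    proof (rule sorted_wrt_mono_rel[rotated])
      fix x y assume xy: "x \<in> set r" "y \<in> set r" "x \<le> y"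
      show "f x \<le> f y"
      proof (cases "x = y")
        case False
        then have "f x < f y" using mono[of x y] xy st(2) by auto
        then show ?thesis by simp
      qed simp
    qed
  qed
  moreover have "T = [] \<or> dom_row (map f r) (hd (map (map f) T))"
  proof (cases T)
    case T: (Cons s U)
    then have d: "dom_row r s" using Cons.prems by (simp add: column_strict_Cons)
    have "f (r ! j) < f (s ! j)" if "j < length s" for j
    proof (rule mono)
      show "r ! j < s ! j" using d that by (simp add: dom_row_def)
      show "r ! j \<in> set (tab_word (r # T))" using d that st(2) by (force simp: dom_row_def)
      show "s ! j \<in> set (tab_word (r # T))" using that T by (auto simp: tab_word_Cons)
    qed
    then show ?thesis using d T by (auto simp: dom_row_def)
  qed simp
  ultimately show ?case using IH Cons.prems by (auto simp: column_strict_Cons)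
qed simp

lemma tab_word_map: "tab_word (map (map f) T) = map f (tab_word T)"
  by (simp add: tab_word_def map_concat rev_map)

lemma tab_word_nonempty: "tab_word (filter (\<lambda>r. r \<noteq> []) T) = tab_word T"
  by (induction T) (auto simp: tab_word_Cons)

lemma filter_nonempty_eq:
  "shape A = shape B \<Longrightarrow> filter (\<lambda>r. r \<noteq> []) A = filter (\<lambda>r. r \<noteq> []) B \<Longrightarrow> A = B"
proof (induction A arbitrary: B)
  case (Cons a A)
  obtain b C where B: "B = b # C" using Cons.prems(1) by (cases B) auto
  have l: "length a = length b" "shape A = shape C" using Cons.prems(1) B by auto
  then have "a = [] \<longleftrightarrow> b = []" by auto
  then show ?case using Cons B l by (auto split: if_splits)
qed (auto simp: shape_def)

section \<open>Tableaux for two rectangles and their shapes\<close>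

definition nth0 :: "nat list \<Rightarrow> nat \<Rightarrow> nat" where
  "nth0 l i = (if i < length l then l ! i else 0)"

lemma nth0_simps [simp]: "nth0 [] j = 0" "nth0 (a # l) 0 = a" "nth0 (a # l) (Suc j) = nth0 l j"
  by (simp_all add: nth0_def)

lemma diff_strict_mono_on: "\<forall>x\<in>S. (h::nat) < x \<Longrightarrow> strict_mono_on S (\<lambda>x. x - h)"
  unfolding strict_mono_on_def by (meson diff_less_mono less_imp_le)

lemma count_superstd: "count_list (tab_word (superstd l)) (Suc j) = nth0 l j"
proof -
  have c: "count_list (replicate m y) x = (if x = y then m else 0)" for m and x y :: nat
    by (induction m) auto
  have "count_list (tab_word (map (\<lambda>i. replicate (f i) (Suc i)) [0..<n])) (Suc j) = (if j < n then f j else 0)" for f n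
    by (induction n) (auto simp: tab_word_append tab_word_Cons c less_Suc_eq)
  then show ?thesis by (simp add: superstd_def nth0_def)
qed

lemma nth0_truncate:
  assumes "sorted_wrt (\<ge>) l"
  shows "nth0 (filter (\<lambda>x. x \<noteq> 0) (map (\<lambda>x. x - c) l)) j = nth0 l j - c"
  using assms
proof (induction l arbitrary: j)
  case (Cons a l)
  show ?case
  proof (cases "a - c = 0")
    case True
    then have "filter (\<lambda>x. x \<noteq> 0) (map (\<lambda>x. x - c) (a # l)) = []"
      using Cons.prems by (auto simp: filter_empty_conv)
    moreover have "nth0 (a # l) j \<le> c"
      using True Cons.prems by (auto simp: nth0_def nth_Cons split: nat.splits intro: order_trans[of _ a])
    ultimately show ?thesis by (simp add: nth0_def)
  next
    case False
    then have e: "filter (\<lambda>x. x \<noteq> 0) (map (\<lambda>x. x - c) (a # l)) = (a - c) # filter (\<lambda>x. x \<noteq> 0) (map (\<lambda>x. x - c) l)"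
      by simp
    have "sorted_wrt (\<ge>) l" using Cons.prems by simp
    then show ?thesis unfolding e using Cons.IH[of "j - 1"] by (cases j) simp_all
  qed
qed (simp add: nth0_def)

lemma nth0_add_cell: "i \<le> length l \<Longrightarrow> nth0 (add_cell i l) j = nth0 l j + (if j = i then 1 else 0)"
  by (auto simp: nth0_def length_add_cell add_cell_nth)

definition two_rect :: "nat \<Rightarrow> nat \<Rightarrow> nat \<Rightarrow> nat \<Rightarrow> word \<Rightarrow> bool" where
  "two_rect h1 m1 h2 m2 w \<longleftrightarrow> set w \<subseteq> {1..h1 + h2} \<and>
     filter (\<lambda>x. x \<le> h1) w \<sim>\<^sub>K tab_word (rect_tab 0 h1 m1) \<and>
     filter (\<lambda>x. h1 < x) w \<sim>\<^sub>K tab_word (rect_tab h1 h2 m2)"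

lemma two_rect_knuth: "u \<sim>\<^sub>K v \<Longrightarrow> two_rect h1 m1 h2 m2 u \<longleftrightarrow> two_rect h1 m1 h2 m2 v"
proof -
  have *: "two_rect h1 m1 h2 m2 v" if "u \<sim>\<^sub>K v" "two_rect h1 m1 h2 m2 u" for u v
  proof -
    have "filter (\<lambda>x. x \<le> h1) v \<sim>\<^sub>K filter (\<lambda>x. x \<le> h1) u" "filter (\<lambda>x. h1 < x) v \<sim>\<^sub>K filter (\<lambda>x. h1 < x) u"
      by (rule knuth_filter[OF knuth_sym[OF that(1)]]; simp)+
    then show ?thesis using that(2) knuth_set[OF that(1)] knuth_trans unfolding two_rect_def by blast
  qed
  then show "u \<sim>\<^sub>K v \<Longrightarrow> two_rect h1 m1 h2 m2 u \<longleftrightarrow> two_rect h1 m1 h2 m2 v" using knuth_sym by blast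
qed

lemma unshift_rect_word: "map (\<lambda>x. x - t) (tab_word (rect_tab t h m)) = tab_word (rect_tab 0 h m)"
  using shift_rect_word[of t 0 h m, symmetric] by (simp add: o_def)

lemma unm_zero_suffix: "unm r (u @ v) = 0 \<Longrightarrow> unm r v = phi r v"
  by (rule unm_phi_suffix[of r u]) simp

text \<open>The tableau splits into the first rectangle in its upper left corner, the part
  \<open>lft\<close> below this corner and the part \<open>rgt\<close> in the columns beyond
  \<open>m1\<close>; the last two carry exactly the letters of the second rectangle.\<close>

locale two_rect_tab =
  fixes h1 m1 h2 m2 :: nat and T :: tableau
  assumes m1: "0 < m1" and m2: "0 < m2" and cs: "column_strict T"
    and tr: "two_rect h1 m1 h2 m2 (tab_word T)"
begin

abbreviation "lft \<equiv> map (take m1) (drop h1 T)"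
abbreviation "rgt \<equiv> filter (\<lambda>r. r \<noteq> []) (map (drop m1) T)"
abbreviation "dn \<equiv> map (\<lambda>x. x - h1)"

lemma restrict_eq: "restrict_tab h1 T = rect_tab 0 h1 m1"
proof -
  have "tab_word (restrict_tab h1 T) \<sim>\<^sub>K tab_word (rect_tab 0 h1 m1)"
    using tr unfolding two_rect_def restrict_tab_word[OF cs] by blast
  then have "Ptab (tab_word (restrict_tab h1 T)) = Ptab (tab_word (rect_tab 0 h1 m1))" by (rule Ptab_knuth)
  then show ?thesis using Ptab_tab_word restrict_tab_column_strict[OF cs] rect_tab_column_strict[OF m1] by simp
qed

lemma length_ge: "h1 \<le> length T"
  using restrict_tab_nth(1)[OF cs, of h1] by (simp add: restrict_eq)

lemma upper_row:
  assumes "i < h1"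
  shows "take m1 (T ! i) = replicate m1 (Suc i)" "\<forall>x\<in>set (drop m1 (T ! i)). h1 < x" "m1 \<le> length (T ! i)"
proof -
  have f: "filter (\<lambda>x. x \<le> h1) (T ! i) = replicate m1 (Suc i)"
    using restrict_tab_nth(2)[OF cs, of i h1] assms by (simp add: restrict_eq nth_rect_tab)
  have s: "sorted (T ! i)" using cs assms length_ge column_strict_sorted by auto
  have l: "length (filter (\<lambda>x. x \<le> h1) (T ! i)) = m1" unfolding f by simp
  show t: "take m1 (T ! i) = replicate m1 (Suc i)" using sorted_filter_take[OF s, of h1] f l by metis
  show "m1 \<le> length (T ! i)" using l length_filter_le[of "\<lambda>x. x \<le> h1" "T ! i"] by simp
  have "filter (\<lambda>x. x \<le> h1) (take m1 (T ! i)) @ filter (\<lambda>x. x \<le> h1) (drop m1 (T ! i)) = filter (\<lambda>x. x \<le> h1) (T ! i)"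
    by (metis append_take_drop_id filter_append)
  moreover have "filter (\<lambda>x. x \<le> h1) (take m1 (T ! i)) = replicate m1 (Suc i)" unfolding t using assms by simp
  ultimately have "filter (\<lambda>x. x \<le> h1) (drop m1 (T ! i)) = []" using f by simp
  then show "\<forall>x\<in>set (drop m1 (T ! i)). h1 < x" by (auto simp: filter_empty_conv)
qed

lemma lower_row: "h1 \<le> i \<Longrightarrow> i < length T \<Longrightarrow> \<forall>x\<in>set (T ! i). h1 < x"
  using restrict_tab_nth(3)[OF cs, of h1 i] by (auto simp: restrict_eq filter_empty_conv)

lemma rgt_letters: "\<forall>x\<in>set (tab_word (map (drop m1) T)). h1 < x"
proof
  fix x assume "x \<in> set (tab_word (map (drop m1) T))"
  then obtain r where r: "r \<in> set T" "x \<in> set (drop m1 r)" by (auto simp: set_tab_word)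
  then obtain i where i: "i < length T" "r = T ! i" by (metis in_set_conv_nth)
  show "h1 < x"
  proof (cases "i < h1")
    case True
    then show ?thesis using upper_row(2) r i by blast
  next
    case False
    then have "h1 \<le> i" by simp
    then show ?thesis using lower_row[of i] r i by (meson in_set_dropD)
  qed
qed

lemma lft_letters: "\<forall>x\<in>set (tab_word lft). h1 < x"
proof
  fix x assume "x \<in> set (tab_word lft)"
  then obtain r where r: "r \<in> set (drop h1 T)" "x \<in> set (take m1 r)" by (auto simp: set_tab_word)
  then obtain i where i: "i < length (drop h1 T)" "r = drop h1 T ! i" by (metis in_set_conv_nth)
  then have ii: "h1 + i < length T" "r = T ! (h1 + i)" using length_ge by auto
  have "x \<in> set (T ! (h1 + i))" using r(2) ii(2) in_set_takeD by metis
  then show "h1 < x" using lower_row[of "h1 + i"] ii(1) by auto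
qed

text \<open>Cut along column \<open>m1\<close>. In the cut word the letters of the first rectangle
  form only the corner, and discarding them is discarding an interval of letters, which respects
  Knuth classes.\<close>

lemma filter_word: "filter (\<lambda>x. h1 < x) (tab_word T) \<sim>\<^sub>K tab_word lft @ tab_word rgt"
proof -
  have "tab_word T \<sim>\<^sub>K tab_word (map (take m1) T) @ tab_word (map (drop m1) T)" by (rule tab_word_cut[OF cs m1])
  then have 1: "filter (\<lambda>x. h1 < x) (tab_word T) \<sim>\<^sub>K
      filter (\<lambda>x. h1 < x) (tab_word (map (take m1) T) @ tab_word (map (drop m1) T))"
    by (rule knuth_filter) simp
  have "map (take m1) T = map (take m1) (take h1 T) @ lft" by (metis append_take_drop_id map_append)
  then have 2: "tab_word (map (take m1) T) = tab_word lft @ tab_word (map (take m1) (take h1 T))"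
    by (simp add: tab_word_append)
  have "\<forall>x\<in>set (tab_word (map (take m1) (take h1 T))). \<not> h1 < x"
  proof
    fix x assume "x \<in> set (tab_word (map (take m1) (take h1 T)))"
    then obtain r where r: "r \<in> set (take h1 T)" "x \<in> set (take m1 r)" by (auto simp: set_tab_word)
    then obtain i where i: "i < length (take h1 T)" "r = take h1 T ! i" by (metis in_set_conv_nth)
    then have "i < h1" "r = T ! i" by auto
    then show "\<not> h1 < x" using upper_row(1)[of i] r(2) by auto
  qed
  then have 3: "filter (\<lambda>x. h1 < x) (tab_word (map (take m1) (take h1 T))) = []" by (simp add: filter_empty_conv)
  have 4: "filter (\<lambda>x. h1 < x) (tab_word lft) = tab_word lft" using lft_letters by (simp add: filter_id_conv)
  have 5: "filter (\<lambda>x. h1 < x) (tab_word (map (drop m1) T)) = tab_word (map (drop m1) T)"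
    using rgt_letters by (simp add: filter_id_conv)
  show ?thesis using 1 unfolding filter_append 2 3 4 5 by (simp add: tab_word_nonempty)
qed

lemma parts_word: "dn (tab_word lft) @ dn (tab_word rgt) \<sim>\<^sub>K tab_word (rect_tab 0 h2 m2)"
proof -
  have k: "tab_word lft @ tab_word rgt \<sim>\<^sub>K tab_word (rect_tab h1 h2 m2)"
    using knuth_trans[OF knuth_sym[OF filter_word]] tr unfolding two_rect_def by blast
  have "\<forall>x\<in>set (tab_word lft @ tab_word rgt). h1 < x" using lft_letters rgt_letters by (auto simp: tab_word_nonempty)
  then have "strict_mono_on (set (tab_word lft @ tab_word rgt)) (\<lambda>x. x - h1)"
    by (rule diff_strict_mono_on)
  from knuth_map[OF k this] have "dn (tab_word lft @ tab_word rgt) \<sim>\<^sub>K dn (tab_word (rect_tab h1 h2 m2))" .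
  moreover have "dn (tab_word (rect_tab h1 h2 m2)) = tab_word (rect_tab 0 h2 m2)"
    by (rule unshift_rect_word)
  ultimately show ?thesis by (simp only: map_append)
qed

lemma parts_set: "set (dn (tab_word lft)) \<subseteq> {1..h2}" "set (dn (tab_word rgt)) \<subseteq> {1..h2}"
  using knuth_set[OF parts_word] set_rect_word[of 0 h2 m2] by auto

lemma lft_cs: "column_strict (map dn lft)"
proof (rule column_strict_map[OF column_strict_take[OF m1 column_strict_drop[OF cs]]])
  show "strict_mono_on (set (tab_word lft)) (\<lambda>x. x - h1)" using lft_letters by (rule diff_strict_mono_on)
qed

lemma rgt_cs: "column_strict (map dn rgt)"
proof (rule column_strict_map[OF column_strict_drop_cols[OF cs]])
  show "strict_mono_on (set (tab_word rgt)) (\<lambda>x. x - h1)"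
    using rgt_letters unfolding tab_word_nonempty by (rule diff_strict_mono_on)
qed

text \<open>Its word is a suffix of a word in the class of a rectangle, where every letter is
  matched; a suffix of such a word has no unmatched \<open>r + 1\<close>.\<close>

lemma rgt_superstd: "map dn rgt = superstd (shape rgt)"
proof -
  have "yamanouchi h2 (dn (tab_word rgt))"
    unfolding yamanouchi_def
  proof
    fix r assume "r \<in> {1..<h2}"
    then have "unm r (tab_word (rect_tab 0 h2 m2)) = 0" by (intro rect_word_unm) auto
    then have "unm r (dn (tab_word lft) @ dn (tab_word rgt)) = 0" using conjunct1[OF unm_knuth[OF parts_word]] by (rule trans[rotated])
    then show "unm r (dn (tab_word rgt)) = phi r (dn (tab_word rgt))"
      by (rule unm_zero_suffix)
  qed
  then have "map dn rgt = superstd (shape (map dn rgt))"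
    using yamanouchi_superstd[OF rgt_cs, of h2] parts_set(2) by (simp only: tab_word_map)
  then show ?thesis by (simp add: shape_def o_def)
qed

text \<open>The mirror image of the argument for the right part: reverse complement fixes the
  rectangle word and turns the prefix into a suffix. So the left part is of lowest weight.\<close>

lemma lft_revcomp: "revcomp h2 (dn (tab_word lft)) \<sim>\<^sub>K tab_word (superstd (shape lft))"
proof -
  let ?a = "dn (tab_word lft)" and ?b = "dn (tab_word rgt)"
  have "set (?a @ ?b) \<subseteq> {1..h2}" using parts_set by simp
  from revcomp_knuth[OF parts_word this] have k: "revcomp h2 ?b @ revcomp h2 ?a \<sim>\<^sub>K tab_word (rect_tab 0 h2 m2)"
    by (simp only: revcomp_append revcomp_rect_word)
  have y: "yamanouchi h2 (revcomp h2 ?a)"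
    unfolding yamanouchi_def
  proof
    fix r assume "r \<in> {1..<h2}"
    then have "unm r (tab_word (rect_tab 0 h2 m2)) = 0" by (intro rect_word_unm) auto
    then have "unm r (revcomp h2 ?b @ revcomp h2 ?a) = 0" using conjunct1[OF unm_knuth[OF k]] by (rule trans[rotated])
    then show "unm r (revcomp h2 ?a) = phi r (revcomp h2 ?a)"
      by (rule unm_zero_suffix)
  qed
  have "yamanouchi h2 (tab_word (Ptab (revcomp h2 ?a)))" using y yamanouchi_knuth[OF tab_word_Ptab] by blast
  moreover have "set (tab_word (Ptab (revcomp h2 ?a))) \<subseteq> {1..h2}"
    using knuth_set[OF tab_word_Ptab] revcomp_set[OF parts_set(1)] by blast
  ultimately have "Ptab (revcomp h2 ?a) = superstd (shape (Ptab (revcomp h2 ?a)))"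
    by (intro yamanouchi_superstd[OF Ptab_column_strict])
  also have "shape (Ptab (revcomp h2 ?a)) = shape (Ptab ?a)" by (rule shape_revcomp[OF parts_set(1)])
  also have "Ptab ?a = map dn lft" using Ptab_tab_word[OF lft_cs] by (simp only: tab_word_map)
  also have "shape (map dn lft) = shape lft" by (simp add: shape_def o_def)
  finally show ?thesis using knuth_sym[OF tab_word_Ptab[of "revcomp h2 ?a"]] by simp
qed

lemma lft_determined: "map dn lft = Ptab (revcomp h2 (tab_word (superstd (shape lft))))"
proof -
  have "set (revcomp h2 (dn (tab_word lft))) \<subseteq> {1..h2}" by (rule revcomp_set[OF parts_set(1)])
  from Ptab_knuth[OF revcomp_knuth[OF lft_revcomp this]]
  have "Ptab (dn (tab_word lft)) = Ptab (revcomp h2 (tab_word (superstd (shape lft))))"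
    by (simp only: revcomp_revcomp[OF parts_set(1)])
  then show ?thesis using Ptab_tab_word[OF lft_cs] by (simp only: tab_word_map)
qed

lemma shape_rgt: "shape rgt = filter (\<lambda>x. x \<noteq> 0) (map (\<lambda>x. x - m1) (shape T))"
proof -
  have "shape (filter (\<lambda>r. r \<noteq> []) (map (drop m1) U)) = filter (\<lambda>x. x \<noteq> 0) (map (\<lambda>x. x - m1) (shape U))" for U
    by (induction U) auto
  then show ?thesis .
qed

lemma shape_lft: "shape lft = map (min m1) (drop h1 (shape T))"
  by (simp add: shape_def drop_map min.commute)

lemma nth0_rgt: "nth0 (shape rgt) j = nth0 (shape T) j - m1"
  unfolding shape_rgt by (rule nth0_truncate[OF shape_sorted[OF cs]])

lemma nth0_lft: "nth0 (shape lft) j = min m1 (nth0 (shape T) (h1 + j))"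
  unfolding shape_lft by (auto simp: nth0_def)

lemma length_parts: "length rgt \<le> h2" "length lft \<le> h2"
proof -
  have "length (map dn rgt) \<le> h2" "length (map dn lft) \<le> h2"
    using column_strict_length_le[OF rgt_cs] column_strict_length_le[OF lft_cs] parts_set by (simp_all only: tab_word_map)
  then show "length rgt \<le> h2" "length lft \<le> h2" by simp_all
qed

text \<open>Counts the letter \<open>h1 + j + 1\<close>, which occurs \<open>m2\<close> times. The
  right part, being superstandard, has it throughout its row \<open>j\<close>; the left part, being
  of lowest weight, has it as often as row \<open>h1 + h2 - j - 1\<close> of \<open>T\<close> has
  cells in the first \<open>m1\<close> columns.\<close>

lemma shape_equation:
  assumes "j < h2"
  shows "nth0 (shape T) j - m1 + min m1 (nth0 (shape T) (h1 + h2 - Suc j)) = m2"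
proof -
  let ?a = "dn (tab_word lft)" and ?b = "dn (tab_word rgt)"
  have "count_list (?a @ ?b) (Suc j) = m2" using knuth_count[OF parts_word, of "Suc j"] count_rect_word[of 0 h2 m2 "Suc j"] assms
    by simp
  moreover have "count_list ?b (Suc j) = nth0 (shape T) j - m1"
    using rgt_superstd count_superstd[of "shape rgt" j] nth0_rgt[of j] by (metis tab_word_map)
  moreover have "count_list ?a (Suc j) = min m1 (nth0 (shape T) (h1 + h2 - Suc j))"
  proof -
    have "count_list ?a (Suc j) = count_list (revcomp h2 ?a) (Suc h2 - Suc j)"
      by (rule count_revcomp[OF parts_set(1), symmetric]) (use assms in auto)
    also have "\<dots> = count_list (tab_word (superstd (shape lft))) (Suc h2 - Suc j)" by (rule knuth_count[OF lft_revcomp])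
    also have "Suc h2 - Suc j = Suc (h2 - Suc j)" using assms by simp
    finally show ?thesis using nth0_lft[of "h2 - Suc j"] assms by (simp add: count_superstd)
  qed
  ultimately show ?thesis by simp
qed

lemma shape_bounds:
  shows "j < h1 \<Longrightarrow> m1 \<le> nth0 (shape T) j" "h2 \<le> j \<Longrightarrow> nth0 (shape T) j \<le> m1"
    "h1 + h2 \<le> j \<Longrightarrow> nth0 (shape T) j = 0"
proof -
  show "j < h1 \<Longrightarrow> m1 \<le> nth0 (shape T) j" using upper_row(3)[of j] length_ge by (simp add: nth0_def shape_def)
  show "h2 \<le> j \<Longrightarrow> nth0 (shape T) j \<le> m1" using nth0_rgt[of j] length_parts(1) by (simp add: nth0_def shape_def)
  show "h1 + h2 \<le> j \<Longrightarrow> nth0 (shape T) j = 0" using length_parts(2) by (auto simp: nth0_def)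
qed

end

text \<open>The corner is fixed, and the other two parts are extreme tableaux of their shapes, which
  the shape of the whole determines.\<close>

lemma two_rect_tab_unique:
  assumes "two_rect_tab h1 m1 h2 m2 T" "two_rect_tab h1 m1 h2 m2 U" "shape T = shape U"
  shows "T = U"
proof -
  interpret T: two_rect_tab h1 m1 h2 m2 T by fact
  interpret U: two_rect_tab h1 m1 h2 m2 U by fact
  have inj: "A = B" if "map T.dn A = map T.dn B" "\<forall>x\<in>set (tab_word A). h1 < x" "\<forall>x\<in>set (tab_word B). h1 < x" for A B
  proof -
    have up: "map (map (\<lambda>x. x + h1)) (map T.dn A) = A" if "\<forall>x\<in>set (tab_word A). h1 < x" for A
    proof -
      have e: "map (\<lambda>x. x + h1) (T.dn r) = r" if "r \<in> set A" for r
      proof -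
        have "\<forall>x\<in>set r. h1 < x" using \<open>\<forall>x\<in>set (tab_word A). h1 < x\<close> that by (auto simp: set_tab_word)
        then show ?thesis by (induction r) auto
      qed
      show ?thesis unfolding map_map[of "map (\<lambda>x. x + h1)"] by (rule map_idI, simp only: o_apply, rule e)
    qed
    show ?thesis using up[OF that(2)] up[OF that(3)] that(1) by metis
  qed
  have l: "length T = length U" using arg_cong[OF assms(3), of length] by simp
  have li: "length (T ! i) = length (U ! i)" if "i < length T" for i
    using arg_cong[OF assms(3), of "\<lambda>l. l ! i"] that l by (simp add: shape_def)
  have lft: "T.lft = U.lft"
    by (rule inj) (use T.lft_determined U.lft_determined T.lft_letters U.lft_letters assms(3) in \<open>simp_all add: T.shape_lft U.shape_lft\<close>)
  have rg: "T.rgt = U.rgt"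
    by (rule inj) (use T.rgt_superstd U.rgt_superstd T.rgt_letters U.rgt_letters assms(3) in \<open>simp_all add: T.shape_rgt U.shape_rgt tab_word_nonempty\<close>)
  have "shape (map (drop m1) V) = map (\<lambda>x. x - m1) (shape V)" for V
    by (simp add: shape_def o_def)
  then have "shape (map (drop m1) T) = shape (map (drop m1) U)" by (simp only: assms(3))
  then have rgt: "map (drop m1) T = map (drop m1) U" using rg by (rule filter_nonempty_eq)
  show ?thesis
  proof (rule nth_equalityI[OF l])
    fix i assume i: "i < length T"
    have "take m1 (T ! i) = take m1 (U ! i)"
    proof (cases "i < h1")
      case True
      then show ?thesis using T.upper_row(1)[OF True] U.upper_row(1)[OF True] by simp
    next
      case False
      have "T.lft ! (i - h1) = U.lft ! (i - h1)" using lft by simp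
      then show ?thesis using False i l by simp
    qed
    moreover have "drop m1 (T ! i) = drop m1 (U ! i)" using arg_cong[OF rgt, of "\<lambda>A. A ! i"] i l by simp
    ultimately show "T ! i = U ! i" by (metis append_take_drop_id)
  qed
qed

text \<open>\<open>m1 \<le> nth0 l i\<close> says that the new cell lies beyond column
  \<open>m1\<close>. If both cells were on the same side, a shape equation involving row
  \<open>i\<close> would hold for \<open>T\<close> and for \<open>U\<close> although one summand
  differs by one and the other is unchanged.\<close>

lemma two_rect_shape_star:
  assumes "two_rect_tab h1 m1 h2 m2 T" "two_rect_tab h1 m1 h2 m2 U"
    "shape T = add_cell i l" "shape U = add_cell k l" "i \<le> length l" "k \<le> length l" "i \<noteq> k"
  shows "m1 \<le> nth0 l i \<longleftrightarrow> \<not> m1 \<le> nth0 l k"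
proof -
  interpret T: two_rect_tab h1 m1 h2 m2 T by fact
  interpret U: two_rect_tab h1 m1 h2 m2 U by fact
  have nT: "nth0 (shape T) j = nth0 l j + (if j = i then 1 else 0)" for j using assms(3,5) nth0_add_cell by simp
  have nU: "nth0 (shape U) j = nth0 l j + (if j = k then 1 else 0)" for j using assms(4,6) nth0_add_cell by simp
  have "\<not> (m1 \<le> nth0 l i \<and> m1 \<le> nth0 l k)"
  proof
    assume a: "m1 \<le> nth0 l i \<and> m1 \<le> nth0 l k"
    have ih: "i < h2" using T.shape_bounds(2)[of i] nT[of i] a by (cases "i < h2") auto
    define q where "q = h1 + h2 - Suc i"
    have 1: "nth0 l i + 1 - m1 + min m1 (nth0 (shape T) q) = m2" using T.shape_equation[OF ih] nT[of i] by (simp add: q_def)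
    have 2: "nth0 l i - m1 + min m1 (nth0 (shape U) q) = m2" using U.shape_equation[OF ih] nU[of i] assms(7) by (simp add: q_def)
    have "min m1 (nth0 (shape T) q) = min m1 (nth0 l q)" "min m1 (nth0 (shape U) q) = min m1 (nth0 l q)"
      using nT[of q] nU[of q] a by (auto simp: min_def)
    then show False using 1 2 conjunct1[OF a] by linarith
  qed
  moreover have "m1 \<le> nth0 l i \<or> m1 \<le> nth0 l k"
  proof (rule ccontr)
    assume a: "\<not> (m1 \<le> nth0 l i \<or> m1 \<le> nth0 l k)"
    have ih: "\<not> i < h1" using U.shape_bounds(1)[of i] nU[of i] assms(7) a by auto
    have ih2: "i < h1 + h2" using T.shape_bounds(3)[of i] nT[of i] by (cases "i < h1 + h2") auto
    \<comment> \<open>On the left side row \<open>i\<close> enters the shape equation as the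
      complement of row \<open>j\<close>; \<open>ih\<close> and \<open>ih2\<close> make
      \<open>j\<close> an admissible index.\<close>
    define j where "j = h1 + h2 - Suc i"
    have j: "j < h2" "h1 + h2 - Suc j = i" using ih ih2 by (auto simp: j_def)
    have 1: "nth0 (shape T) j - m1 + min m1 (nth0 l i + 1) = m2" using T.shape_equation[OF j(1)] j(2) nT[of i] by simp
    have 2: "nth0 (shape U) j - m1 + min m1 (nth0 l i) = m2" using U.shape_equation[OF j(1)] j(2) nU[of i] assms(7) by simp
    have "nth0 (shape T) j - m1 = nth0 l j - m1" "nth0 (shape U) j - m1 = nth0 l j - m1"
      using nT[of j] nU[of j] a by auto
    moreover have "nth0 l i < m1" using a by simp
    moreover have "min m1 (nth0 l i + 1) = nth0 l i + 1" "min m1 (nth0 l i) = nth0 l i" using a by simp_all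
    ultimately show False using 1 2 by simp
  qed
  ultimately show ?thesis by blast
qed

text \<open>Complementation exchanges the two intervals of letters, and the word of a rectangle is
  its own reverse complement up to the shift of letters.\<close>

lemma two_rect_revcomp:
  assumes "two_rect h1 m1 h2 m2 w"
  shows "two_rect h2 m2 h1 m1 (revcomp (h1 + h2) w)"
proof -
  have sw: "set w \<subseteq> {1..h1 + h2}" using assms by (simp add: two_rect_def)
  define a where "a = filter (\<lambda>x. x \<le> h1) w"
  define b where "b = filter (\<lambda>x. h1 < x) w"
  have k: "a \<sim>\<^sub>K tab_word (rect_tab 0 h1 m1)" "b \<sim>\<^sub>K tab_word (rect_tab h1 h2 m2)"
    using assms by (simp_all add: two_rect_def a_def b_def)
  have sa: "set a \<subseteq> {1..h1}" using sw by (auto simp: a_def)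
  have sb: "set b \<subseteq> {h1 + 1..h1 + h2}" using sw by (auto simp: b_def)
  have f1: "filter (\<lambda>x. x \<le> h2) (revcomp (h1 + h2) w) = revcomp h2 (map (\<lambda>x. x - h1) b)"
  proof -
    have *: "filter (\<lambda>x. x \<le> h2) (map (\<lambda>x. Suc (h1 + h2) - x) w) = map (\<lambda>x. Suc h2 - (x - h1)) b"
      using sw unfolding b_def by (induction w) auto
    show ?thesis unfolding revcomp_def rev_filter[symmetric] * by (simp add: o_def)
  qed
  have f2: "filter (\<lambda>x. h2 < x) (revcomp (h1 + h2) w) = map (\<lambda>x. x + h2) (revcomp h1 a)"
  proof -
    have *: "filter (\<lambda>x. h2 < x) (map (\<lambda>x. Suc (h1 + h2) - x) w) = map (\<lambda>x. Suc h1 - x + h2) a"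
      using sw unfolding a_def by (induction w) auto
    show ?thesis unfolding revcomp_def rev_filter[symmetric] * by (simp add: o_def rev_map)
  qed
  have "strict_mono_on (set b) (\<lambda>x. x - h1)" using sb by (fastforce simp: strict_mono_on_def)
  from knuth_map[OF k(2) this] have "map (\<lambda>x. x - h1) b \<sim>\<^sub>K tab_word (rect_tab 0 h2 m2)"
    unfolding shift_rect_word[of h1 0 h2 m2, simplified, symmetric] by (simp add: o_def)
  moreover have "set (map (\<lambda>x. x - h1) b) \<subseteq> {1..h2}" using sb by fastforce
  ultimately have "revcomp h2 (map (\<lambda>x. x - h1) b) \<sim>\<^sub>K tab_word (rect_tab 0 h2 m2)"
    using revcomp_knuth revcomp_rect_word by metis
  moreover have "map (\<lambda>x. x + h2) (revcomp h1 a) \<sim>\<^sub>K tab_word (rect_tab h2 h1 m1)"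
  proof -
    have "revcomp h1 a \<sim>\<^sub>K tab_word (rect_tab 0 h1 m1)" using revcomp_knuth[OF k(1) sa] revcomp_rect_word by metis
    from knuth_map[OF this, of "\<lambda>x. x + h2"] show ?thesis
      by (simp add: shift_rect_word strict_mono_on_def)
  qed
  ultimately show ?thesis using revcomp_set[OF sw] unfolding two_rect_def f1 f2 by (simp add: add.commute)
qed

section \<open>Switching two rectangles\<close>

lemma two_rect_tabI:
  "two_rect h1 m1 h2 m2 w \<Longrightarrow> 0 < m1 \<Longrightarrow> 0 < m2 \<Longrightarrow> two_rect_tab h1 m1 h2 m2 (Ptab w)"
  using two_rect_knuth[OF tab_word_Ptab[of w]] by unfold_locales (simp_all add: Ptab_column_strict)

lemma two_rect_unique:
  assumes "two_rect h1 m1 h2 m2 u" "two_rect h1 m1 h2 m2 v" "0 < m1" "0 < m2" "shape (Ptab u) = shape (Ptab v)"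
  shows "Ptab u = Ptab v"
  using assms two_rect_tabI two_rect_tab_unique by blast

lemma two_rect_set: "two_rect h1 m1 h2 m2 w \<Longrightarrow> set w \<subseteq> {1..h1 + h2}"
  by (simp add: two_rect_def)

lemma set_tab_word_Ptab: "set (tab_word (Ptab w)) = set w"
  by (rule knuth_set[OF tab_word_Ptab])

text \<open>The list is chosen for the two tableaux and thus works for the whole Knuth class of
  \<open>u\<close> at once.\<close>

lemma refills_Ptab:
  assumes "set u \<subseteq> {1..N}" "set v \<subseteq> {1..N}" "shape (Ptab u) = shape (Ptab v)"
  shows "\<exists>gs. fst ` set gs \<subseteq> {1..<N} \<and> (\<forall>u'. u' \<sim>\<^sub>K u \<longrightarrow> refills gs u' \<sim>\<^sub>K v)"
proof -
  obtain gs where gs: "fst ` set gs \<subseteq> {1..<N}" "refills gs (tab_word (Ptab u)) = tab_word (Ptab v)"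
    using refills_same_shape[OF Ptab_column_strict Ptab_column_strict assms(3), of N] assms(1,2)
    by (auto simp: set_tab_word_Ptab)
  have "refills gs u' \<sim>\<^sub>K v" if "u' \<sim>\<^sub>K u" for u'
  proof -
    have "u' \<sim>\<^sub>K tab_word (Ptab u)" using that knuth_sym[OF tab_word_Ptab] by (rule knuth_trans)
    from refills_knuth[OF this, of gs] have "refills gs u' \<sim>\<^sub>K tab_word (Ptab v)" by (simp add: gs(2))
    then show ?thesis using tab_word_Ptab by (rule knuth_trans)
  qed
  then show ?thesis using gs(1) by blast
qed

text \<open>A target for the switch is the reverse complement: it has the same shape and the
  rectangles in the other order, so redistributions lead from the class of \<open>u\<close> to
  it.\<close>

lemma switch_exists:
  assumes "two_rect h1 m1 h2 m2 u"
  shows "\<exists>gs. fst ` set gs \<subseteq> {1..<h1 + h2} \<and> (\<forall>u'. u' \<sim>\<^sub>K u \<longrightarrow> two_rect h2 m2 h1 m1 (refills gs u'))"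
proof -
  have s: "set u \<subseteq> {1..h1 + h2}" by (rule two_rect_set[OF assms])
  obtain gs where gs: "fst ` set gs \<subseteq> {1..<h1 + h2}"
    "\<forall>u'. u' \<sim>\<^sub>K u \<longrightarrow> refills gs u' \<sim>\<^sub>K revcomp (h1 + h2) u"
    using refills_Ptab[OF s revcomp_set[OF s] shape_revcomp[OF s, symmetric]] by blast
  have "two_rect h2 m2 h1 m1 (refills gs u')" if "u' \<sim>\<^sub>K u" for u'
    using two_rect_knuth[OF gs(2)[rule_format, OF that]] two_rect_revcomp[OF assms] by simp
  then show ?thesis using gs(1) by blast
qed

subsection \<open>The longest element on one block\<close>

text \<open>A generator word for the reversal of \<open>s + 1, ..., s + h\<close>: the last factor
  sends \<open>s + 1\<close> to the top and lowers the other letters by one, and the recursive part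
  then reverses the rest.\<close>

fun w0_list :: "nat \<Rightarrow> nat \<Rightarrow> nat list" where
  "w0_list s 0 = []"
| "w0_list s (Suc h) = w0_list s h @ rev [s + 1..<s + h + 1]"

lemma w0_list_set: "set (w0_list s h) \<subseteq> {s + 1..<s + h}"
  by (induction h) auto

lemma perm_of_w0_list:
  "perm_of (w0_list s h) x = (if x \<in> {s + 1..s + h} then s + h + (s + 1) - x else x)"
proof (induction h arbitrary: x)
  case 0
  then show ?case by (simp add: perm_of_foldr)
next
  case (Suc h)
  let ?r = "rev [s + 1..<s + h + 1]"
  consider "x = s + 1" | "s + 1 < x" "x \<le> s + h + 1" | "x < s + 1 \<or> s + h + 1 < x" by linarith
  then show ?case
  proof cases
    case 1
    then have "perm_of ?r x = s + h + 1" using perm_of_rev_upt[of "s + 1" "s + h + 1"] by simp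
    then show ?thesis using 1 unfolding w0_list.simps perm_of_append by (simp add: Suc.IH)
  next
    case 2
    then have p: "perm_of ?r x = x - 1" by (rule perm_of_rev_upt_greater)
    have "x - 1 \<in> {s + 1..s + h}" using 2 by auto
    then show ?thesis using 2 unfolding w0_list.simps perm_of_append p Suc.IH by auto
  next
    case 3
    then have "perm_of ?r x = x" by (intro perm_of_fix) auto
    then show ?thesis using 3 unfolding w0_list.simps perm_of_append by (auto simp: Suc.IH)
  qed
qed

lemma Ptab_rect: "0 < m \<Longrightarrow> w \<sim>\<^sub>K tab_word (rect_tab s h m) \<longleftrightarrow> Ptab w = rect_tab s h m"
  using knuth_iff_Ptab Ptab_tab_word[OF rect_tab_column_strict] by simp

text \<open>The letter inserted last stays in the first row, and the first row of the rectangle is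
  constant.\<close>

lemma block_last_letter:
  assumes "v @ [x] \<sim>\<^sub>K tab_word (rect_tab s h m)" "0 < m"
  shows "x = s + 1"
proof -
  have P: "Ptab (v @ [x]) = rect_tab s h m" using assms Ptab_rect by blast
  then have "tab_ins x (Ptab v) = rect_tab s h m" by (simp add: Ptab_append)
  moreover have "0 < h"
  proof (rule ccontr)
    assume "\<not> 0 < h"
    then show False using calculation by (simp add: rect_tab_def)
  qed
  ultimately have "hd (tab_ins x (Ptab v)) = replicate m (s + 1)"
    using nth_rect_tab[of 0 h s m] length_rect_tab[of s h m] by (cases "rect_tab s h m") auto
  moreover have "x \<in> set (hd (tab_ins x (Ptab v)))" unfolding hd_tab_ins by (rule row_ins_set)
  ultimately show ?thesis using assms(2) by simp
qed

lemma add_cell_rect: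
  assumes "add_cell i l = replicate h m" "i \<le> length l" "k \<le> length l"
    "length (add_cell k l) \<le> h" "nth0 l k < m"
  shows "add_cell k l = replicate h m"
proof -
  have n: "nth0 (replicate h m) j = (if j < h then m else 0)" for j by (simp add: nth0_def)
  have e: "nth0 l j + (if j = i then 1 else 0) = (if j < h then m else 0)" for j
    using nth0_add_cell[OF assms(2), of j] assms(1) n[of j] by simp
  have "k < h" using assms(3,4) by (simp add: length_add_cell split: if_splits)
  then have "k = i" using e[of k] assms(5) by (cases "k = i") auto
  then show ?thesis using assms(1) by simp
qed

text \<open>The tableau of \<open>v\<close> is the rectangle without one corner cell. The reversal
  keeps this shape and leaves \<open>m - 1\<close> letters \<open>h\<close>, so prepending
  \<open>h\<close> adds a cell within the first \<open>m\<close> columns; the letters allow at most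
  \<open>h\<close> rows, and only the missing corner fits.\<close>

lemma block_chi_0:
  assumes "v @ [x] \<sim>\<^sub>K tab_word (rect_tab 0 h m)" "0 < m"
  shows "h # foldr s_op (w0_list 0 h) v \<sim>\<^sub>K tab_word (rect_tab 0 h m)"
proof -
  have x: "x = 1" using block_last_letter[OF assms] by simp
  have sv: "set (v @ [x]) \<subseteq> {1..h}" using knuth_set[OF assms(1)] set_rect_word[of 0 h m] by simp
  then have h: "1 \<le> h" using x by auto
  define v' where "v' = foldr s_op (w0_list 0 h) v"
  have P: "Ptab (v @ [x]) = rect_tab 0 h m" using assms Ptab_rect by blast
  obtain i where i: "i \<le> length (Ptab v)" "shape (Ptab (v @ [x])) = add_cell i (shape (Ptab v))"
    using tab_ins_shape[OF Ptab_column_strict, of v x] by (auto simp: Ptab_append)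
  have shv: "shape (Ptab v') = shape (Ptab v)" unfolding v'_def using dual_shape[OF dual_foldr_s_op] by metis
  have c: "count_list (v @ [x]) y = (if y \<in> {1..h} then m else 0)" for y
    using knuth_count[OF assms(1), of y] count_rect_word[of 0 h m y] by simp
  have cv': "count_list v' (perm_of (w0_list 0 h) y) = count_list v y" for y by (simp add: v'_def count_foldr_s_op)
  have cn: "count_list v' h + 1 = m" using cv'[of 1] c[of 1] h x by (simp add: perm_of_w0_list)
  have c0: "count_list v' y + (if y = h then 1 else 0) = (if y \<in> {1..h} then m else 0)" for y
  proof (cases "y \<in> {1..h}")
    case True
    have "perm_of (w0_list 0 h) (h + 1 - y) = y" using True by (auto simp: perm_of_w0_list)
    then have "count_list v' y = count_list v (h + 1 - y)" using cv'[of "h + 1 - y"] by simp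
    moreover have "h + 1 - y \<in> {1..h}" using True by auto
    then have "count_list (v @ [x]) (h + 1 - y) = m" using c[of "h + 1 - y"] by (simp only: if_True)
    moreover have "(x = h + 1 - y) = (y = h)" using True x by auto
    ultimately show ?thesis using True by (cases "y = h") simp_all
  next
    case False
    then have "perm_of (w0_list 0 h) y = y" by (auto simp: perm_of_w0_list)
    then have "count_list v' y = count_list v y" using cv'[of y] by simp
    moreover have "count_list (v @ [x]) y = 0" using c[of y] False by (simp only: if_False)
    then have "count_list v y = 0" by simp
    moreover have "y \<noteq> h" using False h by auto
    ultimately show ?thesis using False by auto
  qed
  have sv': "set v' \<subseteq> {1..h}"
  proof
    fix y assume "y \<in> set v'"
    then have n: "count_list v' y \<noteq> 0" by (simp add: count_list_0_iff)
    show "y \<in> {1..h}"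
    proof (rule ccontr)
      assume "y \<notin> {1..h}"
      then have "count_list v' y + (if y = h then 1 else 0) = 0" using c0[of y] by (simp only: if_False)
      then show False using n by simp
    qed
  qed
  have cn': "count_list v' h \<le> m - 1" using cn by simp
  obtain k where k: "k \<le> length (Ptab v')" "shape (Ptab (h # v')) = add_cell k (shape (Ptab v'))"
    "shape (Ptab (h # v')) ! k \<le> Suc (m - 1)"
    using first_letter_col[OF sv' h cn'] by blast
  have shk: "shape (Ptab (h # v')) = add_cell k (shape (Ptab v))" using k(2) shv by simp
  have klen: "k \<le> length (shape (Ptab v))" unfolding shv[symmetric] using k(1) by simp
  have "set (h # v') \<subseteq> {1..h}" using sv' h by simp
  then have sP: "set (tab_word (Ptab (h # v'))) \<subseteq> {1..h}" unfolding set_tab_word_Ptab .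
  have lw: "length (Ptab (h # v')) \<le> h" by (rule column_strict_length_le[OF Ptab_column_strict sP])
  have kk: "nth0 (shape (Ptab v)) k < m"
  proof -
    have "k < length (shape (Ptab (h # v')))" unfolding shk using klen by (simp add: length_add_cell del: length_shape)
    then have "nth0 (shape (Ptab (h # v'))) k \<le> m" using k(3) assms(2) by (simp add: nth0_def)
    then show ?thesis unfolding shk nth0_add_cell[OF klen] by simp
  qed
  have "add_cell k (shape (Ptab v)) = replicate h m"
  proof (rule add_cell_rect[OF _ _ klen _ kk])
    show "add_cell i (shape (Ptab v)) = replicate h m" using i(2) unfolding P by (simp add: shape_rect_tab)
    show "i \<le> length (shape (Ptab v))" using i(1) by simp
    show "length (add_cell k (shape (Ptab v))) \<le> h" unfolding shk[symmetric] using lw by simp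
  qed
  then have "Ptab (h # v') = rect_tab 0 h m"
    using rect_tab_unique[OF Ptab_column_strict sP] shk by simp
  then show ?thesis using Ptab_rect[OF assms(2)] v'_def by blast
qed

lemma w0_list_shift: "w0_list s h = map (\<lambda>r. r + s) (w0_list 0 h)"
proof (induction h)
  case (Suc h)
  have *: "[s + 1..<s + h + 1] = map (\<lambda>r. r + s) [0 + 1..<0 + h + 1]"
    by (rule nth_equalityI) (auto simp del: upt_Suc)
  have "rev [s + 1..<s + h + 1] = map (\<lambda>r. r + s) (rev [0 + 1..<0 + h + 1])" unfolding * by (rule rev_map)
  then show ?case using Suc unfolding w0_list.simps map_append by simp
qed simp

lemma unshift_word: "\<forall>x\<in>set w. s < x \<Longrightarrow> map (\<lambda>x. x + s) (map (\<lambda>x. x - s) w) = (w :: word)"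
  by (induction w) auto

lemma rect_shift_iff:
  assumes "\<forall>x\<in>set w. s < x"
  shows "w \<sim>\<^sub>K tab_word (rect_tab s h m) \<longleftrightarrow> map (\<lambda>x. x - s) w \<sim>\<^sub>K tab_word (rect_tab 0 h m)"
proof
  assume "w \<sim>\<^sub>K tab_word (rect_tab s h m)"
  from knuth_map[OF this diff_strict_mono_on[OF assms]]
  show "map (\<lambda>x. x - s) w \<sim>\<^sub>K tab_word (rect_tab 0 h m)" by (simp only: unshift_rect_word)
next
  assume "map (\<lambda>x. x - s) w \<sim>\<^sub>K tab_word (rect_tab 0 h m)"
  from knuth_map[OF this, of "\<lambda>x. x + s"]
  show "w \<sim>\<^sub>K tab_word (rect_tab s h m)"
    unfolding unshift_word[OF assms] shift_rect_word by (simp add: strict_mono_on_def)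
qed

lemma block_chi:
  assumes "v @ [x] \<sim>\<^sub>K tab_word (rect_tab s h m)" "0 < m"
  shows "(s + h) # foldr s_op (w0_list s h) v \<sim>\<^sub>K tab_word (rect_tab s h m)"
proof -
  have sv: "set (v @ [x]) \<subseteq> {s + 1..s + h}" using knuth_set[OF assms(1)] set_rect_word by simp
  then have gt: "\<forall>y\<in>set (v @ [x]). s < y" by auto
  define v0 where "v0 = map (\<lambda>x. x - s) v"
  have "v0 @ [x - s] \<sim>\<^sub>K tab_word (rect_tab 0 h m)"
    using assms(1) rect_shift_iff[OF gt] by (simp add: v0_def)
  from block_chi_0[OF this assms(2)] have k: "h # foldr s_op (w0_list 0 h) v0 \<sim>\<^sub>K tab_word (rect_tab 0 h m)" .
  have v: "v = map (\<lambda>x. x + s) v0" unfolding v0_def using unshift_word[of v s] gt by simp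
  have "foldr s_op (w0_list s h) v = map (\<lambda>x. x + s) (foldr s_op (w0_list 0 h) v0)"
    unfolding v w0_list_shift[of s] by (rule foldr_s_op_shift)
  then have e: "(s + h) # foldr s_op (w0_list s h) v = map (\<lambda>x. x + s) (h # foldr s_op (w0_list 0 h) v0)" by simp
  from knuth_map[OF k, of "\<lambda>x. x + s"] show ?thesis
    unfolding e shift_rect_word by (simp add: strict_mono_on_def)
qed

lemma filter_refill_other: "\<not> P r \<Longrightarrow> \<not> P (Suc r) \<Longrightarrow> filter P (refill r p w) = filter P w"
  by (induction w arbitrary: p) auto

lemma filter_foldr_s_op_other:
  "\<forall>r\<in>set rs. \<not> P r \<and> \<not> P (Suc r) \<Longrightarrow> filter P (foldr s_op rs w) = filter P w"
  by (induction rs) (auto simp: s_op_refill filter_refill_other)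

text \<open>The cyclage of \<open>u @ [x]\<close> for two rectangles. Only the reversal of the block
  of \<open>x\<close> appears: the other block has its full rectangular subword in \<open>u\<close>,
  which its reversal fixes. The new first letter is the image of the smallest letter of the block,
  which \<open>x\<close> has to be.\<close>

definition chi2 :: "nat \<Rightarrow> nat \<Rightarrow> word \<Rightarrow> nat \<Rightarrow> word" where
  "chi2 h1 h2 u x = (if x \<le> h1 then h1 # foldr s_op (w0_list 0 h1) u
     else (h1 + h2) # foldr s_op (w0_list h1 h2) u)"

lemma set_foldr_s_op:
  assumes "set rs \<subseteq> {1..<N}" "set w \<subseteq> {1..N}"
  shows "set (foldr s_op rs w) \<subseteq> {1..N}"
  using assms(1)
proof (induction rs)
  case (Cons r rs)
  have "set (s_op r v) \<subseteq> {x. x \<in> set v \<or> x = r \<or> x = Suc r}" for v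
    unfolding s_op_refill by (rule refill_set)
  then show ?case using Cons by fastforce
qed (use assms in simp)

lemma two_rect_chi2:
  assumes "two_rect h1 m1 h2 m2 (u @ [x])" "0 < m1" "0 < m2"
  shows "two_rect h1 m1 h2 m2 (chi2 h1 h2 u x)"
    "x \<le> h1 \<Longrightarrow> x = 1" "h1 < x \<Longrightarrow> x = h1 + 1"
proof -
  have su: "set (u @ [x]) \<subseteq> {1..h1 + h2}" by (rule two_rect_set[OF assms(1)])
  note t = assms(1)[unfolded two_rect_def]
  show "x \<le> h1 \<Longrightarrow> x = 1"
    using t block_last_letter[of "filter (\<lambda>x. x \<le> h1) u" x 0 h1 m1] assms(2) by simp
  show "h1 < x \<Longrightarrow> x = h1 + 1"
    using t block_last_letter[of "filter (\<lambda>x. h1 < x) u" x h1 h2 m2] assms(3) by simp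
  show "two_rect h1 m1 h2 m2 (chi2 h1 h2 u x)"
  proof (cases "x \<le> h1")
    case True
    then have h1: "1 \<le> h1" using su by auto
    have r: "set (w0_list 0 h1) \<subseteq> {1..<h1}" using w0_list_set[of 0 h1] by simp
    have s: "set (foldr s_op (w0_list 0 h1) u) \<subseteq> {1..h1 + h2}"
      by (rule set_foldr_s_op) (use r su in auto)
    have a: "filter (\<lambda>x. x \<le> h1) (foldr s_op (w0_list 0 h1) u) = foldr s_op (w0_list 0 h1) (filter (\<lambda>x. x \<le> h1) u)"
      by (rule filter_foldr_s_op) (use r in auto)
    have b: "filter (\<lambda>x. h1 < x) (foldr s_op (w0_list 0 h1) u) = filter (\<lambda>x. h1 < x) u"
      by (rule filter_foldr_s_op_other) (use r in auto)
    have "h1 # foldr s_op (w0_list 0 h1) (filter (\<lambda>x. x \<le> h1) u) \<sim>\<^sub>K tab_word (rect_tab 0 h1 m1)"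
      using block_chi[of "filter (\<lambda>x. x \<le> h1) u" x 0 h1 m1] t True assms(2) by simp
    then show ?thesis using t True s h1 by (simp add: two_rect_def chi2_def a b)
  next
    case False
    then have h2: "1 \<le> h2" using su by auto
    have r: "set (w0_list h1 h2) \<subseteq> {h1 + 1..<h1 + h2}" by (rule w0_list_set)
    have s: "set (foldr s_op (w0_list h1 h2) u) \<subseteq> {1..h1 + h2}"
      by (rule set_foldr_s_op) (use r su in auto)
    have a: "filter (\<lambda>x. x \<le> h1) (foldr s_op (w0_list h1 h2) u) = filter (\<lambda>x. x \<le> h1) u"
      by (rule filter_foldr_s_op_other) (use r in auto)
    have b: "filter (\<lambda>x. h1 < x) (foldr s_op (w0_list h1 h2) u) = foldr s_op (w0_list h1 h2) (filter (\<lambda>x. h1 < x) u)"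
      by (rule filter_foldr_s_op) (use r in auto)
    have "(h1 + h2) # foldr s_op (w0_list h1 h2) (filter (\<lambda>x. h1 < x) u) \<sim>\<^sub>K tab_word (rect_tab h1 h2 m2)"
      using block_chi[of "filter (\<lambda>x. h1 < x) u" x h1 h2 m2] t False assms(3) by simp
    then show ?thesis using t False s h2 by (simp add: two_rect_def chi2_def a b)
  qed
qed

subsection \<open>Adding the first or the last cell\<close>

lemma add_cell_inj: "i \<le> length l \<Longrightarrow> k \<le> length l \<Longrightarrow> add_cell i l = add_cell k l \<Longrightarrow> i = k"
proof -
  assume i: "i \<le> length l" and k: "k \<le> length l" and e: "add_cell i l = add_cell k l"
  from arg_cong[OF e, of "\<lambda>l. nth0 l i"] show "i = k"
    unfolding nth0_add_cell[OF i] nth0_add_cell[OF k] by (cases "i = k") simp_all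
qed

lemma last_cell:
  obtains i where "i \<le> length (shape (Ptab u))" "shape (Ptab (u @ [x])) = add_cell i (shape (Ptab u))"
  using tab_ins_shape[OF Ptab_column_strict, of u x] by (auto simp: Ptab_append)

lemma first_cell:
  assumes "set (y # v) \<subseteq> {1..N}"
  obtains i where "i \<le> length (shape (Ptab v))" "shape (Ptab (y # v)) = add_cell i (shape (Ptab v))"
proof -
  obtain i where "i \<le> length (shape (Ptab (revcomp N v)))"
    "shape (Ptab (revcomp N v @ [Suc N - y])) = add_cell i (shape (Ptab (revcomp N v)))" by (rule last_cell)
  moreover have "shape (Ptab (revcomp N v)) = shape (Ptab v)"
    "shape (Ptab (revcomp N v @ [Suc N - y])) = shape (Ptab (y # v))"
    using shape_revcomp[of v N] shape_revcomp[of "y # v" N] assms by (simp_all add: revcomp_Cons)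
  ultimately show ?thesis using that by simp
qed

lemma two_rect_count:
  assumes "two_rect h1 m1 h2 m2 w"
  shows "1 \<le> x \<Longrightarrow> x \<le> h1 \<Longrightarrow> count_list w x = m1"
    "h1 < x \<Longrightarrow> x \<le> h1 + h2 \<Longrightarrow> count_list w x = m2"
proof -
  have c: "P x \<Longrightarrow> count_list (filter P w) x = count_list w x" for P x
    by (induction w) auto
  show "1 \<le> x \<Longrightarrow> x \<le> h1 \<Longrightarrow> count_list w x = m1"
    using knuth_count[of "filter (\<lambda>x. x \<le> h1) w" "tab_word (rect_tab 0 h1 m1)" x] assms c[of "\<lambda>x. x \<le> h1" x]
    by (simp add: two_rect_def count_rect_word)
  show "h1 < x \<Longrightarrow> x \<le> h1 + h2 \<Longrightarrow> count_list w x = m2"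
    using knuth_count[of "filter (\<lambda>x. h1 < x) w" "tab_word (rect_tab h1 h2 m2)" x] assms c[of "\<lambda>x. h1 < x" x]
    by (simp add: two_rect_def count_rect_word)
qed

text \<open>\<open>u\<close> contains \<open>m1 - 1\<close> letters 1, so the bound for a smallest
  last letter gives a column at most \<open>m1\<close>.\<close>

lemma last_one_col:
  assumes "two_rect h1 m1 h2 m2 (u @ [1])" "1 \<le> h1" "i \<le> length (shape (Ptab u))"
    "shape (Ptab (u @ [1])) = add_cell i (shape (Ptab u))"
  shows "nth0 (shape (Ptab u)) i < m1"
proof -
  have s: "\<forall>y\<in>set u. 1 \<le> y" using two_rect_set[OF assms(1)] by auto
  have c: "count_list u 1 + 1 = m1" using two_rect_count(1)[OF assms(1), of 1] assms(2) by simp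
  obtain k where k: "k \<le> length (Ptab u)" "shape (Ptab (u @ [1])) = add_cell k (shape (Ptab u))"
    "shape (Ptab (u @ [1])) ! k \<le> Suc (count_list u 1)"
    using last_letter_col[OF s order_refl] by blast
  have ki: "k = i" by (rule add_cell_inj[of _ "shape (Ptab u)"]) (use k assms in simp_all)
  have "shape (Ptab (u @ [1])) ! i = Suc (nth0 (shape (Ptab u)) i)"
    using assms(3,4) by (simp add: add_cell_nth length_add_cell nth0_def)
  then show ?thesis using k(3) c ki by simp
qed

text \<open>Prepending the largest letter is, after reverse complement, appending the letter 1.\<close>

lemma first_max_col:
  assumes "two_rect h1 m1 h2 m2 ((h1 + h2) # v)" "1 \<le> h2" "i \<le> length (shape (Ptab v))"
    "shape (Ptab ((h1 + h2) # v)) = add_cell i (shape (Ptab v))"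
  shows "nth0 (shape (Ptab v)) i < m2"
proof -
  let ?N = "h1 + h2"
  have s: "set (?N # v) \<subseteq> {1..?N}" by (rule two_rect_set[OF assms(1)])
  have r: "revcomp ?N (?N # v) = revcomp ?N v @ [1]" by (simp add: revcomp_def)
  have t: "two_rect h2 m2 h1 m1 (revcomp ?N v @ [1])" using two_rect_revcomp[OF assms(1)] r by simp
  have sh: "shape (Ptab (revcomp ?N v)) = shape (Ptab v)" "shape (Ptab (revcomp ?N v @ [1])) = shape (Ptab (?N # v))"
    using shape_revcomp[of v ?N] shape_revcomp[OF s] s r by simp_all
  show ?thesis using last_one_col[OF t assms(2), of i] assms(3,4) unfolding sh by simp
qed

lemma two_rect_star:
  assumes "two_rect h1 m1 h2 m2 w" "two_rect h1 m1 h2 m2 w'" "0 < m1" "0 < m2"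
    "shape (Ptab w) = add_cell i l" "shape (Ptab w') = add_cell k l" "i \<le> length l" "k \<le> length l"
    "max m1 m2 \<le> nth0 l i \<longleftrightarrow> max m1 m2 \<le> nth0 l k"
  shows "i = k"
proof (rule ccontr)
  assume n: "i \<noteq> k"
  let ?N = "h1 + h2"
  have 1: "m1 \<le> nth0 l i \<longleftrightarrow> \<not> m1 \<le> nth0 l k"
    by (rule two_rect_shape_star[OF two_rect_tabI[OF assms(1,3,4)] two_rect_tabI[OF assms(2,3,4)] assms(5-8) n])
  \<comment> \<open>Reverse complement keeps both shapes and puts the rectangle of width
    \<open>m2\<close> first, so the separation also holds for column \<open>m2\<close>.\<close>
  have sh: "shape (Ptab (revcomp ?N w)) = add_cell i l" "shape (Ptab (revcomp ?N w')) = add_cell k l"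
    using shape_revcomp two_rect_set assms by metis+
  have 2: "m2 \<le> nth0 l i \<longleftrightarrow> \<not> m2 \<le> nth0 l k"
    by (rule two_rect_shape_star[OF two_rect_tabI[OF two_rect_revcomp[OF assms(1)] assms(4,3)]
        two_rect_tabI[OF two_rect_revcomp[OF assms(2)] assms(4,3)] sh assms(7,8) n])
  show False using 1 2 assms(9) by (cases "m1 \<le> m2") (auto simp: max_def)
qed

section \<open>The cell added by the cyclage for two rectangles\<close>

lemma chi2_Cons:
  "\<exists>y rs. chi2 h1 h2 u x = y # foldr s_op rs u \<and> (x \<le> h1 \<longrightarrow> y = h1) \<and> (h1 < x \<longrightarrow> y = h1 + h2)"
  by (cases "x \<le> h1") (auto simp: chi2_def)

text \<open>A cell beyond both widths cannot come from an appended 1, so \<open>x\<close> belongs to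
  the second block. Then the cyclage prepends the largest letter of all, whose cell stays within the
  first \<open>m2\<close> columns.\<close>

lemma chi2_up:
  assumes "two_rect h1 m1 h2 m2 (u @ [x])" "0 < m1" "0 < m2" "i \<le> length l" "k \<le> length l" "l = shape (Ptab u)"
    "shape (Ptab (u @ [x])) = add_cell i l" "shape (Ptab (chi2 h1 h2 u x)) = add_cell k l" "max m1 m2 \<le> nth0 l i"
  shows "\<not> max m1 m2 \<le> nth0 l k"
proof (cases "x \<le> h1")
  case True
  then have x: "x = 1" using two_rect_chi2(2)[OF assms(1-3)] by simp
  have "nth0 (shape (Ptab u)) i < m1"
    by (rule last_one_col[of h1 m1 h2 m2]) (use assms x True in auto)
  then show ?thesis using assms(6,9) by simp
next
  case False
  then have c: "chi2 h1 h2 u x = (h1 + h2) # foldr s_op (w0_list h1 h2) u" by (simp add: chi2_def)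
  have sh: "shape (Ptab (foldr s_op (w0_list h1 h2) u)) = l" using dual_shape[OF dual_foldr_s_op] assms(6) by metis
  have h2: "1 \<le> h2" using two_rect_set[OF assms(1)] False by auto
  have "nth0 (shape (Ptab (foldr s_op (w0_list h1 h2) u))) k < m2"
    by (rule first_max_col[of h1 m1 h2 m2]) (use two_rect_chi2(1)[OF assms(1-3)] assms h2 in \<open>simp_all add: c sh\<close>)
  then show ?thesis using sh by simp
qed

lemma chi2_shape:
  assumes "two_rect h1 m1 h2 m2 (u @ [x])" "0 < m1" "0 < m2"
  obtains k where "k \<le> length (shape (Ptab u))" "shape (Ptab (chi2 h1 h2 u x)) = add_cell k (shape (Ptab u))"
proof -
  obtain y rs where c: "chi2 h1 h2 u x = y # foldr s_op rs u" using chi2_Cons by blast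
  have s: "set (y # foldr s_op rs u) \<subseteq> {1..h1 + h2}" using two_rect_set[OF two_rect_chi2(1)[OF assms]] c by simp
  have sh: "shape (Ptab (foldr s_op rs u)) = shape (Ptab u)" using dual_shape[OF dual_foldr_s_op] by metis
  show ?thesis using first_cell[OF s] that unfolding sh c by metis
qed

text \<open>Equal shapes force equal tableaux. Splitting off the first letters leaves dual words
  with equal tableaux, hence equal words, and the operator of the block can be undone.\<close>

lemma chi2_inj:
  assumes "two_rect h1 m1 h2 m2 (u @ [x])" "two_rect h1 m1 h2 m2 (v @ [z])" "0 < m1" "0 < m2" "1 \<le> h2"
    "dual u v" "shape (Ptab (chi2 h1 h2 u x)) = shape (Ptab (chi2 h1 h2 v z))"
  shows "u = v \<and> x = z"
proof -
  have P: "Ptab (chi2 h1 h2 u x) = Ptab (chi2 h1 h2 v z)"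
    by (rule two_rect_unique[OF two_rect_chi2(1)[OF assms(1,3,4)] two_rect_chi2(1)[OF assms(2-4)] assms(3,4,7)])
  obtain y rs where c: "chi2 h1 h2 u x = y # foldr s_op rs u" "x \<le> h1 \<longrightarrow> y = h1" "h1 < x \<longrightarrow> y = h1 + h2" using chi2_Cons by blast
  obtain y' rs' where c': "chi2 h1 h2 v z = y' # foldr s_op rs' v" "z \<le> h1 \<longrightarrow> y' = h1" "h1 < z \<longrightarrow> y' = h1 + h2" using chi2_Cons by blast
  have d: "dual (foldr s_op rs u) (foldr s_op rs' v)"
    using dual_trans[OF dual_sym[OF dual_foldr_s_op] dual_trans[OF assms(6) dual_foldr_s_op]] .
  have "y = y' \<and> Ptab (foldr s_op rs u) = Ptab (foldr s_op rs' v)"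
    by (rule shape_eq_first_letter[of _ _ _ _ "h1 + h2"])
       (use P c c' dual_shape[OF d] two_rect_set[OF two_rect_chi2(1)[OF assms(1,3,4)]] two_rect_set[OF two_rect_chi2(1)[OF assms(2-4)]] in simp_all)
  then have y: "y = y'" and e: "foldr s_op rs u = foldr s_op rs' v" using dual_Ptab_eq[OF d] by simp_all
  \<comment> \<open>For \<open>1 \<le> h2\<close> the possible first letters \<open>h1\<close> and
    \<open>h1 + h2\<close> differ, so they reveal the block of the last letter.\<close>
  have xz: "x \<le> h1 \<longleftrightarrow> z \<le> h1" using y c(2,3) c'(2,3) assms(5) by (cases "x \<le> h1"; cases "z \<le> h1") auto
  then have "x = z" using two_rect_chi2(2,3)[OF assms(1,3,4)] two_rect_chi2(2,3)[OF assms(2-4)]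
    by (cases "x \<le> h1") auto
  moreover have "chi2 h1 h2 u x = chi2 h1 h2 v z" using c(1) c'(1) y e by simp
  then have "u = v" using calculation foldr_s_op_inj by (auto simp: chi2_def split: if_splits)
  ultimately show ?thesis by blast
qed

text \<open>By contradiction, with a competitor: the reverse complement of \<open>y # v\<close> has
  the original order of rectangles and last cell \<open>j\<close>, and its prefix can be moved into
  the dual class of \<open>u\<close>. Its cell lies on the right, so its cyclage adds a cell on the
  left, as the cyclage of \<open>u @ [x]\<close> would. The two cells then agree, injectivity
  identifies the two words, and \<open>i = j\<close> is absurd.\<close>

lemma chi2_down:
  assumes "two_rect h1 m1 h2 m2 (u @ [x])" "two_rect h2 m2 h1 m1 (y # v)" "0 < m1" "0 < m2" "1 \<le> h2" "dual u v"
    "i \<le> length l" "j \<le> length l" "k \<le> length l" "l = shape (Ptab u)"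
    "shape (Ptab (u @ [x])) = add_cell i l" "shape (Ptab (y # v)) = add_cell j l"
    "shape (Ptab (chi2 h1 h2 u x)) = add_cell k l"
    "\<not> max m1 m2 \<le> nth0 l i" "max m1 m2 \<le> nth0 l j"
  shows "max m1 m2 \<le> nth0 l k"
proof (rule ccontr)
  assume nk: "\<not> max m1 m2 \<le> nth0 l k"
  let ?N = "h1 + h2"
  have sv: "set (y # v) \<subseteq> {1..?N}" using two_rect_set[OF assms(2)] by (simp add: add.commute)
  have su: "set (u @ [x]) \<subseteq> {1..?N}" by (rule two_rect_set[OF assms(1)])
  define x0 where "x0 = Suc ?N - y"
  have t0: "two_rect h1 m1 h2 m2 (revcomp ?N v @ [x0])"
    using two_rect_revcomp[OF assms(2)] by (simp add: revcomp_Cons x0_def add.commute)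
  have sh0: "shape (Ptab (revcomp ?N v)) = l" "shape (Ptab (revcomp ?N v @ [x0])) = add_cell j l"
    using shape_revcomp[of v ?N] shape_revcomp[OF sv] sv dual_shape[OF assms(6)] assms(10,12)
    by (simp_all add: revcomp_Cons x0_def)
  have suv: "set u \<subseteq> {1..?N}" "set (revcomp ?N v) \<subseteq> {1..?N}" using su revcomp_set[of v ?N] sv by simp_all
  obtain gs where gs: "\<forall>u'. u' \<sim>\<^sub>K u \<longrightarrow> refills gs u' \<sim>\<^sub>K revcomp ?N v"
    using refills_Ptab[OF suv] sh0(1) assms(10) by auto
  \<comment> \<open>Dual to \<open>u\<close>, as injectivity requires, and in the Knuth class of the
    reverse complement of \<open>v\<close>, so that appending \<open>x0\<close> adds cell
    \<open>j\<close>.\<close>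
  define u0 where "u0 = refills gs u"
  have k0: "u0 \<sim>\<^sub>K revcomp ?N v" using gs by (simp add: u0_def)
  then have k1: "u0 @ [x0] \<sim>\<^sub>K revcomp ?N v @ [x0]" by (rule knuth_app[OF _ knuth_refl])
  have tr0: "two_rect h1 m1 h2 m2 (u0 @ [x0])" using t0 two_rect_knuth[OF k1] by blast
  have shj: "shape (Ptab (u0 @ [x0])) = add_cell j l" using Ptab_knuth[OF k1] sh0(2) by simp
  have d: "dual u u0" unfolding u0_def by (rule dual_refills)
  have l0: "l = shape (Ptab u0)" using dual_shape[OF d] assms(10) by simp
  obtain k' where k': "k' \<le> length l" "shape (Ptab (chi2 h1 h2 u0 x0)) = add_cell k' l"
    using chi2_shape[OF tr0 assms(3,4)] l0 by auto
  have "\<not> max m1 m2 \<le> nth0 l k'"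
    by (rule chi2_up[OF tr0 assms(3,4,8) k'(1) l0 shj k'(2) assms(15)])
  then have "k' = k"
    using two_rect_star[OF two_rect_chi2(1)[OF tr0 assms(3,4)] two_rect_chi2(1)[OF assms(1,3,4)] assms(3,4) k'(2) assms(13) k'(1) assms(9)] nk
    by blast
  then have "u = u0 \<and> x = x0"
    using chi2_inj[OF assms(1) tr0 assms(3-5) d] k'(2) assms(13) by simp
  then have "i = j" using shj assms(7,8,11) add_cell_inj by metis
  then show False using assms(14,15) by simp
qed

lemma chi2_switch_shape:
  assumes "two_rect h1 m1 h2 m2 (u @ [x])" "two_rect h2 m2 h1 m1 (v @ [z])" "0 < m1" "0 < m2" "1 \<le> h1" "1 \<le> h2"
    "dual (u @ [x]) (v @ [z])"
  shows "shape (Ptab (chi2 h1 h2 u x)) = shape (Ptab (chi2 h2 h1 v z))"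
proof -
  have lu: "length u = length v" using dual_length[OF assms(7)] by simp
  have d: "dual u v" by (rule dual_append(1)[OF assms(7) lu])
  define l where "l = shape (Ptab u)"
  have lv: "l = shape (Ptab v)" using dual_shape[OF d] by (simp add: l_def)
  have c: "max m2 m1 = max m1 m2" by (rule max.commute)
  obtain i where i: "i \<le> length l" "shape (Ptab (u @ [x])) = add_cell i l" unfolding l_def by (rule last_cell)
  have i': "shape (Ptab (v @ [z])) = add_cell i l" using i(2) dual_shape[OF assms(7)] by simp
  obtain j where j: "j \<le> length l" "shape (Ptab (chi2 h1 h2 u x)) = add_cell j l"
    using chi2_shape[OF assms(1,3,4)] l_def by blast
  obtain k where k: "k \<le> length l" "shape (Ptab (chi2 h2 h1 v z)) = add_cell k l"
    using chi2_shape[OF assms(2,4,3)] lv by metis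
  note tu = two_rect_chi2(1)[OF assms(1,3,4)] and tv = two_rect_chi2(1)[OF assms(2,4,3)]
  obtain y rs where cu: "chi2 h1 h2 u x = y # foldr s_op rs u" using chi2_Cons by blast
  obtain y' rs' where cv: "chi2 h2 h1 v z = y' # foldr s_op rs' v" using chi2_Cons by blast
  have star: "max m1 m2 \<le> nth0 l j \<longleftrightarrow> max m1 m2 \<le> nth0 l k \<Longrightarrow> j = k"
  proof -
    assume e: "max m1 m2 \<le> nth0 l j \<longleftrightarrow> max m1 m2 \<le> nth0 l k"
    \<comment> \<open>The comparison of cells concerns words with one order of the rectangles;
      reverse complement restores that order without changing the shape.\<close>
    have "shape (Ptab (revcomp (h2 + h1) (chi2 h2 h1 v z))) = add_cell k l"
      using shape_revcomp[OF two_rect_set[OF tv]] k(2) by simp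
    from two_rect_star[OF tu two_rect_revcomp[OF tv] assms(3,4) j(2) this j(1) k(1) e] show ?thesis .
  qed
  have "j = k"
  proof (cases "max m1 m2 \<le> nth0 l i")
    case True
    have "\<not> max m1 m2 \<le> nth0 l j" by (rule chi2_up[OF assms(1,3,4) i(1) j(1) l_def i(2) j(2) True])
    moreover have "\<not> max m2 m1 \<le> nth0 l k"
      by (rule chi2_up[OF assms(2,4,3) i(1) k(1) lv i' k(2)]) (use True c in simp)
    ultimately show ?thesis unfolding c by (intro star) blast
  next
    case False
    show ?thesis
    proof (rule star, rule iffI)
      assume up: "max m1 m2 \<le> nth0 l j"
      \<comment> \<open>The word \<open>chi2 h1 h2 u x\<close> itself, with its first letter split
        off, serves as the word \<open>y # v\<close> of the exchanged situation.\<close>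
      have "max m2 m1 \<le> nth0 l k"
        by (rule chi2_down[OF assms(2) tu[unfolded cu] assms(4,3,5) dual_trans[OF dual_sym[OF d] dual_foldr_s_op] i(1) j(1) k(1) lv i' j(2)[unfolded cu] k(2)])
           (use False up c in simp_all)
      then show "max m1 m2 \<le> nth0 l k" using c by simp
    next
      assume up: "max m1 m2 \<le> nth0 l k"
      show "max m1 m2 \<le> nth0 l j"
        by (rule chi2_down[OF assms(1) tv[unfolded cv] assms(3,4,6) dual_trans[OF d dual_foldr_s_op] i(1) k(1) j(1) l_def i(2) k(2)[unfolded cv] j(2) False up])
    qed
  qed
  then show ?thesis using j(2) k(2) by simp
qed

text \<open>The switched image \<open>w\<close> of one cyclage has the tableau of the other, since a
  shape determines the tableau. Without the first letters the two words are dual with equal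
  tableaux, so \<open>w\<close> is the other cyclage.\<close>

theorem chi2_switch:
  assumes "two_rect h1 m1 h2 m2 (u @ [x])" "two_rect h2 m2 h1 m1 (v @ [z])" "0 < m1" "0 < m2" "1 \<le> h1" "1 \<le> h2"
    "dual (u @ [x]) (v @ [z])"
  shows "dual (chi2 h1 h2 u x) (chi2 h2 h1 v z)"
proof -
  note tu = two_rect_chi2(1)[OF assms(1,3,4)] and tv = two_rect_chi2(1)[OF assms(2,4,3)]
  have lu: "length u = length v" using dual_length[OF assms(7)] by simp
  have d: "dual u v" by (rule dual_append(1)[OF assms(7) lu])
  obtain gs where gs: "\<forall>w. w \<sim>\<^sub>K chi2 h1 h2 u x \<longrightarrow> two_rect h2 m2 h1 m1 (refills gs w)"
    using switch_exists[OF tu] by blast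
  define w where "w = refills gs (chi2 h1 h2 u x)"
  have tw: "two_rect h2 m2 h1 m1 w" unfolding w_def using gs by simp
  have dw: "dual (chi2 h1 h2 u x) w" unfolding w_def by (rule dual_refills)
  have P: "Ptab w = Ptab (chi2 h2 h1 v z)"
    by (rule two_rect_unique[OF tw tv assms(4,3)]) (use dual_shape[OF dw] chi2_switch_shape[OF assms] in simp)
  obtain y rs where cu: "chi2 h1 h2 u x = y # foldr s_op rs u" using chi2_Cons by blast
  obtain y' rs' where cv: "chi2 h2 h1 v z = y' # foldr s_op rs' v" using chi2_Cons by blast
  obtain y3 u3 where w: "w = y3 # u3" using dual_length[OF dw] cu by (cases w) auto
  have "dual (foldr s_op rs u) u3" using dual_append(2)[of "[y]" "foldr s_op rs u" "[y3]" u3] dw cu w by simp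
  then have d3: "dual u3 (foldr s_op rs' v)"
    using dual_trans[OF dual_sym dual_trans[OF dual_sym[OF dual_foldr_s_op] dual_trans[OF d dual_foldr_s_op]]] by blast
  have "y3 = y' \<and> Ptab u3 = Ptab (foldr s_op rs' v)"
    by (rule shape_eq_first_letter[of _ _ _ _ "h2 + h1"])
       (use P cv w dual_shape[OF d3] two_rect_set[OF tw] two_rect_set[OF tv] in simp_all)
  then have "w = chi2 h2 h1 v z" using dual_Ptab_eq[OF d3] cv w by simp
  then show ?thesis using dw by simp
qed

section \<open>Switching in a sequence of rectangles\<close>

subsection \<open>Blocks\<close>

lemma offs_0 [simp]: "offs R 0 = 0"
  by (simp add: offs_def)

lemma offs_Suc: "i < length R \<Longrightarrow> offs R (Suc i) = offs R i + fst (R ! i)"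
  by (simp add: offs_def take_Suc_conv_app_nth)

lemma offs_length: "offs R (length R) = rect_n R"
  by (simp add: offs_def rect_n_def)

lemma offs_mono: "i \<le> j \<Longrightarrow> j \<le> length R \<Longrightarrow> offs R i \<le> offs R j"
  by (induction j rule: dec_induct) (auto simp: offs_Suc)

lemma Ablock_alt: "i < length R \<Longrightarrow> Ablock R i = {offs R i + 1..offs R (Suc i)}"
  by (simp add: Ablock_def offs_Suc)

lemma Ablock_disjoint:
  assumes "i < length R" "j < length R" "x \<in> Ablock R i" "x \<in> Ablock R j"
  shows "i = j"
proof (rule ccontr)
  assume "i \<noteq> j"
  then consider "Suc i \<le> j" | "Suc j \<le> i" by linarith
  then show False
  proof cases
    case 1
    then have "offs R (Suc i) \<le> offs R j" using offs_mono assms by simp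
    then show False using assms by (simp add: Ablock_alt)
  next
    case 2
    then have "offs R (Suc j) \<le> offs R i" using offs_mono assms by simp
    then show False using assms by (simp add: Ablock_alt)
  qed
qed

lemma Ablock_cover:
  assumes "k \<le> length R" "1 \<le> x" "x \<le> offs R k"
  shows "\<exists>i<k. x \<in> Ablock R i"
  using assms
proof (induction k)
  case (Suc k)
  show ?case
  proof (cases "x \<le> offs R k")
    case True
    then show ?thesis using Suc less_Suc_eq by auto
  next
    case False
    then have "x \<in> Ablock R k" using Suc.prems by (simp add: Ablock_alt)
    then show ?thesis by blast
  qed
qed simp

lemma Ablock_sub: "i < length R \<Longrightarrow> Ablock R i \<subseteq> {1..rect_n R}"
  using offs_mono[of "Suc i" "length R" R] by (auto simp: Ablock_alt offs_length)

lemma Ytab_rect: "Ytab R i = rect_tab (offs R i) (fst (R ! i)) (snd (R ! i))"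
  by (simp add: Ytab_def rect_tab_def)

lemma Wset_knuth: "u \<sim>\<^sub>K v \<Longrightarrow> u \<in> Wset R \<longleftrightarrow> v \<in> Wset R"
proof -
  have *: "v \<in> Wset R" if "u \<sim>\<^sub>K v" "u \<in> Wset R" for u v
  proof -
    have "filter (\<lambda>x. x \<in> Ablock R i) v \<sim>\<^sub>K filter (\<lambda>x. x \<in> Ablock R i) u" for i
      by (rule knuth_filter[OF knuth_sym[OF that(1)]]) (auto simp: Ablock_def)
    then show ?thesis using that(2) knuth_set[OF that(1)] knuth_trans unfolding Wset_def by blast
  qed
  assume "u \<sim>\<^sub>K v"
  then show ?thesis using * knuth_sym[of u v] by blast
qed

lemma LRT_Ptab: "w \<in> Wset R \<Longrightarrow> Ptab w \<in> LRT R"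
  using Wset_knuth[OF tab_word_Ptab[of w]] by (simp add: LRT_def Ptab_column_strict)

lemma Ptab_LRT: "Ptab w \<in> LRT R \<Longrightarrow> w \<in> Wset R"
  using Wset_knuth[OF tab_word_Ptab[of w]] by (simp add: LRT_def)

subsection \<open>Two rectangles\<close>

lemma Wset_two: "Wset [(h1, m1), (h2, m2)] = {w. two_rect h1 m1 h2 m2 w}"
proof -
  have "w \<in> Wset [(h1, m1), (h2, m2)] \<longleftrightarrow> two_rect h1 m1 h2 m2 w" for w
  proof (cases "set w \<subseteq> {1..h1 + h2}")
    case True
    then have "filter (\<lambda>x. x \<in> {1..h1}) w = filter (\<lambda>x. x \<le> h1) w"
      "filter (\<lambda>x. x \<in> {h1 + 1..h1 + h2}) w = filter (\<lambda>x. h1 < x) w"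
      by (intro filter_cong; auto)+
    moreover have "Ablock [(h1, m1), (h2, m2)] 0 = {1..h1}" "Ablock [(h1, m1), (h2, m2)] (Suc 0) = {h1 + 1..h1 + h2}"
      "Ytab [(h1, m1), (h2, m2)] 0 = rect_tab 0 h1 m1" "Ytab [(h1, m1), (h2, m2)] (Suc 0) = rect_tab h1 h2 m2"
      by (simp_all add: Ablock_def Ytab_rect offs_def)
    moreover have "(\<forall>i<length [(h1, m1), (h2, m2)]. Q i) \<longleftrightarrow> Q 0 \<and> Q (Suc 0)" for Q
      by (auto simp: less_Suc_eq)
    ultimately show ?thesis using True
      by (simp only: Wset_def two_rect_def mem_Collect_eq) (simp add: rect_n_def)
  next
    case False
    then show ?thesis by (simp add: Wset_def two_rect_def rect_n_def)
  qed
  then show ?thesis by blast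
qed

text \<open>Replaces both definite descriptions by one criterion: exchanged type and duality. The
  tableau is unique for its shape, and the word is then unique because the Schensted correspondence
  is injective.\<close>

lemma tau2_word_eq:
  assumes "two_rect h1 m1 h2 m2 u" "two_rect h2 m2 h1 m1 v" "dual u v" "0 < m1" "0 < m2"
  shows "tau2_word (h1, m1) (h2, m2) u = v"
proof -
  have T: "tau2_tab (h1, m1) (h2, m2) (Ptab u) = Ptab v"
    unfolding tau2_tab_def
  proof (rule the_equality)
    show "Ptab v \<in> LRT [(h2, m2), (h1, m1)] \<and> shape (Ptab v) = shape (Ptab u)"
      using LRT_Ptab[of v] assms(2) dual_shape[OF assms(3)] by (simp add: Wset_two)
  next
    fix T' assume T': "T' \<in> LRT [(h2, m2), (h1, m1)] \<and> shape T' = shape (Ptab u)"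
    then have cs: "column_strict T'" and t: "two_rect h2 m2 h1 m1 (tab_word T')" by (simp_all add: LRT_def Wset_two)
    have "Ptab (tab_word T') = Ptab v"
      by (rule two_rect_unique[OF t assms(2,5,4)]) (use T' Ptab_tab_word[OF cs] dual_shape[OF assms(3)] in simp)
    then show "T' = Ptab v" using Ptab_tab_word[OF cs] by simp
  qed
  show ?thesis
    unfolding tau2_word_def T
  proof (rule the_equality)
    show "Ptab v = Ptab v \<and> Qtab v = Qtab u" using dual_Qtab[OF assms(3)] by simp
    fix v' assume "Ptab v' = Ptab v \<and> Qtab v' = Qtab u"
    then show "v' = v" using dual_Qtab[OF assms(3)] by (intro RS_inj) simp_all
  qed
qed

lemma sub_two_rect:
  "two_rect h1 m1 h2 m2 (map (\<lambda>x. x - s) (filter (\<lambda>x. x \<in> {s + 1..s + h1 + h2}) w)) \<longleftrightarrow>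
   filter (\<lambda>x. x \<in> {s + 1..s + h1}) w \<sim>\<^sub>K tab_word (rect_tab s h1 m1) \<and>
   filter (\<lambda>x. x \<in> {s + h1 + 1..s + h1 + h2}) w \<sim>\<^sub>K tab_word (rect_tab (s + h1) h2 m2)"
proof -
  define u where "u = map (\<lambda>x. x - s) (filter (\<lambda>x. x \<in> {s + 1..s + h1 + h2}) w)"
  define a where "a = filter (\<lambda>x. x \<in> {s + 1..s + h1}) w"
  define b where "b = filter (\<lambda>x. x \<in> {s + h1 + 1..s + h1 + h2}) w"
  have su: "set u \<subseteq> {1..h1 + h2}" by (auto simp: u_def)
  have fa: "filter (\<lambda>x. x \<le> h1) u = map (\<lambda>x. x - s) a" unfolding u_def a_def by (induction w) auto
  have fb: "filter (\<lambda>x. h1 < x) u = map (\<lambda>x. x - s) b" unfolding u_def b_def by (induction w) auto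
  have 1: "a \<sim>\<^sub>K tab_word (rect_tab s h1 m1) \<longleftrightarrow> map (\<lambda>x. x - s) a \<sim>\<^sub>K tab_word (rect_tab 0 h1 m1)"
    by (rule rect_shift_iff) (auto simp: a_def)
  have 2: "b \<sim>\<^sub>K tab_word (rect_tab (s + h1) h2 m2) \<longleftrightarrow> map (\<lambda>x. x - (s + h1)) b \<sim>\<^sub>K tab_word (rect_tab 0 h2 m2)"
    by (rule rect_shift_iff) (auto simp: b_def)
  have 3: "map (\<lambda>x. x - s) b \<sim>\<^sub>K tab_word (rect_tab h1 h2 m2) \<longleftrightarrow>
      map (\<lambda>x. x - h1) (map (\<lambda>x. x - s) b) \<sim>\<^sub>K tab_word (rect_tab 0 h2 m2)"
    by (rule rect_shift_iff) (auto simp: b_def)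
  have e: "map (\<lambda>x. x - h1) (map (\<lambda>x. x - s) b) = map (\<lambda>x. x - (s + h1)) b" by simp
  show ?thesis unfolding u_def[symmetric] a_def[symmetric] b_def[symmetric] two_rect_def fa fb 1 2
    using su 3 unfolding e by simp
qed

subsection \<open>Replacing a subword\<close>

lemma filter_nth_take:
  "i < length Z \<Longrightarrow> P (Z ! i) \<Longrightarrow> filter P Z ! length (filter P (take i Z)) = Z ! i"
proof (induction Z arbitrary: i)
  case (Cons z Z)
  then show ?case by (cases i) auto
qed simp

lemma length_filter_mask:
  assumes "length Z = length w" "\<And>i. i < length w \<Longrightarrow> P (Z ! i) \<longleftrightarrow> P (w ! i)"
  shows "length (filter P (take i Z)) = length (filter P (take i w))"
  using assms
proof (induction Z w arbitrary: i rule: list_induct2)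
  case (Cons z Z x w)
  have "P z \<longleftrightarrow> P x" using Cons.prems[of 0] by simp
  moreover have "length (filter P (take k Z)) = length (filter P (take k w))" for k
    using Cons.IH[of k] Cons.prems[of "Suc _"] by simp
  ultimately show ?case by (cases i) auto
qed simp

text \<open>Characterises the result by which positions carry letters of the pair, by the letters
  elsewhere and by the subword of the pair, so that lists of positions do not occur again.\<close>

lemma tau_word_eq:
  fixes R p w
  defines "s \<equiv> offs R (p - 1)" and "P \<equiv> (\<lambda>x. x \<in> {offs R (p - 1) + 1..offs R (p - 1) + fst (R ! (p - 1)) + fst (R ! p)})"
  assumes len: "length Z = length w"
    and mask: "\<And>i. i < length w \<Longrightarrow> (P (Z ! i) \<longleftrightarrow> P (w ! i)) \<and> (\<not> P (w ! i) \<longrightarrow> Z ! i = w ! i)"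
    and sub: "filter P Z = map (\<lambda>x. x + s) (tau2_word (R ! (p - 1)) (R ! p) (map (\<lambda>x. x - s) (filter P w)))"
  shows "tau_word R p w = Z"
proof -
  define pos where "pos = filter (\<lambda>i. P (w ! i)) [0..<length w]"
  define v where "v = tau2_word (R ! (p - 1)) (R ! p) (map (\<lambda>x. x - s) (filter P w))"
  have fw: "filter P w = map (\<lambda>i. w ! i) pos"
  proof -
    have "filter P (map ((!) w) [0..<length w]) = map ((!) w) (filter (P \<circ> (!) w) [0..<length w])" by (rule filter_map)
    then show ?thesis by (simp add: map_nth pos_def o_def)
  qed
  have u: "map (\<lambda>i. w ! i - s) pos = map (\<lambda>x. x - s) (filter P w)" by (simp add: fw)
  have t: "tau_word R p w = map (\<lambda>i. if P (w ! i) then v ! length (filter (\<lambda>j. j < i) pos) + s else w ! i) [0..<length w]"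
    unfolding v_def u[symmetric] unfolding tau_word_def Let_def pos_def P_def s_def by (rule refl)
  have cnt: "length (filter (\<lambda>j. j < i) pos) = length (filter P (take i w))" if "i < length w" for i
  proof -
    have "filter (\<lambda>j. j < i) pos = filter (\<lambda>j. P (w ! j)) (filter (\<lambda>j. j < i) [0..<length w])"
      by (simp add: pos_def conj_commute)
    also have "filter (\<lambda>j. j < i) [0..<length w] = [0..<i]"
    proof -
      have "[0..<length w] = [0..<i] @ [i..<length w]" using upt_add_eq_append[of 0 i "length w - i"] that by simp
      then show ?thesis by (simp add: filter_id_conv filter_empty_conv)
    qed
    finally have "length (filter (\<lambda>j. j < i) pos) = length (filter (P \<circ> (!) w) [0..<i])" by (simp add: o_def)
    also have "\<dots> = length (filter P (map ((!) w) [0..<i]))" by (simp add: filter_map)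
    also have "map ((!) w) [0..<i] = take i w" using that by (intro nth_equalityI) auto
    finally show ?thesis .
  qed
  show ?thesis
  proof (rule nth_equalityI)
    show "length (tau_word R p w) = length Z" by (simp add: t len)
    fix i assume "i < length (tau_word R p w)"
    then have i: "i < length w" by (simp add: t)
    show "tau_word R p w ! i = Z ! i"
    proof (cases "P (w ! i)")
      case True
      then have PZ: "P (Z ! i)" using mask[OF i] by simp
      have iZ: "i < length Z" using i len by simp
      have l: "length (filter P (take i Z)) = length (filter P (take i w))"
        by (rule length_filter_mask[OF len]) (use mask in blast)
      have lt: "length (filter P (take i Z)) < length (filter P Z)"
      proof -
        have "filter P Z = filter P (take i Z) @ filter P (Z ! i # drop (Suc i) Z)"
          using iZ by (metis append_take_drop_id filter_append Cons_nth_drop_Suc)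
        then show ?thesis using PZ by simp
      qed
      have "Z ! i = filter P Z ! length (filter P (take i w))" using filter_nth_take[where P = P, OF iZ PZ] l by simp
      also have "\<dots> = v ! length (filter P (take i w)) + s"
        using lt l unfolding sub v_def[symmetric] by simp
      finally show ?thesis using True i cnt[OF i] by (simp add: t)
    next
      case False
      then show ?thesis using mask[OF i] i by (simp add: t)
    qed
  qed
qed

subsection \<open>The operator chi\<close>

definition w0_blocks :: "rects \<Rightarrow> nat \<Rightarrow> nat list" where
  "w0_blocks R k = concat (map (\<lambda>i. w0_list (offs R i) (fst (R ! i))) [0..<k])"

lemma w0_blocks_Suc: "w0_blocks R (Suc k) = w0_blocks R k @ w0_list (offs R k) (fst (R ! k))"
  by (simp add: w0_blocks_def)

lemma w0_list_block:
  assumes "i < length R" "r \<in> set (w0_list (offs R i) (fst (R ! i)))"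
  shows "r \<in> Ablock R i" "Suc r \<in> Ablock R i"
  using assms w0_list_set[of "offs R i" "fst (R ! i)"] by (auto simp: Ablock_def)

lemma w0_blocks_set: "k \<le> length R \<Longrightarrow> set (w0_blocks R k) \<subseteq> {1..<rect_n R}"
proof (induction k)
  case (Suc k)
  have "set (w0_list (offs R k) (fst (R ! k))) \<subseteq> {1..<rect_n R}"
  proof
    fix r assume "r \<in> set (w0_list (offs R k) (fst (R ! k)))"
    then have "r \<in> Ablock R k" "Suc r \<in> Ablock R k" using w0_list_block Suc.prems by simp_all
    then show "r \<in> {1..<rect_n R}" using Ablock_sub[of k R] Suc.prems by auto
  qed
  then show ?case using Suc by (simp add: w0_blocks_Suc)
qed (simp add: w0_blocks_def)

lemma perm_of_w0_blocks:
  assumes "k \<le> length R"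
  shows "i < k \<Longrightarrow> x \<in> Ablock R i \<Longrightarrow> perm_of (w0_blocks R k) x = offs R i + fst (R ! i) + (offs R i + 1) - x"
    "\<forall>i<k. x \<notin> Ablock R i \<Longrightarrow> perm_of (w0_blocks R k) x = x"
  using assms
proof (induction k arbitrary: x)
  case 0
  { case 1 then show ?case by simp }
  { case 2 then show ?case by (simp add: w0_blocks_def perm_of_foldr) }
next
  case (Suc k)
  have p: "perm_of (w0_list (offs R k) (fst (R ! k))) y = (if y \<in> Ablock R k then offs R k + fst (R ! k) + (offs R k + 1) - y else y)" for y
    by (simp add: perm_of_w0_list Ablock_def)
  { case 1
    show ?case
    proof (cases "i = k")
      case True
      let ?y = "offs R k + fst (R ! k) + (offs R k + 1) - x"
      have y: "?y \<in> Ablock R k" using 1 True by (auto simp: Ablock_def)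
      have "\<forall>j<k. ?y \<notin> Ablock R j"
      proof (intro allI impI notI)
        fix j assume j: "j < k" "?y \<in> Ablock R j"
        then have "j = k" using Ablock_disjoint[of j R k ?y] y 1(3) by simp
        then show False using j by simp
      qed
      then show ?thesis using 1 True Suc.IH(2)[of ?y] by (simp add: w0_blocks_Suc perm_of_append p)
    next
      case False
      then have "x \<notin> Ablock R k" using Ablock_disjoint[of i R k x] 1 by auto
      then show ?thesis using 1 False Suc.IH(1)[of x] by (simp add: w0_blocks_Suc perm_of_append p)
    qed }
  { case 2
    then show ?case using Suc.IH(2)[of x] by (simp add: w0_blocks_Suc perm_of_append p) }
qed

lemma w0R_eq: "perm_of (w0_blocks R (length R)) = w0R R"
proof
  fix x
  show "perm_of (w0_blocks R (length R)) x = w0R R x"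
  proof (cases "\<exists>i<length R. x \<in> Ablock R i")
    case True
    then obtain i where i: "i < length R" "x \<in> Ablock R i" by blast
    have "(THE i. i < length R \<and> x \<in> Ablock R i) = i"
      by (rule the_equality) (use i Ablock_disjoint in blast)+
    then have "w0R R x = offs R i + fst (R ! i) + 1 - (x - offs R i)" using True by (simp add: w0R_def Let_def)
    then show ?thesis using perm_of_w0_blocks(1)[OF order_refl i] i(2) by (simp add: Ablock_def)
  next
    case False
    then show ?thesis using perm_of_w0_blocks(2)[OF order_refl, of R x] by (auto simp: w0R_def)
  qed
qed

lemma act_w0R: "act (rect_n R) (w0R R) w = foldr s_op (w0_blocks R (length R)) w"
  by (rule act_foldr) (use w0_blocks_set[of "length R" R] w0R_eq in auto)

lemma s_op_unm_zero: "unm r w = 0 \<Longrightarrow> s_op r w = w"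
  using refill_phi[of r w] by (simp add: s_op_refill)

lemma unm_foldr_s_op:
  "\<forall>q\<in>set rs. r \<noteq> q \<and> r \<noteq> Suc q \<and> q \<noteq> Suc r \<Longrightarrow> unm r (foldr s_op rs w) = unm r w"
  by (induction rs) (auto simp: s_op_refill phi_refill_other)

lemma foldr_s_op_trivial: "\<forall>r\<in>set rs. unm r w = 0 \<Longrightarrow> foldr s_op rs w = w"
  by (induction rs) (auto simp: s_op_unm_zero)

text \<open>A block with all letters matched is fixed by its generators. Generators \<open>r\<close>
  of a block also have \<open>r + 1\<close> in it, so those of different blocks are never adjacent
  and do not disturb each other's bracketing.\<close>

lemma foldr_w0_blocks:
  assumes "k \<le> length R" "i < length R"
    "\<And>j r. j < k \<Longrightarrow> j \<noteq> i \<Longrightarrow> r \<in> set (w0_list (offs R j) (fst (R ! j))) \<Longrightarrow> unm r w = 0"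
  shows "foldr s_op (w0_blocks R k) w = (if i < k then foldr s_op (w0_list (offs R i) (fst (R ! i))) w else w)"
  using assms
proof (induction k arbitrary: w)
  case 0
  then show ?case by (simp add: w0_blocks_def)
next
  case (Suc k)
  let ?v = "foldr s_op (w0_list (offs R k) (fst (R ! k))) w"
  show ?case
  proof (cases "k = i")
    case True
    have "unm r ?v = 0" if j: "j < k" "j \<noteq> i" "r \<in> set (w0_list (offs R j) (fst (R ! j)))" for j r
    proof -
      have "\<forall>q\<in>set (w0_list (offs R k) (fst (R ! k))). r \<noteq> q \<and> r \<noteq> Suc q \<and> q \<noteq> Suc r"
        using w0_list_block[of j R r] w0_list_block[of k R] Ablock_disjoint[of j R k] j Suc.prems(1)
        by (metis Suc_le_lessD less_trans nat_neq_iff)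
      then show ?thesis using unm_foldr_s_op[of _ r w] Suc.prems(3)[of j r] j by simp
    qed
    then have "foldr s_op (w0_blocks R k) ?v = ?v" using Suc.IH[of ?v] Suc.prems True by simp
    then show ?thesis using True by (simp add: w0_blocks_Suc)
  next
    case False
    have "?v = w" by (rule foldr_s_op_trivial) (use Suc.prems(3)[of k] False in blast)
    moreover have "foldr s_op (w0_blocks R k) w = (if i < k then foldr s_op (w0_list (offs R i) (fst (R ! i))) w else w)"
    proof (rule Suc.IH)
      show "\<And>j r. j < k \<Longrightarrow> j \<noteq> i \<Longrightarrow> r \<in> set (w0_list (offs R j) (fst (R ! j))) \<Longrightarrow> unm r w = 0"
        using Suc.prems(3) less_SucI by blast
    qed (use Suc.prems in simp_all)
    moreover have "i < Suc k \<longleftrightarrow> i < k" using False by auto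
    ultimately show ?thesis by (simp only: w0_blocks_Suc foldr_append o_apply)
  qed
qed

text \<open>Removing the last letter damages only its own block; every other block keeps its
  complete rectangular subword in \<open>u\<close>, and its reversal acts trivially.\<close>

lemma chiR_eq:
  assumes pos: "\<forall>(h, m)\<in>set R. 0 < h \<and> 0 < m" and w: "u @ [x] \<in> Wset R" and i: "i < length R" "x \<in> Ablock R i"
  shows "chiR R (u @ [x]) = (offs R i + fst (R ! i)) # foldr s_op (w0_list (offs R i) (fst (R ! i))) u"
proof -
  have W: "filter (\<lambda>y. y \<in> Ablock R j) (u @ [x]) \<sim>\<^sub>K tab_word (rect_tab (offs R j) (fst (R ! j)) (snd (R ! j)))" if "j < length R" for j
    using w that by (simp add: Wset_def Ytab_rect)
  have m: "0 < snd (R ! i)" using pos nth_mem[OF i(1)] by (cases "R ! i") auto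
  have x: "x = offs R i + 1"
    using block_last_letter[of "filter (\<lambda>y. y \<in> Ablock R i) u" x] W[OF i(1)] i(2) m by simp
  have "foldr s_op (w0_blocks R (length R)) u = foldr s_op (w0_list (offs R i) (fst (R ! i))) u"
  proof -
    have "unm r u = 0" if j: "j < length R" "j \<noteq> i" "r \<in> set (w0_list (offs R j) (fst (R ! j)))" for j r
    proof -
      have "x \<notin> Ablock R j" using Ablock_disjoint[of i R j x] i j by auto
      then have k: "filter (\<lambda>y. y \<in> Ablock R j) u \<sim>\<^sub>K tab_word (rect_tab (offs R j) (fst (R ! j)) (snd (R ! j)))"
        using W[OF j(1)] by simp
      have "unm r (filter (\<lambda>y. y \<in> Ablock R j) u) = unm r u"
        by (rule filter_refill(2)) (use w0_list_block[OF j(1,3)] in auto)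
      moreover have "unm r (tab_word (rect_tab (offs R j) (fst (R ! j)) (snd (R ! j)))) = 0"
        by (rule rect_word_unm) (use j(3) w0_list_set[of "offs R j" "fst (R ! j)"] in auto)
      ultimately show ?thesis using unm_knuth[OF k, of r] by simp
    qed
    then show ?thesis using foldr_w0_blocks[OF order_refl i(1), of u] i(1) by simp
  qed
  moreover have "foldr s_op (w0_blocks R (length R)) [x] = [offs R i + fst (R ! i)]"
    using perm_of_w0_blocks(1)[OF order_refl i] x by (simp add: foldr_s_op_single)
  ultimately show ?thesis by (simp add: chiR_def act_w0R)
qed

subsection \<open>The switch of two neighbours\<close>

lemma filter_refills_other:
  "\<forall>r\<in>fst ` set gs. \<not> P r \<and> \<not> P (Suc r) \<Longrightarrow> filter P (refills gs w) = filter P w"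
proof (induction gs arbitrary: w)
  case (Cons g gs)
  obtain r p where g: "g = (r, p)" by (cases g)
  then have "filter P (refill r p w) = filter P w" using Cons.prems by (intro filter_refill_other) auto
  then show ?case using Cons by (simp add: g refills_Cons)
qed simp

lemma refills_Cons_out:
  "\<forall>r\<in>fst ` set gs. x \<noteq> r \<and> x \<noteq> Suc r \<Longrightarrow> refills gs (x # w) = x # refills gs w"
proof (induction gs arbitrary: w)
  case (Cons g gs)
  obtain r p where g: "g = (r, p)" by (cases g)
  have "refill r p (x # w) = x # refill r p w" by (rule refill_Cons_out(1)) (use Cons.prems g in auto)
  then show ?case using Cons by (simp add: g refills_Cons)
qed simp

lemma phi_snoc_out: "x \<noteq> r \<Longrightarrow> x \<noteq> Suc r \<Longrightarrow> phi r (w @ [x]) = phi r w"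
  by (simp add: phi_append)

lemma refill_snoc_out:
  assumes "x \<noteq> r" "x \<noteq> Suc r"
  shows "refill r p (w @ [x]) = refill r p w @ [x]"
proof (induction w arbitrary: p)
  case Nil
  then show ?case using refill_Cons_out(1)[OF assms, of p "[]"] by simp
next
  case (Cons y w)
  then show ?case using phi_snoc_out[OF assms, of w] by simp
qed

lemma refills_snoc_out:
  "\<forall>r\<in>fst ` set gs. x \<noteq> r \<and> x \<noteq> Suc r \<Longrightarrow> refills gs (w @ [x]) = refills gs w @ [x]"
proof (induction gs arbitrary: w)
  case (Cons g gs)
  obtain r p where g: "g = (r, p)" by (cases g)
  have "refill r p (w @ [x]) = refill r p w @ [x]" by (rule refill_snoc_out) (use Cons.prems g in auto)
  then show ?case using Cons by (simp add: g refills_Cons)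
qed simp

lemma s_op_refill_commute:
  assumes "r \<noteq> q" "r \<noteq> Suc q" "q \<noteq> Suc r"
  shows "s_op r (refill q p w) = refill q p (s_op r w)"
  using phi_refill_other[OF assms] by (simp add: s_op_refill refill_commute[OF assms])

lemma s_op_refills_commute:
  "\<forall>q\<in>fst ` set gs. r \<noteq> q \<and> r \<noteq> Suc q \<and> q \<noteq> Suc r \<Longrightarrow> s_op r (refills gs w) = refills gs (s_op r w)"
proof (induction gs arbitrary: w)
  case (Cons g gs)
  obtain q p where g: "g = (q, p)" by (cases g)
  have "s_op r (refill q p w) = refill q p (s_op r w)" by (rule s_op_refill_commute) (use Cons.prems g in auto)
  then show ?case using Cons by (simp add: g refills_Cons)
qed simp

lemma foldr_s_op_refills_commute:
  "\<forall>r\<in>set rs. \<forall>q\<in>fst ` set gs. r \<noteq> q \<and> r \<noteq> Suc q \<and> q \<noteq> Suc r \<Longrightarrow>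
   foldr s_op rs (refills gs w) = refills gs (foldr s_op rs w)"
  by (induction rs) (auto simp: s_op_refills_commute)

text \<open>Counted from 0, the exchanged rectangles stand at positions \<open>q\<close> and
  \<open>p\<close>. As \<open>s\<close> letters precede them, \<open>sub\<close> is the subword of
  the pair with letters renumbered from 1.\<close>

locale switch =
  fixes R :: rects and p :: nat
  assumes pos: "\<forall>(h, m)\<in>set R. 0 < h \<and> 0 < m" and p1: "1 \<le> p" and p2: "p \<le> length R - 1"
begin

definition "R' = swapR p R"
definition "q = p - 1"
definition "s = offs R q"
definition "h1 = fst (R ! q)"
definition "m1 = snd (R ! q)"
definition "h2 = fst (R ! p)"
definition "m2 = snd (R ! p)"
definition "inB x \<longleftrightarrow> x \<in> {s + 1..s + h1 + h2}"
definition "sub w = map (\<lambda>x. x - s) (filter inB w)"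

lemma idx: "q < length R" "p < length R" "p = Suc q" "q \<noteq> p"
  using p1 p2 by (auto simp: q_def)

lemma pos': "0 < h1" "0 < m1" "0 < h2" "0 < m2"
  using pos nth_mem[OF idx(1)] nth_mem[OF idx(2)] by (cases "R ! q"; cases "R ! p"; auto simp: h1_def h2_def m1_def m2_def)+

lemma R'_length [simp]: "length R' = length R"
  by (simp add: R'_def swapR_def)

lemma R'_nth: "R' ! q = R ! p" "R' ! p = R ! q" "i \<noteq> q \<Longrightarrow> i \<noteq> p \<Longrightarrow> R' ! i = R ! i"
  using idx by (auto simp: R'_def swapR_def q_def nth_list_update)

lemma R'_set: "set R' = set R"
  using set_swap[of q R p] idx by (simp add: R'_def swapR_def q_def)

lemma R'_swap: "swapR p R' = R"
proof -
  have q: "p - 1 = q" by (simp add: q_def)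
  show ?thesis unfolding swapR_def q
    by (rule nth_equalityI) (use idx R'_nth in \<open>auto simp: nth_list_update\<close>)
qed

text \<open>The exchanged sequence satisfies the same assumptions, so each fact is also available
  with the roles of \<open>R\<close> and \<open>R'\<close> reversed; this yields inverse maps and
  converse implications.\<close>

lemma switch': "switch R' p"
  by unfold_locales (use pos p1 p2 R'_set in auto)

lemma offs_p: "offs R p = s + h1"
  using offs_Suc[OF idx(1)] by (simp add: s_def h1_def flip: idx(3))

lemma offs'_le: "i \<le> q \<Longrightarrow> offs R' i = offs R i"
proof (induction i)
  case (Suc i)
  then show ?case using idx R'_nth(3)[of i] by (simp add: offs_Suc)
qed simp

lemma offs'_p: "offs R' p = s + h2"
  using offs_Suc[of q R'] idx(1) offs'_le[of q] R'_nth(1) by (simp add: s_def h2_def flip: idx(3))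

lemma offs'_ge: "p < i \<Longrightarrow> i \<le> length R \<Longrightarrow> offs R' i = offs R i"
proof (induction i)
  case (Suc i)
  show ?case
  proof (cases "i = p")
    case True
    have "offs R' (Suc p) = s + h2 + h1" using idx offs'_p R'_nth(2) by (simp add: offs_Suc h1_def)
    moreover have "offs R (Suc p) = s + h1 + h2" using idx offs_p by (simp add: offs_Suc h2_def)
    ultimately show ?thesis using True by simp
  next
    case False
    then have "p < i" "i < length R" using Suc.prems by auto
    then show ?thesis using Suc.IH idx R'_nth(3)[of i] by (simp add: offs_Suc)
  qed
qed simp

lemma offs'_other: "i < length R \<Longrightarrow> i \<noteq> p \<Longrightarrow> offs R' i = offs R i"
  using offs'_le[of i] offs'_ge[of i] idx by (cases "i \<le> q") auto

lemma rect_n': "rect_n R' = rect_n R"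
  using offs'_ge[of "length R"] idx offs_length[of R] offs_length[of R'] by simp

lemma rect_a': "rect_a R' = rect_a R"
  by (simp add: rect_a_def R'_set)

lemma block_other: "i < length R \<Longrightarrow> i \<noteq> q \<Longrightarrow> i \<noteq> p \<Longrightarrow> Ablock R' i = Ablock R i \<and> Ytab R' i = Ytab R i"
  using offs'_other[of i] R'_nth(3)[of i] by (simp add: Ablock_def Ytab_def)

lemma block_qp: "Ablock R q = {s + 1..s + h1}" "Ablock R p = {s + h1 + 1..s + h1 + h2}"
  "Ablock R' q = {s + 1..s + h2}" "Ablock R' p = {s + h2 + 1..s + h2 + h1}"
  using offs_p offs'_p offs'_le[of q] R'_nth(1,2) by (simp_all add: Ablock_def s_def h1_def h2_def)

lemma inB_iff: "inB x \<longleftrightarrow> x \<in> Ablock R q \<or> x \<in> Ablock R p"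
  by (auto simp: inB_def block_qp)

lemma inB_other: "i < length R \<Longrightarrow> i \<noteq> q \<Longrightarrow> i \<noteq> p \<Longrightarrow> x \<in> Ablock R i \<Longrightarrow> \<not> inB x"
  unfolding inB_iff using Ablock_disjoint idx by metis

lemma sub_iff: "two_rect h1 m1 h2 m2 (sub w) \<longleftrightarrow>
    (\<forall>i\<in>{q, p}. filter (\<lambda>x. x \<in> Ablock R i) w \<sim>\<^sub>K tab_word (Ytab R i))"
proof -
  have Y: "Ytab R q = rect_tab s h1 m1" "Ytab R p = rect_tab (s + h1) h2 m2"
    using offs_p by (simp_all add: Ytab_rect s_def h1_def m1_def h2_def m2_def)
  have e: "sub w = map (\<lambda>x. x - s) (filter (\<lambda>x. x \<in> {s + 1..s + h1 + h2}) w)" unfolding sub_def inB_def ..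
  show ?thesis unfolding e sub_two_rect by (simp only: ball_simps block_qp Y ball_empty simp_thms)
qed

lemma sub'_iff: "two_rect h2 m2 h1 m1 (sub w) \<longleftrightarrow>
    (\<forall>i\<in>{q, p}. filter (\<lambda>x. x \<in> Ablock R' i) w \<sim>\<^sub>K tab_word (Ytab R' i))"
proof -
  have Y: "Ytab R' q = rect_tab s h2 m2" "Ytab R' p = rect_tab (s + h2) h1 m1"
    using offs'_p offs'_le[of q] R'_nth by (simp_all add: Ytab_rect s_def h1_def m1_def h2_def m2_def)
  have e: "sub w = map (\<lambda>x. x - s) (filter (\<lambda>x. x \<in> {s + 1..s + h2 + h1}) w)"
    unfolding sub_def inB_def by (simp only: add.assoc add.commute[of h1])
  show ?thesis unfolding e sub_two_rect by (simp only: ball_simps block_qp Y ball_empty simp_thms)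
qed

lemma ball_idx: "(\<forall>i<length R. P i) \<longleftrightarrow> (\<forall>i\<in>{q, p}. P i) \<and> (\<forall>i<length R. i \<noteq> q \<longrightarrow> i \<noteq> p \<longrightarrow> P i)"
  using idx by auto

lemma Wset_iff: "w \<in> Wset R \<longleftrightarrow> set w \<subseteq> {1..rect_n R} \<and> two_rect h1 m1 h2 m2 (sub w) \<and>
   (\<forall>i<length R. i \<noteq> q \<longrightarrow> i \<noteq> p \<longrightarrow> filter (\<lambda>x. x \<in> Ablock R i) w \<sim>\<^sub>K tab_word (Ytab R i))"
  unfolding Wset_def mem_Collect_eq sub_iff
    ball_idx[of "\<lambda>i. filter (\<lambda>x. x \<in> Ablock R i) w \<sim>\<^sub>K tab_word (Ytab R i)"] by (rule refl)

lemma Wset'_iff: "w \<in> Wset R' \<longleftrightarrow> set w \<subseteq> {1..rect_n R} \<and> two_rect h2 m2 h1 m1 (sub w) \<and>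
   (\<forall>i<length R. i \<noteq> q \<longrightarrow> i \<noteq> p \<longrightarrow> filter (\<lambda>x. x \<in> Ablock R i) w \<sim>\<^sub>K tab_word (Ytab R i))"
  unfolding Wset_def mem_Collect_eq sub'_iff rect_n' R'_length
    ball_idx[of "\<lambda>i. filter (\<lambda>x. x \<in> Ablock R' i) w \<sim>\<^sub>K tab_word (Ytab R' i)"]
  using block_other by simp

lemma inB_convex: "x \<le> y \<Longrightarrow> y \<le> z \<Longrightarrow> inB x \<Longrightarrow> inB z \<Longrightarrow> inB y"
  by (auto simp: inB_def)

lemma sub_shift: "map (\<lambda>x. x + s) (sub w) = filter inB w"
  unfolding sub_def by (rule unshift_word) (auto simp: inB_def)

lemma sub_knuth: "filter inB u \<sim>\<^sub>K filter inB v \<Longrightarrow> sub u \<sim>\<^sub>K sub v"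
  unfolding sub_def by (erule knuth_map) (auto intro!: diff_strict_mono_on simp: inB_def)

lemma tau_eq:
  assumes "length Z = length w" "\<And>i. i < length w \<Longrightarrow> (inB (Z ! i) \<longleftrightarrow> inB (w ! i)) \<and> (\<not> inB (w ! i) \<longrightarrow> Z ! i = w ! i)"
    "filter inB Z = map (\<lambda>x. x + s) (tau2_word (h1, m1) (h2, m2) (sub w))"
  shows "tau_word R p w = Z"
proof -
  have q: "p - 1 = q" by (simp add: q_def)
  have P: "(\<lambda>x. x \<in> {offs R q + 1..offs R q + fst (R ! q) + fst (R ! p)}) = inB"
    by (rule ext) (simp only: inB_def s_def h1_def h2_def)
  have B: "x \<in> {offs R q + 1..offs R q + fst (R ! q) + fst (R ! p)} \<longleftrightarrow> inB x" for x
    by (simp only: inB_def s_def h1_def h2_def)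
  show ?thesis
  proof (rule tau_word_eq[of Z w R p, unfolded q P B, folded s_def])
    show "(inB (Z ! i) \<longleftrightarrow> inB (w ! i)) \<and> (\<not> inB (w ! i) \<longrightarrow> Z ! i = w ! i)" if "i < length w" for i
      by (rule assms(2)[OF that])
    show "filter inB Z = map (\<lambda>x. x + s) (tau2_word (R ! q) (R ! p) (map (\<lambda>x. x - s) (filter inB w)))"
      using assms(3) by (simp only: sub_def h1_def h2_def m1_def m2_def prod.collapse)
  qed (rule assms(1))
qed

text \<open>The switch is performed by one list for all words whose pair subword lies in the given
  class. The condition is on the subword and not on the word, because a cyclage with last letter
  outside the pair leaves the Knuth class of the word but not that of the subword.\<close>

lemma tau_refills:
  assumes "w \<in> Wset R"
  shows "\<exists>gs. (\<forall>r\<in>fst ` set gs. inB r \<and> inB (Suc r)) \<and>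
     (\<forall>w'. filter inB w' \<sim>\<^sub>K filter inB w \<longrightarrow> tau_word R p w' = refills gs w') \<and>
     (\<forall>w'. w' \<sim>\<^sub>K w \<longrightarrow> refills gs w' \<in> Wset R')"
proof -
  have t: "two_rect h1 m1 h2 m2 (sub w)" using assms unfolding Wset_iff by (elim conjE)
  obtain hs where hs: "fst ` set hs \<subseteq> {1..<h1 + h2}" "\<forall>u'. u' \<sim>\<^sub>K sub w \<longrightarrow> two_rect h2 m2 h1 m1 (refills hs u')"
    using switch_exists[OF t] by blast
  define gs where "gs = map (\<lambda>(r, p). (r + s, p)) hs"
  have gB: "\<forall>r\<in>fst ` set gs. inB r \<and> inB (Suc r)"
  proof
    fix r assume "r \<in> fst ` set gs"
    then obtain r0 where r0: "r0 \<in> fst ` set hs" "r = r0 + s" by (force simp: gs_def)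
    then have "r0 \<in> {1..<h1 + h2}" using hs(1) by blast
    then show "inB r \<and> inB (Suc r)" using r0(2) by (simp add: inB_def)
  qed
  have fB: "filter inB (refills gs w') = map (\<lambda>x. x + s) (refills hs (sub w'))" for w'
  proof -
    have "filter inB (refills gs w') = refills gs (filter inB w')" by (rule filter_refills[OF gB])
    also have "\<dots> = refills gs (map (\<lambda>x. x + s) (sub w'))" by (simp only: sub_shift)
    also have "\<dots> = map (\<lambda>x. x + s) (refills hs (sub w'))" unfolding gs_def by (rule refills_shift)
    finally show ?thesis .
  qed
  have sB: "sub (refills gs w') = refills hs (sub w')" for w'
  proof -
    have "map (\<lambda>x. x - s) (map (\<lambda>x. x + s) v) = v" for v by (induction v) simp_all
    then show ?thesis unfolding sub_def[of "refills gs w'"] fB .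
  qed
  have tw: "tau_word R p w' = refills gs w'" if "filter inB w' \<sim>\<^sub>K filter inB w" for w'
  proof (rule tau_eq)
    have k: "sub w' \<sim>\<^sub>K sub w" by (rule sub_knuth[OF that])
    have "tau2_word (h1, m1) (h2, m2) (sub w') = refills hs (sub w')"
    proof (rule tau2_word_eq[OF _ _ dual_refills pos'(2,4)])
      show "two_rect h1 m1 h2 m2 (sub w')" unfolding two_rect_knuth[OF k] by (rule t)
      show "two_rect h2 m2 h1 m1 (refills hs (sub w'))" by (rule hs(2)[rule_format, OF k])
    qed
    then show "filter inB (refills gs w') = map (\<lambda>x. x + s) (tau2_word (h1, m1) (h2, m2) (sub w'))" using fB by simp
    show "(inB (refills gs w' ! i) \<longleftrightarrow> inB (w' ! i)) \<and> (\<not> inB (w' ! i) \<longrightarrow> refills gs w' ! i = w' ! i)" if "i < length w'" for i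
      by (rule refills_nth_outside[OF gB that])
  qed simp
  have "refills gs w' \<in> Wset R'" if "w' \<sim>\<^sub>K w" for w'
  proof -
    have w': "w' \<in> Wset R" unfolding Wset_knuth[OF that] by (rule assms)
    have n: "x \<in> {1..rect_n R}" if "inB x" for x
    proof -
      have "x \<in> Ablock R q \<or> x \<in> Ablock R p" using that unfolding inB_iff .
      then show ?thesis using subsetD[OF Ablock_sub[OF idx(1)]] subsetD[OF Ablock_sub[OF idx(2)]] by (elim disjE)
    qed
    have "fst ` set gs \<subseteq> {1..<rect_n R}"
    proof
      fix r assume "r \<in> fst ` set gs"
      then have "inB r \<and> inB (Suc r)" by (rule gB[rule_format])
      then have "r \<in> {1..rect_n R}" "Suc r \<in> {1..rect_n R}" using n[of r] n[of "Suc r"] by simp_all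
      then show "r \<in> {1..<rect_n R}" by simp
    qed
    moreover have "set w' \<subseteq> {1..rect_n R}" using w' by (simp add: Wset_def)
    ultimately have st: "set (refills gs w') \<subseteq> {1..rect_n R}" by (intro refills_set)
    have "sub w' \<sim>\<^sub>K sub w" by (intro sub_knuth knuth_filter[OF that]) (rule inB_convex)
    then have tr: "two_rect h2 m2 h1 m1 (sub (refills gs w'))" unfolding sB by (rule hs(2)[rule_format])
    have "filter (\<lambda>x. x \<in> Ablock R i) (refills gs w') = filter (\<lambda>x. x \<in> Ablock R i) w'" if "i < length R" "i \<noteq> q" "i \<noteq> p" for i
    proof (rule filter_refills_other, rule ballI)
      fix r assume "r \<in> fst ` set gs"
      then have "inB r" "inB (Suc r)" using gB by blast+
      then show "r \<notin> Ablock R i \<and> Suc r \<notin> Ablock R i" using inB_other[OF that] by blast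
    qed
    then show ?thesis unfolding Wset'_iff using st tr w'[unfolded Wset_iff] by (intro conjI allI impI) simp_all
  qed
  then show ?thesis using gB tw by (intro exI[of _ gs] conjI allI impI) simp_all
qed

lemma tau_props:
  assumes "w \<in> Wset R"
  shows "tau_word R p w \<in> Wset R'" "dual w (tau_word R p w)" "length (tau_word R p w) = length w"
    "i < length w \<Longrightarrow> (inB (tau_word R p w ! i) \<longleftrightarrow> inB (w ! i)) \<and> (\<not> inB (w ! i) \<longrightarrow> tau_word R p w ! i = w ! i)"
    "dual (sub w) (sub (tau_word R p w))"
    "u \<sim>\<^sub>K w \<Longrightarrow> tau_word R p u \<sim>\<^sub>K tau_word R p w"
proof -
  obtain gs where gs: "\<forall>r\<in>fst ` set gs. inB r \<and> inB (Suc r)"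
    "\<forall>w'. filter inB w' \<sim>\<^sub>K filter inB w \<longrightarrow> tau_word R p w' = refills gs w'"
    "\<forall>w'. w' \<sim>\<^sub>K w \<longrightarrow> refills gs w' \<in> Wset R'" using tau_refills[OF assms] by blast
  have t: "tau_word R p w = refills gs w" using gs(2) by simp
  show "tau_word R p w \<in> Wset R'" unfolding t using gs(3) by simp
  show "dual w (tau_word R p w)" unfolding t by (rule dual_refills)
  show "length (tau_word R p w) = length w" unfolding t by simp
  show "i < length w \<Longrightarrow> (inB (tau_word R p w ! i) \<longleftrightarrow> inB (w ! i)) \<and> (\<not> inB (w ! i) \<longrightarrow> tau_word R p w ! i = w ! i)"
    unfolding t by (rule refills_nth_outside[OF gs(1)])
  have two: "two_rect h1 m1 h2 m2 (sub w)" using assms unfolding Wset_iff by (elim conjE)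
  obtain hs where hs: "\<forall>u'. u' \<sim>\<^sub>K sub w \<longrightarrow> two_rect h2 m2 h1 m1 (refills hs u')"
    using switch_exists[OF two] by blast
  have f: "filter inB (tau_word R p w) = refills gs (filter inB w)" unfolding t by (rule filter_refills[OF gs(1)])
  have "dual (filter inB w) (filter inB (tau_word R p w))" unfolding f by (rule dual_refills)
  then have d: "dual (map (\<lambda>x. x + s) (sub w)) (map (\<lambda>x. x + s) (sub (tau_word R p w)))" unfolding sub_shift .
  \<comment> \<open>Moves depend only on comparisons, so they commute with the shift, and duality of
    the shifted words descends to \<open>sub\<close>.\<close>
  have km: "fold kmove ks (map (\<lambda>x. x + s) v) = map (\<lambda>x. x + s) (fold kmove ks v)" for ks v
  proof -
    have "kmove i (map (\<lambda>x. x + s) v) = map (\<lambda>x. x + s) (kmove i v)" for i v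
      by (induction i arbitrary: v) (auto split: list.splits simp: ktrip_def)
    then show ?thesis by (induction ks arbitrary: v) auto
  qed
  show "dual (sub w) (sub (tau_word R p w))" using d unfolding dual_def by (auto simp: km)
  show "tau_word R p u \<sim>\<^sub>K tau_word R p w" if "u \<sim>\<^sub>K w"
  proof -
    have "filter inB u \<sim>\<^sub>K filter inB w" by (rule knuth_filter[OF that inB_convex])
    then have "tau_word R p u = refills gs u" using gs(2) by blast
    then show ?thesis using refills_knuth[OF that, of gs] t by (simp only:)
  qed
qed

section \<open>The exchanged sequence, inverse switch and tableaux\<close>

lemma shift'_eq: "switch.s R' p = s" "switch.h1 R' p = h2" "switch.h2 R' p = h1"
  unfolding switch.s_def[OF switch'] switch.h1_def[OF switch'] switch.h2_def[OF switch'] s_def h1_def h2_def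
    R'_nth(1,2) offs'_le[OF order_refl] by (rule refl)+

lemma inB'_eq: "switch.inB R' p = inB"
proof
  fix x
  have "s + h2 + h1 = s + h1 + h2" by simp
  then show "switch.inB R' p x = inB x" unfolding switch.inB_def[OF switch'] inB_def shift'_eq by (simp only:)
qed

lemma sub'_eq: "switch.sub R' p w = sub w"
  by (simp only: switch.sub_def[OF switch'] sub_def inB'_eq shift'_eq)

lemma pos_R': "\<forall>(h, m)\<in>set R'. 0 < h \<and> 0 < m"
  using pos R'_set by simp

lemma m'_eq: "switch.m1 R' p = m2" "switch.m2 R' p = m1"
  unfolding switch.m1_def[OF switch'] switch.m2_def[OF switch'] m1_def m2_def R'_nth(1,2) by (rule refl)+

lemma Wset_sub: "w \<in> Wset R \<Longrightarrow> two_rect h1 m1 h2 m2 (sub w)"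
  unfolding Wset_iff by (elim conjE)

lemma Wset'_sub: "w \<in> Wset R' \<Longrightarrow> two_rect h2 m2 h1 m1 (sub w)"
  unfolding Wset'_iff by (elim conjE)

lemmas tau'_eq = switch.tau_eq[OF switch', unfolded inB'_eq sub'_eq shift'_eq m'_eq]

text \<open>By symmetry of duality, \<open>w\<close> itself meets the criterion that characterises
  the switch of \<open>tau_word R p w\<close> back.\<close>

lemma tau_inverse:
  assumes w: "w \<in> Wset R"
  shows "tau_word R' p (tau_word R p w) = w"
proof (rule tau'_eq)
  show "length w = length (tau_word R p w)" using tau_props(3)[OF w] by simp
  show "(inB (w ! i) \<longleftrightarrow> inB (tau_word R p w ! i)) \<and> (\<not> inB (tau_word R p w ! i) \<longrightarrow> w ! i = tau_word R p w ! i)"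
    if "i < length (tau_word R p w)" for i
    using tau_props(4)[OF w, of i] that tau_props(3)[OF w] by simp
  have "tau2_word (h2, m2) (h1, m1) (sub (tau_word R p w)) = sub w"
    by (rule tau2_word_eq[OF Wset'_sub[OF tau_props(1)[OF w]] Wset_sub[OF w] dual_sym[OF tau_props(5)[OF w]] pos'(4,2)])
  then show "filter inB w = map (\<lambda>x. x + s) (tau2_word (h2, m2) (h1, m1) (sub (tau_word R p w)))"
    by (simp only: sub_shift)
qed

text \<open>A word dual to a tableau word is again the word of a tableau of the same shape, and a
  column-strict tableau is determined by its word; so the definite description is justified.\<close>

lemma tau_tab_props:
  assumes T: "T \<in> LRT R"
  shows "column_strict (tau_tab R p T)" "shape (tau_tab R p T) = shape T"
    "tab_word (tau_tab R p T) = tau_word R p (tab_word T)" "tau_tab R p T \<in> LRT R'"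
proof -
  have c: "column_strict T" and W: "tab_word T \<in> Wset R" using T by (simp_all add: LRT_def)
  obtain T' where T': "column_strict T'" "shape T' = shape T" "tau_word R p (tab_word T) = tab_word T'"
    using dual_tab_word[OF c tau_props(2)[OF W]] by blast
  have t: "tau_tab R p T = T'"
    unfolding tau_tab_def
  proof (rule the_equality)
    show "column_strict T' \<and> shape T' = shape T \<and> tab_word T' = tau_word R p (tab_word T)" using T' by simp
    show "U = T'" if "column_strict U \<and> shape U = shape T \<and> tab_word U = tau_word R p (tab_word T)" for U
      by (rule tab_word_inj) (use that T' in simp_all)
  qed
  show "column_strict (tau_tab R p T)" "shape (tau_tab R p T) = shape T"
    "tab_word (tau_tab R p T) = tau_word R p (tab_word T)" using t T' by simp_all
  show "tau_tab R p T \<in> LRT R'" using t T' tau_props(1)[OF W] by (simp add: LRT_def)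
qed

lemma tau_tab_inverse:
  assumes T: "T \<in> LRT R"
  shows "tau_tab R' p (tau_tab R p T) = T"
proof -
  note t = tau_tab_props[OF T]
  note t' = switch.tau_tab_props[OF switch' t(4)]
  have "tab_word (tau_tab R' p (tau_tab R p T)) = tab_word T"
    unfolding t'(3) t(3) by (rule tau_inverse) (use T in \<open>simp add: LRT_def\<close>)
  moreover have "column_strict T" using T by (simp add: LRT_def)
  ultimately show ?thesis by (intro tab_word_inj[OF t'(1)])
qed

text \<open>The switch respects Knuth classes, so it can be evaluated on the word of the insertion
  tableau instead of \<open>w\<close>.\<close>

lemma Ptab_tau:
  assumes w: "w \<in> Wset R"
  shows "Ptab (tau_word R p w) = tau_tab R p (Ptab w)"
proof -
  note t = tau_tab_props[OF LRT_Ptab[OF w]]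
  have "tab_word (tau_tab R p (Ptab w)) \<sim>\<^sub>K tau_word R p w"
    unfolding t(3) by (rule tau_props(6)[OF w tab_word_Ptab])
  then have "Ptab (tab_word (tau_tab R p (Ptab w))) = Ptab (tau_word R p w)" by (rule Ptab_knuth)
  then show ?thesis using Ptab_tab_word[OF t(1)] by simp
qed

subsection \<open>Switching and the cyclage operator\<close>

lemma sub_foldr_s_op:
  assumes "set rs \<subseteq> {1..<h1 + h2}"
  shows "sub (foldr s_op (map (\<lambda>r. r + s) rs) u) = foldr s_op rs (sub u)"
    "\<forall>r\<in>set (map (\<lambda>r. r + s) rs). inB r \<and> inB (Suc r)"
proof -
  show B: "\<forall>r\<in>set (map (\<lambda>r. r + s) rs). inB r \<and> inB (Suc r)" using assms by (auto simp: inB_def)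
  have "filter inB (foldr s_op (map (\<lambda>r. r + s) rs) u) = foldr s_op (map (\<lambda>r. r + s) rs) (map (\<lambda>x. x + s) (sub u))"
    unfolding sub_shift by (rule filter_foldr_s_op[OF B])
  also have "\<dots> = map (\<lambda>x. x + s) (foldr s_op rs (sub u))" by (rule foldr_s_op_shift)
  finally have f: "filter inB (foldr s_op (map (\<lambda>r. r + s) rs) u) = map (\<lambda>x. x + s) (foldr s_op rs (sub u))" .
  have "map (\<lambda>x. x - s) (map (\<lambda>x. x + s) v) = v" for v by (induction v) simp_all
  then show "sub (foldr s_op (map (\<lambda>r. r + s) rs) u) = foldr s_op rs (sub u)"
    unfolding sub_def[of "foldr _ _ _"] f .
qed

text \<open>The generators of the block of \<open>x\<close> are those of \<open>chi2\<close> shifted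
  by \<open>s\<close>, so they commute with passing to the pair subword and leave the other
  positions alone.\<close>

lemma chiR_inB:
  assumes w: "u @ [x] \<in> Wset R" and x: "inB x"
  shows "\<exists>y z. chiR R (u @ [x]) = y # z \<and> length z = length u \<and> inB y \<and>
     (\<forall>i<length u. (inB (z ! i) \<longleftrightarrow> inB (u ! i)) \<and> (\<not> inB (u ! i) \<longrightarrow> z ! i = u ! i)) \<and>
     sub (y # z) = chi2 h1 h2 (sub u) (x - s)"
proof -
  have main: ?thesis if c: "chiR R (u @ [x]) = (y + s) # foldr s_op (map (\<lambda>r. r + s) rs) u"
    and rs: "set rs \<subseteq> {1..<h1 + h2}" and y: "y \<in> {1..h1 + h2}"
    and e: "chi2 h1 h2 (sub u) (x - s) = y # foldr s_op rs (sub u)" for y rs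
  proof (intro exI conjI)
    note B = sub_foldr_s_op(2)[OF rs]
    show "chiR R (u @ [x]) = (y + s) # foldr s_op (map (\<lambda>r. r + s) rs) u" by (rule c)
    show "length (foldr s_op (map (\<lambda>r. r + s) rs) u) = length u" by simp
    show iy: "inB (y + s)" using y by (simp add: inB_def)
    show "\<forall>i<length u. (inB (foldr s_op (map (\<lambda>r. r + s) rs) u ! i) \<longleftrightarrow> inB (u ! i)) \<and>
        (\<not> inB (u ! i) \<longrightarrow> foldr s_op (map (\<lambda>r. r + s) rs) u ! i = u ! i)"
      using foldr_s_op_nth_outside[OF B] by blast
    have "sub ((y + s) # v) = y # sub v" for v using iy by (simp add: sub_def)
    then show "sub ((y + s) # foldr s_op (map (\<lambda>r. r + s) rs) u) = chi2 h1 h2 (sub u) (x - s)"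
      unfolding e sub_foldr_s_op(1)[OF rs, symmetric] .
  qed
  have w0: "w0_list (k + s) h = map (\<lambda>r. r + s) (w0_list k h)" for k h
    using w0_list_shift[of "k + s" h] w0_list_shift[of k h] by (simp add: add.assoc)
  from x consider (q) "x \<in> Ablock R q" | (p) "x \<in> Ablock R p" unfolding inB_iff by blast
  then show ?thesis
  proof cases
    case q
    show ?thesis
    proof (rule main)
      show "chiR R (u @ [x]) = (h1 + s) # foldr s_op (map (\<lambda>r. r + s) (w0_list 0 h1)) u"
        using chiR_eq[OF pos w idx(1) q] w0[of 0 h1] by (simp add: s_def h1_def)
      show "set (w0_list 0 h1) \<subseteq> {1..<h1 + h2}" using w0_list_set[of 0 h1] by auto
      show "h1 \<in> {1..h1 + h2}" using pos' by simp
      have "x - s \<le> h1" using q unfolding block_qp by auto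
      then show "chi2 h1 h2 (sub u) (x - s) = h1 # foldr s_op (w0_list 0 h1) (sub u)" by (simp add: chi2_def)
    qed
  next
    case p
    show ?thesis
    proof (rule main)
      show "chiR R (u @ [x]) = (h1 + h2 + s) # foldr s_op (map (\<lambda>r. r + s) (w0_list h1 h2)) u"
        using chiR_eq[OF pos w idx(2) p] w0[of h1 h2] offs_p by (simp add: h2_def ac_simps)
      show "set (w0_list h1 h2) \<subseteq> {1..<h1 + h2}" using w0_list_set[of h1 h2] by auto
      show "h1 + h2 \<in> {1..h1 + h2}" using pos' by simp
      have "\<not> x - s \<le> h1" using p unfolding block_qp by auto
      then show "chi2 h1 h2 (sub u) (x - s) = (h1 + h2) # foldr s_op (w0_list h1 h2) (sub u)" by (simp add: chi2_def)
    qed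
  qed
qed

lemmas chiR'_inB = switch.chiR_inB[OF switch', unfolded inB'_eq sub'_eq shift'_eq]

lemma tau_snoc:
  assumes w: "u @ [x] \<in> Wset R"
  obtains v z where "tau_word R p (u @ [x]) = v @ [z]" "length v = length u" "dual u v" "inB z \<longleftrightarrow> inB x"
    "\<not> inB x \<Longrightarrow> z = x"
    "\<forall>i<length u. (inB (v ! i) \<longleftrightarrow> inB (u ! i)) \<and> (\<not> inB (u ! i) \<longrightarrow> v ! i = u ! i)"
proof -
  have "tau_word R p (u @ [x]) \<noteq> []" using tau_props(3)[OF w] by force
  then obtain v z where v: "tau_word R p (u @ [x]) = v @ [z]" by (metis rev_exhaust)
  have l: "length v = length u" using tau_props(3)[OF w] v by simp
  have d: "dual u v" by (rule dual_append(1)[OF _ l[symmetric]]) (use tau_props(2)[OF w] v in simp)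
  have m: "(inB ((v @ [z]) ! i) \<longleftrightarrow> inB ((u @ [x]) ! i)) \<and> (\<not> inB ((u @ [x]) ! i) \<longrightarrow> (v @ [z]) ! i = (u @ [x]) ! i)"
    if "i < Suc (length u)" for i using tau_props(4)[OF w, of i] that v by simp
  have "(inB (v ! i) \<longleftrightarrow> inB (u ! i)) \<and> (\<not> inB (u ! i) \<longrightarrow> v ! i = u ! i)" if "i < length u" for i
    using m[of i] that l by (simp add: nth_append)
  moreover have "(inB z \<longleftrightarrow> inB x) \<and> (\<not> inB x \<longrightarrow> z = x)"
    using m[of "length u"] nth_append_length[of v z "[]"] unfolding l by simp
  ultimately show ?thesis using that[OF v l d] by blast
qed

lemma tau_chiR:
  assumes w: "u @ [x] \<in> Wset R"
  shows "tau_word R p (chiR R (u @ [x])) = chiR R' (tau_word R p (u @ [x]))"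
proof (cases "inB x")
  case True
  obtain v z where v: "tau_word R p (u @ [x]) = v @ [z]" "length v = length u" "inB z \<longleftrightarrow> inB x"
    "\<forall>i<length u. (inB (v ! i) \<longleftrightarrow> inB (u ! i)) \<and> (\<not> inB (u ! i) \<longrightarrow> v ! i = u ! i)"
    using tau_snoc[OF w] by metis
  have W': "v @ [z] \<in> Wset R'" using tau_props(1)[OF w] unfolding v(1) .
  obtain y a where a: "chiR R (u @ [x]) = y # a" "length a = length u" "inB y"
     "\<forall>i<length u. (inB (a ! i) \<longleftrightarrow> inB (u ! i)) \<and> (\<not> inB (u ! i) \<longrightarrow> a ! i = u ! i)"
     "sub (y # a) = chi2 h1 h2 (sub u) (x - s)" using chiR_inB[OF w True] by blast
  obtain y' b where b: "chiR R' (v @ [z]) = y' # b" "length b = length v" "inB y'"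
     "\<forall>i<length v. (inB (b ! i) \<longleftrightarrow> inB (v ! i)) \<and> (\<not> inB (v ! i) \<longrightarrow> b ! i = v ! i)"
     "sub (y' # b) = chi2 h2 h1 (sub v) (z - s)" using chiR'_inB[OF W'] v(3) True by blast
  have su: "sub (u @ [x]) = sub u @ [x - s]" "sub (v @ [z]) = sub v @ [z - s]"
    using True v(3) by (simp_all add: sub_def)
  have t: "two_rect h1 m1 h2 m2 (sub u @ [x - s])" "two_rect h2 m2 h1 m1 (sub v @ [z - s])"
    using Wset_sub[OF w] Wset'_sub[OF W'] unfolding su by this+
  have d: "dual (sub u @ [x - s]) (sub v @ [z - s])" using tau_props(5)[OF w] unfolding v(1) su .
  have h: "1 \<le> h1" "1 \<le> h2" using pos' by simp_all
  \<comment> \<open>The two cyclages of the subwords are dual and of exchanged type, which is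
    precisely the criterion for the switched word.\<close>
  have e: "tau2_word (h1, m1) (h2, m2) (sub (y # a)) = sub (y' # b)"
    unfolding a(5) b(5)
    by (rule tau2_word_eq[OF two_rect_chi2(1)[OF t(1) pos'(2,4)] two_rect_chi2(1)[OF t(2) pos'(4,2)]
        chi2_switch[OF t pos'(2,4) h d] pos'(2,4)])
  show ?thesis unfolding v(1) a(1) b(1)
  proof (rule tau_eq)
    show "length (y' # b) = length (y # a)" using a(2) b(2) v(2) by simp
    show "(inB ((y' # b) ! i) \<longleftrightarrow> inB ((y # a) ! i)) \<and> (\<not> inB ((y # a) ! i) \<longrightarrow> (y' # b) ! i = (y # a) ! i)"
      if "i < length (y # a)" for i
    proof (cases i)
      case 0
      then show ?thesis using a(3) b(3) by simp
    next
      case (Suc j)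
      then have "j < length u" using that a(2) by simp
      then have "inB (a ! j) \<longleftrightarrow> inB (u ! j)" "\<not> inB (u ! j) \<Longrightarrow> a ! j = u ! j"
        "inB (b ! j) \<longleftrightarrow> inB (v ! j)" "\<not> inB (v ! j) \<Longrightarrow> b ! j = v ! j"
        "inB (v ! j) \<longleftrightarrow> inB (u ! j)" "\<not> inB (u ! j) \<Longrightarrow> v ! j = u ! j"
        using a(4) b(4) v(2,4) by simp_all
      then show ?thesis using Suc by simp
    qed
    show "filter inB (y' # b) = map (\<lambda>x. x + s) (tau2_word (h1, m1) (h2, m2) (sub (y # a)))"
      unfolding e by (rule sub_shift[symmetric])
  qed
next
  case False
  have "x \<in> {1..rect_n R}" using w by (simp add: Wset_def)
  then obtain i where i: "i < length R" "x \<in> Ablock R i"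
    using Ablock_cover[of "length R" R x] by (auto simp: offs_length)
  have iq: "i \<noteq> q" "i \<noteq> p" using i(2) False unfolding inB_iff by auto
  define rs where "rs = w0_list (offs R i) (fst (R ! i))"
  define y where "y = offs R i + fst (R ! i)"
  note out = inB_other[OF i(1) iq]
  have rs: "\<not> inB r" "\<not> inB (Suc r)" if "r \<in> set rs" for r
    using that w0_list_block[OF i(1)] out unfolding rs_def by blast+
  have y: "\<not> inB y" by (rule out) (use i(2) in \<open>auto simp: y_def Ablock_def\<close>)
  obtain gs where gs: "\<forall>r\<in>fst ` set gs. inB r \<and> inB (Suc r)"
    "\<And>w'. filter inB w' \<sim>\<^sub>K filter inB (u @ [x]) \<Longrightarrow> tau_word R p w' = refills gs w'"
    using tau_refills[OF w] by blast
  have "tau_word R p (u @ [x]) = refills gs (u @ [x])" by (rule gs(2)) simp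
  also have "\<dots> = refills gs u @ [x]" by (rule refills_snoc_out) (use gs(1) False in blast)
  finally have v: "tau_word R p (u @ [x]) = refills gs u @ [x]" .
  have c: "chiR R (u @ [x]) = y # foldr s_op rs u"
    using chiR_eq[OF pos w i] by (simp add: rs_def y_def)
  have W': "refills gs u @ [x] \<in> Wset R'" using tau_props(1)[OF w] unfolding v .
  have "chiR R' (refills gs u @ [x]) = y # foldr s_op rs (refills gs u)"
    using chiR_eq[OF pos_R' W', of i] i block_other[OF i(1) iq] offs'_other[OF i(1) iq(2)] R'_nth(3)[OF iq]
    by (simp add: rs_def y_def)
  also have "foldr s_op rs (refills gs u) = refills gs (foldr s_op rs u)"
    by (rule foldr_s_op_refills_commute) (use gs(1) rs in blast)
  also have "y # refills gs (foldr s_op rs u) = refills gs (y # foldr s_op rs u)"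
    by (rule refills_Cons_out[symmetric]) (use gs(1) y in blast)
  also have "\<dots> = tau_word R p (y # foldr s_op rs u)"
  proof (rule gs(2)[symmetric])
    \<comment> \<open>The rotated word has the same pair subword as \<open>u @ [x]\<close>, so the
      list \<open>gs\<close> chosen for the latter also computes the switch of the former.\<close>
    have "filter inB (foldr s_op rs u) = filter inB u"
      by (rule filter_foldr_s_op_other) (use rs in blast)
    then show "filter inB (y # foldr s_op rs u) \<sim>\<^sub>K filter inB (u @ [x])" using y False by simp
  qed
  finally show ?thesis unfolding v c by (rule sym)
qed

text \<open>The condition on the cell mentions only the shapes of the word and its prefix, which
  duality preserves, and the number \<open>rect_a\<close>, a maximum over the same set of
  rectangles.\<close>

lemma lessR_tau:
  assumes "lessR R T S"
  shows "lessR R' (tau_tab R p T) (tau_tab R p S)"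
proof -
  have TS: "S \<in> LRT R" "T \<in> LRT R" using assms by (simp_all add: lessR_def)
  obtain u x k where w: "u @ [x] \<in> Wset R" and S: "S = Ptab (u @ [x])" and T: "T = Ptab (chiR R (u @ [x]))"
    and k: "k < length (Ptab (u @ [x]))"
    "length (Ptab u) \<le> k \<or> length (Ptab u ! k) \<noteq> length (Ptab (u @ [x]) ! k)"
    "rect_a R < length (Ptab (u @ [x]) ! k)"
    using assms unfolding lessR_def by blast
  obtain v z where v: "tau_word R p (u @ [x]) = v @ [z]" "dual u v" using tau_snoc[OF w] by metis
  \<comment> \<open>Read off from the membership of its tableau \<open>T\<close>; it makes the
    switch applicable to the rotated word.\<close>
  have c: "chiR R (u @ [x]) \<in> Wset R" using TS(2) unfolding T by (rule Ptab_LRT)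
  have sh: "length A = length B" "i < length A \<Longrightarrow> length (A ! i) = length (B ! i)"
    if "shape A = shape B" for A B :: tableau and i
    using that by (metis length_map nth_map shape_def)+
  have d1: "shape (Ptab u) = shape (Ptab v)" by (rule dual_shape[OF v(2)])
  have d2: "shape (Ptab (u @ [x])) = shape (Ptab (v @ [z]))"
    by (rule dual_shape) (use tau_props(2)[OF w] v(1) in simp)
  have k': "k < length (Ptab (v @ [z]))"
    "length (Ptab v) \<le> k \<or> length (Ptab v ! k) \<noteq> length (Ptab (v @ [z]) ! k)"
    "rect_a R' < length (Ptab (v @ [z]) ! k)"
  proof -
    show "k < length (Ptab (v @ [z]))" using k(1) sh(1)[OF d2] by simp
    show "rect_a R' < length (Ptab (v @ [z]) ! k)" using k(3) sh(2)[OF d2 k(1)] rect_a' by simp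
    show "length (Ptab v) \<le> k \<or> length (Ptab v ! k) \<noteq> length (Ptab (v @ [z]) ! k)"
    proof (cases "length (Ptab u) \<le> k")
      case True
      then show ?thesis using sh(1)[OF d1] by simp
    next
      case False
      then show ?thesis using k(2) sh(2)[OF d1, of k] sh(2)[OF d2 k(1)] by simp
    qed
  qed
  have "tau_tab R p S = Ptab (v @ [z])" unfolding S v(1)[symmetric] by (rule Ptab_tau[OF w, symmetric])
  moreover have "tau_tab R p T = Ptab (chiR R' (v @ [z]))"
    unfolding T v(1)[symmetric] tau_chiR[OF w, symmetric] by (rule Ptab_tau[OF c, symmetric])
  moreover have "v @ [z] \<in> Wset R'" using tau_props(1)[OF w] unfolding v(1) .
  ultimately show ?thesis
    unfolding lessR_def using tau_tab_props(4)[OF TS(1)] tau_tab_props(4)[OF TS(2)] k' by blast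
qed

lemma leR_tau: "leR R T S \<Longrightarrow> leR R' (tau_tab R p T) (tau_tab R p S)"
  unfolding leR_def
proof (induction rule: rtranclp_induct)
  case (step U V)
  from step(3) lessR_tau[OF step(2)] show ?case by (rule rtranclp.rtrancl_into_rtrancl)
qed simp

end

theorem theorem3p9:
  fixes R :: rects and p :: nat
  assumes "\<forall>(\<eta>, \<mu>) \<in> set R. 0 < \<eta> \<and> 0 < \<mu>"
    and "1 \<le> p" and "p \<le> length R - 1"
  shows "bij_betw (tau_tab R p) (LRT R) (LRT (swapR p R)) \<and>
         (\<forall>S \<in> LRT R. \<forall>T \<in> LRT R. lessR R T S \<longrightarrow>
           lessR (swapR p R) (tau_tab R p T) (tau_tab R p S)) \<and>
         (\<forall>S \<in> LRT R. \<forall>T \<in> LRT R. leR R T S \<longleftrightarrow>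
           leR (swapR p R) (tau_tab R p T) (tau_tab R p S))"
proof -
  have sw: "switch R p" by unfold_locales (use assms in auto)
  then interpret switch R p .
  \<comment> \<open>Exchanging twice restores \<open>R\<close>. So the inverse bijection and the
    reflection of the order are the facts already proved, taken for \<open>R'\<close>.\<close>
  have R_back: "switch.R' R' p = R" unfolding switch.R'_def[OF switch'] by (rule R'_swap)
  note inv' = switch.tau_tab_inverse[OF switch', unfolded R_back]
  have "bij_betw (tau_tab R p) (LRT R) (LRT R')"
    by (rule bij_betw_byWitness[where f' = "tau_tab R' p"])
       (use tau_tab_inverse inv' tau_tab_props(4) switch.tau_tab_props(4)[OF switch', unfolded R_back] in auto)
  moreover have "leR R T S" if "S \<in> LRT R" "T \<in> LRT R" "leR R' (tau_tab R p T) (tau_tab R p S)" for S T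
    using switch.leR_tau[OF switch' that(3)] unfolding R_back tau_tab_inverse[OF that(1)] tau_tab_inverse[OF that(2)] .
  ultimately show ?thesis unfolding R'_def[symmetric] using lessR_tau leR_tau by blast
qed

end
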